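(* Let $\mathfrak{o}$ be a complete discrete valuation ring (of arbitrary characteristic) with finite residue field of cardinality $q$ and fraction field $\mathfrak{f}$. Let $\mathfrak{d}$ be a central division algebra of index $d$ over $\mathfrak{f}$ (so $\dim_\mathfrak{f}\mathfrak{d}=d^2$) and let $\Delta$ be its unique maximal $\mathfrak{o}$-order. Let $n\in\mathbb{N}$. For $\xi\in\mathbb{P}^n(\Delta)$ let $P_\xi\le\mathrm{GL}_{n+1}(\Delta)$ denote the stabiliser of $\xi$. Then for all $\xi\in\mathbb{P}^n(\Delta)$ the pair $(\mathrm{GL}_{n+1}(\Delta),P_\xi)$ is a Gelfand pair and the induced representation $\rho=\mathrm{Ind}_{P_\xi}^{\mathrm{GL}_{n+1}(\Delta)}(\mathbb{1}_{P_\xi})$ has the zeta function $$\zeta_\rho(s)=1+\Big(\frac{q^{dn}-1}{q^d-1}\Big)^{-s}\left(q^{-ds}+\frac{(q^{d(n+1)}-1)^{-s}}{1-q^{-dns}}\right).$$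
   Context: $\Delta$ has a unique maximal (two-sided) ideal $\mathfrak{P}=\Pi\Delta$ with $|\Delta/\mathfrak{P}|=q^d$. $\mathbb{P}^n(\Delta)$ is the (left) projective $n$-space over $\Delta$: classes $(x_0:\dots:x_n)$ of primitive vectors $(x_0,\dots,x_n)\in\Delta^{n+1}$ (at least one entry not in $\mathfrak{P}$) modulo left multiplication by units $z\in\Delta^\times$; $\mathrm{GL}_{n+1}(\Delta)$ acts on it from the right by matrix multiplication. All representations are over $\mathbb{C}$. For a profinite group $G$ and closed subgroup $P$, $\mathrm{Ind}_P^G(\mathbb{1}_P)$ is the space of locally constant functions $f\colon G\to\mathbb{C}$ with $f(hx)=f(x)$ for $h\in P$, with $G$ acting by right translation. $(G,P)$ is a Gelfand pair if $\mathrm{Ind}_P^G(\mathbb{1}_P)$ is multiplicity-free. For a smooth representation $\rho$ with finitely many irreducible constituents (with multiplicity) of each dimension, $\zeta_\rho(s)=\sum_\pi m(\pi,\rho)(\dim\pi)^{-s}$, summed over isomorphism classes of smooth irreducible representations $\pi$ of $G$, with $m(\pi,\rho)$ the multiplicity of $\pi$ in $\rho$. *)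

theory Defs
  imports "HOL-Analysis.Analysis" "HOL-Algebra.Group" "HOL-Library.Function_Algebras"
begin

section \<open>Complete discrete valuation rings\<close>

text \<open>
  The field is the whole type; a normalised discrete valuation is an integer-valued function
  whose value at 0 is irrelevant (conventionally infinite).
\<close>

definition discrete_valuation :: "('f::field \<Rightarrow> int) \<Rightarrow> bool" where
  "discrete_valuation v \<longleftrightarrow>
     (\<forall>a b. a \<noteq> 0 \<longrightarrow> b \<noteq> 0 \<longrightarrow> v (a * b) = v a + v b) \<and>
     (\<forall>a b. a \<noteq> 0 \<longrightarrow> b \<noteq> 0 \<longrightarrow> a + b \<noteq> 0 \<longrightarrow> v (a + b) \<ge> min (v a) (v b)) \<and>
     v ` (UNIV - {0}) = UNIV"

definition val_ring :: "('f::field \<Rightarrow> int) \<Rightarrow> 'f set" where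
  "val_ring v = {a. a = 0 \<or> v a \<ge> 0}"

text \<open>The \<open>k\<close>-th power of the maximal ideal of the valuation ring.\<close>

definition val_ideal_pow :: "('f::field \<Rightarrow> int) \<Rightarrow> nat \<Rightarrow> 'f set" where
  "val_ideal_pow v k = {a. a = 0 \<or> v a \<ge> int k}"

definition val_complete :: "('f::field \<Rightarrow> int) \<Rightarrow> bool" where
  "val_complete v \<longleftrightarrow>
     (\<forall>X :: nat \<Rightarrow> 'f. (\<forall>i. X i \<in> val_ring v) \<and>
          (\<forall>k. \<exists>N. \<forall>i\<ge>N. \<forall>j\<ge>N. X i - X j \<in> val_ideal_pow v k) \<longrightarrow>
          (\<exists>L\<in>val_ring v. \<forall>k. \<exists>N. \<forall>i\<ge>N. X i - L \<in> val_ideal_pow v k))"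

definition residue_field :: "('f::field \<Rightarrow> int) \<Rightarrow> 'f set set" where
  "residue_field v =
     val_ring v // {(a, b). a \<in> val_ring v \<and> b \<in> val_ring v \<and> a - b \<in> val_ideal_pow v 1}"

section \<open>Central division algebras and maximal orders\<close>

text \<open>
  The index of the algebra is the number \<open>d\<close> with dimension \<open>d^2\<close>. The library assigns
  dimension 0 to infinite-dimensional spaces, so \<open>d \<ge> 1\<close> forces finite dimension.
\<close>

locale central_division_algebra = vector_space smul
  for smul :: "'f::field \<Rightarrow> 'd::division_ring \<Rightarrow> 'd" +
  fixes d :: nat
  assumes smul_mult_left: "smul a x * y = smul a (x * y)"
    and smul_mult_right: "x * smul a y = smul a (x * y)"
    and central: "{z. \<forall>x. z * x = x * z} = range (\<lambda>a. smul a 1)"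
    and index_pos: "d \<ge> 1"
    and dim_eq: "dim UNIV = d ^ 2"

definition is_order :: "'f::field set \<Rightarrow> ('f \<Rightarrow> 'd::division_ring \<Rightarrow> 'd) \<Rightarrow> 'd set \<Rightarrow> bool" where
  "is_order R smul \<Delta> \<longleftrightarrow>
     1 \<in> \<Delta> \<and> (\<forall>x\<in>\<Delta>. \<forall>y\<in>\<Delta>. x - y \<in> \<Delta> \<and> x * y \<in> \<Delta>) \<and>
     (\<exists>B. finite B \<and> \<Delta> = {\<Sum>b\<in>B. smul (c b) b | c. \<forall>b\<in>B. c b \<in> R}) \<and>
     module.span smul \<Delta> = UNIV"

definition is_maximal_order ::
    "'f::field set \<Rightarrow> ('f \<Rightarrow> 'd::division_ring \<Rightarrow> 'd) \<Rightarrow> 'd set \<Rightarrow> bool" where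
  "is_maximal_order R smul \<Delta> \<longleftrightarrow>
     is_order R smul \<Delta> \<and> (\<forall>\<Gamma>. is_order R smul \<Gamma> \<longrightarrow> \<Delta> \<subseteq> \<Gamma> \<longrightarrow> \<Gamma> = \<Delta>)"

definition two_sided_ideal :: "'d::ring set \<Rightarrow> 'd set \<Rightarrow> bool" where
  "two_sided_ideal \<Delta> I \<longleftrightarrow>
     I \<subseteq> \<Delta> \<and> 0 \<in> I \<and> (\<forall>x\<in>I. \<forall>y\<in>I. x - y \<in> I) \<and>
     (\<forall>x\<in>I. \<forall>r\<in>\<Delta>. r * x \<in> I \<and> x * r \<in> I)"

definition maximal_two_sided_ideal :: "'d::ring set \<Rightarrow> 'd set \<Rightarrow> bool" where
  "maximal_two_sided_ideal \<Delta> I \<longleftrightarrow>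
     two_sided_ideal \<Delta> I \<and> I \<noteq> \<Delta> \<and>
     (\<forall>J. two_sided_ideal \<Delta> J \<longrightarrow> I \<subseteq> J \<longrightarrow> J = I \<or> J = \<Delta>)"

section \<open>The general linear group and projective space over an order\<close>

definition mat_monoid :: "'d::ring_1 set \<Rightarrow> ('d ^ 'n ^ 'n) monoid" where
  "mat_monoid \<Delta> = \<lparr>carrier = {A. \<forall>i j. A $ i $ j \<in> \<Delta>}, monoid.mult = (**), one = mat 1\<rparr>"

definition GL :: "'d::ring_1 set \<Rightarrow> ('d ^ 'n ^ 'n) monoid" where
  "GL \<Delta> = units_of (mat_monoid \<Delta>)"

text \<open>
  The profinite topology: neighbourhoods of \<open>A\<close> are given by congruence modulo
  the ideals of \<open>\<Delta>\<close> generated by the powers of the maximal ideal of the valuation ring. As these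
  powers are principal, the set of products below is already an ideal.
\<close>

definition cong_ideal ::
    "('f::field \<Rightarrow> int) \<Rightarrow> ('f \<Rightarrow> 'd::division_ring \<Rightarrow> 'd) \<Rightarrow> 'd set \<Rightarrow> nat \<Rightarrow> 'd set" where
  "cong_ideal v smul \<Delta> k = {smul a x | a x. a \<in> val_ideal_pow v k \<and> x \<in> \<Delta>}"

definition GL_topology ::
    "('f::field \<Rightarrow> int) \<Rightarrow> ('f \<Rightarrow> 'd::division_ring \<Rightarrow> 'd) \<Rightarrow> 'd set \<Rightarrow> ('d ^ 'n ^ 'n) topology" where
  "GL_topology v smul \<Delta> = topology (\<lambda>U. U \<subseteq> carrier (GL \<Delta>) \<and>
     (\<forall>A\<in>U. \<exists>k. \<forall>B\<in>carrier (GL \<Delta>).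
        (\<forall>i j. B $ i $ j - A $ i $ j \<in> cong_ideal v smul \<Delta> k) \<longrightarrow> B \<in> U))"

lemma openin_GL_topology:
  fixes \<Delta> :: "'d::division_ring set" and U :: "('d ^ 'n ^ 'n) set"
  shows "openin (GL_topology v smul \<Delta>) U \<longleftrightarrow> U \<subseteq> carrier (GL \<Delta>) \<and>
     (\<forall>A\<in>U. \<exists>k. \<forall>B\<in>carrier (GL \<Delta>).
        (\<forall>i j. B $ i $ j - A $ i $ j \<in> cong_ideal v smul \<Delta> k) \<longrightarrow> B \<in> U)"
proof -
  let ?P = "\<lambda>U :: ('d ^ 'n ^ 'n) set. U \<subseteq> carrier (GL \<Delta>) \<and>
     (\<forall>A\<in>U. \<exists>k. \<forall>B\<in>carrier (GL \<Delta>).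
        (\<forall>i j. B $ i $ j - A $ i $ j \<in> cong_ideal v smul \<Delta> k) \<longrightarrow> B \<in> U)"
  have mono: "cong_ideal v smul \<Delta> l \<subseteq> cong_ideal v smul \<Delta> k" if "k \<le> l" for k l
    using that unfolding cong_ideal_def val_ideal_pow_def by fastforce
  have "istopology ?P"
    unfolding istopology_def
  proof (intro conjI allI impI)
    fix S T assume S: "?P S" and T: "?P T"
    show "S \<inter> T \<subseteq> carrier (GL \<Delta>)" using S by blast
    show "\<forall>A\<in>S \<inter> T. \<exists>k. \<forall>B\<in>carrier (GL \<Delta>).
        (\<forall>i j. B $ i $ j - A $ i $ j \<in> cong_ideal v smul \<Delta> k) \<longrightarrow> B \<in> S \<inter> T"
    proof
      fix A assume A: "A \<in> S \<inter> T"
      obtain k where k: "\<forall>B\<in>carrier (GL \<Delta>).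
          (\<forall>i j. B $ i $ j - A $ i $ j \<in> cong_ideal v smul \<Delta> k) \<longrightarrow> B \<in> S"
        using S A by blast
      obtain l where l: "\<forall>B\<in>carrier (GL \<Delta>).
          (\<forall>i j. B $ i $ j - A $ i $ j \<in> cong_ideal v smul \<Delta> l) \<longrightarrow> B \<in> T"
        using T A by blast
      show "\<exists>k. \<forall>B\<in>carrier (GL \<Delta>).
          (\<forall>i j. B $ i $ j - A $ i $ j \<in> cong_ideal v smul \<Delta> k) \<longrightarrow> B \<in> S \<inter> T"
      proof (intro exI[of _ "max k l"] ballI impI)
        fix B assume B: "B \<in> carrier (GL \<Delta>)"
          "\<forall>i j. B $ i $ j - A $ i $ j \<in> cong_ideal v smul \<Delta> (max k l)"
        have "\<forall>i j. B $ i $ j - A $ i $ j \<in> cong_ideal v smul \<Delta> k"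
          using B(2) mono[of k "max k l"] by auto
        moreover have "\<forall>i j. B $ i $ j - A $ i $ j \<in> cong_ideal v smul \<Delta> l"
          using B(2) mono[of l "max k l"] by auto
        ultimately show "B \<in> S \<inter> T" using k l B(1) by blast
      qed
    qed
  next
    fix \<K> assume K: "\<forall>K\<in>\<K>. ?P K"
    show "\<Union>\<K> \<subseteq> carrier (GL \<Delta>)" using K by blast
    show "\<forall>A\<in>\<Union>\<K>. \<exists>k. \<forall>B\<in>carrier (GL \<Delta>).
        (\<forall>i j. B $ i $ j - A $ i $ j \<in> cong_ideal v smul \<Delta> k) \<longrightarrow> B \<in> \<Union>\<K>"
    proof
      fix A assume "A \<in> \<Union>\<K>"
      then obtain K where "K \<in> \<K>" "A \<in> K" by blast
      then show "\<exists>k. \<forall>B\<in>carrier (GL \<Delta>).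
        (\<forall>i j. B $ i $ j - A $ i $ j \<in> cong_ideal v smul \<Delta> k) \<longrightarrow> B \<in> \<Union>\<K>"
        using K by (meson UnionI)
    qed
  qed
  then show ?thesis unfolding GL_topology_def by (simp add: topology_inverse')
qed

definition order_units :: "'d::monoid_mult set \<Rightarrow> 'd set" where
  "order_units \<Delta> = {z\<in>\<Delta>. \<exists>w\<in>\<Delta>. z * w = 1 \<and> w * z = 1}"

definition primitive_vectors :: "'d set \<Rightarrow> 'd set \<Rightarrow> ('d ^ 'n) set" where
  "primitive_vectors \<Delta> \<PP> = {x. (\<forall>i. x $ i \<in> \<Delta>) \<and> (\<exists>i. x $ i \<notin> \<PP>)}"

text \<open>A point is the set of left unit multiples of a primitive row vector.\<close>

definition proj_point :: "'d::monoid_mult set \<Rightarrow> 'd ^ 'n \<Rightarrow> ('d ^ 'n) set" where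
  "proj_point \<Delta> x = {\<chi> i. z * x $ i | z. z \<in> order_units \<Delta>}"

definition proj_space :: "'d::monoid_mult set \<Rightarrow> 'd set \<Rightarrow> ('d ^ 'n) set set" where
  "proj_space \<Delta> \<PP> = proj_point \<Delta> ` primitive_vectors \<Delta> \<PP>"

definition proj_stabiliser :: "'d::ring_1 set \<Rightarrow> ('d ^ 'n) set \<Rightarrow> ('d ^ 'n ^ 'n) set" where
  "proj_stabiliser \<Delta> \<xi> = {A \<in> carrier (GL \<Delta>). (\<lambda>x. x v* A) ` \<xi> = \<xi>}"

section \<open>Smooth complex representations\<close>

text \<open>
  Representation spaces are subspaces of a space of complex-valued functions on an arbitrary
  type. This is no restriction, as a choice of basis identifies every complex vector
  space with such a subspace.
\<close>

definition fscale :: "complex \<Rightarrow> ('x \<Rightarrow> complex) \<Rightarrow> 'x \<Rightarrow> complex" where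
  "fscale c f = (\<lambda>x. c * f x)"

global_interpretation cfun: vector_space "fscale :: complex \<Rightarrow> ('x \<Rightarrow> complex) \<Rightarrow> 'x \<Rightarrow> complex"
  by unfold_locales (auto simp: fscale_def fun_eq_iff algebra_simps)

type_synonym ('g, 'x) rep = "('x \<Rightarrow> complex) set \<times> ('g \<Rightarrow> ('x \<Rightarrow> complex) \<Rightarrow> 'x \<Rightarrow> complex)"

definition is_rep :: "('g, 'm) monoid_scheme \<Rightarrow> ('g, 'x) rep \<Rightarrow> bool" where
  "is_rep G = (\<lambda>(V, \<pi>). cfun.subspace V \<and>
     (\<forall>g\<in>carrier G. \<forall>f\<in>V. \<pi> g f \<in> V) \<and>
     (\<forall>g\<in>carrier G. \<forall>f\<in>V. \<forall>f'\<in>V. \<pi> g (f + f') = \<pi> g f + \<pi> g f') \<and>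
     (\<forall>g\<in>carrier G. \<forall>c. \<forall>f\<in>V. \<pi> g (fscale c f) = fscale c (\<pi> g f)) \<and>
     (\<forall>f\<in>V. \<pi> \<one>\<^bsub>G\<^esub> f = f) \<and>
     (\<forall>g\<in>carrier G. \<forall>h\<in>carrier G. \<forall>f\<in>V. \<pi> (g \<otimes>\<^bsub>G\<^esub> h) f = \<pi> g (\<pi> h f)))"

definition smooth_rep ::
    "('g, 'm) monoid_scheme \<Rightarrow> 'g topology \<Rightarrow> ('g, 'x) rep \<Rightarrow> bool" where
  "smooth_rep G T = (\<lambda>(V, \<pi>). is_rep G (V, \<pi>) \<and>
     (\<forall>f\<in>V. openin T {g\<in>carrier G. \<pi> g f = f}))"

definition irreducible_rep :: "('g, 'm) monoid_scheme \<Rightarrow> ('g, 'x) rep \<Rightarrow> bool" where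
  "irreducible_rep G = (\<lambda>(V, \<pi>). is_rep G (V, \<pi>) \<and> V \<noteq> {0} \<and>
     (\<forall>W\<subseteq>V. is_rep G (W, \<pi>) \<longrightarrow> W = {0} \<or> W = V))"

definition rep_iso :: "('g, 'm) monoid_scheme \<Rightarrow> ('g, 'x) rep \<Rightarrow> ('g, 'y) rep \<Rightarrow> bool" where
  "rep_iso G = (\<lambda>(V, \<pi>) (W, \<sigma>). \<exists>\<phi>. bij_betw \<phi> V W \<and>
     (\<forall>f\<in>V. \<forall>f'\<in>V. \<phi> (f + f') = \<phi> f + \<phi> f') \<and>
     (\<forall>c. \<forall>f\<in>V. \<phi> (fscale c f) = fscale c (\<phi> f)) \<and>
     (\<forall>g\<in>carrier G. \<forall>f\<in>V. \<phi> (\<pi> g f) = \<sigma> g (\<phi> f)))"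

text \<open>
  The multiplicity of an irreducible \<open>\<pi>\<close> in \<open>\<rho>\<close> is the number of summands isomorphic to \<open>\<pi>\<close> in a
  decomposition of \<open>\<rho>\<close>, obtained as the largest size of a family of subrepresentations
  isomorphic to \<open>\<pi>\<close> whose sum is direct. Smooth representations of profinite groups are
  semisimple, so the number does not depend on the decomposition.
\<close>

definition direct_family :: "('x \<Rightarrow> complex) set set \<Rightarrow> bool" where
  "direct_family F \<longleftrightarrow> (\<forall>w. (\<forall>W\<in>F. w W \<in> W) \<and> (\<Sum>W\<in>F. w W) = 0 \<longrightarrow> (\<forall>W\<in>F. w W = 0))"

definition rep_mult ::
    "('g, 'm) monoid_scheme \<Rightarrow> ('g, 'x) rep \<Rightarrow> ('g, 'y) rep \<Rightarrow> enat" where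
  "rep_mult G p = (\<lambda>(V, \<rho>).
     (SUP F \<in> {F. finite F \<and> direct_family F \<and>
                  (\<forall>W\<in>F. W \<subseteq> V \<and> is_rep G (W, \<rho>) \<and> rep_iso G p (W, \<rho>))}. enat (card F)))"

text \<open>
  Models of the smooth irreducible representations live on functions on the group itself; by
  the lemma \<open>irreducible_rep_model\<close> below every isomorphism class is represented.
\<close>

definition smooth_irreps :: "('g, 'm) monoid_scheme \<Rightarrow> 'g topology \<Rightarrow> ('g, 'g) rep set" where
  "smooth_irreps G T = {p. smooth_rep G T p \<and> irreducible_rep G p}"

definition smooth_irr_classes ::
    "('g, 'm) monoid_scheme \<Rightarrow> 'g topology \<Rightarrow> ('g, 'g) rep set set" where
  "smooth_irr_classes G T =
     smooth_irreps G T // {(p, p'). p \<in> smooth_irreps G T \<and> p' \<in> smooth_irreps G T \<and> rep_iso G p p'}"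

definition class_dim :: "('g, 'g) rep set \<Rightarrow> nat" where
  "class_dim C = cfun.dim (fst (SOME p. p \<in> C))"

definition class_mult ::
    "('g, 'm) monoid_scheme \<Rightarrow> ('g, 'g) rep set \<Rightarrow> ('g, 'y) rep \<Rightarrow> enat" where
  "class_mult G C \<rho> = rep_mult G (SOME p. p \<in> C) \<rho>"

definition multiplicity_free ::
    "('g, 'm) monoid_scheme \<Rightarrow> 'g topology \<Rightarrow> ('g, 'y) rep \<Rightarrow> bool" where
  "multiplicity_free G T \<rho> \<longleftrightarrow> (\<forall>C\<in>smooth_irr_classes G T. class_mult G C \<rho> \<le> 1)"

definition finitely_many_constituents ::
    "('g, 'm) monoid_scheme \<Rightarrow> 'g topology \<Rightarrow> ('g, 'y) rep \<Rightarrow> bool" where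
  "finitely_many_constituents G T \<rho> \<longleftrightarrow>
     (\<forall>C\<in>smooth_irr_classes G T. class_mult G C \<rho> \<noteq> \<infinity>) \<and>
     (\<forall>k. finite {C\<in>smooth_irr_classes G T. class_dim C = k \<and> class_mult G C \<rho> \<noteq> 0})"

definition zeta_term ::
    "('g, 'm) monoid_scheme \<Rightarrow> ('g, 'y) rep \<Rightarrow> complex \<Rightarrow> ('g, 'g) rep set \<Rightarrow> complex" where
  "zeta_term G \<rho> s C = of_nat (the_enat (class_mult G C \<rho>)) * of_nat (class_dim C) powr (- s)"

definition rep_zeta ::
    "('g, 'm) monoid_scheme \<Rightarrow> 'g topology \<Rightarrow> ('g, 'y) rep \<Rightarrow> complex \<Rightarrow> complex" where
  "rep_zeta G T \<rho> s = (\<Sum>\<^sub>\<infinity>C\<in>smooth_irr_classes G T. zeta_term G \<rho> s C)"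

section \<open>Representations induced from the trivial representation\<close>

text \<open>Functions on the group are extended by 0 outside the carrier.\<close>

definition ind_space ::
    "('g, 'm) monoid_scheme \<Rightarrow> 'g topology \<Rightarrow> 'g set \<Rightarrow> ('g \<Rightarrow> complex) set" where
  "ind_space G T P = {f.
     (\<forall>x\<in>carrier G. \<exists>U. openin T U \<and> x \<in> U \<and> (\<forall>y\<in>U. f y = f x)) \<and>
     (\<forall>h\<in>P. \<forall>x\<in>carrier G. f (h \<otimes>\<^bsub>G\<^esub> x) = f x) \<and>
     (\<forall>x. x \<notin> carrier G \<longrightarrow> f x = 0)}"

definition right_translation ::
    "('g, 'm) monoid_scheme \<Rightarrow> 'g \<Rightarrow> ('g \<Rightarrow> complex) \<Rightarrow> 'g \<Rightarrow> complex" where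
  "right_translation G g f = (\<lambda>x. if x \<in> carrier G then f (x \<otimes>\<^bsub>G\<^esub> g) else 0)"

definition Ind :: "('g, 'm) monoid_scheme \<Rightarrow> 'g topology \<Rightarrow> 'g set \<Rightarrow> ('g, 'g) rep" where
  "Ind G T P = (ind_space G T P, right_translation G)"

definition gelfand_pair :: "('g, 'm) monoid_scheme \<Rightarrow> 'g topology \<Rightarrow> 'g set \<Rightarrow> bool" where
  "gelfand_pair G T P \<longleftrightarrow> multiplicity_free G T (Ind G T P)"

section \<open>Every irreducible representation has a model on functions on the group\<close>

lemma irreducible_rep_model:
  fixes G :: "('g, 'm) monoid_scheme" and p :: "('g, 'x) rep"
  assumes G: "group G" and sm: "smooth_rep G T p" and irr: "irreducible_rep G p"
  shows "\<exists>p'\<in>smooth_irreps G T. rep_iso G p p'"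
proof -
  interpret group G by (rule G)
  obtain V \<pi> where p: "p = (V, \<pi>)" by (cases p)
  have subV: "cfun.subspace V"
    and cl: "\<And>g f. g \<in> carrier G \<Longrightarrow> f \<in> V \<Longrightarrow> \<pi> g f \<in> V"
    and add: "\<And>g f f'. g \<in> carrier G \<Longrightarrow> f \<in> V \<Longrightarrow> f' \<in> V \<Longrightarrow> \<pi> g (f + f') = \<pi> g f + \<pi> g f'"
    and hom: "\<And>g c f. g \<in> carrier G \<Longrightarrow> f \<in> V \<Longrightarrow> \<pi> g (fscale c f) = fscale c (\<pi> g f)"
    and one: "\<And>f. f \<in> V \<Longrightarrow> \<pi> \<one>\<^bsub>G\<^esub> f = f"
    and mul: "\<And>g h f. g \<in> carrier G \<Longrightarrow> h \<in> carrier G \<Longrightarrow> f \<in> V \<Longrightarrow>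
                \<pi> (g \<otimes>\<^bsub>G\<^esub> h) f = \<pi> g (\<pi> h f)"
    using sm unfolding p smooth_rep_def is_rep_def by auto
  have V0: "0 \<in> V" and Vadd: "\<And>f f'. f \<in> V \<Longrightarrow> f' \<in> V \<Longrightarrow> f + f' \<in> V"
    and Vsc: "\<And>c f. f \<in> V \<Longrightarrow> fscale c f \<in> V"
    using subV by (auto simp: cfun.subspace_def)
  have irrV: "V \<noteq> {0}" "\<And>W. W \<subseteq> V \<Longrightarrow> is_rep G (W, \<pi>) \<Longrightarrow> W = {0} \<or> W = V"
    using irr unfolding p irreducible_rep_def by auto
  obtain f0 where f0V: "f0 \<in> V" "f0 \<noteq> 0"
    using irrV(1) V0 by blast
  then obtain x0 where f0: "f0 \<in> V" "f0 x0 \<noteq> 0"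
    by (auto simp: fun_eq_iff)
  define \<phi> where "\<phi> f = (\<lambda>g. if g \<in> carrier G then \<pi> g f x0 else 0)" for f
  let ?\<sigma> = "right_translation G"
  define W where "W = \<phi> ` V"
  have \<phi>_add: "\<phi> (f + f') = \<phi> f + \<phi> f'" if "f \<in> V" "f' \<in> V" for f f'
    using that by (auto simp: \<phi>_def add fun_eq_iff)
  have \<phi>_hom: "\<phi> (fscale c f) = fscale c (\<phi> f)" if "f \<in> V" for f c
    using that by (auto simp: \<phi>_def hom fun_eq_iff) (auto simp: fscale_def)
  have \<phi>_eqv: "\<phi> (\<pi> g f) = ?\<sigma> g (\<phi> f)" if "g \<in> carrier G" "f \<in> V" for f g
    using that by (auto simp: \<phi>_def right_translation_def mul fun_eq_iff)
  have fscale0: "fscale 0 f = 0" for f :: "'y \<Rightarrow> complex"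
    by (simp add: fscale_def fun_eq_iff)
  have \<phi>0: "\<phi> 0 = 0" using \<phi>_hom[OF V0, of 0] by (simp add: fscale0)
  define K where "K = {f\<in>V. \<phi> f = 0}"
  have \<sigma>0: "?\<sigma> g 0 = 0" for g by (simp add: right_translation_def fun_eq_iff)
  have fsc0: "fscale c 0 = (0 :: 'y \<Rightarrow> complex)" for c by (simp add: fscale_def fun_eq_iff)
  have "is_rep G (K, \<pi>)"
    unfolding is_rep_def cfun.subspace_def K_def
    by (auto simp: V0 Vadd Vsc cl add hom one mul \<phi>_add \<phi>_hom \<phi>_eqv \<phi>0 \<sigma>0 fsc0)
  moreover have "f0 \<notin> K"
  proof
    assume "f0 \<in> K"
    then have "\<phi> f0 \<one>\<^bsub>G\<^esub> = 0" by (simp add: K_def)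
    then show False using f0 by (simp add: \<phi>_def one)
  qed
  ultimately have K0: "K = {0}" using irrV(2)[of K] f0 by (auto simp: K_def)
  have inj: "inj_on \<phi> V"
  proof (rule inj_onI)
    fix f f' assume f: "f \<in> V" "f' \<in> V" "\<phi> f = \<phi> f'"
    have m: "fscale (-1) f' \<in> V" using f Vsc by blast
    have "\<phi> (f + fscale (-1) f') = 0"
      unfolding \<phi>_add[OF f(1) m] \<phi>_hom[OF f(2)] f(3) by (simp add: fscale_def fun_eq_iff)
    then have "f + fscale (-1) f' \<in> K"
      using Vadd[OF f(1) m] unfolding K_def by blast
    then show "f = f'" using K0 by (auto simp: fscale_def fun_eq_iff)
  qed
  have bij: "bij_betw \<phi> V W" using inj by (simp add: bij_betw_def W_def)
  have \<sigma>_add: "?\<sigma> g (u + u') = ?\<sigma> g u + ?\<sigma> g u'" for g u u'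
    by (auto simp: right_translation_def fun_eq_iff)
  have \<sigma>_hom: "?\<sigma> g (fscale c u) = fscale c (?\<sigma> g u)" for g c u
    by (auto simp: right_translation_def fscale_def fun_eq_iff)
  have \<sigma>_mul: "?\<sigma> (g \<otimes>\<^bsub>G\<^esub> h) u = ?\<sigma> g (?\<sigma> h u)"
    if "g \<in> carrier G" "h \<in> carrier G" for g h u
    using that by (auto simp: right_translation_def fun_eq_iff m_assoc)
  have \<sigma>_one: "?\<sigma> \<one>\<^bsub>G\<^esub> u = u" if "u \<in> W" for u
    using that by (auto simp: right_translation_def W_def \<phi>_def fun_eq_iff)
  have \<sigma>_cl: "?\<sigma> g u \<in> W" if "g \<in> carrier G" "u \<in> W" for g u
    using that cl by (auto simp: W_def \<phi>_eqv[symmetric])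
  have subW: "cfun.subspace W"
    unfolding cfun.subspace_def W_def
    by (auto simp: \<phi>_add[symmetric] \<phi>_hom[symmetric] Vadd Vsc intro!: image_eqI[of _ _ 0] V0 \<phi>0[symmetric])
  have repW: "is_rep G (W, ?\<sigma>)"
    using subW by (auto simp: is_rep_def \<sigma>_cl \<sigma>_add \<sigma>_hom \<sigma>_one \<sigma>_mul)
  have iso: "rep_iso G p (W, ?\<sigma>)"
    unfolding p rep_iso_def using bij \<phi>_add \<phi>_hom \<phi>_eqv by auto
  have "openin T {g\<in>carrier G. ?\<sigma> g u = u}" if "u \<in> W" for u
  proof -
    obtain f where f: "f \<in> V" "u = \<phi> f" using \<open>u \<in> W\<close> by (auto simp: W_def)
    have "?\<sigma> g u = u \<longleftrightarrow> \<pi> g f = f" if "g \<in> carrier G" for g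
      using that f inj cl by (auto simp: \<phi>_eqv[symmetric] inj_on_eq_iff)
    then have "{g\<in>carrier G. ?\<sigma> g u = u} = {g\<in>carrier G. \<pi> g f = f}" by blast
    then show ?thesis using sm f unfolding p smooth_rep_def by auto
  qed
  then have smW: "smooth_rep G T (W, ?\<sigma>)" using repW by (simp add: smooth_rep_def)
  have W0: "W \<noteq> {0}"
  proof
    assume "W = {0}"
    then have "\<phi> f0 = \<phi> 0" using f0V \<phi>0 by (auto simp: W_def)
    then show False using inj f0V V0 by (auto simp: inj_on_def)
  qed
  have minW: "U = {0} \<or> U = W" if U: "U \<subseteq> W" "is_rep G (U, ?\<sigma>)" for U
  proof -
    define U' where "U' = {f\<in>V. \<phi> f \<in> U}"
    have "0 \<in> U" "\<And>u u'. u \<in> U \<Longrightarrow> u' \<in> U \<Longrightarrow> u + u' \<in> U" "\<And>c u. u \<in> U \<Longrightarrow> fscale c u \<in> U"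
      "\<And>g u. g \<in> carrier G \<Longrightarrow> u \<in> U \<Longrightarrow> ?\<sigma> g u \<in> U"
      using U(2) by (auto simp: is_rep_def cfun.subspace_def)
    then have "is_rep G (U', \<pi>)"
      unfolding is_rep_def cfun.subspace_def U'_def
      by (auto simp: V0 Vadd Vsc cl add hom one mul \<phi>_add \<phi>_hom \<phi>_eqv \<phi>0)
    then have "U' = {0} \<or> U' = V" using irrV(2)[of U'] by (auto simp: U'_def)
    moreover have "U = \<phi> ` U'" using U(1) by (auto simp: U'_def W_def)
    ultimately show ?thesis using \<phi>0 by (auto simp: W_def)
  qed
  have "irreducible_rep G (W, ?\<sigma>)"
    using repW W0 minW by (simp add: irreducible_rep_def)
  then show ?thesis using iso smW by (auto simp: smooth_irreps_def)
qed

end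

theory Submission
  imports Defs "HOL-Algebra.QuotRing" "HOL-Algebra.Zassenhaus" "HOL-Algebra.Multiplicative_Group" "HOL-Computational_Algebra.Computational_Algebra"
begin

text \<open>
  The congruence subgroups \<open>N k\<close> produce a descending chain of open subgroups \<open>P N k\<close> with
  intersection \<open>P\<close>, and each shell \<open>P N k - P N (k + 1)\<close> is a single \<open>P\<close>-double coset. Hence the
  permutation representation on the cosets of \<open>P N (k + 1)\<close> has exactly one irreducible constituent
  more than the one on the cosets of \<open>P N k\<close>, so the induced representation is multiplicity-free,
  and the dimensions of its constituents are differences of consecutive indices. These are counted
  with residues modulo the maximal ideal of \<open>\<Delta>\<close>: the residue ring is a field by Wedderburn's theorem,
  and its degree as well as the ramification index of \<open>\<Delta>\<close> are at most \<open>d\<close>, while their product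
  is \<open>d\<^sup>2\<close>, so the residue field has \<open>q\<^sup>d\<close> elements.
\<close>

text \<open>The obstacle is that \<open>GL_topology\<close> is given by the ideals
  \<open>J k\<close> that a uniformizer of the centre generates, and \<open>J 1\<close> is a proper
  power of the maximal ideal as soon as \<open>d > 1\<close>. The shells of the chain of those
  congruence subgroups then split into several double cosets. So the chain has to be refined to all
  powers of the maximal ideal, which must first be shown to be generated by an element
  \<open>p\<close> whose left and right multiples coincide. For the representations neither Schur's
  lemma nor a Hecke algebra is used. Averaging over \<open>P\<close> shows that each nonzero
  invariant subspace contains one of the explicit kernels \<open>U k\<close>, and these are told
  apart by their strictly increasing dimensions. Both bounds by \<open>d\<close> come from one fact:
  powers of a single element that are independent over the centre number at most \<open>d\<close>.
  For ramification the element is \<open>p\<close>. For the residue degree it lifts a generator of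
  the multiplicative group of the residue ring, and the existence of such a generator is what
  Wedderburn's theorem is for.\<close>

lemma sum_fun_apply: "(\<Sum>i\<in>I. F i) x = (\<Sum>i\<in>I. F i x :: complex)"
  by (induction I rule: infinite_finite_induct) auto

lemma fscale_apply [simp]: "fscale c f x = c * f x"
  by (simp add: fscale_def)

text \<open>\<open>T k\<close> represents the right cosets of \<open>P <#> N (Suc k)\<close> in
  \<open>P <#> N k\<close>. Finite index and \<open>N_complete\<close> together replace compactness
  of the group. The bound 3 in \<open>T_0\<close> makes the first nontrivial constituent, of
  dimension \<open>card (T 0) - 1\<close>, larger than the trivial one.\<close>

locale tower = group G for G :: "('g, 'm) monoid_scheme" (structure) +
  fixes Top :: "'g topology" and P :: "'g set" and N :: "nat \<Rightarrow> 'g set" and T :: "nat \<Rightarrow> 'g set"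
  assumes P_subgroup: "subgroup P G"
    and N_normal: "N k \<lhd> G"
    and N_0: "N 0 = carrier G"
    and N_Suc: "N (Suc k) \<subseteq> N k"
    and N_finite_index: "\<exists>F. finite F \<and> F \<subseteq> carrier G \<and> (\<forall>g\<in>carrier G. \<exists>f\<in>F. \<exists>n\<in>N k. g = f \<otimes> n)"
    and N_complete: "\<And>A. \<forall>k. A k \<in> carrier G \<and> (\<exists>n\<in>N k. A (Suc k) = A k \<otimes> n) \<Longrightarrow>
          \<exists>a\<in>carrier G. \<forall>k. \<exists>n\<in>N k. a = A k \<otimes> n"
    and open_iff: "openin Top U \<longleftrightarrow> U \<subseteq> carrier G \<and> (\<forall>A\<in>U. \<exists>k. \<forall>n\<in>N k. A \<otimes> n \<in> U)"
    and T_subset: "T k \<subseteq> P <#> N k"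
    and T_transversal: "x \<in> P <#> N k \<Longrightarrow> \<exists>!t. t \<in> T k \<and> x \<otimes> inv t \<in> P <#> N (Suc k)"
    and T_0: "card (T 0) \<ge> 3"
    and T_card: "card (T k) \<ge> 2"
    and double_coset: "\<lbrakk>A \<in> P <#> N k; A \<notin> P <#> N (Suc k); B \<in> P <#> N k; B \<notin> P <#> N (Suc k)\<rbrakk>
          \<Longrightarrow> \<exists>p\<in>P. \<exists>p'\<in>P. B = p \<otimes> A \<otimes> p'"
begin

section \<open>Functions on the cosets of a descending chain of open subgroups\<close>

definition L :: "nat \<Rightarrow> 'g set" where "L k = P <#> N k"

abbreviation R :: "'g \<Rightarrow> ('g \<Rightarrow> complex) \<Rightarrow> 'g \<Rightarrow> complex" where "R \<equiv> right_translation G"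

lemma N_subgroup: "subgroup (N k) G"
  using N_normal by (rule normal_imp_subgroup)

lemma N_carrier: "n \<in> N k \<Longrightarrow> n \<in> carrier G"
  by (rule subgroup.mem_carrier[OF N_subgroup])

lemma P_carrier: "p \<in> P \<Longrightarrow> p \<in> carrier G"
  by (rule subgroup.mem_carrier[OF P_subgroup])

lemma N_mono: "k \<le> l \<Longrightarrow> N l \<subseteq> N k"
  by (rule lift_Suc_antimono_le[of N]) (rule N_Suc)

lemma L_subgroup: "subgroup (L k) G"
  unfolding L_def using mult_norm_subgroup[OF N_normal P_subgroup] commut_normal[OF P_subgroup N_normal]
  by simp

lemma L_carrier: "x \<in> L k \<Longrightarrow> x \<in> carrier G"
  by (rule subgroup.mem_carrier[OF L_subgroup])

lemma L_mono: "k \<le> l \<Longrightarrow> L l \<subseteq> L k"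
  unfolding L_def set_mult_def using N_mono by fastforce

lemma P_L: "P \<subseteq> L k"
  unfolding L_def set_mult_def using subgroup.one_closed[OF N_subgroup] P_carrier by force

lemma N_L: "N k \<subseteq> L k"
  unfolding L_def set_mult_def using subgroup.one_closed[OF P_subgroup] N_carrier by force

lemma L_0: "L 0 = carrier G"
  using N_L[of 0] N_0 L_carrier by blast

lemma T_L: "t \<in> T k \<Longrightarrow> t \<in> L k"
  using T_subset L_def by blast

lemma T_carrier: "t \<in> T k \<Longrightarrow> t \<in> carrier G"
  using T_L L_carrier by blast

lemma T_finite: "finite (T k)"
  using T_card[of k] card.infinite by fastforce

lemma N_conj: "n \<in> N k \<Longrightarrow> x \<in> carrier G \<Longrightarrow> \<exists>n'\<in>N k. x \<otimes> n = n' \<otimes> x"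
  using normal.inv_op_closed2[OF N_normal, of x n k]
  by (intro bexI[of _ "x \<otimes> n \<otimes> inv x"]) (auto simp: m_assoc N_carrier)

text \<open>These are the functions on the right cosets of \<open>L k\<close>, that is the
  permutation representation at level \<open>k\<close>, with the same extension by 0 as in
  \<open>ind_space\<close>.\<close>

definition V :: "nat \<Rightarrow> ('g \<Rightarrow> complex) set" where
  "V k = {f. (\<forall>x. x \<notin> carrier G \<longrightarrow> f x = 0) \<and> (\<forall>h\<in>L k. \<forall>x\<in>carrier G. f (h \<otimes> x) = f x)}"

lemma V_outside: "f \<in> V k \<Longrightarrow> x \<notin> carrier G \<Longrightarrow> f x = 0"
  by (simp add: V_def)

lemma V_left: "f \<in> V k \<Longrightarrow> h \<in> L k \<Longrightarrow> x \<in> carrier G \<Longrightarrow> f (h \<otimes> x) = f x"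
  by (simp add: V_def)

text \<open>As \<open>N k\<close> is normal, \<open>x n = n' x\<close> with \<open>n'\<close> in
  \<open>N k\<close>, so left invariance yields right invariance.\<close>

lemma V_right: "f \<in> V k \<Longrightarrow> n \<in> N k \<Longrightarrow> x \<in> carrier G \<Longrightarrow> f (x \<otimes> n) = f x"
  using N_conj[of n k x] N_L V_left by fastforce

lemma V_mono: "k \<le> l \<Longrightarrow> V k \<subseteq> V l"
  using L_mono unfolding V_def by blast

lemma V_subspace: "cfun.subspace (V k)"
  by (auto simp: cfun.subspace_def V_def)

lemma R_outside: "x \<notin> carrier G \<Longrightarrow> R g f x = 0"
  by (simp add: right_translation_def)

lemma R_apply: "x \<in> carrier G \<Longrightarrow> R g f x = f (x \<otimes> g)"
  by (simp add: right_translation_def)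

lemma R_mult: "g \<in> carrier G \<Longrightarrow> h \<in> carrier G \<Longrightarrow> R (g \<otimes> h) f = R g (R h f)"
  by (auto simp: right_translation_def m_assoc fun_eq_iff)

lemma R_one: "f \<in> V k \<Longrightarrow> R \<one> f = f"
  by (auto simp: right_translation_def fun_eq_iff V_outside)

lemma R_add: "R g (f + f') = R g f + R g f'"
  by (auto simp: right_translation_def fun_eq_iff)

lemma R_scale: "R g (fscale c f) = fscale c (R g f)"
  by (auto simp: right_translation_def fun_eq_iff)

lemma R_zero: "R g 0 = 0"
  by (auto simp: right_translation_def fun_eq_iff)

lemma R_sum: "R g (\<Sum>i\<in>I. F i) = (\<Sum>i\<in>I. R g (F i))"
  by (auto simp: fun_eq_iff right_translation_def sum_fun_apply)

lemma R_V: "f \<in> V k \<Longrightarrow> g \<in> carrier G \<Longrightarrow> R g f \<in> V k"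
  unfolding V_def
  by (auto simp: R_outside R_apply L_carrier m_assoc)

lemma R_fixed: "f \<in> V k \<Longrightarrow> n \<in> N k \<Longrightarrow> R n f = f"
  by (auto simp: fun_eq_iff right_translation_def V_right V_outside)

lemma coset_open:
  assumes "x \<in> carrier G"
  shows "openin Top {x \<otimes> n |n. n \<in> N k}"
  unfolding open_iff
proof (intro conjI ballI)
  show "{x \<otimes> n |n. n \<in> N k} \<subseteq> carrier G" using assms N_carrier by auto
  fix A assume "A \<in> {x \<otimes> n |n. n \<in> N k}"
  then obtain m where m: "A = x \<otimes> m" "m \<in> N k" by blast
  show "\<exists>k'. \<forall>n\<in>N k'. A \<otimes> n \<in> {x \<otimes> n |n. n \<in> N k}"
  proof (intro exI[of _ k] ballI CollectI)
    fix n assume n: "n \<in> N k"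
    show "\<exists>n'. A \<otimes> n = x \<otimes> n' \<and> n' \<in> N k"
      using m n assms N_carrier subgroup.m_closed[OF N_subgroup]
      by (intro exI[of _ "m \<otimes> n"]) (auto simp: m_assoc)
  qed
qed

text \<open>A locally constant function is invariant under some \<open>N k\<close>: otherwise there would be a nested
  sequence of cosets on none of which the function is uniformly locally constant, and this fails at
  a common point of the sequence.\<close>

lemma locally_constant_uniform:
  fixes f :: "'g \<Rightarrow> complex"
  assumes lc: "\<forall>x\<in>carrier G. \<exists>U. openin Top U \<and> x \<in> U \<and> (\<forall>y\<in>U. f y = f x)"
  shows "\<exists>k. \<forall>x\<in>carrier G. \<forall>n\<in>N k. f (x \<otimes> n) = f x"
proof (rule ccontr)
  assume neg: "\<not> ?thesis"
  define good where "good k x \<longleftrightarrow> (\<exists>m. \<forall>n\<in>N k. \<forall>n'\<in>N m. f (x \<otimes> n \<otimes> n') = f (x \<otimes> n))" for k x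
  have step: "\<exists>n\<in>N k. \<not> good (Suc k) (x \<otimes> n)" if x: "x \<in> carrier G" "\<not> good k x" for k x
  proof (rule ccontr)
    assume "\<not> ?thesis"
    then have gd: "\<And>n. n \<in> N k \<Longrightarrow> good (Suc k) (x \<otimes> n)" by blast
    obtain F where F: "finite F" "F \<subseteq> carrier G"
      "\<forall>g\<in>carrier G. \<exists>f\<in>F. \<exists>n\<in>N (Suc k). g = f \<otimes> n"
      using N_finite_index by meson
    define F' where "F' = {a\<in>F. good (Suc k) a}"
    have "\<forall>a\<in>F'. \<exists>m. \<forall>n\<in>N (Suc k). \<forall>n'\<in>N m. f (a \<otimes> n \<otimes> n') = f (a \<otimes> n)"
      unfolding F'_def good_def by blast
    then obtain m where m: "\<And>a n n'. a \<in> F' \<Longrightarrow> n \<in> N (Suc k) \<Longrightarrow> n' \<in> N (m a) \<Longrightarrow>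
        f (a \<otimes> n \<otimes> n') = f (a \<otimes> n)" by metis
    \<comment> \<open>Every coset of \<open>N (Suc k)\<close> that meets \<open>x N k\<close> is
      good, and there are finitely many of them, so the largest of their moduli serves the whole of
      \<open>x N k\<close>.\<close>
    define M where "M = Max (insert 0 (m ` F'))"
    have finF: "finite F'" using F(1) by (simp add: F'_def)
    have "f (x \<otimes> n \<otimes> n') = f (x \<otimes> n)" if n: "n \<in> N k" "n' \<in> N M" for n n'
    proof -
      have c: "x \<otimes> n \<in> carrier G" using x n N_carrier by blast
      then obtain a n1 where a: "a \<in> F" "n1 \<in> N (Suc k)" "x \<otimes> n = a \<otimes> n1" using F(3) by blast
      have ac: "a \<in> carrier G" "n1 \<in> carrier G" using a F N_carrier by auto
      have a_eq: "a = x \<otimes> n \<otimes> inv n1" using a ac c by (simp add: m_assoc)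
      obtain mm where mm: "\<forall>u\<in>N (Suc k). \<forall>n'\<in>N mm. f (x \<otimes> n \<otimes> u \<otimes> n') = f (x \<otimes> n \<otimes> u)"
        using gd[OF n(1)] unfolding good_def by blast
      have "good (Suc k) a" unfolding good_def
      proof (intro exI[of _ mm] ballI)
        fix u n' assume u: "u \<in> N (Suc k)" "n' \<in> N mm"
        have "inv n1 \<otimes> u \<in> N (Suc k)" using a u N_subgroup
          by (simp add: subgroup.m_closed subgroup.m_inv_closed)
        then have "f (x \<otimes> n \<otimes> (inv n1 \<otimes> u) \<otimes> n') = f (x \<otimes> n \<otimes> (inv n1 \<otimes> u))" using mm u by blast
        then show "f (a \<otimes> u \<otimes> n') = f (a \<otimes> u)"
          unfolding a_eq using c ac u N_carrier by (simp add: m_assoc)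
      qed
      then have aF: "a \<in> F'" using a by (simp add: F'_def)
      have "m a \<le> M" unfolding M_def using finF aF by (intro Max_ge) auto
      then have "n' \<in> N (m a)" using n N_mono by blast
      then show ?thesis using m[OF aF a(2)] a(3) by simp
    qed
    then have "good k x" unfolding good_def by blast
    then show False using x by blast
  qed
  have "\<not> good 0 \<one>"
  proof
    assume "good 0 \<one>"
    then obtain m where "\<forall>n\<in>N 0. \<forall>n'\<in>N m. f (\<one> \<otimes> n \<otimes> n') = f (\<one> \<otimes> n)" unfolding good_def by blast
    then have "\<forall>x\<in>carrier G. \<forall>n\<in>N m. f (x \<otimes> n) = f x" using N_0 by simp
    then show False using neg by blast
  qed
  moreover have "\<exists>y. (y \<in> carrier G \<and> \<not> good (Suc k) y) \<and> (\<exists>n\<in>N k. y = x \<otimes> n)"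
    if "x \<in> carrier G \<and> \<not> good k x" for x k
    using step[of x k] that N_carrier by blast
  ultimately obtain A where A: "\<And>k. A k \<in> carrier G \<and> \<not> good k (A k)"
      "\<And>k. \<exists>n\<in>N k. A (Suc k) = A k \<otimes> n"
    using dependent_nat_choice[of "\<lambda>k x. x \<in> carrier G \<and> \<not> good k x" "\<lambda>k x y. \<exists>n\<in>N k. y = x \<otimes> n"]
      one_closed by metis
  obtain a where a: "a \<in> carrier G" "\<forall>k. \<exists>n\<in>N k. a = A k \<otimes> n" using N_complete A by blast
  obtain U where U: "openin Top U" "a \<in> U" "\<forall>y\<in>U. f y = f a" using lc a by blast
  then obtain k where k: "\<forall>n\<in>N k. a \<otimes> n \<in> U" unfolding open_iff by blast
  obtain n0 where n0: "n0 \<in> N k" "a = A k \<otimes> n0" using a by blast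
  have const: "f (A k \<otimes> n) = f a" if "n \<in> N k" for n
  proof -
    have "n0 \<otimes> (inv n0 \<otimes> n) = n"
      using n0 that N_carrier by (simp add: m_assoc[symmetric])
    then have "A k \<otimes> n = a \<otimes> (inv n0 \<otimes> n)"
      using n0 A(1)[of k] that N_carrier by (simp add: m_assoc)
    moreover have "inv n0 \<otimes> n \<in> N k" using n0 that N_subgroup
      by (simp add: subgroup.m_closed subgroup.m_inv_closed)
    ultimately show ?thesis using k U(3) by metis
  qed
  have "good k (A k)" unfolding good_def
  proof (intro exI[of _ k] ballI)
    fix n n' assume n: "n \<in> N k" "n' \<in> N k"
    then have "n \<otimes> n' \<in> N k" using N_subgroup by (simp add: subgroup.m_closed)
    then show "f (A k \<otimes> n \<otimes> n') = f (A k \<otimes> n)"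
      using const[of "n \<otimes> n'"] const[of n] n A(1)[of k] N_carrier by (simp add: m_assoc)
  qed
  then show False using A by blast
qed

text \<open>Local constancy is uniform, hence a right invariance under some \<open>N k\<close>.
  Normality makes it a left invariance, which combines with invariance under \<open>P\<close> to
  invariance under \<open>L k\<close>.\<close>

lemma ind_space_eq: "ind_space G Top P = (\<Union>k. V k)"
proof (intro equalityI subsetI)
  fix f assume f: "f \<in> ind_space G Top P"
  then obtain k where k: "\<forall>x\<in>carrier G. \<forall>n\<in>N k. f (x \<otimes> n) = f x"
    using locally_constant_uniform[of f] unfolding ind_space_def by blast
  have "f (h \<otimes> x) = f x" if "h \<in> L k" and x: "x \<in> carrier G" for h x
  proof -
    obtain p n where pn: "p \<in> P" "n \<in> N k" "h = p \<otimes> n"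
      using \<open>h \<in> L k\<close> unfolding L_def set_mult_def by blast
    obtain n' where n': "n' \<in> N k" "n \<otimes> x = x \<otimes> n'"
      using pn x N_carrier normal.inv_op_closed1[OF N_normal, of x n k]
      by (intro that[of "inv x \<otimes> n \<otimes> x"]) (auto simp: m_assoc[symmetric])
    have "f (h \<otimes> x) = f (p \<otimes> (x \<otimes> n'))" using pn x n' N_carrier P_carrier by (simp add: m_assoc)
    also have "\<dots> = f (x \<otimes> n')" using f pn x n' N_carrier unfolding ind_space_def by auto
    finally show ?thesis using k x n' by simp
  qed
  then show "f \<in> (\<Union>k. V k)" using f unfolding V_def ind_space_def by auto
next
  fix f assume "f \<in> (\<Union>k. V k)"
  then obtain k where k: "f \<in> V k" by blast
  have "\<exists>U. openin Top U \<and> x \<in> U \<and> (\<forall>y\<in>U. f y = f x)" if x: "x \<in> carrier G" for x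
    using coset_open[OF x, of k] V_right[OF k _ x] x subgroup.one_closed[OF N_subgroup]
    by (intro exI[of _ "{x \<otimes> n |n. n \<in> N k}"]) force
  then show "f \<in> ind_space G Top P"
    using k P_L unfolding ind_space_def V_def by blast
qed

definition invariant_subspace :: "('g \<Rightarrow> complex) set \<Rightarrow> bool" where
  "invariant_subspace W \<longleftrightarrow> cfun.subspace W \<and> W \<subseteq> (\<Union>k. V k) \<and> (\<forall>g\<in>carrier G. \<forall>f\<in>W. R g f \<in> W)"

lemma invariant_ex_V: "invariant_subspace W \<Longrightarrow> f \<in> W \<Longrightarrow> \<exists>k. f \<in> V k"
  unfolding invariant_subspace_def subset_iff UN_iff by simp

text \<open>Functions in the union vanish off the carrier, so the unit acts on them as the identity
  and the axioms of a linear action hold automatically; what remains is stability of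
  \<open>W\<close>.\<close>

lemma is_rep_iff: "W \<subseteq> (\<Union>k. V k) \<Longrightarrow> is_rep G (W, R) \<longleftrightarrow> invariant_subspace W"
  unfolding is_rep_def invariant_subspace_def using R_one by (auto simp: R_add R_scale R_mult)

lemma subspace_UN_V: "cfun.subspace (\<Union>k. V k)"
proof -
  have "f + f' \<in> V (max k l)" if "f \<in> V k" "f' \<in> V l" for f f' k l
  proof -
    have "f \<in> V (max k l)" "f' \<in> V (max k l)"
      using that V_mono[of k "max k l"] V_mono[of l "max k l"] by (simp_all add: subset_iff)
    then show ?thesis by (rule cfun.subspace_add[OF V_subspace])
  qed
  moreover have "0 \<in> V 0" "\<And>c f k. f \<in> V k \<Longrightarrow> fscale c f \<in> V k"
    using V_subspace unfolding cfun.subspace_def by simp_all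
  ultimately show ?thesis unfolding cfun.subspace_def UN_iff by simp metis
qed

lemma invariant_UN_V: "invariant_subspace (\<Union>k. V k)"
  unfolding invariant_subspace_def using subspace_UN_V R_V by (metis UN_iff subset_refl)

text \<open>A vector of \<open>V k\<close> is fixed by \<open>N k\<close>, so its stabiliser is a
  union of cosets of \<open>N k\<close>.\<close>

lemma smooth_rep_invariant:
  assumes "invariant_subspace W"
  shows "smooth_rep G Top (W, R)"
proof -
  have "openin Top {g \<in> carrier G. R g f = f}" if "f \<in> W" for f
  proof -
    have "\<exists>k. f \<in> V k" using assms that by (rule invariant_ex_V)
    then obtain k where k: "f \<in> V k" by blast
    show ?thesis unfolding open_iff
    proof (intro conjI ballI)
      fix g assume "g \<in> {g \<in> carrier G. R g f = f}"
      then show "\<exists>k. \<forall>n\<in>N k. g \<otimes> n \<in> {g \<in> carrier G. R g f = f}"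
        using R_fixed[OF k] N_carrier by (intro exI[of _ k]) (auto simp: R_mult)
    qed auto
  qed
  then show ?thesis using assms is_rep_iff unfolding smooth_rep_def
    by (auto simp: invariant_subspace_def)
qed

end

section \<open>The kernels \<open>U k\<close> of summation along fibres, and averaging over
  orbits\<close>

context tower
begin

text \<open>Summation over the fibres of the map from cosets of \<open>L (Suc k)\<close> to cosets
  of \<open>L k\<close>: the coset \<open>L k x\<close> is the disjoint union of the cosets
  \<open>L (Suc k) t x\<close>. On \<open>V k\<close> this is multiplication by
  \<open>card (T k)\<close>.\<close>

definition fibre_sum :: "nat \<Rightarrow> ('g \<Rightarrow> complex) \<Rightarrow> 'g \<Rightarrow> complex" where
  "fibre_sum k f x = (if x \<in> carrier G then \<Sum>t\<in>T k. f (t \<otimes> x) else 0)"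

text \<open>Right multiplication by an element \<open>h\<close> of \<open>L k\<close> permutes the
  cosets \<open>L (Suc k) t\<close>. The map \<open>u\<close> below records this permutation on
  \<open>T k\<close>, and it merely reorders the sum.\<close>

lemma fibre_sum_V:
  assumes f: "f \<in> V (Suc k)"
  shows "fibre_sum k f \<in> V k"
proof -
  have "(\<Sum>t\<in>T k. f (t \<otimes> (h \<otimes> x))) = (\<Sum>t\<in>T k. f (t \<otimes> x))" if h: "h \<in> L k" and x: "x \<in> carrier G" for h x
  proof -
    have "\<exists>t'. t' \<in> T k \<and> t \<otimes> h \<otimes> inv t' \<in> L (Suc k)" if "t \<in> T k" for t
    proof -
      have "t \<otimes> h \<in> L k" using T_L[OF that] h subgroup.m_closed[OF L_subgroup] by simp
      then show ?thesis using T_transversal[of "t \<otimes> h" k] unfolding L_def by auto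
    qed
    then obtain u where u: "\<And>t. t \<in> T k \<Longrightarrow> u t \<in> T k \<and> t \<otimes> h \<otimes> inv (u t) \<in> L (Suc k)" by metis
    have hc: "h \<in> carrier G" using h by (rule L_carrier)
    have "inj_on u (T k)"
    proof (rule inj_onI)
      fix t1 t2 assume t: "t1 \<in> T k" "t2 \<in> T k" "u t1 = u t2"
      have c: "t1 \<in> carrier G" "t2 \<in> carrier G" "u t1 \<in> carrier G"
        using t u T_carrier by auto
      have "t1 \<otimes> h \<otimes> inv (u t1) \<otimes> inv (t2 \<otimes> h \<otimes> inv (u t2)) \<in> L (Suc k)"
        using u[OF t(1)] u[OF t(2)] L_subgroup by (simp add: subgroup.m_closed subgroup.m_inv_closed)
      also have "t1 \<otimes> h \<otimes> inv (u t1) \<otimes> inv (t2 \<otimes> h \<otimes> inv (u t2)) = t1 \<otimes> inv t2"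
      proof -
        have "h \<otimes> (inv (u t1) \<otimes> (u t1 \<otimes> (inv h \<otimes> inv t2))) = inv t2"
          using c hc by (simp add: m_assoc[symmetric])
        then show ?thesis using c hc t(3) by (simp add: inv_mult_group m_assoc)
      qed
      finally have "t1 \<otimes> inv t2 \<in> L (Suc k)" .
      moreover have "t1 \<otimes> inv t1 \<in> L (Suc k)" using c L_subgroup by (simp add: subgroup.one_closed)
      ultimately show "t1 = t2"
        using T_transversal[of t1 k] T_L[OF t(1)] t unfolding L_def by auto
    qed
    moreover have "u ` T k \<subseteq> T k" using u by blast
    ultimately have "bij_betw u (T k) (T k)"
      using endo_inj_surj[OF T_finite] unfolding bij_betw_def by auto
    moreover have "f (t \<otimes> (h \<otimes> x)) = f (u t \<otimes> x)" if t: "t \<in> T k" for t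
    proof -
      have c: "t \<in> carrier G" "u t \<in> carrier G" using t u T_carrier by auto
      have "inv (u t) \<otimes> (u t \<otimes> x) = x" using c x by (simp add: m_assoc[symmetric])
      then have "t \<otimes> (h \<otimes> x) = (t \<otimes> h \<otimes> inv (u t)) \<otimes> (u t \<otimes> x)"
        using c x hc by (simp add: m_assoc)
      then show ?thesis using V_left[OF f, of "t \<otimes> h \<otimes> inv (u t)" "u t \<otimes> x"] u[OF t] c x by simp
    qed
    ultimately show ?thesis using sum.reindex_bij_betw[of u "T k" "T k" "\<lambda>t. f (t \<otimes> x)"] by simp
  qed
  then show ?thesis unfolding V_def fibre_sum_def using L_carrier by auto
qed

lemma fibre_sum_R: "g \<in> carrier G \<Longrightarrow> fibre_sum k (R g f) = R g (fibre_sum k f)"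
  using T_carrier by (auto simp: fibre_sum_def right_translation_def m_assoc fun_eq_iff intro!: sum.cong)

lemma fibre_sum_sum: "fibre_sum k (\<Sum>i\<in>I. F i) = (\<Sum>i\<in>I. fibre_sum k (F i))"
  by (auto simp: fibre_sum_def fun_eq_iff sum_fun_apply intro: sum.swap)

text \<open>\<open>U (Suc k)\<close> is an invariant complement of \<open>V k\<close> in
  \<open>V (Suc k)\<close>. Given as a kernel, it has a membership condition that can be tested
  fibre by fibre.\<close>

fun U :: "nat \<Rightarrow> ('g \<Rightarrow> complex) set" where
  "U 0 = V 0"
| "U (Suc k) = {f \<in> V (Suc k). fibre_sum k f = 0}"

lemma U_V: "U k \<subseteq> V k"
  by (cases k) auto

lemma fibre_sum_add: "fibre_sum k (f + f') = fibre_sum k f + fibre_sum k f'"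
  by (auto simp: fibre_sum_def fun_eq_iff sum.distrib)

lemma fibre_sum_scale: "fibre_sum k (fscale c f) = fscale c (fibre_sum k f)"
  by (auto simp: fibre_sum_def fun_eq_iff sum_distrib_left)

lemma invariant_U: "invariant_subspace (U k)"
proof (cases k)
  case 0
  then show ?thesis using V_subspace R_V unfolding invariant_subspace_def by auto
next
  case (Suc j)
  have z: "fibre_sum j 0 = 0" by (auto simp: fibre_sum_def fun_eq_iff)
  have "cfun.subspace (U k)"
    unfolding Suc cfun.subspace_def using V_subspace[of "Suc j"]
    by (auto simp: cfun.subspace_add cfun.subspace_0 cfun.subspace_scale fibre_sum_add fibre_sum_scale z)
  then show ?thesis unfolding invariant_subspace_def
    using Suc R_V[of _ "Suc j"] by (auto simp: fibre_sum_R R_zero)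
qed

text \<open>A substitute for integration over a possibly infinite group \<open>H\<close>: a vector
  of \<open>V k\<close> has only finitely many translates, and each distinct one is counted
  once.\<close>

definition orbit_sum :: "'g set \<Rightarrow> ('g \<Rightarrow> complex) \<Rightarrow> 'g \<Rightarrow> complex" where
  "orbit_sum H f = (\<Sum>u\<in>(\<lambda>h. R h f) ` H. u)"

lemma finite_orbit:
  assumes "f \<in> V k" "H \<subseteq> carrier G"
  shows "finite ((\<lambda>h. R h f) ` H)"
proof -
  obtain F where F: "finite F" "F \<subseteq> carrier G" "\<forall>g\<in>carrier G. \<exists>a\<in>F. \<exists>n\<in>N k. g = a \<otimes> n"
    using N_finite_index by meson
  have "(\<lambda>h. R h f) ` H \<subseteq> (\<lambda>h. R h f) ` F"
  proof
    fix u assume "u \<in> (\<lambda>h. R h f) ` H"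
    then obtain h where h: "h \<in> carrier G" "u = R h f" using assms by auto
    obtain a n where "a \<in> F" "n \<in> N k" "h = a \<otimes> n" using F(3) h(1) by blast
    then show "u \<in> (\<lambda>h. R h f) ` F" using h F N_carrier R_fixed[OF assms(1)] by (auto simp: R_mult)
  qed
  then show ?thesis using F(1) finite_subset by blast
qed

text \<open>Translation by \<open>h\<close> permutes the orbit.\<close>

lemma orbit_sum_R:
  assumes "subgroup H G" "h \<in> H"
  shows "R h (orbit_sum H f) = orbit_sum H f"
proof -
  let ?O = "(\<lambda>h. R h f) ` H"
  have c: "\<And>x. x \<in> H \<Longrightarrow> x \<in> carrier G" using assms(1) by (rule subgroup.mem_carrier)
  have h': "inv h \<in> H" using assms by (simp add: subgroup.m_inv_closed)
  have key: "R (inv h) (R h (R g f)) = R g f" "R h (R (inv h) (R g f)) = R g f" if "g \<in> H" for g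
  proof -
    have "inv h \<otimes> (h \<otimes> g) = g" "h \<otimes> (inv h \<otimes> g) = g"
      using c[OF that] c[OF assms(2)] by (simp_all add: m_assoc[symmetric])
    then show "R (inv h) (R h (R g f)) = R g f" "R h (R (inv h) (R g f)) = R g f"
      using c[OF that] c[OF assms(2)] by (simp_all flip: R_mult)
  qed
  have "bij_betw (R h) ?O ?O"
    by (rule bij_betw_byWitness[where f' = "R (inv h)"])
      (auto simp: key R_mult[symmetric] c assms h' subgroup.m_closed[OF assms(1)])
  then show ?thesis unfolding orbit_sum_def R_sum
    using sum.reindex_bij_betw[of "R h" ?O ?O "\<lambda>u. u"] by simp
qed

lemma orbit_sum_mem:
  assumes "invariant_subspace W" "f \<in> W" "H \<subseteq> carrier G"
  shows "orbit_sum H f \<in> W"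
  unfolding orbit_sum_def using assms
  by (intro cfun.subspace_sum) (auto simp: invariant_subspace_def)

lemma orbit_sum_V: "f \<in> V k \<Longrightarrow> H \<subseteq> carrier G \<Longrightarrow> orbit_sum H f \<in> V k"
  unfolding orbit_sum_def by (intro cfun.subspace_sum V_subspace) (auto intro: R_V)

text \<open>All translates agree at the unit, so nothing cancels there and a nonzero value stays
  nonzero under averaging.\<close>

lemma orbit_sum_fixed:
  assumes "\<And>h. h \<in> H \<Longrightarrow> f h = f \<one>" "H \<subseteq> carrier G"
  shows "orbit_sum H f \<one> = of_nat (card ((\<lambda>h. R h f) ` H)) * f \<one>"
proof -
  have "u \<one> = f \<one>" if "u \<in> (\<lambda>h. R h f) ` H" for u
    using that assms by (auto simp: R_apply)
  then have "(\<Sum>u\<in>(\<lambda>h. R h f) ` H. u \<one>) = (\<Sum>u\<in>(\<lambda>h. R h f) ` H. f \<one>)"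
    by (rule sum.cong[OF refl])
  then show ?thesis by (simp add: orbit_sum_def sum_fun_apply)
qed

text \<open>Take \<open>k\<close> minimal such that \<open>W\<close> meets \<open>V k\<close>. Summing over an orbit of \<open>N (k - 1)\<close> maps
  \<open>W \<inter> V k\<close> to \<open>W \<inter> V (k - 1) = 0\<close>, while it preserves fibre sums up to a positive factor.\<close>

lemma invariant_meets_U:
  assumes W: "invariant_subspace W" "W \<noteq> {0}"
  shows "\<exists>k. \<exists>f\<in>W. f \<in> U k \<and> f \<noteq> 0"
proof -
  have "0 \<in> W" using W(1) by (simp add: invariant_subspace_def cfun.subspace_0)
  then obtain f0 where "f0 \<in> W" "f0 \<noteq> 0" using W(2) by blast
  then have ex: "\<exists>k. \<exists>f\<in>W. f \<in> V k \<and> f \<noteq> 0"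
    using invariant_ex_V[OF W(1)] by metis
  define k where "k = (LEAST k. \<exists>f\<in>W. f \<in> V k \<and> f \<noteq> 0)"
  obtain f where f: "f \<in> W" "f \<in> V k" "f \<noteq> 0"
    using LeastI_ex[OF ex] unfolding k_def by blast
  have min: "u = 0" if "u \<in> W" "u \<in> V j" "j < k" for u j
    using that not_less_Least[of j "\<lambda>k. \<exists>f\<in>W. f \<in> V k \<and> f \<noteq> 0"] unfolding k_def by blast
  show ?thesis
  proof (cases k)
    case 0
    then show ?thesis using f by (intro exI[of _ 0]) auto
  next
    case (Suc j)
    define S where "S = orbit_sum (N j) f"
    have Nc: "N j \<subseteq> carrier G" using N_carrier by blast
    have SV: "S \<in> V k" unfolding S_def using orbit_sum_V[OF f(2) Nc] .
    have "S (h \<otimes> x) = S x" if h: "h \<in> L j" and x: "x \<in> carrier G" for h x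
    proof -
      obtain p n where pn: "p \<in> P" "n \<in> N j" "h = p \<otimes> n"
        using h unfolding L_def set_mult_def by blast
      define n' where "n' = inv x \<otimes> n \<otimes> x"
      have n': "n' \<in> N j"
        unfolding n'_def using normal.inv_op_closed1[OF N_normal x pn(2)] .
      have nx: "n \<otimes> x = x \<otimes> n'"
        unfolding n'_def using x N_carrier[OF pn(2)] by (simp add: m_assoc[symmetric])
      have "S (h \<otimes> x) = S (p \<otimes> (n \<otimes> x))"
        using pn x N_carrier P_carrier by (simp add: m_assoc)
      also have "\<dots> = S (n \<otimes> x)"
        using V_left[OF SV] pn P_L x N_carrier by blast
      also have "\<dots> = R n' S x" using x nx by (simp add: R_apply)
      also have "\<dots> = S x" unfolding S_def by (simp add: orbit_sum_R[OF N_subgroup n'])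
      finally show ?thesis .
    qed
    then have "S \<in> V j" using V_outside[OF SV] unfolding V_def by blast
    moreover have "S \<in> W" unfolding S_def using orbit_sum_mem[OF W(1) f(1) Nc] .
    ultimately have S0: "S = 0" using min Suc by blast
    let ?O = "(\<lambda>h. R h f) ` N j"
    have fs: "fibre_sum j f \<in> V j" using fibre_sum_V f Suc by blast
    \<comment> \<open>Fibre sums commute with translation, and \<open>fibre_sum j f\<close> lies in
      \<open>V j\<close>, which \<open>N j\<close> fixes pointwise; so all these translates of
      \<open>f\<close> have the same fibre sum.\<close>
    have "fibre_sum j u = fibre_sum j f" if "u \<in> ?O" for u
      using that R_fixed[OF fs] Nc by (auto simp: fibre_sum_R)
    then have "fibre_sum j S = fscale (of_nat (card ?O)) (fibre_sum j f)"
      unfolding S_def orbit_sum_def fibre_sum_sum by (auto simp: fun_eq_iff sum_fun_apply)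
    moreover have "fibre_sum j S = 0" unfolding S0 by (auto simp: fibre_sum_def fun_eq_iff)
    moreover have "card ?O \<noteq> 0"
      using finite_orbit[OF f(2) Nc] subgroup.one_closed[OF N_subgroup] by auto
    ultimately have "fibre_sum j f = 0" by (auto simp: fun_eq_iff)
    then show ?thesis using f Suc by (intro exI[of _ k]) auto
  qed
qed

text \<open>Multiplying representatives level by level yields one element in each right coset of
  \<open>L k\<close>.\<close>

primrec reps :: "nat \<Rightarrow> 'g set" where
  "reps 0 = {\<one>}"
| "reps (Suc k) = (\<lambda>(t, x). t \<otimes> x) ` (T k \<times> reps k)"

lemma reps_carrier: "x \<in> reps k \<Longrightarrow> x \<in> carrier G"
  by (induction k arbitrary: x) (auto simp: T_carrier)

lemma reps_finite: "finite (reps k)"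
  by (induction k) (auto simp: T_finite)

lemma reps_ex: "g \<in> carrier G \<Longrightarrow> \<exists>x\<in>reps k. g \<otimes> inv x \<in> L k"
proof (induction k)
  case 0
  then show ?case by (simp add: L_0)
next
  case (Suc k)
  then obtain x where x: "x \<in> reps k" "g \<otimes> inv x \<in> L k" by blast
  then obtain t where t: "t \<in> T k" "g \<otimes> inv x \<otimes> inv t \<in> L (Suc k)"
    using T_transversal[of "g \<otimes> inv x" k] unfolding L_def by blast
  have "g \<otimes> inv (t \<otimes> x) = g \<otimes> inv x \<otimes> inv t"
    using Suc.prems x t reps_carrier T_carrier by (simp add: inv_mult_group m_assoc)
  then show ?case using x t by force
qed

lemma T_unique: "t \<in> T k \<Longrightarrow> t' \<in> T k \<Longrightarrow> t \<otimes> inv t' \<in> L (Suc k) \<Longrightarrow> t = t'"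
  using T_transversal[of t k] T_L[of t k] T_carrier[of t k] subgroup.one_closed[OF L_subgroup, of "Suc k"]
  unfolding L_def by (metis r_inv)

text \<open>\<open>T k\<close> lies in \<open>L k\<close>, so the left factors disappear modulo
  \<open>L k\<close> and induction identifies the right factors; the left ones then agree by
  \<open>T_unique\<close>.\<close>

lemma reps_unique: "x \<in> reps k \<Longrightarrow> x' \<in> reps k \<Longrightarrow> x \<otimes> inv x' \<in> L k \<Longrightarrow> x = x'"
proof (induction k arbitrary: x x')
  case (Suc k)
  obtain t y t' y' where e: "t \<in> T k" "y \<in> reps k" "x = t \<otimes> y" "t' \<in> T k" "y' \<in> reps k" "x' = t' \<otimes> y'"
    using Suc.prems by auto
  have c: "t \<in> carrier G" "y \<in> carrier G" "t' \<in> carrier G" "y' \<in> carrier G"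
    using e T_carrier reps_carrier by auto
  have "x \<otimes> inv x' \<in> L k" using Suc.prems L_mono[of k "Suc k"] by auto
  then have "inv t \<otimes> (x \<otimes> inv x') \<otimes> t' \<in> L k"
    using e T_L L_subgroup by (simp add: subgroup.m_closed subgroup.m_inv_closed)
  moreover have "inv t \<otimes> (x \<otimes> inv x') \<otimes> t' = y \<otimes> inv y'"
  proof -
    have "inv t \<otimes> (x \<otimes> inv x') \<otimes> t' = (inv t \<otimes> t) \<otimes> (y \<otimes> inv y' \<otimes> (inv t' \<otimes> t'))"
      unfolding e(3,6) using c by (simp only: inv_mult_group m_assoc m_closed inv_closed)
    then show ?thesis using c by simp
  qed
  ultimately have y: "y = y'" using Suc.IH e by simp
  have "t \<otimes> inv t' = x \<otimes> inv x'"
  proof -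
    have "x \<otimes> inv x' = t \<otimes> (y' \<otimes> inv y') \<otimes> inv t'"
      unfolding e(3,6) y using c by (simp only: inv_mult_group m_assoc m_closed inv_closed)
    then show ?thesis using c by simp
  qed
  then show ?case using T_unique[OF e(1,4)] Suc.prems(3) y e by simp
qed auto

lemma reps_inj: "inj_on (\<lambda>(t, x). t \<otimes> x) (T k \<times> reps k)"
proof (rule inj_onI, clarify)
  fix t x t' x' assume e: "t \<in> T k" "x \<in> reps k" "t' \<in> T k" "x' \<in> reps k" "t \<otimes> x = t' \<otimes> x'"
  have c: "t \<in> carrier G" "x \<in> carrier G" "t' \<in> carrier G" "x' \<in> carrier G"
    using e T_carrier reps_carrier by auto
  have "x \<otimes> inv x' = inv t \<otimes> (t \<otimes> x) \<otimes> inv x'" using c by (simp add: m_assoc[symmetric])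
  also have "\<dots> = inv t \<otimes> t' \<otimes> (x' \<otimes> inv x')" unfolding e(5) using c by (simp only: m_assoc m_closed inv_closed)
  also have "\<dots> = inv t \<otimes> t'" using c by simp
  also have "\<dots> \<in> L k" using e T_L L_subgroup by (simp add: subgroup.m_closed subgroup.m_inv_closed)
  finally have "x = x'" using reps_unique e by blast
  then show "t = t' \<and> x = x'" using e(5) c by simp
qed

lemma card_reps: "card (reps k) = (\<Prod>i<k. card (T i))"
  by (induction k) (auto simp: card_image[OF reps_inj] card_cartesian_product)

lemma V_eqI:
  assumes "f \<in> V k" "f' \<in> V k" "\<And>x. x \<in> reps k \<Longrightarrow> f x = f' x"
  shows "f = f'"
proof
  fix g
  show "f g = f' g"
  proof (cases "g \<in> carrier G")
    case True
    then obtain x where x: "x \<in> reps k" "g \<otimes> inv x \<in> L k" using reps_ex by blast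
    have "g = (g \<otimes> inv x) \<otimes> x" using True reps_carrier[OF x(1)] by (simp add: m_assoc)
    then show ?thesis using V_left[OF assms(1) x(2)] V_left[OF assms(2) x(2)] reps_carrier x assms(3) by metis
  next
    case False
    then show ?thesis using V_outside[OF assms(1)] V_outside[OF assms(2)] by simp
  qed
qed

end

text \<open>Evaluation at \<open>p i\<close> serves as the coordinate functional of
  \<open>b i\<close>, so that dimension counts reduce to checking values of functions at
  points.\<close>

lemma dim_dual_basis:
  fixes b :: "'i \<Rightarrow> 'x \<Rightarrow> complex"
  assumes I: "finite I" and b: "\<And>i. i \<in> I \<Longrightarrow> b i \<in> S"
    and dual: "\<And>i j. i \<in> I \<Longrightarrow> j \<in> I \<Longrightarrow> b i (p j) = (if i = j then 1 else 0)"
    and span: "\<And>f. f \<in> S \<Longrightarrow> f = (\<Sum>i\<in>I. fscale (f (p i)) (b i))"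
  shows "cfun.dim S = card I"
proof (rule cfun.dim_unique[of "b ` I"])
  have inj: "inj_on b I"
    by (rule inj_onI) (metis dual zero_neq_one)
  then show "card (b ` I) = card I" by (rule card_image)
  show "b ` I \<subseteq> S" using b by blast
  show "S \<subseteq> cfun.span (b ` I)"
  proof
    fix f assume "f \<in> S"
    have "(\<Sum>i\<in>I. fscale (f (p i)) (b i)) \<in> cfun.span (b ` I)"
      by (intro cfun.span_sum cfun.span_scale cfun.span_base) auto
    then show "f \<in> cfun.span (b ` I)" using span[OF \<open>f \<in> S\<close>] by simp
  qed
  have "u v = 0" if u: "(\<Sum>v\<in>b ` I. fscale (u v) v) = 0" and v: "v \<in> b ` I" for u v
  proof -
    obtain j where j: "j \<in> I" "v = b j" using v by blast
    have "0 = (\<Sum>v\<in>b ` I. fscale (u v) v) (p j)" using u by simp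
    also have "\<dots> = (\<Sum>i\<in>I. u (b i) * b i (p j))"
      by (simp add: sum_fun_apply sum.reindex[OF inj])
    also have "\<dots> = (\<Sum>i\<in>I. if i = j then u (b i) else 0)"
      using j by (intro sum.cong) (auto simp: dual)
    also have "\<dots> = u v" using I j by simp
    finally show ?thesis by simp
  qed
  then show "cfun.independent (b ` I)" using I by (auto simp: cfun.dependent_finite)
qed

section \<open>Irreducibility and dimension of the kernels \<open>U k\<close>\<close>

context tower
begin

text \<open>The orbit sum is invariant under \<open>P\<close> from the right by construction and
  from the left as an element of \<open>V j\<close>, so it is constant on double cosets of
  \<open>P\<close>; each shell is one of these.\<close>

lemma orbit_sum_P_constant:
  assumes f: "f \<in> V j" and A: "A \<in> L k" "A \<notin> L (Suc k)" and B: "B \<in> L k" "B \<notin> L (Suc k)"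
  shows "orbit_sum P f A = orbit_sum P f B"
proof -
  let ?S = "orbit_sum P f"
  have Pc: "P \<subseteq> carrier G" using P_carrier by blast
  obtain p p' where p: "p \<in> P" "p' \<in> P" "B = p \<otimes> A \<otimes> p'"
    using double_coset[of A k B] A B unfolding L_def by blast
  have c: "p \<in> carrier G" "p' \<in> carrier G" "A \<in> carrier G" using p P_carrier A L_carrier by auto
  have "?S B = ?S (p \<otimes> (A \<otimes> p'))" using p c by (simp add: m_assoc)
  also have "\<dots> = ?S (A \<otimes> p')" using V_left[OF orbit_sum_V[OF f Pc], of p] P_L p c by blast
  also have "\<dots> = R p' ?S A" using c by (simp add: R_apply)
  also have "\<dots> = ?S A" by (simp add: orbit_sum_R[OF P_subgroup p(2)])
  finally show ?thesis by simp
qed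

text \<open>The unit lies in exactly one coset of \<open>L (Suc k)\<close>, which is
  \<open>L (Suc k)\<close> itself.\<close>

lemma T_mem_L_Suc: "\<exists>t\<in>T k. t \<in> L (Suc k) \<and> (\<forall>t'\<in>T k. t' \<in> L (Suc k) \<longrightarrow> t' = t)"
proof -
  have one: "\<one> \<in> L i" for i using L_subgroup by (rule subgroup.one_closed)
  obtain t where t: "t \<in> T k" "\<one> \<otimes> inv t \<in> L (Suc k)"
    using T_transversal[of \<one> k] one unfolding L_def by blast
  have tc: "t \<in> carrier G" using t T_carrier by blast
  then have tL: "t \<in> L (Suc k)"
    using t subgroup.m_inv_closed[OF L_subgroup, of "inv t" "Suc k"] by simp
  moreover have "t' = t" if "t' \<in> T k" "t' \<in> L (Suc k)" for t'
    using T_unique[of t' k t] that t(1) tL L_subgroup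
    by (simp add: subgroup.m_closed subgroup.m_inv_closed)
  ultimately show ?thesis using t by blast
qed

text \<open>Summing over an orbit of \<open>P\<close> produces a vector \<open>S\<close> of \<open>W\<close> which is constant, with different
  values \<open>a\<close> and \<open>c\<close>, on \<open>L (j + 1)\<close> and on \<open>L j - L (j + 1)\<close>, and vanishes elsewhere. The
  translates of \<open>S\<close> span \<open>U (j + 1)\<close>.\<close>

lemma U_Suc_minimal:
  assumes W: "invariant_subspace W" "W \<subseteq> U (Suc j)" and f: "f \<in> W" "f \<noteq> 0"
  shows "U (Suc j) \<subseteq> W"
proof
  fix u assume u: "u \<in> U (Suc j)"
  have fV: "f \<in> V (Suc j)" using f W by auto
  then obtain g where g: "g \<in> carrier G" "f g \<noteq> 0"
    using f(2) V_outside[OF fV] by (metis ext zero_fun_apply)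
  \<comment> \<open>Translating by \<open>g\<close> moves a nonzero value of \<open>f\<close> to the
    unit, the place where \<open>orbit_sum_fixed\<close> excludes cancellation.\<close>
  define f1 where "f1 = R g f"
  have f1: "f1 \<in> W" "f1 \<in> V (Suc j)" "f1 \<one> \<noteq> 0"
    using W(1) f g R_V[OF fV] by (auto simp: f1_def invariant_subspace_def R_apply)
  define S where "S = orbit_sum P f1"
  define a where "a = S \<one>"
  have Pc: "P \<subseteq> carrier G" using P_carrier by blast
  have SW: "S \<in> W" unfolding S_def using orbit_sum_mem[OF W(1) f1(1) Pc] .
  then have SV: "S \<in> V (Suc j)" and S0: "fibre_sum j S = 0" using W(2) by auto
  have f1P: "f1 h = f1 \<one>" if "h \<in> P" for h
    using V_left[OF f1(2), of h \<one>] that P_L P_carrier by auto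
  have "a = of_nat (card ((\<lambda>h. R h f1) ` P)) * f1 \<one>"
    unfolding a_def S_def using f1P Pc by (rule orbit_sum_fixed)
  moreover have "card ((\<lambda>h. R h f1) ` P) \<noteq> 0"
    using finite_orbit[OF f1(2) Pc] subgroup.one_closed[OF P_subgroup] by auto
  ultimately have a0: "a \<noteq> 0" using f1 by simp
  have Sa: "S x = a" if "x \<in> L (Suc j)" for x
    using V_left[OF SV that one_closed] L_carrier[OF that] by (simp add: a_def)
  obtain t0 where t0: "t0 \<in> T j" "t0 \<in> L (Suc j)" "\<And>t. t \<in> T j \<Longrightarrow> t \<in> L (Suc j) \<Longrightarrow> t = t0"
    using T_mem_L_Suc by blast
  obtain t1 where t1: "t1 \<in> T j" "t1 \<noteq> t0"
  proof -
    have "\<not> T j \<subseteq> {t0}"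
    proof
      assume "T j \<subseteq> {t0}"
      then have "card (T j) \<le> 1" using card_mono[of "{t0}" "T j"] by simp
      then show False using T_card[of j] by simp
    qed
    then show ?thesis using that by blast
  qed
  define c where "c = S t1"
  have Sc: "S x = c" if "x \<in> L j" "x \<notin> L (Suc j)" for x
    unfolding c_def S_def using orbit_sum_P_constant[OF f1(2) that] T_L t1 t0(3) by blast
  \<comment> \<open>If \<open>x\<close> first leaves the chain at \<open>Suc m\<close>, with
    \<open>m < j\<close>, then multiplication by any \<open>t\<close> in \<open>T j\<close> keeps it
    in the shell of level \<open>m\<close>. So \<open>S\<close> is constant on the fibre of
    \<open>x\<close>, and a vanishing fibre sum forces \<open>S x = 0\<close>.\<close>
  have S_out: "S x = 0" if x: "x \<in> carrier G" "x \<notin> L j" for x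
  proof -
    define i where "i = (LEAST i. x \<notin> L i)"
    have i: "x \<notin> L i" "i \<le> j" unfolding i_def using x(2) by (rule LeastI, rule Least_le)
    have "i \<noteq> 0" using i(1) x(1) L_0 by metis
    then obtain m where m: "i = Suc m" by (cases i) auto
    have xm: "x \<in> L m" using not_less_Least[of m "\<lambda>i. x \<notin> L i"] m unfolding i_def by auto
    have "S (t \<otimes> x) = S x" if t: "t \<in> T j" for t
    proof -
      have tL: "t \<in> L (Suc m)" using T_L[OF t] L_mono[of "Suc m" j] i m by auto
      then have tm: "t \<in> L m" using L_mono[of m "Suc m"] by auto
      have tc: "t \<in> carrier G" using t T_carrier by blast
      have "t \<otimes> x \<notin> L (Suc m)"
      proof
        assume "t \<otimes> x \<in> L (Suc m)"
        then have "inv t \<otimes> (t \<otimes> x) \<in> L (Suc m)"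
          using tL L_subgroup by (simp add: subgroup.m_closed subgroup.m_inv_closed)
        then show False using i m tc x(1) by (simp add: m_assoc[symmetric])
      qed
      then show ?thesis unfolding S_def
        using orbit_sum_P_constant[OF f1(2), of "t \<otimes> x" m x] xm i m tm L_subgroup
        by (simp add: subgroup.m_closed)
    qed
    then have "fibre_sum j S x = of_nat (card (T j)) * S x" using x by (simp add: fibre_sum_def)
    moreover have "card (T j) \<noteq> 0" using T_card[of j] by simp
    ultimately show ?thesis using S0 by simp
  qed
  \<comment> \<open>With \<open>a = c\<close> the fibre sum at the unit would be
    \<open>card (T j)\<close> times \<open>a\<close>, which is not 0.\<close>
  have ac: "a \<noteq> c"
  proof
    assume e: "a = c"
    have "fibre_sum j S \<one> = (\<Sum>t\<in>T j. a)"
    proof -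
      have "S t = a" if "t \<in> T j" for t
        using T_L[OF that] Sa Sc e by (cases "t \<in> L (Suc j)") auto
      then show ?thesis unfolding fibre_sum_def using T_carrier by simp
    qed
    moreover have "card (T j) \<noteq> 0" using T_card[of j] by simp
    ultimately show False using S0 a0 by simp
  qed
  \<comment> \<open>The translate of \<open>S\<close> that belongs to \<open>t x\<close> has value
    \<open>a\<close> on the coset of \<open>t x\<close>, value \<open>c\<close> on the other cosets
    of that fibre and 0 elsewhere. Weighted with the values of \<open>u\<close>, the translates add
    up to \<open>(a - c) u\<close> plus \<open>c\<close> times the fibre sum of \<open>u\<close>,
    and the latter is 0.\<close>
  define F where "F = (\<Sum>x\<in>reps j. \<Sum>t\<in>T j. fscale (u (t \<otimes> x)) (R (inv (t \<otimes> x)) S))"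
  have subW: "cfun.subspace W" using W(1) by (simp add: invariant_subspace_def)
  have FW: "F \<in> W"
    unfolding F_def using W(1) SW T_carrier reps_carrier
    by (intro cfun.subspace_sum[OF subW] cfun.subspace_scale[OF subW])
      (simp add: invariant_subspace_def)
  have uV: "u \<in> V (Suc j)" and u0: "fibre_sum j u = 0" using u by auto
  have "fscale (1 / (a - c)) F = u"
  proof (rule V_eqI[of _ "Suc j"])
    show "fscale (1 / (a - c)) F \<in> V (Suc j)"
      using FW W(2) cfun.subspace_scale[OF V_subspace] by auto
    show "u \<in> V (Suc j)" by (rule uV)
    fix y assume "y \<in> reps (Suc j)"
    then obtain s z where sz: "s \<in> T j" "z \<in> reps j" "y = s \<otimes> z" by auto
    have cs: "s \<in> carrier G" "z \<in> carrier G" using sz T_carrier reps_carrier by auto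
    have val: "S (y \<otimes> inv (t \<otimes> x)) = (if x = z then (if t = s then a else c) else 0)"
      if "x \<in> reps j" "t \<in> T j" for x t
    proof -
      have ct: "t \<in> carrier G" "x \<in> carrier G" using that T_carrier reps_carrier by auto
      have e: "y \<otimes> inv (t \<otimes> x) = s \<otimes> (z \<otimes> inv x) \<otimes> inv t"
        using ct cs by (simp add: sz(3) inv_mult_group m_assoc)
      show ?thesis
      proof (cases "x = z")
        case True
        then have e': "y \<otimes> inv (t \<otimes> x) = s \<otimes> inv t" using e ct cs by simp
        have "s \<otimes> inv t \<in> L j" using T_L sz that L_subgroup
          by (simp add: subgroup.m_closed subgroup.m_inv_closed)
        moreover have "s \<otimes> inv t \<in> L (Suc j)" if "t = s"
          using that cs subgroup.one_closed[OF L_subgroup] by simp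
        moreover have "s \<otimes> inv t \<notin> L (Suc j)" if "t \<noteq> s"
          using that T_unique[OF sz(1) \<open>t \<in> T j\<close>] by auto
        ultimately show ?thesis using True e' Sa Sc by auto
      next
        case False
        have "y \<otimes> inv (t \<otimes> x) \<notin> L j"
        proof
          assume "y \<otimes> inv (t \<otimes> x) \<in> L j"
          then have "inv s \<otimes> (y \<otimes> inv (t \<otimes> x)) \<otimes> t \<in> L j"
            using T_L sz that L_subgroup by (simp add: subgroup.m_closed subgroup.m_inv_closed)
          moreover have "inv s \<otimes> (y \<otimes> inv (t \<otimes> x)) \<otimes> t = (inv s \<otimes> s) \<otimes> (z \<otimes> inv x \<otimes> (inv t \<otimes> t))"
            unfolding e using ct cs by (simp only: m_assoc m_closed inv_closed)
          ultimately have "z \<otimes> inv x \<in> L j" using ct cs by simp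
          then show False using reps_unique[OF sz(2) that(1)] False by simp
        qed
        then show ?thesis using False S_out ct cs sz by simp
      qed
    qed
    have yc: "y \<in> carrier G" using sz cs by simp
    have "F y = (\<Sum>x\<in>reps j. \<Sum>t\<in>T j. u (t \<otimes> x) * S (y \<otimes> inv (t \<otimes> x)))"
      unfolding F_def using yc by (simp add: sum_fun_apply R_apply)
    also have "\<dots> = (\<Sum>x\<in>reps j. if x = z then \<Sum>t\<in>T j. u (t \<otimes> z) * (if t = s then a else c) else 0)"
      by (intro sum.cong refl) (auto simp: val intro!: sum.cong)
    also have "\<dots> = (\<Sum>t\<in>T j. u (t \<otimes> z) * (if t = s then a else c))"
      using sz reps_finite by simp
    also have "\<dots> = (\<Sum>t\<in>T j. u (t \<otimes> z) * c + (if t = s then u (s \<otimes> z) * (a - c) else 0))"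
      by (intro sum.cong) (auto simp: algebra_simps)
    also have "\<dots> = (\<Sum>t\<in>T j. u (t \<otimes> z)) * c + u (s \<otimes> z) * (a - c)"
      using sz T_finite by (simp add: sum.distrib sum_distrib_right)
    also have "(\<Sum>t\<in>T j. u (t \<otimes> z)) = fibre_sum j u z" using cs by (simp add: fibre_sum_def)
    finally show "fscale (1 / (a - c)) F y = u y" using ac u0 sz by simp
  qed
  then show "u \<in> W" using cfun.subspace_scale[OF subW FW] by metis
qed

lemma U_minimal:
  assumes W: "invariant_subspace W" "W \<subseteq> U k" "W \<noteq> {0}"
  shows "W = U k"
proof -
  have "0 \<in> W" using W(1) by (simp add: invariant_subspace_def cfun.subspace_0)
  then obtain f where f: "f \<in> W" "f \<noteq> 0" using W(3) by blast
  have "U k \<subseteq> W"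
  proof (cases k)
    case 0
    have const: "v x = (if x \<in> carrier G then v \<one> else 0)" if "v \<in> V 0" for v x
      using V_left[OF that, of x \<one>] V_outside[OF that] L_0 by auto
    have fV: "f \<in> V 0" using f W 0 by auto
    have f1: "f \<one> \<noteq> 0"
    proof
      assume "f \<one> = 0"
      then have "f x = 0" for x using const[OF fV, of x] by simp
      then have "f = 0" by (simp add: fun_eq_iff)
      then show False using f by simp
    qed
    have "u \<in> W" if "u \<in> V 0" for u
    proof -
      have "fscale (u \<one> / f \<one>) f x = u x" for x
        using const[OF fV, of x] const[OF that, of x] f1 by auto
      then have "fscale (u \<one> / f \<one>) f = u" by blast
      then show ?thesis using W(1) f cfun.subspace_scale unfolding invariant_subspace_def by metis
    qed
    then show ?thesis using 0 by auto
  next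
    case (Suc j)
    then show ?thesis using U_Suc_minimal W f by simp
  qed
  then show ?thesis using W by blast
qed

text \<open>This takes the place of a decomposition of the induced representation: applied to an
  irreducible subspace, it identifies that subspace with some \<open>U k\<close>.\<close>

lemma invariant_contains_U:
  assumes W: "invariant_subspace W" "W \<noteq> {0}"
  shows "\<exists>k. U k \<subseteq> W"
proof -
  obtain k f where f: "f \<in> W" "f \<in> U k" "f \<noteq> 0" using invariant_meets_U[OF W] by blast
  have "invariant_subspace (W \<inter> U k)"
    using W(1) invariant_U[of k] unfolding invariant_subspace_def by (auto intro: cfun.subspace_inter)
  then have "W \<inter> U k = U k" using f by (intro U_minimal) auto
  then show ?thesis by blast
qed

lemma dim_U_0: "cfun.dim (U 0) = 1"
proof -
  define b where "b i x = (if x \<in> carrier G then 1 else 0 :: complex)" for i :: unit and x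
  have "cfun.dim (U 0) = card {()}"
  proof (rule dim_dual_basis[where b = b and p = "\<lambda>_. \<one>"])
    fix f assume f: "f \<in> U 0"
    then have "f \<in> V 0" by simp
    then have "f x = (\<Sum>i\<in>{()}. fscale (f \<one>) (b i)) x" for x
      using V_left[of f 0 x \<one>] V_outside[of f 0 x] L_0 by (simp add: b_def)
    then show "f = (\<Sum>i\<in>{()}. fscale (f \<one>) (b i))" by blast
  qed (auto simp: b_def V_def L_carrier)
  then show ?thesis by simp
qed

text \<open>In each fibre the vanishing sum removes one dimension. The basis consists of differences
  of indicator functions of two cosets in the same fibre, the second one always that of the fixed
  \<open>r\<close>; the values at \<open>t x\<close> with \<open>t\<close> other than
  \<open>r\<close> are the coordinates.\<close>

lemma dim_U_Suc: "cfun.dim (U (Suc k)) = (card (T k) - 1) * card (reps k)"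
proof -
  obtain r where r: "r \<in> T k" using T_mem_L_Suc by blast
  define \<delta> where "\<delta> g x = (if x \<in> carrier G \<and> x \<otimes> inv g \<in> L (Suc k) then 1 else 0 :: complex)" for g x
  define I where "I = (T k - {r}) \<times> reps k"
  define b where "b = (\<lambda>(t, x). \<delta> (t \<otimes> x) + fscale (- 1) (\<delta> (r \<otimes> x)))"
  have \<delta>V: "\<delta> g \<in> V (Suc k)" if g: "g \<in> carrier G" for g
  proof -
    have "(h \<otimes> x) \<otimes> inv g \<in> L (Suc k) \<longleftrightarrow> x \<otimes> inv g \<in> L (Suc k)"
      if h: "h \<in> L (Suc k)" and x: "x \<in> carrier G" for h x
    proof
      have hc: "h \<in> carrier G" using h by (rule L_carrier)
      assume "(h \<otimes> x) \<otimes> inv g \<in> L (Suc k)"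
      then have "inv h \<otimes> ((h \<otimes> x) \<otimes> inv g) \<in> L (Suc k)"
        using h L_subgroup by (simp add: subgroup.m_closed subgroup.m_inv_closed)
      then show "x \<otimes> inv g \<in> L (Suc k)" using hc x g by (simp add: m_assoc[symmetric])
    next
      assume "x \<otimes> inv g \<in> L (Suc k)"
      then have "h \<otimes> (x \<otimes> inv g) \<in> L (Suc k)" using h L_subgroup by (simp add: subgroup.m_closed)
      then show "(h \<otimes> x) \<otimes> inv g \<in> L (Suc k)" using x g L_carrier[OF h] by (simp add: m_assoc)
    qed
    then show ?thesis unfolding V_def \<delta>_def using L_carrier by auto
  qed
  have \<delta>_val: "\<delta> (t \<otimes> x) (t' \<otimes> x') = (if t = t' \<and> x = x' then 1 else 0)"
    if "t \<in> T k" "t' \<in> T k" "x \<in> reps k" "x' \<in> reps k" for t x t' x'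
  proof -
    have c: "t \<otimes> x \<in> carrier G" "t' \<otimes> x' \<in> carrier G" using that T_carrier reps_carrier by auto
    have m: "t \<otimes> x \<in> reps (Suc k)" "t' \<otimes> x' \<in> reps (Suc k)" using that by force+
    have "(t' \<otimes> x') \<otimes> inv (t \<otimes> x) \<in> L (Suc k) \<longleftrightarrow> t' \<otimes> x' = t \<otimes> x"
      using reps_unique[OF m(2,1)] c(1) subgroup.one_closed[OF L_subgroup, of "Suc k"] by auto
    also have "\<dots> \<longleftrightarrow> t = t' \<and> x = x'"
      using inj_onD[OF reps_inj, of "(t', x')" "(t, x)" k] that by auto
    finally show ?thesis unfolding \<delta>_def using c by auto
  qed
  have bV: "b i \<in> V (Suc k)" if "i \<in> I" for i
  proof -
    obtain t x where tx: "i = (t, x)" "t \<in> T k" "x \<in> reps k" using \<open>i \<in> I\<close> unfolding I_def by auto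
    show ?thesis
      unfolding tx(1) b_def prod.case using tx r T_carrier reps_carrier
      by (intro cfun.subspace_add[OF V_subspace] cfun.subspace_scale[OF V_subspace] \<delta>V) simp_all
  qed
  have b_val: "b (t, x) (t' \<otimes> x') =
      (if x = x' then (if t = t' then 1 else 0) - (if t' = r then 1 else 0) else 0)"
    if "t \<in> T k" "t' \<in> T k" "x \<in> reps k" "x' \<in> reps k" for t x t' x'
    using \<delta>_val that r by (simp add: b_def)
  have "cfun.dim (U (Suc k)) = card I"
  proof (rule dim_dual_basis[where b = b and p = "\<lambda>(t, x). t \<otimes> x"])
    show fin: "finite I" unfolding I_def using T_finite reps_finite by blast
    show "b i (case j of (t, x) \<Rightarrow> t \<otimes> x) = (if i = j then 1 else 0)" if "i \<in> I" "j \<in> I" for i j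
      using that b_val unfolding I_def by (auto split: prod.splits if_splits)
    show "b i \<in> U (Suc k)" if i: "i \<in> I" for i
    proof -
      obtain t x where tx: "i = (t, x)" "t \<in> T k" "t \<noteq> r" "x \<in> reps k" using i unfolding I_def by auto
      have "fibre_sum k (b i) = 0"
      proof (rule V_eqI[of _ k])
        show "fibre_sum k (b i) \<in> V k" using bV[OF i] by (rule fibre_sum_V)
        show "0 \<in> V k" by (rule cfun.subspace_0[OF V_subspace])
        fix y assume y: "y \<in> reps k"
        have "fibre_sum k (b i) y = (\<Sum>s\<in>T k. b (t, x) (s \<otimes> y))"
          using reps_carrier[OF y] by (simp add: fibre_sum_def tx(1))
        also have "\<dots> = (\<Sum>s\<in>T k. if x = y then (if t = s then 1 else 0) - (if s = r then 1 else 0) else 0)"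
          using tx y by (intro sum.cong) (auto simp: b_val)
        also have "\<dots> = 0" using tx r T_finite[of k] by (cases "x = y") (simp_all add: sum_subtractf)
        finally show "fibre_sum k (b i) y = 0 y" by simp
      qed
      then show ?thesis using bV[OF i] by simp
    qed
    show "f = (\<Sum>i\<in>I. fscale (f (case i of (t, x) \<Rightarrow> t \<otimes> x)) (b i))" if f: "f \<in> U (Suc k)" for f
    proof (rule V_eqI[of _ "Suc k"])
      show "f \<in> V (Suc k)" using f by simp
      show "(\<Sum>i\<in>I. fscale (f (case i of (t, x) \<Rightarrow> t \<otimes> x)) (b i)) \<in> V (Suc k)"
        by (intro cfun.subspace_sum[OF V_subspace] cfun.subspace_scale[OF V_subspace] bV)
      fix y assume "y \<in> reps (Suc k)"
      then obtain s z where sz: "s \<in> T k" "z \<in> reps k" "y = s \<otimes> z" by auto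
      have "fibre_sum k f z = 0" using f by simp
      then have "(\<Sum>t\<in>T k. f (t \<otimes> z)) = 0" using reps_carrier[OF sz(2)] by (simp add: fibre_sum_def)
      \<comment> \<open>The value at the omitted point is minus the sum of the coordinates in its
        fibre.\<close>
      then have fr: "f (r \<otimes> z) = - (\<Sum>t\<in>T k - {r}. f (t \<otimes> z))"
        using sum.remove[OF T_finite r, of "\<lambda>t. f (t \<otimes> z)"] by (simp add: eq_neg_iff_add_eq_0)
      have "(\<Sum>i\<in>I. fscale (f (case i of (t, x) \<Rightarrow> t \<otimes> x)) (b i)) y
          = (\<Sum>t\<in>T k - {r}. \<Sum>x\<in>reps k. f (t \<otimes> x) * b (t, x) (s \<otimes> z))"
        unfolding sum.cartesian_product I_def sz(3) sum_fun_apply by (auto intro!: sum.cong)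
      also have "\<dots> = (\<Sum>t\<in>T k - {r}. \<Sum>x\<in>reps k. if x = z then f (t \<otimes> z) *
            ((if t = s then 1 else 0) - (if s = r then 1 else 0)) else 0)"
        using sz by (intro sum.cong refl) (auto simp: b_val)
      also have "\<dots> = (\<Sum>t\<in>T k - {r}. f (t \<otimes> z) * ((if t = s then 1 else 0) - (if s = r then 1 else 0)))"
        using sz reps_finite by simp
      also have "\<dots> = f y"
      proof (cases "s = r")
        case True
        then have "(\<Sum>t\<in>T k - {r}. f (t \<otimes> z) * ((if t = s then 1 else 0) - (if s = r then 1 else 0)))
            = (\<Sum>t\<in>T k - {r}. - f (t \<otimes> z))" by (intro sum.cong) auto
        then show ?thesis using fr True sz by (simp add: sum_negf)
      next
        case False
        then have "(\<Sum>t\<in>T k - {r}. f (t \<otimes> z) * ((if t = s then 1 else 0) - (if s = r then 1 else 0)))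
            = (\<Sum>t\<in>T k - {r}. if t = s then f (s \<otimes> z) else 0)" by (intro sum.cong) auto
        then show ?thesis using False sz T_finite by simp
      qed
      finally show "f y = (\<Sum>i\<in>I. fscale (f (case i of (t, x) \<Rightarrow> t \<otimes> x)) (b i)) y" by simp
    qed
  qed
  then show ?thesis using r T_finite by (simp add: I_def card_cartesian_product)
qed

text \<open>Distinct dimensions are what keeps the constituents apart, as isomorphic representations
  have equal dimension. The step from 0 to 1 relies on \<open>T_0\<close>, the others on
  \<open>T_card\<close>.\<close>

lemma strict_mono_dim_U: "strict_mono (\<lambda>k. cfun.dim (U k))"
  unfolding strict_mono_Suc_iff
proof
  fix k
  show "cfun.dim (U k) < cfun.dim (U (Suc k))"
  proof (cases k)
    case 0
    then show ?thesis using T_0 by (simp add: dim_U_0 dim_U_Suc del: U.simps)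
  next
    case (Suc j)
    have "card (reps j) > 0" using T_card unfolding card_reps
      by (intro prod_pos) (metis gr0I not_numeral_le_zero)
    moreover have "card (T j) \<ge> 2" by (rule T_card)
    ultimately have "(card (T j) - 1) * card (reps j) < card (T j) * card (reps j)" by simp
    also have "\<dots> = 1 * card (reps (Suc j))" unfolding card_reps by simp
    also have "\<dots> \<le> (card (T (Suc j)) - 1) * card (reps (Suc j))"
      using T_card[of "Suc j"] by (intro mult_right_mono) auto
    finally show ?thesis unfolding Suc dim_U_Suc .
  qed
qed

end

section \<open>Transport along isomorphisms of representations\<close>

lemma rep_iso_dim:
  fixes p :: "('g, 'x) rep" and p' :: "('g, 'y) rep"
  assumes iso: "rep_iso G p p'" and p: "is_rep G p"
  shows "cfun.dim (fst p') = cfun.dim (fst p)"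
proof -
  obtain V \<pi> W \<sigma> where pp: "p = (V, \<pi>)" "p' = (W, \<sigma>)" by (metis prod.exhaust)
  obtain \<phi> where \<phi>: "bij_betw \<phi> V W" "\<And>f f'. f \<in> V \<Longrightarrow> f' \<in> V \<Longrightarrow> \<phi> (f + f') = \<phi> f + \<phi> f'"
    "\<And>c f. f \<in> V \<Longrightarrow> \<phi> (fscale c f) = fscale c (\<phi> f)"
    using iso unfolding rep_iso_def pp by auto
  have V: "cfun.subspace V" using p unfolding is_rep_def pp by simp
  interpret vp: vector_space_pair "fscale :: complex \<Rightarrow> ('x \<Rightarrow> complex) \<Rightarrow> 'x \<Rightarrow> complex"
    "fscale :: complex \<Rightarrow> ('y \<Rightarrow> complex) \<Rightarrow> 'y \<Rightarrow> complex"
    by unfold_locales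
  obtain B where B: "B \<subseteq> V" "cfun.independent B" "V \<subseteq> cfun.span B" "card B = cfun.dim V"
    by (rule cfun.basis_exists)
  have spanB: "cfun.span B = V" using B V cfun.span_minimal by blast
  \<comment> \<open>The isomorphism is known to be linear on \<open>V\<close> only.
    \<open>construct\<close> extends its restriction to a basis to a linear map on the whole
    function space, where the general results on dimension apply.\<close>
  define g where "g = vp.construct B \<phi>"
  have lin: "Vector_Spaces.linear fscale fscale g"
    unfolding g_def by (rule vp.linear_construct[OF B(2)])
  interpret g: Vector_Spaces.linear fscale fscale g by (rule lin)
  have \<phi>0: "\<phi> 0 = 0" using \<phi>(3)[OF cfun.subspace_0[OF V], of 0] by simp
  have g\<phi>: "f \<in> V \<and> g f = \<phi> f" if "f \<in> cfun.span B" for f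
    using that
  proof (induction rule: cfun.span_induct_alt)
    case base
    show ?case using cfun.subspace_0[OF V] \<phi>0 g.zero by metis
  next
    case (step c x y)
    have x: "x \<in> V" "g x = \<phi> x" using step B unfolding g_def by (auto simp: vp.construct_basis)
    have cx: "fscale c x \<in> V" using x V by (simp add: cfun.subspace_scale)
    have y: "y \<in> V" "g y = \<phi> y" using step by auto
    have "g (fscale c x + y) = \<phi> (fscale c x + y)"
      unfolding g.add g.scale \<phi>(2)[OF cx y(1)] \<phi>(3)[OF x(1)] x(2) y(2) ..
    then show ?case using cfun.subspace_add[OF V cx y(1)] by blast
  qed
  have inj: "inj_on g (cfun.span B)"
    using \<phi>(1) g\<phi> spanB unfolding bij_betw_def inj_on_def by metis
  have "cfun.independent (g ` B)"
    using vp.linear_independent_injective_image[OF lin B(2) inj] .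
  moreover have "g ` V = W" using \<phi>(1) g\<phi> spanB unfolding bij_betw_def by (metis image_cong)
  then have "g ` B \<subseteq> W" "W \<subseteq> cfun.span (g ` B)" using B spanB g.span_image[of B] by auto
  moreover have "card (g ` B) = card B"
    using inj cfun.span_superset by (intro card_image) (rule inj_on_subset)
  ultimately show ?thesis using B(4) pp cfun.dim_unique by (metis fst_conv)
qed

lemma rep_iso_refl: "rep_iso G p p"
  unfolding rep_iso_def by (auto intro!: exI[of _ id] split: prod.splits)

lemma rep_iso_sym:
  assumes iso: "rep_iso G p p'" and p: "is_rep G p"
  shows "rep_iso G p' p"
proof -
  obtain V \<pi> W \<sigma> where pp: "p = (V, \<pi>)" "p' = (W, \<sigma>)" by (metis prod.exhaust)
  obtain \<phi> where \<phi>: "bij_betw \<phi> V W" "\<And>f f'. f \<in> V \<Longrightarrow> f' \<in> V \<Longrightarrow> \<phi> (f + f') = \<phi> f + \<phi> f'"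
    "\<And>c f. f \<in> V \<Longrightarrow> \<phi> (fscale c f) = fscale c (\<phi> f)"
    "\<And>g f. g \<in> carrier G \<Longrightarrow> f \<in> V \<Longrightarrow> \<phi> (\<pi> g f) = \<sigma> g (\<phi> f)"
    using iso unfolding rep_iso_def pp by auto
  have V: "cfun.subspace V" "\<And>g f. g \<in> carrier G \<Longrightarrow> f \<in> V \<Longrightarrow> \<pi> g f \<in> V"
    using p unfolding is_rep_def pp by auto
  define \<psi> where "\<psi> = inv_into V \<phi>"
  have W: "W = \<phi> ` V" and inj: "inj_on \<phi> V" using \<phi>(1) by (auto simp: bij_betw_def)
  have \<psi>: "\<psi> (\<phi> f) = f" if "f \<in> V" for f using that inj by (simp add: \<psi>_def)
  have "bij_betw \<psi> W V" unfolding \<psi>_def using \<phi>(1) by (rule bij_betw_inv_into)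
  moreover have "\<psi> (\<phi> f + \<phi> f') = \<psi> (\<phi> f) + \<psi> (\<phi> f')" if "f \<in> V" "f' \<in> V" for f f'
    using that \<phi>(2) \<psi> cfun.subspace_add[OF V(1)] by metis
  moreover have "\<psi> (fscale c (\<phi> f)) = fscale c (\<psi> (\<phi> f))" if "f \<in> V" for f c
    using that \<phi>(3) \<psi> cfun.subspace_scale[OF V(1)] by metis
  moreover have "\<psi> (\<sigma> g (\<phi> f)) = \<pi> g (\<psi> (\<phi> f))" if "f \<in> V" "g \<in> carrier G" for f g
    using that \<phi>(4) \<psi> V(2) by metis
  ultimately show ?thesis unfolding rep_iso_def pp prod.case W by blast
qed

lemma rep_iso_trans:
  assumes "rep_iso G p p'" "rep_iso G p' p''"
  shows "rep_iso G p p''"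
proof -
  obtain V \<pi> W \<sigma> U \<tau> where pp: "p = (V, \<pi>)" "p' = (W, \<sigma>)" "p'' = (U, \<tau>)" by (metis prod.exhaust)
  obtain \<phi> where \<phi>: "bij_betw \<phi> V W" "\<And>f f'. f \<in> V \<Longrightarrow> f' \<in> V \<Longrightarrow> \<phi> (f + f') = \<phi> f + \<phi> f'"
    "\<And>c f. f \<in> V \<Longrightarrow> \<phi> (fscale c f) = fscale c (\<phi> f)"
    "\<And>g f. g \<in> carrier G \<Longrightarrow> f \<in> V \<Longrightarrow> \<phi> (\<pi> g f) = \<sigma> g (\<phi> f)"
    using assms(1) unfolding rep_iso_def pp by auto
  obtain \<psi> where \<psi>: "bij_betw \<psi> W U" "\<And>f f'. f \<in> W \<Longrightarrow> f' \<in> W \<Longrightarrow> \<psi> (f + f') = \<psi> f + \<psi> f'"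
    "\<And>c f. f \<in> W \<Longrightarrow> \<psi> (fscale c f) = fscale c (\<psi> f)"
    "\<And>g f. g \<in> carrier G \<Longrightarrow> f \<in> W \<Longrightarrow> \<psi> (\<sigma> g f) = \<tau> g (\<psi> f)"
    using assms(2) unfolding rep_iso_def pp by auto
  have m: "\<phi> f \<in> W" if "f \<in> V" for f using \<phi>(1) that by (auto simp: bij_betw_def)
  show ?thesis unfolding rep_iso_def pp prod.case
    by (rule exI[of _ "\<psi> \<circ> \<phi>"]) (auto simp: \<phi> \<psi> m intro: bij_betw_trans[OF \<phi>(1) \<psi>(1)])
qed

text \<open>The preimage of \<open>W'\<close> is a subrepresentation of the irreducible
  \<open>p\<close>.\<close>

lemma rep_iso_irreducible:
  assumes iso: "rep_iso G p (W, \<sigma>)" and p: "irreducible_rep G p"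
    and W': "W' \<subseteq> W" "is_rep G (W', \<sigma>)" "W' \<noteq> {0}"
  shows "W' = W"
proof -
  obtain V \<pi> where pp: "p = (V, \<pi>)" by (metis prod.exhaust)
  obtain \<phi> where \<phi>: "bij_betw \<phi> V W" "\<And>f f'. f \<in> V \<Longrightarrow> f' \<in> V \<Longrightarrow> \<phi> (f + f') = \<phi> f + \<phi> f'"
    "\<And>c f. f \<in> V \<Longrightarrow> \<phi> (fscale c f) = fscale c (\<phi> f)"
    "\<And>g f. g \<in> carrier G \<Longrightarrow> f \<in> V \<Longrightarrow> \<phi> (\<pi> g f) = \<sigma> g (\<phi> f)"
    using iso unfolding rep_iso_def pp by auto
  have rV: "is_rep G (V, \<pi>)" and min: "\<And>Y. Y \<subseteq> V \<Longrightarrow> is_rep G (Y, \<pi>) \<Longrightarrow> Y = {0} \<or> Y = V"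
    using p unfolding irreducible_rep_def pp by auto
  have subV: "cfun.subspace V" using rV by (simp add: is_rep_def)
  have subW': "cfun.subspace W'" using W' by (simp add: is_rep_def)
  have \<phi>0: "\<phi> 0 = 0" using \<phi>(3)[OF cfun.subspace_0[OF subV], of 0] by simp
  define Y where "Y = {f\<in>V. \<phi> f \<in> W'}"
  have "cfun.subspace Y" unfolding cfun.subspace_def Y_def
    using cfun.subspace_0[OF subV] cfun.subspace_0[OF subW'] \<phi> \<phi>0
    by (auto simp: cfun.subspace_add[OF subV] cfun.subspace_add[OF subW']
      cfun.subspace_scale[OF subV] cfun.subspace_scale[OF subW'])
  then have "is_rep G (Y, \<pi>)"
    using rV W'(2) \<phi>(4) unfolding is_rep_def Y_def by auto
  then have "Y = {0} \<or> Y = V" using min[of Y] by (auto simp: Y_def)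
  moreover have "W' = \<phi> ` Y" using W'(1) \<phi>(1) by (auto simp: Y_def bij_betw_def)
  ultimately show ?thesis using W'(3) \<phi>0 \<phi>(1) by (auto simp: bij_betw_def)
qed

section \<open>Multiplicities in the induced representation\<close>

context tower
begin

lemma is_rep_U: "is_rep G (U k, R)"
  using invariant_U[of k] is_rep_iff unfolding invariant_subspace_def by blast

lemma U_nonzero: "U k \<noteq> {0}"
proof -
  have "cfun.dim (U k) \<ge> 1"
    using strict_mono_less_eq[OF strict_mono_dim_U, of 0 k] dim_U_0 by simp
  moreover have "cfun.dim {0 :: 'g \<Rightarrow> complex} = 0"
    using cfun.dim_eq_card_independent[OF cfun.independent_empty] cfun.span_empty cfun.dim_span
    by (metis card.empty)
  ultimately show ?thesis by (metis not_one_le_zero)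
qed

lemma U_subset_UN: "U k \<subseteq> (\<Union>k. V k)"
  using invariant_U unfolding invariant_subspace_def by simp

lemma U_smooth_irrep: "(U k, R) \<in> smooth_irreps G Top"
proof -
  have "W = {0} \<or> W = U k" if "W \<subseteq> U k" "is_rep G (W, R)" for W
    using U_minimal[of W k] is_rep_iff[of W] that subset_trans[OF that(1) U_subset_UN] by metis
  then show ?thesis
    unfolding smooth_irreps_def irreducible_rep_def
    using smooth_rep_invariant[OF invariant_U] is_rep_U U_nonzero by simp
qed

text \<open>\<open>W\<close> is nonzero, hence contains some \<open>U k\<close>, and irreducibility
  leaves no room for more.\<close>

lemma subrep_eq_U:
  assumes p: "irreducible_rep G p" and W: "W \<subseteq> (\<Union>k. V k)" "is_rep G (W, R)" "rep_iso G p (W, R)"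
  shows "\<exists>k. W = U k"
proof -
  have inv: "invariant_subspace W" using W is_rep_iff by blast
  have "W \<noteq> {0}"
  proof
    obtain Vp \<pi> where pp: "p = (Vp, \<pi>)" by (metis prod.exhaust)
    have Vp: "0 \<in> Vp" "Vp \<noteq> {0}"
      using p unfolding pp irreducible_rep_def is_rep_def by (auto simp: cfun.subspace_0)
    assume "W = {0}"
    then obtain \<phi> where "bij_betw \<phi> Vp {0 :: 'g \<Rightarrow> complex}" using W(3) unfolding rep_iso_def pp by auto
    then have "inj_on \<phi> Vp" "\<And>f. f \<in> Vp \<Longrightarrow> \<phi> f = 0" by (auto simp: bij_betw_def)
    then have "\<And>f. f \<in> Vp \<Longrightarrow> f = 0" using Vp unfolding inj_on_def by metis
    then show False using Vp by blast
  qed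
  then obtain k where "U k \<subseteq> W" using invariant_contains_U[OF inv] by blast
  then show ?thesis using rep_iso_irreducible[OF W(3) p _ is_rep_U U_nonzero] by blast
qed

lemma U_eq_iff_dim: "U k = U l \<longleftrightarrow> k = l" "rep_iso G (U k, R) (U l, R) \<longleftrightarrow> k = l"
proof -
  have "rep_iso G (U k, R) (U l, R) \<Longrightarrow> k = l"
    using rep_iso_dim[OF _ is_rep_U, of k "(U l, R)"] strict_mono_eq[OF strict_mono_dim_U, of k l] by simp
  then show "U k = U l \<longleftrightarrow> k = l" "rep_iso G (U k, R) (U l, R) \<longleftrightarrow> k = l"
    using rep_iso_refl by metis+
qed

text \<open>Any copy of \<open>p\<close> inside the induced representation is equal, and not just
  isomorphic, to some \<open>U k\<close>; at most one \<open>U k\<close> is isomorphic to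
  \<open>p\<close>. So no admissible family has two members.\<close>

lemma rep_mult_Ind:
  assumes p: "p \<in> smooth_irreps G Top"
  shows "rep_mult G p (Ind G Top P) = (if \<exists>k. rep_iso G p (U k, R) then 1 else 0)"
proof -
  let ?\<F> = "{F. finite F \<and> direct_family F \<and>
      (\<forall>W\<in>F. W \<subseteq> (\<Union>k. V k) \<and> is_rep G (W, R) \<and> rep_iso G p (W, R))}"
  have irr: "irreducible_rep G p" and rep: "is_rep G p"
    using p unfolding smooth_irreps_def smooth_rep_def by auto
  have mult: "rep_mult G p (Ind G Top P) = (SUP F \<in> ?\<F>. enat (card F))"
    unfolding rep_mult_def Ind_def ind_space_eq by simp
  have sub: "F \<subseteq> {W. \<exists>k. W = U k \<and> rep_iso G p (U k, R)}" if "F \<in> ?\<F>" for F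
  proof
    fix W assume "W \<in> F"
    then have "W \<subseteq> (\<Union>k. V k)" "is_rep G (W, R)" "rep_iso G p (W, R)" using that by auto
    then show "W \<in> {W. \<exists>k. W = U k \<and> rep_iso G p (U k, R)}" using subrep_eq_U[OF irr] by blast
  qed
  show ?thesis
  proof (cases "\<exists>k. rep_iso G p (U k, R)")
    case True
    then obtain k where k: "rep_iso G p (U k, R)" by blast
    have "l = k" if "rep_iso G p (U l, R)" for l
      using rep_iso_trans[OF rep_iso_sym[OF that rep] k] U_eq_iff_dim by simp
    then have "F \<subseteq> {U k}" if "F \<in> ?\<F>" for F using sub[OF that] by blast
    then have "card F \<le> 1" if "F \<in> ?\<F>" for F
      using that card_mono[of "{U k}" F] by simp
    then have "enat (card F) \<le> 1" if "F \<in> ?\<F>" for F using that by (simp add: one_enat_def)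
    moreover have "{U k} \<in> ?\<F>"
      using k is_rep_U U_V[of k] by (auto simp: direct_family_def)
    ultimately have "(SUP F \<in> ?\<F>. enat (card F)) = 1"
      by (intro antisym SUP_least SUP_upper2[of "{U k}"]) (simp_all add: one_enat_def)
    then show ?thesis using True mult by simp
  next
    case False
    then have "F = {}" if "F \<in> ?\<F>" for F using sub[OF that] by blast
    then have "(SUP F \<in> ?\<F>. enat (card F)) \<le> 0"
      by (intro SUP_least) (simp add: zero_enat_def)
    then show ?thesis unfolding mult using False by simp
  qed
qed

abbreviation iso_rel :: "(('g, 'g) rep \<times> ('g, 'g) rep) set" where
  "iso_rel \<equiv> {(p, p'). p \<in> smooth_irreps G Top \<and> p' \<in> smooth_irreps G Top \<and> rep_iso G p p'}"

lemma equiv_iso_rel: "equiv (smooth_irreps G Top) iso_rel"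
proof (rule equivI)
  show "refl_on (smooth_irreps G Top) iso_rel" by (auto simp: refl_on_def rep_iso_refl)
  show "sym iso_rel"
    by (rule symI) (auto intro: rep_iso_sym simp: smooth_irreps_def irreducible_rep_def split: prod.splits)
  show "trans iso_rel" by (rule transI) (auto intro: rep_iso_trans)
  show "iso_rel \<subseteq> smooth_irreps G Top \<times> smooth_irreps G Top" by blast
qed

definition U_class :: "nat \<Rightarrow> ('g, 'g) rep set" where
  "U_class k = iso_rel `` {(U k, R)}"

lemma U_class_in: "U_class k \<in> smooth_irr_classes G Top"
  unfolding U_class_def smooth_irr_classes_def using U_smooth_irrep by (rule quotientI)

lemma inj_U_class: "inj U_class"
proof (rule injI)
  fix k l assume "U_class k = U_class l"
  then have "((U k, R), (U l, R)) \<in> iso_rel"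
    unfolding U_class_def using eq_equiv_class[OF _ equiv_iso_rel U_smooth_irrep] by blast
  then show "k = l" using U_eq_iff_dim by blast
qed

lemma some_in_class:
  assumes "C \<in> smooth_irr_classes G Top"
  shows "(SOME p. p \<in> C) \<in> C"
  using in_quotient_imp_non_empty[OF equiv_iso_rel, of C] assms unfolding smooth_irr_classes_def
  by (simp add: some_in_eq)

lemma class_mult_Ind:
  assumes C: "C \<in> smooth_irr_classes G Top"
  shows "class_mult G C (Ind G Top P) = (if C \<in> range U_class then 1 else 0)"
proof -
  define p where "p = (SOME p. p \<in> C)"
  have p: "p \<in> C" unfolding p_def using C by (rule some_in_class)
  have "C \<subseteq> smooth_irreps G Top"
    using in_quotient_imp_subset[OF equiv_iso_rel, of C] C unfolding smooth_irr_classes_def by simp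
  then have pi: "p \<in> smooth_irreps G Top" using p by blast
  then have rep: "is_rep G p" unfolding smooth_irreps_def irreducible_rep_def by auto
  have Cp: "C = iso_rel `` {p}"
  proof -
    obtain p0 where p0: "C = iso_rel `` {p0}"
      using C unfolding smooth_irr_classes_def by (rule quotientE)
    then have "(p0, p) \<in> iso_rel" using p by (simp only: Image_singleton_iff)
    then show ?thesis unfolding p0 by (rule equiv_class_eq[OF equiv_iso_rel])
  qed
  have "rep_iso G p (U k, R) \<longleftrightarrow> C = U_class k" for k
  proof
    assume "rep_iso G p (U k, R)"
    then have "(p, (U k, R)) \<in> iso_rel" using pi U_smooth_irrep by blast
    then show "C = U_class k" unfolding U_class_def
      by (rule trans[OF Cp equiv_class_eq[OF equiv_iso_rel]])
  next
    assume "C = U_class k"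
    then have "rep_iso G (U k, R) p" using p unfolding U_class_def by blast
    then show "rep_iso G p (U k, R)" using rep_iso_sym is_rep_U by blast
  qed
  then show ?thesis unfolding class_mult_def p_def[symmetric] rep_mult_Ind[OF pi] by (simp add: image_iff)
qed

lemma class_dim_U_class: "class_dim (U_class k) = cfun.dim (U k)"
proof -
  have "(SOME p. p \<in> U_class k) \<in> U_class k" using some_in_class[OF U_class_in] .
  then have "rep_iso G (U k, R) (SOME p. p \<in> U_class k)" unfolding U_class_def by blast
  from rep_iso_dim[OF this is_rep_U] show ?thesis unfolding class_dim_def by simp
qed

theorem gelfand_pair: "gelfand_pair G Top P"
  unfolding gelfand_pair_def multiplicity_free_def by (simp add: class_mult_Ind)

theorem smooth_rep_Ind: "smooth_rep G Top (Ind G Top P)"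
  unfolding Ind_def ind_space_eq by (rule smooth_rep_invariant[OF invariant_UN_V])

theorem finitely_many_constituents_Ind: "finitely_many_constituents G Top (Ind G Top P)"
  unfolding finitely_many_constituents_def
proof (intro conjI ballI allI)
  fix C assume "C \<in> smooth_irr_classes G Top"
  then show "class_mult G C (Ind G Top P) \<noteq> \<infinity>"
    by (simp add: class_mult_Ind one_enat_def zero_enat_def)
next
  fix k
  have "finite ((\<lambda>l. cfun.dim (U l)) -` {k})"
    using strict_mono_imp_inj_on[OF strict_mono_dim_U] by (intro finite_vimageI) simp_all
  then have fin: "finite {l. cfun.dim (U l) = k}" by (simp add: vimage_def)
  have sub: "{C \<in> smooth_irr_classes G Top. class_dim C = k \<and> class_mult G C (Ind G Top P) \<noteq> 0}
      \<subseteq> U_class ` {l. cfun.dim (U l) = k}"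
  proof
    fix C assume "C \<in> {C \<in> smooth_irr_classes G Top. class_dim C = k \<and> class_mult G C (Ind G Top P) \<noteq> 0}"
    then have C: "C \<in> smooth_irr_classes G Top" "class_dim C = k" "class_mult G C (Ind G Top P) \<noteq> 0"
      by simp_all
    then have "C \<in> range U_class" using class_mult_Ind[OF C(1)] by metis
    then obtain l where l: "C = U_class l" by (rule rangeE)
    have "cfun.dim (U l) = k" using C(2) unfolding l class_dim_U_class .
    then show "C \<in> U_class ` {l. cfun.dim (U l) = k}" using l by (intro image_eqI[of _ _ l] CollectI)
  qed
  show "finite {C \<in> smooth_irr_classes G Top. class_dim C = k \<and> class_mult G C (Ind G Top P) \<noteq> 0}"
    by (rule finite_subset[OF sub finite_imageI[OF fin]])
qed

text \<open>Classes outside the range of \<open>U_class\<close> contribute 0 because their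
  multiplicity vanishes, and \<open>U_class\<close> is injective, so the sum can be indexed by the
  levels \<open>k\<close>.\<close>

theorem has_sum_zeta_term:
  assumes "((\<lambda>k. of_nat (cfun.dim (U k)) powr (- s)) has_sum z) UNIV"
  shows "(zeta_term G (Ind G Top P) s has_sum z) (smooth_irr_classes G Top)"
proof -
  have m: "the_enat 1 = 1" "the_enat 0 = 0" by (simp_all add: one_enat_def zero_enat_def)
  have "((zeta_term G (Ind G Top P) s \<circ> U_class) has_sum z) UNIV"
    using assms by (simp add: o_def zeta_term_def class_mult_Ind U_class_in class_dim_U_class m)
  then have "(zeta_term G (Ind G Top P) s has_sum z) (range U_class)"
    using has_sum_reindex[OF inj_U_class] by blast
  then show ?thesis
  proof (rule has_sum_cong_neutral[THEN iffD1, rotated -1])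
    fix C assume "C \<in> range U_class - smooth_irr_classes G Top"
    then show "zeta_term G (Ind G Top P) s C = 0" using U_class_in by (metis DiffD1 DiffD2 rangeE)
  next
    fix C assume "C \<in> smooth_irr_classes G Top - range U_class"
    then show "zeta_term G (Ind G Top P) s C = 0" by (simp add: zeta_term_def class_mult_Ind m)
  qed simp
qed

end

section \<open>Summation of the Dirichlet series\<close>

lemma has_sum_zeta:
  fixes q d n c :: nat and s :: complex and a T :: "nat \<Rightarrow> nat"
  assumes q: "q \<ge> 2" and d: "d \<ge> 1" and n: "n \<ge> 1" and s: "Re s > 0"
    and c: "(q ^ d - 1) * T 0 = q ^ (d * (n + 1)) - 1"
    and T: "\<And>k. k \<ge> 1 \<Longrightarrow> T k = q ^ (d * n)"
    and a0: "a 0 = 1" and a_Suc: "\<And>k. a (Suc k) = (T k - 1) * (\<Prod>i<k. T i)"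
  shows "((\<lambda>k. of_nat (a k) powr (- s)) has_sum
      (1 + ((of_nat q ^ (d * n) - 1) / (of_nat q ^ d - 1)) powr (- s) *
                (of_nat q powr (- (of_nat d * s)) +
                 (of_nat q ^ (d * (n + 1)) - 1) powr (- s) /
                   (1 - of_nat q powr (- (of_nat d * of_nat n * s)))))) UNIV"
proof -
  \<comment> \<open>The dimensions become 1, then \<open>A Q\<close>, then \<open>A B\<close> times
    the powers of \<open>Q ^ n\<close>, so that the terms from the third on form a geometric
    series.\<close>
  define Q where "Q = real q ^ d"
  define A where "A = (Q ^ n - 1) / (Q - 1)"
  define B where "B = Q ^ (n + 1) - 1"
  have Q1: "Q > 1" unfolding Q_def using q d by (intro one_less_power) auto
  have Qn: "Q ^ n > 1" using Q1 n by (intro one_less_power) auto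
  have Qn1: "Q ^ (n + 1) > 1" using Q1 by (intro one_less_power) auto
  have A0: "A > 0" and B0: "B > 0" using Q1 Qn Qn1 by (auto simp: A_def B_def)
  have rQn: "real (q ^ (d * n)) = Q ^ n" by (simp add: Q_def power_mult)
  have T0: "real (T 0) = B / (Q - 1)"
  proof -
    have "real ((q ^ d - 1) * T 0) = real (q ^ (d * (n + 1)) - 1)" using c by simp
    moreover have "q ^ d \<ge> 1" "q ^ (d * (n + 1)) \<ge> 1" using q by simp_all
    ultimately have "(Q - 1) * real (T 0) = B"
      by (simp add: of_nat_diff Q_def B_def power_mult[symmetric] power_add[symmetric])
    then show ?thesis using Q1 by (simp add: field_simps)
  qed
  have a1: "real (a 1) = A * Q"
  proof -
    have "real (T 0) - 1 = A * Q" unfolding T0 A_def B_def using Q1 by (simp add: field_simps)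
    moreover have "T 0 \<ge> 1"
    proof -
      have "real (T 0) > 0" unfolding T0 using B0 Q1 by simp
      then show ?thesis by simp
    qed
    ultimately show ?thesis using a_Suc[of 0] by (simp add: of_nat_diff)
  qed
  have a2: "real (a (Suc (Suc k))) = A * B * (Q ^ n) ^ k" for k
  proof -
    have "(\<Prod>i<Suc k. T i) = T 0 * (\<Prod>i<k. T (Suc i))" by (rule prod.lessThan_Suc_shift)
    also have "(\<Prod>i<k. T (Suc i)) = (q ^ (d * n)) ^ k" by (simp add: T)
    finally have "a (Suc (Suc k)) = (q ^ (d * n) - 1) * (T 0 * (q ^ (d * n)) ^ k)" using a_Suc[of "Suc k"] T[of "Suc k"] by simp
    moreover have "q ^ (d * n) \<ge> 1" using q by simp
    ultimately have "real (a (Suc (Suc k))) = (Q ^ n - 1) * (B / (Q - 1) * (Q ^ n) ^ k)"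
      using T0 rQn by (simp add: of_nat_diff)
    then show ?thesis by (simp add: A_def)
  qed
  \<comment> \<open>Complex powers are multiplicative on positive real bases, which is why the
    dimensions are treated as real numbers.\<close>
  have powr_mult: "complex_of_real (x * y) powr (- s) = complex_of_real x powr (- s) * complex_of_real y powr (- s)"
    if "x > 0" "y > 0" for x y
    using that by (simp add: powr_times_real)
  define w where "w = complex_of_real (Q ^ n) powr (- s)"
  have pw: "complex_of_real ((Q ^ n) ^ k) powr (- s) = w ^ k" for k
  proof (induction k)
    case 0
    then show ?case by simp
  next
    case (Suc k)
    have "complex_of_real ((Q ^ n) ^ Suc k) powr (- s) = complex_of_real (Q ^ n * (Q ^ n) ^ k) powr (- s)" by simp
    also have "\<dots> = w * w ^ k" unfolding w_def using Qn Suc by (subst powr_mult) (auto simp: w_def)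
    finally show ?case by simp
  qed
  \<comment> \<open>Here \<open>Re s > 0\<close> enters: the ratio has norm
    \<open>(Q ^ n) powr (- Re s)\<close>.\<close>
  have w1: "norm w < 1"
  proof -
    have "norm w = (Q ^ n) powr (- Re s)" unfolding w_def using Qn by (subst norm_powr_real_powr) auto
    also have "\<dots> < 1" using Qn s by (simp add: powr_less_one)
    finally show ?thesis .
  qed
  define x0 where "x0 = complex_of_real A powr (- s)"
  define x1 where "x1 = complex_of_real B powr (- s)"
  have ck: "of_nat (a (Suc (Suc k))) powr (- s) = x0 * x1 * w ^ k" for k
  proof -
    have "of_nat (a (Suc (Suc k))) = complex_of_real (A * B * (Q ^ n) ^ k)" using a2[of k] by (metis of_real_of_nat_eq)
    also have "\<dots> powr (- s) = complex_of_real (A * B) powr (- s) * complex_of_real ((Q ^ n) ^ k) powr (- s)"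
      using A0 B0 Q1 by (intro powr_mult) auto
    also have "complex_of_real (A * B) powr (- s) = x0 * x1" unfolding x0_def x1_def using A0 B0 by (rule powr_mult)
    finally show ?thesis by (simp only: pw)
  qed
  have "(\<lambda>k. w ^ k) summable_on UNIV"
    using w1 by (intro norm_summable_imp_summable_on) (simp add: norm_power summable_geometric)
  then have "((\<lambda>k. w ^ k) has_sum (\<Sum>\<^sub>\<infinity>k. w ^ k)) UNIV" by (rule has_sum_infsum)
  moreover have "(\<lambda>k. w ^ k) sums (1 / (1 - w))" using w1 by (rule geometric_sums)
  ultimately have "((\<lambda>k. w ^ k) has_sum (1 / (1 - w))) UNIV"
    using has_sum_imp_sums sums_unique2 by metis
  then have "((\<lambda>k. x0 * x1 * w ^ k) has_sum (x0 * x1 * (1 / (1 - w)))) UNIV" by (rule has_sum_cmult_right)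
  then have "((\<lambda>k. of_nat (a (Suc (Suc k))) powr (- s)) has_sum (x0 * x1 * (1 / (1 - w)))) UNIV"
    unfolding ck .
  then have "(((\<lambda>k. of_nat (a k) powr (- s)) \<circ> (\<lambda>k. Suc (Suc k))) has_sum (x0 * x1 * (1 / (1 - w)))) UNIV"
    by (simp add: o_def)
  then have tail: "((\<lambda>k. of_nat (a k) powr (- s)) has_sum (x0 * x1 * (1 / (1 - w)))) (range (\<lambda>k. Suc (Suc k)))"
    by (subst has_sum_reindex) (auto simp: inj_def)
  have head: "((\<lambda>k. of_nat (a k) powr (- s)) has_sum (\<Sum>k\<in>{0, 1}. of_nat (a k) powr (- s))) {0, 1}"
    by (rule has_sum_finite) simp
  have "UNIV = {0, 1} \<union> range (\<lambda>k. Suc (Suc k))"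
  proof -
    have "k \<in> {0, 1} \<union> range (\<lambda>k. Suc (Suc k))" for k
    proof (cases "k \<ge> 2")
      case True
      then have "k = Suc (Suc (k - 2))" by simp
      then show ?thesis by blast
    qed auto
    then show ?thesis by blast
  qed
  then have total: "((\<lambda>k. of_nat (a k) powr (- s)) has_sum
      ((\<Sum>k\<in>{0, 1}. of_nat (a k) powr (- s)) + x0 * x1 * (1 / (1 - w)))) UNIV"
    using has_sum_Un_disjoint[OF head tail] by auto
  have Qs: "complex_of_real Q powr (- s) = of_nat q powr (- (of_nat d * s))"
  proof -
    have "complex_of_real Q powr (- s) = exp (- s * of_real (ln Q))" using Q1 by (simp add: powr_def Ln_of_real)
    also have "ln Q = of_nat d * ln (real q)" unfolding Q_def using q by (simp add: ln_realpow)
    also have "exp (- s * complex_of_real (of_nat d * ln (real q))) = exp (- (of_nat d * s) * of_real (ln (real q)))"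
      by (simp add: algebra_simps)
    also have "\<dots> = of_nat q powr (- (of_nat d * s))" using q by (simp add: powr_def)
    finally show ?thesis .
  qed
  have ws: "w = of_nat q powr (- (of_nat d * of_nat n * s))"
  proof -
    have "w = exp (- s * of_real (ln (Q ^ n)))" unfolding w_def using Qn Q1 by (simp add: powr_def Ln_of_real del: of_real_power)
    also have "ln (Q ^ n) = of_nat n * (of_nat d * ln (real q))" unfolding Q_def using q by (simp add: ln_realpow)
    also have "exp (- s * complex_of_real (of_nat n * (of_nat d * ln (real q)))) = exp (- (of_nat d * of_nat n * s) * of_real (ln (real q)))"
      by (simp add: algebra_simps)
    also have "\<dots> = of_nat q powr (- (of_nat d * of_nat n * s))" using q by (simp add: powr_def)
    finally show ?thesis .
  qed
  have "of_nat (a 1) powr (- s) = x0 * of_nat q powr (- (of_nat d * s))"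
  proof -
    have "of_nat (a 1) = complex_of_real (A * Q)" using a1 by (metis of_real_of_nat_eq)
    then show ?thesis unfolding x0_def Qs[symmetric] using A0 Q1 by (simp only: powr_mult)
  qed
  then have hd: "(\<Sum>k\<in>{0, 1}. of_nat (a k) powr (- s)) = 1 + x0 * of_nat q powr (- (of_nat d * s))"
    using a0 by simp
  have cA: "complex_of_real A = (of_nat q ^ (d * n) - 1) / (of_nat q ^ d - 1)"
    by (simp add: A_def Q_def power_mult)
  have cB: "complex_of_real B = of_nat q ^ (d * (n + 1)) - 1"
    by (simp add: B_def Q_def power_mult power_add algebra_simps)
  have "(\<Sum>k\<in>{0, 1}. of_nat (a k) powr (- s)) + x0 * x1 * (1 / (1 - w)) =
     1 + ((of_nat q ^ (d * n) - 1) / (of_nat q ^ d - 1)) powr (- s) *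
                (of_nat q powr (- (of_nat d * s)) +
                 (of_nat q ^ (d * (n + 1)) - 1) powr (- s) /
                   (1 - of_nat q powr (- (of_nat d * of_nat n * s))))"
    unfolding hd cA[symmetric] cB[symmetric] ws[symmetric] x0_def[symmetric] x1_def[symmetric]
    by (simp add: distrib_left)
  then show ?thesis using total by simp
qed

section \<open>Residue systems and noncommutative discrete valuation rings\<close>

definition transversal :: "'a::ab_group_add set \<Rightarrow> 'a set \<Rightarrow> 'a set \<Rightarrow> bool" where
  "transversal S I T \<longleftrightarrow> T \<subseteq> S \<and> (\<forall>x\<in>S. \<exists>!r. r \<in> T \<and> x - r \<in> I)"

text \<open>Passing to the representative in the other system gives mutually inverse maps. Thus
  orders of quotients can be compared without forming quotient sets.\<close>

lemma transversal_card:
  assumes T: "transversal S I T" and T': "transversal S I T'"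
    and I: "0 \<in> I" "\<And>x y. x \<in> I \<Longrightarrow> y \<in> I \<Longrightarrow> x - y \<in> I"
  shows "card T = card T'"
proof -
  have neg: "y - x \<in> I" if "x - y \<in> I" for x y using I(2)[OF I(1) that] by simp
  have tr: "x - z \<in> I" if "x - y \<in> I" "y - z \<in> I" for x y z
    using I(2)[OF that(1) neg[OF that(2)]] by simp
  define f where "f r = (THE s. s \<in> T' \<and> r - s \<in> I)" for r
  have f: "f r \<in> T' \<and> r - f r \<in> I" if "r \<in> T" for r
    using theI'[of "\<lambda>s. s \<in> T' \<and> r - s \<in> I"] T T' that unfolding transversal_def f_def by blast
  define g where "g r = (THE s. s \<in> T \<and> r - s \<in> I)" for r
  have g: "g r \<in> T \<and> r - g r \<in> I" if "r \<in> T'" for r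
    using theI'[of "\<lambda>s. s \<in> T \<and> r - s \<in> I"] T T' that unfolding transversal_def g_def by blast
  have uT: "r = s" if "r \<in> T" "s \<in> T" "r - s \<in> I" for r s
    using T that I(1) unfolding transversal_def by (metis diff_self subsetD)
  have uT': "r = s" if "r \<in> T'" "s \<in> T'" "r - s \<in> I" for r s
    using T' that I(1) unfolding transversal_def by (metis diff_self subsetD)
  have "g (f r) = r" if "r \<in> T" for r
    using f[OF that] g[of "f r"] uT[of r "g (f r)"] tr[of r "f r" "g (f r)"] that by simp
  moreover have "f (g r) = r" if "r \<in> T'" for r
    using g[OF that] f[of "g r"] uT'[of r "f (g r)"] tr[of r "g r" "f (g r)"] that by simp
  ultimately have "bij_betw f T T'"
    using f g by (intro bij_betw_byWitness[where f' = g]) auto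
  then show ?thesis by (rule bij_betw_same_card)
qed

text \<open>\<open>p_left\<close> and \<open>p_right\<close> say that \<open>p\<close> normalises
  the ring, so that the ideals generated by its powers are two-sided. Completeness is demanded for
  sequences with a prescribed rate of convergence. Both the valuation ring of the centre and the
  maximal order are instances.\<close>

locale nc_dvr =
  fixes \<Delta> :: "'d::division_ring set" and p :: 'd
  assumes one_mem: "1 \<in> \<Delta>"
    and diff_mem: "x \<in> \<Delta> \<Longrightarrow> y \<in> \<Delta> \<Longrightarrow> x - y \<in> \<Delta>"
    and mult_mem: "x \<in> \<Delta> \<Longrightarrow> y \<in> \<Delta> \<Longrightarrow> x * y \<in> \<Delta>"
    and p_mem: "p \<in> \<Delta>" and p_nonzero: "p \<noteq> 0"
    and p_left: "x \<in> \<Delta> \<Longrightarrow> \<exists>y\<in>\<Delta>. p * x = y * p"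
    and p_right: "x \<in> \<Delta> \<Longrightarrow> \<exists>y\<in>\<Delta>. x * p = p * y"
    and unit_or: "x \<in> \<Delta> \<Longrightarrow> (x \<noteq> 0 \<and> inverse x \<in> \<Delta>) \<or> (\<exists>y\<in>\<Delta>. x = p * y)"
    and p_nonunit: "inverse p \<notin> \<Delta>"
    and separated: "(\<And>k. \<exists>y\<in>\<Delta>. x = p ^ k * y) \<Longrightarrow> x = 0"
    and complete: "(\<And>k. X k \<in> \<Delta>) \<Longrightarrow> (\<And>k. \<exists>y\<in>\<Delta>. X (Suc k) - X k = p ^ k * y) \<Longrightarrow>
        \<exists>L\<in>\<Delta>. \<forall>k. \<exists>y\<in>\<Delta>. L - X k = p ^ k * y"
begin

definition I :: "nat \<Rightarrow> 'd set" where "I k = {p ^ k * y |y. y \<in> \<Delta>}"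

lemma zero_mem: "0 \<in> \<Delta>" using diff_mem[OF one_mem one_mem] by simp

lemma uminus_mem: "x \<in> \<Delta> \<Longrightarrow> - x \<in> \<Delta>" using diff_mem[OF zero_mem, of x] by simp

lemma add_mem: "x \<in> \<Delta> \<Longrightarrow> y \<in> \<Delta> \<Longrightarrow> x + y \<in> \<Delta>" using diff_mem[OF _ uminus_mem, of x y] by simp

lemma sum_mem: "(\<And>i. i \<in> A \<Longrightarrow> f i \<in> \<Delta>) \<Longrightarrow> sum f A \<in> \<Delta>"
  by (induction A rule: infinite_finite_induct) (auto simp: zero_mem add_mem)

lemma power_mem: "x \<in> \<Delta> \<Longrightarrow> x ^ k \<in> \<Delta>"
  by (induction k) (auto simp: one_mem mult_mem)

lemma p_pow_right: "x \<in> \<Delta> \<Longrightarrow> \<exists>y\<in>\<Delta>. x * p ^ k = p ^ k * y"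
proof (induction k arbitrary: x)
  case (Suc k)
  obtain y where y: "y \<in> \<Delta>" "x * p = p * y" using p_right[OF Suc.prems] by blast
  obtain z where z: "z \<in> \<Delta>" "y * p ^ k = p ^ k * z" using Suc.IH[OF y(1)] by blast
  have "x * p ^ Suc k = p * (y * p ^ k)" using y by (simp add: mult.assoc[symmetric])
  also have "\<dots> = p ^ Suc k * z" unfolding z(2) by (simp add: mult.assoc)
  finally show ?case using z by blast
qed auto

lemma I_iff: "x \<in> I k \<longleftrightarrow> inverse (p ^ k) * x \<in> \<Delta>"
proof
  assume "x \<in> I k"
  then obtain y where "x = p ^ k * y" "y \<in> \<Delta>" unfolding I_def by blast
  then show "inverse (p ^ k) * x \<in> \<Delta>" using p_nonzero by (simp add: mult.assoc[symmetric])
next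
  assume "inverse (p ^ k) * x \<in> \<Delta>"
  moreover have "x = p ^ k * (inverse (p ^ k) * x)" using p_nonzero by (simp add: mult.assoc[symmetric])
  ultimately show "x \<in> I k" unfolding I_def by blast
qed

lemma I_0: "I 0 = \<Delta>" by (auto simp: I_iff)

lemma I_zero: "0 \<in> I k" by (simp add: I_iff zero_mem)

lemma I_diff: "x \<in> I k \<Longrightarrow> y \<in> I k \<Longrightarrow> x - y \<in> I k"
  by (simp add: I_iff right_diff_distrib diff_mem)

lemma I_add: "x \<in> I k \<Longrightarrow> y \<in> I k \<Longrightarrow> x + y \<in> I k"
  by (simp add: I_iff distrib_left add_mem)

lemma I_uminus: "x \<in> I k \<Longrightarrow> - x \<in> I k"
  by (simp add: I_iff uminus_mem)

lemma I_sum: "(\<And>i. i \<in> A \<Longrightarrow> f i \<in> I k) \<Longrightarrow> sum f A \<in> I k"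
  by (induction A rule: infinite_finite_induct) (auto simp: I_zero I_add)

lemma I_mult_right: "x \<in> I k \<Longrightarrow> y \<in> \<Delta> \<Longrightarrow> x * y \<in> I k"
  by (simp add: I_iff mult.assoc[symmetric] mult_mem)

lemma I_mult_left:
  assumes "x \<in> I k" "y \<in> \<Delta>" shows "y * x \<in> I k"
proof -
  obtain z where z: "x = p ^ k * z" "z \<in> \<Delta>" using assms unfolding I_def by blast
  obtain w where w: "w \<in> \<Delta>" "y * p ^ k = p ^ k * w" using p_pow_right[OF assms(2)] by blast
  have "y * x = p ^ k * (w * z)" unfolding z(1) by (simp add: mult.assoc[symmetric] w(2))
  then show ?thesis using z w mult_mem unfolding I_def by blast
qed

lemma p_pow_I: "p ^ k \<in> I k" using one_mem unfolding I_def by force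

lemma I_mult: "x \<in> I k \<Longrightarrow> y \<in> I l \<Longrightarrow> x * y \<in> I (k + l)"
proof -
  assume "x \<in> I k" "y \<in> I l"
  then obtain z w where z: "x = p ^ k * z" "z \<in> \<Delta>" "y = p ^ l * w" "w \<in> \<Delta>" unfolding I_def by blast
  obtain u where u: "u \<in> \<Delta>" "z * p ^ l = p ^ l * u" using p_pow_right[OF z(2)] by blast
  have "x * y = p ^ k * (z * p ^ l) * w" unfolding z(1,3) by (simp only: mult.assoc)
  also have "\<dots> = p ^ (k + l) * (u * w)" unfolding u(2) power_add by (simp only: mult.assoc)
  finally show ?thesis unfolding I_def using u z mult_mem by blast
qed

lemma I_mono: "k \<le> l \<Longrightarrow> I l \<subseteq> I k"
proof
  fix x assume "k \<le> l" "x \<in> I l"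
  then obtain y where y: "x = p ^ l * y" "y \<in> \<Delta>" unfolding I_def by blast
  have "x = p ^ k * (p ^ (l - k) * y)"
    unfolding y(1) using \<open>k \<le> l\<close> by (simp add: mult.assoc[symmetric] power_add[symmetric])
  then show "x \<in> I k" unfolding I_def using y mult_mem power_mem p_mem by blast
qed

lemma I_subset: "I k \<subseteq> \<Delta>" using I_mono[of 0 k] I_0 by simp

lemma I_separated: "(\<And>k. x \<in> I k) \<Longrightarrow> x = 0"
  using separated[of x] unfolding I_def by blast

lemma I_complete:
  assumes "\<And>k. X k \<in> \<Delta>" "\<And>k. X (Suc k) - X k \<in> I k"
  shows "\<exists>L\<in>\<Delta>. \<forall>k. L - X k \<in> I k"
proof -
  have "\<exists>y\<in>\<Delta>. X (Suc k) - X k = p ^ k * y" for k using assms(2)[of k] unfolding I_def by blast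
  from complete[OF assms(1) this] show ?thesis unfolding I_def by blast
qed

lemma one_notin_I: "1 \<notin> I (Suc k)"
proof
  assume "1 \<in> I (Suc k)"
  then have "1 \<in> I 1" using I_mono[of 1 "Suc k"] by auto
  then show False using p_nonunit by (simp add: I_iff)
qed

lemma unit_iff: "x \<in> \<Delta> \<Longrightarrow> inverse x \<in> \<Delta> \<and> x \<noteq> 0 \<longleftrightarrow> x \<notin> I 1"
proof
  assume x: "x \<in> \<Delta>" "inverse x \<in> \<Delta> \<and> x \<noteq> 0"
  show "x \<notin> I 1"
  proof
    assume "x \<in> I 1"
    then have "x * inverse x \<in> I 1" using x I_mult_right by blast
    then show False using one_notin_I[of 0] x by simp
  qed
next
  assume "x \<in> \<Delta>" "x \<notin> I 1"
  then show "inverse x \<in> \<Delta> \<and> x \<noteq> 0" using unit_or[of x] unfolding I_def by auto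
qed

lemma unit_mult_I: "u \<in> \<Delta> \<Longrightarrow> inverse u \<in> \<Delta> \<Longrightarrow> u \<noteq> 0 \<Longrightarrow> u * x \<in> I k \<longleftrightarrow> x \<in> I k"
  using I_mult_left[of "u * x" k "inverse u"] I_mult_left[of x k u] by (auto simp: mult.assoc[symmetric])

lemma I_1_prime: "x \<in> \<Delta> \<Longrightarrow> y \<in> \<Delta> \<Longrightarrow> x * y \<in> I 1 \<Longrightarrow> x \<in> I 1 \<or> y \<in> I 1"
  using unit_iff[of x] unit_mult_I[of x y 1] by blast

lemma p_pow_mult_I: "p ^ k * x \<in> I (k + l) \<longleftrightarrow> x \<in> I l"
  using p_nonzero by (simp add: I_iff power_add nonzero_inverse_mult_distrib mult.assoc
    mult.assoc[symmetric, of "inverse (p ^ k)" "p ^ k"])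

text \<open>The exponent is the valuation of \<open>x\<close>: separatedness yields a first ideal
  \<open>I i\<close> that misses \<open>x\<close>.\<close>

lemma unit_factor:
  assumes "x \<in> \<Delta>" "x \<noteq> 0"
  shows "\<exists>k u. x = p ^ k * u \<and> u \<in> \<Delta> \<and> inverse u \<in> \<Delta> \<and> u \<noteq> 0"
proof -
  obtain j where j: "x \<notin> I j" using I_separated assms by blast
  define i where "i = (LEAST i. x \<notin> I i)"
  have i: "x \<notin> I i" unfolding i_def using j by (rule LeastI)
  then have "i \<noteq> 0" using assms I_0 by metis
  then obtain k where k: "i = Suc k" by (cases i) auto
  then have "x \<in> I k" using not_less_Least[of k "\<lambda>i. x \<notin> I i"] unfolding i_def by auto
  then obtain u where u: "x = p ^ k * u" "u \<in> \<Delta>" unfolding I_def by blast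
  then have "u \<notin> I 1" using i p_pow_mult_I[of k u 1] k by simp
  then show ?thesis using u unit_iff by blast
qed

text \<open>Expansion in digits: adding \<open>p ^ k\<close> times residues from \<open>F\<close>
  refines a system modulo \<open>I k\<close> to one modulo \<open>I (Suc k)\<close>, since
  \<open>p ^ k * y\<close> lies in \<open>I (Suc k)\<close> exactly if \<open>y\<close> lies in
  \<open>I 1\<close>.\<close>

lemma transversal_I:
  assumes F: "transversal \<Delta> (I 1) F"
  shows "\<exists>T. finite F \<longrightarrow> finite T \<and> transversal \<Delta> (I k) T \<and> card T = card F ^ k"
proof (induction k)
  case 0
  have "transversal \<Delta> (I 0) {0}"
    unfolding transversal_def using zero_mem by (auto simp: I_0)
  then show ?case by (intro exI[of _ "{0}"]) simp
next
  case (Suc k)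
  then obtain T where T: "finite F \<longrightarrow> finite T \<and> transversal \<Delta> (I k) T \<and> card T = card F ^ k" by blast
  define T' where "T' = (\<lambda>(r, s). r + p ^ k * s) ` (T \<times> F)"
  show ?case
  proof (intro exI[of _ T'] impI)
    assume fin: "finite F"
    then have Tk: "finite T" "transversal \<Delta> (I k) T" "card T = card F ^ k" using T by auto
    have TD: "T \<subseteq> \<Delta>" "F \<subseteq> \<Delta>" using Tk F unfolding transversal_def by auto
    have uniq: "r = r' \<and> s = s'"
      if m: "r \<in> T" "s \<in> F" "r' \<in> T" "s' \<in> F" "r + p ^ k * s - (r' + p ^ k * s') \<in> I (Suc k)" for r s r' s'
    proof -
      have "r + p ^ k * s - (r' + p ^ k * s') \<in> I k" using m(5) I_mono[of k "Suc k"] by auto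
      moreover have "p ^ k * s' - p ^ k * s \<in> I k"
        unfolding right_diff_distrib[symmetric] using m TD diff_mem unfolding I_def by blast
      ultimately have "r - r' \<in> I k"
        using I_add[of "r + p ^ k * s - (r' + p ^ k * s')" k "p ^ k * s' - p ^ k * s"] by (simp add: algebra_simps)
      then have r: "r = r'" using Tk(2) m TD I_zero[of k] unfolding transversal_def by (metis diff_self subsetD)
      then have "p ^ k * (s - s') \<in> I (k + 1)" using m(5) by (simp add: algebra_simps)
      then have "s - s' \<in> I 1" by (simp only: p_pow_mult_I)
      then have "s = s'" using F m TD I_zero[of 1] unfolding transversal_def by (metis diff_self subsetD)
      then show ?thesis using r by blast
    qed
    have "inj_on (\<lambda>(r, s). r + p ^ k * s) (T \<times> F)"
    proof (rule inj_onI, clarify)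
      fix r s r' s' assume "r \<in> T" "s \<in> F" "r' \<in> T" "s' \<in> F" "r + p ^ k * s = r' + p ^ k * s'"
      then show "r = r' \<and> s = s'" using uniq[of r s r' s'] I_zero by simp
    qed
    then have "card T' = card F ^ Suc k"
      unfolding T'_def using Tk by (simp add: card_image card_cartesian_product)
    moreover have "finite T'" unfolding T'_def using Tk fin by simp
    moreover have "transversal \<Delta> (I (Suc k)) T'"
      unfolding transversal_def
    proof (intro conjI ballI)
      show "T' \<subseteq> \<Delta>" unfolding T'_def using TD by (auto intro!: add_mem mult_mem power_mem p_mem)
      fix x assume x: "x \<in> \<Delta>"
      obtain r where r: "r \<in> T" "x - r \<in> I k" using Tk(2) x unfolding transversal_def by blast
      then obtain y where y: "y \<in> \<Delta>" "x - r = p ^ k * y" unfolding I_def by blast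
      obtain s where s: "s \<in> F" "y - s \<in> I 1" using F y unfolding transversal_def by blast
      have "x - (r + p ^ k * s) = p ^ k * (y - s)" using y(2) by (simp add: algebra_simps)
      then have m: "x - (r + p ^ k * s) \<in> I (Suc k)" using s p_pow_mult_I[of k "y - s" 1] by simp
      show "\<exists>!r. r \<in> T' \<and> x - r \<in> I (Suc k)"
      proof (rule ex1I[of _ "r + p ^ k * s"])
        show "r + p ^ k * s \<in> T' \<and> x - (r + p ^ k * s) \<in> I (Suc k)" unfolding T'_def using r s m by force
        fix z assume z: "z \<in> T' \<and> x - z \<in> I (Suc k)"
        then obtain r' s' where z': "r' \<in> T" "s' \<in> F" "z = r' + p ^ k * s'" unfolding T'_def by auto
        have "(x - (r + p ^ k * s)) - (x - z) \<in> I (Suc k)" using m z I_diff by blast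
        then have "z - (r + p ^ k * s) \<in> I (Suc k)" by (simp add: algebra_simps)
        then show "z = r + p ^ k * s" using uniq[OF z'(1,2) r(1) s(1)] unfolding z'(3) by blast
      qed
    qed
    ultimately show "finite T' \<and> transversal \<Delta> (I (Suc k)) T' \<and> card T' = card F ^ Suc k" by blast
  qed
qed

end

section \<open>The valuation ring of a complete discretely valued field\<close>

lemma
  assumes "discrete_valuation v"
  shows valuation_mult: "a \<noteq> 0 \<Longrightarrow> b \<noteq> 0 \<Longrightarrow> v (a * b) = v a + v b"
    and valuation_add: "a \<noteq> 0 \<Longrightarrow> b \<noteq> 0 \<Longrightarrow> a + b \<noteq> 0 \<Longrightarrow> v (a + b) \<ge> min (v a) (v b)"
    and valuation_surj: "\<exists>a. a \<noteq> 0 \<and> v a = j"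
proof -
  show "a \<noteq> 0 \<Longrightarrow> b \<noteq> 0 \<Longrightarrow> v (a * b) = v a + v b"
   "a \<noteq> 0 \<Longrightarrow> b \<noteq> 0 \<Longrightarrow> a + b \<noteq> 0 \<Longrightarrow> v (a + b) \<ge> min (v a) (v b)"
    using assms unfolding discrete_valuation_def by blast+
  have "j \<in> v ` (UNIV - {0})" using assms unfolding discrete_valuation_def by simp
  then show "\<exists>a. a \<noteq> 0 \<and> v a = j" by blast
qed

locale complete_dvf =
  fixes v :: "'f::field \<Rightarrow> int" and t :: 'f
  assumes dv: "discrete_valuation v" and comp: "val_complete v" and t: "t \<noteq> 0" "v t = 1"
begin

lemma v_one: "v 1 = 0" using valuation_mult[OF dv, of 1 1] by simp

lemma v_uminus: "a \<noteq> 0 \<Longrightarrow> v (- a) = v a"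
  using valuation_mult[OF dv, of "-1" "-1"] valuation_mult[OF dv, of "-1" a] v_one by simp

lemma v_inverse: "a \<noteq> 0 \<Longrightarrow> v (inverse a) = - v a"
  using valuation_mult[OF dv, of a "inverse a"] v_one by simp

lemma v_power: "v (t ^ k) = int k"
  using valuation_mult[OF dv t(1), of "t ^ n" for n] t v_one by (induction k) auto

lemma v_diff: "a \<noteq> 0 \<Longrightarrow> b \<noteq> 0 \<Longrightarrow> a - b \<noteq> 0 \<Longrightarrow> v (a - b) \<ge> min (v a) (v b)"
  using valuation_add[OF dv, of a "- b"] v_uminus[of b] by simp

lemma val_ideal_pow_iff: "a \<in> val_ideal_pow v k \<longleftrightarrow> (\<exists>b\<in>val_ring v. a = t ^ k * b)"
proof
  assume a: "a \<in> val_ideal_pow v k"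
  show "\<exists>b\<in>val_ring v. a = t ^ k * b"
  proof (cases "a = 0")
    case False
    have "v (inverse (t ^ k) * a) = v a - int k"
      using valuation_mult[OF dv, of "inverse (t ^ k)" a] False t v_inverse[of "t ^ k"] v_power by simp
    then show ?thesis using a False t
      by (intro bexI[of _ "inverse (t ^ k) * a"]) (auto simp: val_ideal_pow_def val_ring_def)
  qed (auto simp: val_ring_def)
next
  assume "\<exists>b\<in>val_ring v. a = t ^ k * b"
  then obtain b where "b \<in> val_ring v" "a = t ^ k * b" by blast
  then show "a \<in> val_ideal_pow v k"
    using valuation_mult[OF dv, of "t ^ k" b] v_power[of k] t
    by (cases "b = 0") (auto simp: val_ideal_pow_def val_ring_def)
qed

lemma val_ideal_pow_diff: "a \<in> val_ideal_pow v k \<Longrightarrow> b \<in> val_ideal_pow v k \<Longrightarrow> a - b \<in> val_ideal_pow v k"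
  using v_diff[of a b] v_uminus[of b] unfolding val_ideal_pow_def by (cases "a = 0"; cases "b = 0") force+

lemma val_ring_dvr: "nc_dvr (val_ring v) t"
proof
  show "1 \<in> val_ring v" using v_one by (simp add: val_ring_def)
  show "x - y \<in> val_ring v" if "x \<in> val_ring v" "y \<in> val_ring v" for x y
    using val_ideal_pow_diff[of x 0 y] that by (simp add: val_ring_def val_ideal_pow_def)
  show "x * y \<in> val_ring v" if "x \<in> val_ring v" "y \<in> val_ring v" for x y
    using that valuation_mult[OF dv, of x y] by (cases "x = 0"; cases "y = 0") (auto simp: val_ring_def)
  show "t \<in> val_ring v" "t \<noteq> 0" using t by (auto simp: val_ring_def)
  show "\<exists>y\<in>val_ring v. t * x = y * t" "\<exists>y\<in>val_ring v. x * t = t * y" if "x \<in> val_ring v" for x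
    using that by (auto simp: mult.commute)
  show "x \<noteq> 0 \<and> inverse x \<in> val_ring v \<or> (\<exists>y\<in>val_ring v. x = t * y)" if "x \<in> val_ring v" for x
  proof (cases "x \<in> val_ideal_pow v 1")
    case True
    then show ?thesis using val_ideal_pow_iff[of x 1] by simp
  next
    case False
    then show ?thesis using that v_inverse[of x] by (auto simp: val_ideal_pow_def val_ring_def)
  qed
  show "inverse t \<notin> val_ring v" using t v_inverse[of t] by (auto simp: val_ring_def)
  show "x = 0" if "\<And>k. \<exists>y\<in>val_ring v. x = t ^ k * y" for x
  proof (rule ccontr)
    assume x: "x \<noteq> 0"
    have "x \<in> val_ideal_pow v (nat (v x + 1))" using that val_ideal_pow_iff by blast
    then have "int (nat (v x + 1)) \<le> v x" using x by (simp add: val_ideal_pow_def)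
    then show False by linarith
  qed
  show "\<exists>L\<in>val_ring v. \<forall>k. \<exists>y\<in>val_ring v. L - X k = t ^ k * y"
    if X: "\<And>k. X k \<in> val_ring v" "\<And>k. \<exists>y\<in>val_ring v. X (Suc k) - X k = t ^ k * y" for X
  proof -
    have mono: "a \<in> val_ideal_pow v k" if "a \<in> val_ideal_pow v l" "k \<le> l" for a k l
      using that by (auto simp: val_ideal_pow_def)
    have neg: "- a \<in> val_ideal_pow v k" if "a \<in> val_ideal_pow v k" for a k
      using that v_uminus[of a] by (cases "a = 0") (auto simp: val_ideal_pow_def)
    \<comment> \<open>The ultrametric inequality turns control of consecutive differences into the
      Cauchy condition of \<open>val_complete\<close>.\<close>
    have st: "X i - X k \<in> val_ideal_pow v k" if "k \<le> i" for i k
      using that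
    proof (induction i rule: dec_induct)
      case base
      then show ?case by (simp add: val_ideal_pow_def)
    next
      case (step i)
      have "X (Suc i) - X i \<in> val_ideal_pow v i" using X(2)[of i] val_ideal_pow_iff by blast
      then have "X (Suc i) - X i \<in> val_ideal_pow v k" using mono step.hyps(1) by blast
      then have "(X (Suc i) - X i) - - (X i - X k) \<in> val_ideal_pow v k"
        by (rule val_ideal_pow_diff[OF _ neg[OF step.IH]])
      then show ?case by simp
    qed
    have "X i - X j \<in> val_ideal_pow v k" if "i \<ge> k" "j \<ge> k" for i j k
      using val_ideal_pow_diff[OF st[OF that(1)] st[OF that(2)]] by simp
    then have "\<forall>k. \<exists>N. \<forall>i\<ge>N. \<forall>j\<ge>N. X i - X j \<in> val_ideal_pow v k" by blast
    then have "\<exists>L\<in>val_ring v. \<forall>k. \<exists>N. \<forall>i\<ge>N. X i - L \<in> val_ideal_pow v k"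
      using comp X(1) unfolding val_complete_def by simp
    then obtain L where L: "L \<in> val_ring v" "\<forall>k. \<exists>N. \<forall>i\<ge>N. X i - L \<in> val_ideal_pow v k" by blast
    have "L - X k \<in> val_ideal_pow v k" for k
    proof -
      obtain N where "\<forall>i\<ge>N. X i - L \<in> val_ideal_pow v k" using L by blast
      \<comment> \<open>The index \<open>max N k\<close> is late enough both to be close to the
        limit and to be compared with \<open>X k\<close>.\<close>
      then have m: "X (max N k) - L \<in> val_ideal_pow v k" by simp
      have "(X (max N k) - X k) - (X (max N k) - L) \<in> val_ideal_pow v k"
        by (rule val_ideal_pow_diff[OF st m]) simp
      then show ?thesis by simp
    qed
    then show ?thesis using L val_ideal_pow_iff by blast
  qed
qed

sublocale R: nc_dvr "val_ring v" t by (rule val_ring_dvr)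

lemma val_ideal_pow_eq: "val_ideal_pow v k = R.I k"
  using val_ideal_pow_iff unfolding R.I_def by blast

text \<open>The residue field is a set of classes; one chosen element per class turns its
  cardinality into that of a residue system.\<close>

lemma residue_transversal: "\<exists>K. transversal (val_ring v) (R.I 1) K \<and> card K = card (residue_field v) \<and>
    (finite (residue_field v) \<longrightarrow> finite K)"
proof -
  let ?r = "{(a, b). a \<in> val_ring v \<and> b \<in> val_ring v \<and> a - b \<in> val_ideal_pow v 1}"
  have eq: "equiv (val_ring v) ?r"
  proof (rule equivI)
    show "refl_on (val_ring v) ?r" by (auto simp: refl_on_def val_ideal_pow_def)
    show "sym ?r"
    proof (rule symI, clarify)
      fix a b assume "a - b \<in> val_ideal_pow v 1"
      then show "b - a \<in> val_ideal_pow v 1" using R.I_uminus[of "a - b" 1] by (simp add: val_ideal_pow_eq)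
    qed
    show "trans ?r"
    proof (rule transI, clarify)
      fix a b c assume "a - b \<in> val_ideal_pow v 1" "b - c \<in> val_ideal_pow v 1"
      then show "a - c \<in> val_ideal_pow v 1"
        using R.I_add[of "a - b" 1 "b - c"] by (simp add: val_ideal_pow_eq)
    qed
  qed auto
  define f where "f C = (SOME a :: 'f. a \<in> C)" for C
  have f: "f C \<in> C" if "C \<in> residue_field v" for C
    using that in_quotient_imp_non_empty[OF eq] unfolding f_def residue_field_def by (auto simp: some_in_eq)
  have sub: "C \<subseteq> val_ring v" if "C \<in> residue_field v" for C
    using that in_quotient_imp_subset[OF eq] unfolding residue_field_def by blast
  have same: "C = C'" if "C \<in> residue_field v" "C' \<in> residue_field v" "f C - f C' \<in> R.I 1" for C C'
    using quotient_eqI[OF eq, of C C' "f C" "f C'"] that f sub unfolding residue_field_def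
    by (auto simp: val_ideal_pow_eq)
  have inj: "inj_on f (residue_field v)" by (rule inj_onI) (metis R.I_zero diff_self same)
  have "transversal (val_ring v) (R.I 1) (f ` residue_field v)"
    unfolding transversal_def
  proof (intro conjI ballI)
    show "f ` residue_field v \<subseteq> val_ring v" using f sub by blast
    fix x assume x: "x \<in> val_ring v"
    define C where "C = ?r `` {x}"
    have C: "C \<in> residue_field v" unfolding C_def residue_field_def using x by (rule quotientI)
    have xf: "x - f C \<in> R.I 1" using f[OF C] unfolding C_def val_ideal_pow_eq by blast
    show "\<exists>!r. r \<in> f ` residue_field v \<and> x - r \<in> R.I 1"
    proof (rule ex1I[of _ "f C"])
      show "f C \<in> f ` residue_field v \<and> x - f C \<in> R.I 1" using C xf by blast
      fix r assume r: "r \<in> f ` residue_field v \<and> x - r \<in> R.I 1"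
      then obtain C' where C': "C' \<in> residue_field v" "r = f C'" by blast
      have "(x - f C) - (x - r) \<in> R.I 1" using xf r R.I_diff by blast
      then have "f C' - f C \<in> R.I 1" unfolding C'(2) by simp
      then show "r = f C" using same[OF C'(1) C] C'(2) by simp
    qed
  qed
  moreover have "card (f ` residue_field v) = card (residue_field v)" using inj by (rule card_image)
  ultimately show ?thesis by blast
qed

end

section \<open>Coordinates and the central filtration of a maximal order\<close>

definition coeff_span :: "('a \<Rightarrow> 'b \<Rightarrow> 'b) \<Rightarrow> 'a set \<Rightarrow> 'b set \<Rightarrow> 'b::comm_monoid_add set" where
  "coeff_span smul R B = {\<Sum>b\<in>B. smul (c b) b | c. \<forall>b\<in>B. c b \<in> R}"

lemma mult_3_right: "x * 3 = x + x + x" for x :: "'a::ring_1"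
proof -
  have "x * (1 + 1 + 1) = x + x + x" by (simp only: distrib_left mult_1_right)
  then show ?thesis by simp
qed

lemma coeff_spanI: "x = (\<Sum>b\<in>B. smul (c b) b) \<Longrightarrow> (\<And>b. b \<in> B \<Longrightarrow> c b \<in> R) \<Longrightarrow> x \<in> coeff_span smul R B"
  unfolding coeff_span_def by (intro CollectI exI[of _ c]) simp

text \<open>\<open>K\<close> represents the residue field of the centre, so its cardinality is the
  \<open>q\<close> of the theorem.\<close>

locale maximal_order = central_division_algebra smul d + complete_dvf v t
  for smul :: "'f::field \<Rightarrow> 'd::division_ring \<Rightarrow> 'd" and d and v :: "'f \<Rightarrow> int" and t +
  fixes \<Delta> :: "'d set" and K :: "'f set"
  assumes max_order: "is_maximal_order (val_ring v) smul \<Delta>"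
    and K: "transversal (val_ring v) (R.I 1) K" "finite K"
begin

abbreviation emb :: "'f \<Rightarrow> 'd" where "emb a \<equiv> smul a 1"

abbreviation varpi :: 'd where "varpi \<equiv> emb t"

lemma smul_emb: "smul a x = emb a * x"
  by (simp add: smul_mult_left)

lemma emb_comm: "emb a * x = x * emb a"
  by (simp add: smul_mult_left smul_mult_right)

lemma emb_mult: "emb (a * b) = emb a * emb b"
  by (simp add: smul_mult_left)

lemma emb_power: "emb (a ^ k) = emb a ^ k"
  by (induction k) (simp_all add: emb_mult flip: smul_emb)

lemma varpi_nonzero: "varpi \<noteq> 0" using t by simp

lemma order:
  shows one_mem: "1 \<in> \<Delta>" and diff_mem: "\<And>x y. x \<in> \<Delta> \<Longrightarrow> y \<in> \<Delta> \<Longrightarrow> x - y \<in> \<Delta>"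
    and mult_mem: "\<And>x y. x \<in> \<Delta> \<Longrightarrow> y \<in> \<Delta> \<Longrightarrow> x * y \<in> \<Delta>"
    and finitely_generated: "\<exists>B. finite B \<and> \<Delta> = coeff_span smul (val_ring v) B"
    and span_order: "span \<Delta> = UNIV"
  using max_order unfolding is_maximal_order_def is_order_def coeff_span_def by blast+

lemma maximal: "is_order (val_ring v) smul \<Gamma> \<Longrightarrow> \<Delta> \<subseteq> \<Gamma> \<Longrightarrow> \<Gamma> = \<Delta>"
  using max_order unfolding is_maximal_order_def by blast

lemma zero_mem: "0 \<in> \<Delta>" using diff_mem[OF one_mem one_mem] by simp

lemma uminus_mem: "x \<in> \<Delta> \<Longrightarrow> - x \<in> \<Delta>" using diff_mem[OF zero_mem, of x] by simp

lemma add_mem: "x \<in> \<Delta> \<Longrightarrow> y \<in> \<Delta> \<Longrightarrow> x + y \<in> \<Delta>" using diff_mem[OF _ uminus_mem, of x y] by simp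

lemma power_mem: "x \<in> \<Delta> \<Longrightarrow> x ^ k \<in> \<Delta>"
  by (induction k) (auto simp: one_mem mult_mem)

lemma sum_mem: "(\<And>i. i \<in> A \<Longrightarrow> f i \<in> \<Delta>) \<Longrightarrow> sum f A \<in> \<Delta>"
  by (induction A rule: infinite_finite_induct) (auto simp: zero_mem add_mem)

lemma smul_mem: assumes "a \<in> val_ring v" "x \<in> \<Delta>" shows "smul a x \<in> \<Delta>"
proof -
  obtain B where B: "finite B" "\<Delta> = coeff_span smul (val_ring v) B" using finitely_generated by blast
  obtain c where c: "x = (\<Sum>b\<in>B. smul (c b) b)" "\<forall>b\<in>B. c b \<in> val_ring v"
    using assms(2) B(2) unfolding coeff_span_def by blast
  have "smul a x = (\<Sum>b\<in>B. smul (a * c b) b)" unfolding c(1) scale_sum_right by simp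
  moreover have "\<forall>b\<in>B. a * c b \<in> val_ring v" using c(2) assms(1) R.mult_mem by simp
  ultimately show ?thesis unfolding B(2) by (intro coeff_spanI[where c = "\<lambda>b. a * c b"]) simp_all
qed

lemma emb_mem: "a \<in> val_ring v \<Longrightarrow> emb a \<in> \<Delta>"
  using smul_mem[OF _ one_mem] .

text \<open>Divide by a coefficient of least valuation. Relations over the field thus become
  integral with a coefficient 1, which survives reduction.\<close>

lemma scale_to_unit:
  fixes c :: "'i \<Rightarrow> 'f"
  assumes "finite A" "i \<in> A" "c i \<noteq> 0"
  shows "\<exists>a j. a \<noteq> 0 \<and> j \<in> A \<and> a * c j = 1 \<and> (\<forall>i\<in>A. a * c i \<in> val_ring v)"
proof -
  let ?A = "{i\<in>A. c i \<noteq> 0}"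
  have A: "finite ?A" "?A \<noteq> {}" using assms by auto
  obtain j where j: "j \<in> ?A" "\<And>i. i \<in> ?A \<Longrightarrow> v (c j) \<le> v (c i)"
    using arg_min_if_finite[OF A, of "\<lambda>i. v (c i)"] by (metis (no_types, lifting) not_le)
  have "inverse (c j) * c i \<in> val_ring v" if "i \<in> A" for i
  proof (cases "c i = 0")
    case False
    then have "v (inverse (c j) * c i) = v (c i) - v (c j)"
      using valuation_mult[OF dv, of "inverse (c j)" "c i"] v_inverse j(1) by simp
    then show ?thesis using j(2)[of i] that False by (simp add: val_ring_def)
  qed (simp add: val_ring_def)
  then show ?thesis using j(1) by (intro exI[of _ "inverse (c j)"] exI[of _ j]) auto
qed

text \<open>A generating set of least cardinality is free: a relation, scaled to be integral with
  one coefficient 1, would express a generator through the others. A free generating set is a basis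
  of the algebra, whence its size.\<close>

lemma basis:
  "\<exists>B. finite B \<and> \<Delta> = coeff_span smul (val_ring v) B \<and> card B = d ^ 2 \<and>
     (\<forall>c. (\<Sum>b\<in>B. smul (c b) b) = 0 \<longrightarrow> (\<forall>b\<in>B. c b = 0))"
proof -
  define gen where "gen B \<longleftrightarrow> finite B \<and> \<Delta> = coeff_span smul (val_ring v) B" for B
  obtain B0 where "gen B0" using finitely_generated unfolding gen_def by blast
  then obtain B where B: "gen B" "\<And>B'. gen B' \<Longrightarrow> card B \<le> card B'"
    using ex_has_least_nat[of gen B0 card] by blast
  have fin: "finite B" and eq: "\<Delta> = coeff_span smul (val_ring v) B" using B(1) unfolding gen_def by auto
  have indep: "\<forall>b\<in>B. c b = 0" if c: "(\<Sum>b\<in>B. smul (c b) b) = 0" for c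
  proof (rule ccontr)
    assume "\<not> ?thesis"
    then obtain i where "i \<in> B" "c i \<noteq> 0" by blast
    then obtain a j where a: "j \<in> B" "a * c j = 1" "\<forall>i\<in>B. a * c i \<in> val_ring v"
      using scale_to_unit[OF fin, of i c] by blast
    have "0 = smul a (\<Sum>b\<in>B. smul (c b) b)" unfolding c by simp
    also have "\<dots> = (\<Sum>b\<in>B. smul (a * c b) b)" unfolding scale_sum_right by simp
    also have "\<dots> = j + (\<Sum>b\<in>B - {j}. smul (a * c b) b)" unfolding sum.remove[OF fin a(1)] a(2) by simp
    finally have j: "j = - (\<Sum>b\<in>B - {j}. smul (a * c b) b)" by (simp add: eq_neg_iff_add_eq_0)
    have gen_sub: "coeff_span smul (val_ring v) B \<subseteq> coeff_span smul (val_ring v) (B - {j})"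
    proof
      fix x assume "x \<in> coeff_span smul (val_ring v) B"
      then obtain e where e: "x = (\<Sum>b\<in>B. smul (e b) b)" "\<forall>b\<in>B. e b \<in> val_ring v"
        unfolding coeff_span_def by blast
      have "x = smul (e j) j + (\<Sum>b\<in>B - {j}. smul (e b) b)" unfolding e(1) using sum.remove[OF fin a(1)] .
      also have "smul (e j) j = - smul (e j) (\<Sum>b\<in>B - {j}. smul (a * c b) b)"
        using arg_cong[OF j, of "smul (e j)"] by simp
      also have "- smul (e j) (\<Sum>b\<in>B - {j}. smul (a * c b) b) + (\<Sum>b\<in>B - {j}. smul (e b) b)
          = (\<Sum>b\<in>B - {j}. smul (e b - e j * (a * c b)) b)"
        unfolding scale_sum_right by (simp add: scale_left_diff_distrib sum_subtractf)
      finally show "x \<in> coeff_span smul (val_ring v) (B - {j})"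
        by (rule coeff_spanI) (use e(2) a(1,3) R.diff_mem R.mult_mem in simp)
    qed
    moreover have "coeff_span smul (val_ring v) (B - {j}) \<subseteq> \<Delta>"
    proof
      fix x assume "x \<in> coeff_span smul (val_ring v) (B - {j})"
      then obtain e where e: "x = (\<Sum>b\<in>B - {j}. smul (e b) b)" "\<forall>b\<in>B - {j}. e b \<in> val_ring v"
        unfolding coeff_span_def by blast
      have "x = (\<Sum>b\<in>B. smul (if b = j then 0 else e b) b)"
        unfolding e(1) by (rule sum.mono_neutral_cong_left) (use fin in auto)
      then show "x \<in> \<Delta>" unfolding eq by (rule coeff_spanI) (use e(2) R.zero_mem in simp)
    qed
    ultimately have "gen (B - {j})" using fin eq unfolding gen_def by blast
    then have "card B \<le> card (B - {j})" by (rule B(2))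
    then show False using a(1) fin card_Diff1_less[OF fin a(1)] by simp
  qed
  have "independent B" unfolding dependent_finite[OF fin] using indep by blast
  moreover have "\<Delta> \<subseteq> span B"
  proof
    fix x assume "x \<in> \<Delta>"
    then obtain c where "x = (\<Sum>b\<in>B. smul (c b) b)" unfolding eq coeff_span_def by blast
    then show "x \<in> span B" by (simp add: span_sum span_scale span_base)
  qed
  then have "span B = UNIV" using span_minimal[OF _ subspace_span] span_order by blast
  ultimately have "card B = d ^ 2" using dim_eq_card[of B UNIV] dim_eq span_UNIV by simp
  then show ?thesis using fin eq indep by blast
qed

definition B :: "'d set" where
  "B = (SOME B. finite B \<and> \<Delta> = coeff_span smul (val_ring v) B \<and> card B = d ^ 2 \<and>
     (\<forall>c. (\<Sum>b\<in>B. smul (c b) b) = 0 \<longrightarrow> (\<forall>b\<in>B. c b = 0)))"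

lemma B: "finite B" "\<Delta> = coeff_span smul (val_ring v) B" "card B = d ^ 2"
    "(\<Sum>b\<in>B. smul (c b) b) = 0 \<Longrightarrow> b \<in> B \<Longrightarrow> c b = 0"
proof -
  have "finite B \<and> \<Delta> = coeff_span smul (val_ring v) B \<and> card B = d ^ 2 \<and>
     (\<forall>c. (\<Sum>b\<in>B. smul (c b) b) = 0 \<longrightarrow> (\<forall>b\<in>B. c b = 0))"
    unfolding B_def by (rule someI_ex[OF basis])
  then show "finite B" "\<Delta> = coeff_span smul (val_ring v) B" "card B = d ^ 2"
    "(\<Sum>b\<in>B. smul (c b) b) = 0 \<Longrightarrow> b \<in> B \<Longrightarrow> c b = 0" by simp_all
qed

lemma coords_eq: "(\<Sum>b\<in>B. smul (c b) b) = (\<Sum>b\<in>B. smul (c' b) b) \<Longrightarrow> b \<in> B \<Longrightarrow> c b = c' b"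
  using B(4)[of "\<lambda>b. c b - c' b" b] by (simp add: scale_left_diff_distrib sum_subtractf)

lemma coords: "x \<in> \<Delta> \<Longrightarrow> \<exists>c. x = (\<Sum>b\<in>B. smul (c b) b) \<and> (\<forall>b\<in>B. c b \<in> val_ring v)"
proof -
  assume "x \<in> \<Delta>"
  then have "x \<in> coeff_span smul (val_ring v) B" using B(2) by simp
  then show ?thesis unfolding coeff_span_def by simp
qed

lemma coords_mem: "(\<And>b. b \<in> B \<Longrightarrow> c b \<in> val_ring v) \<Longrightarrow> (\<Sum>b\<in>B. smul (c b) b) \<in> \<Delta>"
  by (subst B(2)) (rule coeff_spanI[OF refl])

definition J :: "nat \<Rightarrow> 'd set" where "J k = {smul (t ^ k) x |x. x \<in> \<Delta>}"

lemma cong_ideal_eq: "cong_ideal v smul \<Delta> k = J k"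
proof (intro equalityI subsetI)
  fix x assume "x \<in> cong_ideal v smul \<Delta> k"
  then obtain a y where ay: "x = smul a y" "a \<in> val_ideal_pow v k" "y \<in> \<Delta>" unfolding cong_ideal_def by blast
  then obtain b where "b \<in> val_ring v" "a = t ^ k * b" using val_ideal_pow_iff by blast
  then have "x = smul (t ^ k) (smul b y)" "smul b y \<in> \<Delta>" using ay smul_mem by auto
  then show "x \<in> J k" unfolding J_def by blast
next
  fix x assume "x \<in> J k"
  then show "x \<in> cong_ideal v smul \<Delta> k"
    unfolding J_def cong_ideal_def using val_ideal_pow_iff[of "t ^ k" k] R.one_mem by force
qed

lemma J_iff: "x \<in> J k \<longleftrightarrow> inverse varpi ^ k * x \<in> \<Delta>"
proof -
  have "x = smul (t ^ k) y \<longleftrightarrow> y = inverse varpi ^ k * x" for y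
  proof -
    have "smul (t ^ k) y = varpi ^ k * y" by (simp add: smul_emb[of "t ^ k"] emb_power)
    then show ?thesis using varpi_nonzero by (auto simp: power_inverse mult.assoc[symmetric])
  qed
  then show ?thesis unfolding J_def by auto
qed

lemma J_0: "J 0 = \<Delta>" by (auto simp: J_iff)

lemma J_zero: "0 \<in> J k" by (simp add: J_iff zero_mem)

lemma J_diff: "x \<in> J k \<Longrightarrow> y \<in> J k \<Longrightarrow> x - y \<in> J k"
  by (simp add: J_iff right_diff_distrib diff_mem)

lemma J_uminus: "x \<in> J k \<Longrightarrow> - x \<in> J k" using J_diff[OF J_zero] by simp

lemma J_add: "x \<in> J k \<Longrightarrow> y \<in> J k \<Longrightarrow> x + y \<in> J k"
  by (simp add: J_iff distrib_left add_mem)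

lemma J_mult: "x \<in> J k \<Longrightarrow> y \<in> J l \<Longrightarrow> x * y \<in> J (k + l)"
proof -
  assume "x \<in> J k" "y \<in> J l"
  then obtain z w where "x = smul (t ^ k) z" "y = smul (t ^ l) w" "z \<in> \<Delta>" "w \<in> \<Delta>" unfolding J_def by blast
  then have "x * y = smul (t ^ (k + l)) (z * w)" "z * w \<in> \<Delta>"
    using mult_mem by (auto simp: smul_mult_left smul_mult_right power_add mult.commute)
  then show ?thesis unfolding J_def by blast
qed

lemma J_mult_right: "x \<in> J k \<Longrightarrow> y \<in> \<Delta> \<Longrightarrow> x * y \<in> J k"
  using J_mult[of x k y 0] J_0 by simp

lemma J_mult_left: "x \<in> J k \<Longrightarrow> y \<in> \<Delta> \<Longrightarrow> y * x \<in> J k"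
  using J_mult[of y 0 x k] J_0 by simp

lemma t_power_mem: "t ^ k \<in> val_ring v" by (rule R.power_mem[OF R.p_mem])

lemma varpi_power_J: "varpi ^ k \<in> J k" using varpi_nonzero by (simp add: J_iff power_inverse one_mem)

lemma J_mono: "k \<le> l \<Longrightarrow> J l \<subseteq> J k"
proof
  fix x assume kl: "k \<le> l" and "x \<in> J l"
  then obtain y where y: "x = smul (t ^ l) y" "y \<in> \<Delta>" unfolding J_def by blast
  have "x = smul (t ^ k) (smul (t ^ (l - k)) y)" using kl y(1) by (simp flip: power_add)
  then show "x \<in> J k" unfolding J_def using smul_mem[OF t_power_mem y(2)] by blast
qed

lemma J_subset: "J k \<subseteq> \<Delta>" using J_mono[of 0 k] J_0 by simp

text \<open>Uniqueness of coordinates makes the filtration coordinatewise, so separatedness,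
  completeness and the number of residues can be taken over from the valuation ring.\<close>

lemma J_coords: "(\<Sum>b\<in>B. smul (c b) b) \<in> J k \<longleftrightarrow> (\<forall>b\<in>B. c b \<in> R.I k)"
proof
  assume "(\<Sum>b\<in>B. smul (c b) b) \<in> J k"
  then obtain x where x: "(\<Sum>b\<in>B. smul (c b) b) = smul (t ^ k) x" "x \<in> \<Delta>"
    unfolding J_def by blast
  obtain e where "x = (\<Sum>b\<in>B. smul (e b) b)" "\<forall>b\<in>B. e b \<in> val_ring v" using coords[OF x(2)] by blast
  then have e: "(\<Sum>b\<in>B. smul (c b) b) = smul (t ^ k) (\<Sum>b\<in>B. smul (e b) b)" "\<forall>b\<in>B. e b \<in> val_ring v"
    using x(1) by simp_all
  then have "(\<Sum>b\<in>B. smul (c b) b) = (\<Sum>b\<in>B. smul (t ^ k * e b) b)" by (simp add: scale_sum_right)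
  from coords_eq[OF this] show "\<forall>b\<in>B. c b \<in> R.I k" using e(2) unfolding R.I_def by auto
next
  assume c: "\<forall>b\<in>B. c b \<in> R.I k"
  then have "\<forall>b\<in>B. \<exists>e\<in>val_ring v. c b = t ^ k * e" unfolding R.I_def by blast
  then obtain e where e: "\<forall>b\<in>B. e b \<in> val_ring v \<and> c b = t ^ k * e b" by metis
  have "(\<Sum>b\<in>B. smul (c b) b) = smul (t ^ k) (\<Sum>b\<in>B. smul (e b) b)"
    unfolding scale_sum_right by (rule sum.cong) (use e in auto)
  moreover have "(\<Sum>b\<in>B. smul (e b) b) \<in> \<Delta>" using e by (intro coords_mem) simp
  ultimately show "(\<Sum>b\<in>B. smul (c b) b) \<in> J k" unfolding J_def by blast
qed

lemma J_separated: assumes "\<And>k. x \<in> J k" shows "x = 0"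
proof -
  have "x \<in> \<Delta>" using assms J_0 by blast
  then obtain c where c: "x = (\<Sum>b\<in>B. smul (c b) b)" using coords by blast
  have "c b = 0" if "b \<in> B" for b using assms that R.I_separated unfolding c J_coords by blast
  then show ?thesis unfolding c by simp
qed

lemma J_complete:
  assumes X: "\<And>k. X k \<in> \<Delta>" "\<And>k. X (Suc k) - X k \<in> J k"
  shows "\<exists>L\<in>\<Delta>. \<forall>k. L - X k \<in> J k"
proof -
  obtain c where c: "\<And>k. X k = (\<Sum>b\<in>B. smul (c k b) b)" "\<And>k b. b \<in> B \<Longrightarrow> c k b \<in> val_ring v"
    using coords[OF X(1)] by metis
  have "X (Suc k) - X k = (\<Sum>b\<in>B. smul (c (Suc k) b - c k b) b)" for k
    unfolding c(1) by (simp add: scale_left_diff_distrib sum_subtractf)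
  then have st: "c (Suc k) b - c k b \<in> R.I k" if "b \<in> B" for k b
    using X(2)[of k] that by (simp add: J_coords)
  have "\<exists>l\<in>val_ring v. \<forall>k. l - c k b \<in> R.I k" if "b \<in> B" for b
    using R.I_complete[of "\<lambda>k. c k b"] c(2)[OF that] st[OF that] by blast
  then obtain l where l: "\<And>b. b \<in> B \<Longrightarrow> l b \<in> val_ring v" "\<And>b k. b \<in> B \<Longrightarrow> l b - c k b \<in> R.I k" by metis
  have "(\<Sum>b\<in>B. smul (l b) b) - X k \<in> J k" for k
  proof -
    have "(\<Sum>b\<in>B. smul (l b) b) - X k = (\<Sum>b\<in>B. smul (l b - c k b) b)"
      unfolding c(1) by (simp add: scale_left_diff_distrib sum_subtractf)
    then show ?thesis using l(2) by (simp add: J_coords)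
  qed
  moreover have "(\<Sum>b\<in>B. smul (l b) b) \<in> \<Delta>" using l(1) by (rule coords_mem)
  ultimately show ?thesis by blast
qed

text \<open>Residues of the coordinates can be prescribed independently. The product of residue
  degree and ramification index is later found by comparison with this count.\<close>

lemma J_transversal:
  "\<exists>F. finite F \<and> transversal \<Delta> (J 1) F \<and> card F = card K ^ (d ^ 2)"
proof -
  define F where "F = (\<lambda>f. \<Sum>b\<in>B. smul (f b) b) ` (B \<rightarrow>\<^sub>E K)"
  have KR: "a \<in> val_ring v" if "a \<in> K" for a using K that unfolding transversal_def by blast
  have KI: "a = a'" if "a \<in> K" "a' \<in> K" "a - a' \<in> R.I 1" for a a'
    using K(1) that KR R.I_zero[of 1] unfolding transversal_def by (metis diff_self)
  have diff: "(\<Sum>b\<in>B. smul (c b) b) - (\<Sum>b\<in>B. smul (e b) b) = (\<Sum>b\<in>B. smul (c b - e b) b)" for c e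
    by (simp add: scale_left_diff_distrib sum_subtractf)
  have uniq: "f = g" if "f \<in> B \<rightarrow>\<^sub>E K" "g \<in> B \<rightarrow>\<^sub>E K"
      "(\<Sum>b\<in>B. smul (f b) b) - (\<Sum>b\<in>B. smul (g b) b) \<in> J 1" for f g
    using that unfolding diff J_coords by (intro PiE_ext[OF that(1,2)] KI) auto
  have "inj_on (\<lambda>f. \<Sum>b\<in>B. smul (f b) b) (B \<rightarrow>\<^sub>E K)"
    by (rule inj_onI, rule uniq) (auto simp: J_zero)
  then have "card F = card K ^ (d ^ 2)"
    unfolding F_def using B(1,3) by (simp add: card_image card_PiE)
  moreover have "finite F" unfolding F_def using B(1) K(2) by (simp add: finite_PiE)
  moreover have "transversal \<Delta> (J 1) F"
    unfolding transversal_def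
  proof (intro conjI ballI)
    show "F \<subseteq> \<Delta>" unfolding F_def using KR by (intro image_subsetI coords_mem) blast
    fix x assume "x \<in> \<Delta>"
    then obtain c where c: "x = (\<Sum>b\<in>B. smul (c b) b)" "\<And>b. b \<in> B \<Longrightarrow> c b \<in> val_ring v" using coords by metis
    have "\<exists>a. a \<in> K \<and> c b - a \<in> R.I 1" if "b \<in> B" for b
      using K(1) c(2)[OF that] unfolding transversal_def by blast
    then obtain g where g: "\<And>b. b \<in> B \<Longrightarrow> g b \<in> K \<and> c b - g b \<in> R.I 1" by metis
    define f where "f = restrict g B"
    have f: "f \<in> B \<rightarrow>\<^sub>E K" "\<And>b. b \<in> B \<Longrightarrow> c b - f b \<in> R.I 1" using g by (auto simp: f_def)
    show "\<exists>!r. r \<in> F \<and> x - r \<in> J 1"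
    proof (rule ex1I[of _ "\<Sum>b\<in>B. smul (f b) b"])
      show m: "(\<Sum>b\<in>B. smul (f b) b) \<in> F \<and> x - (\<Sum>b\<in>B. smul (f b) b) \<in> J 1"
        unfolding F_def c(1) diff J_coords using f by blast
      fix r assume r: "r \<in> F \<and> x - r \<in> J 1"
      then obtain h where h: "h \<in> B \<rightarrow>\<^sub>E K" "r = (\<Sum>b\<in>B. smul (h b) b)" unfolding F_def by blast
      have "(x - (\<Sum>b\<in>B. smul (f b) b)) - (x - r) \<in> J 1" using m r J_diff by blast
      then have "r - (\<Sum>b\<in>B. smul (f b) b) \<in> J 1" by simp
      then show "r = (\<Sum>b\<in>B. smul (f b) b)" using uniq[OF h(1) f(1)] unfolding h(2) by blast
    qed
  qed
  ultimately show ?thesis by blast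
qed

text \<open>The geometric series in \<open>x\<close> converges because \<open>x ^ k\<close> lies in
  \<open>J k\<close>.\<close>

lemma one_minus_unit:
  assumes "x \<in> J 1"
  shows "\<exists>s\<in>\<Delta>. (1 - x) * s = 1"
proof -
  have xD: "x \<in> \<Delta>" using assms J_subset by blast
  have xk: "x ^ k \<in> J k" for k
  proof (induction k)
    case 0
    then show ?case by (simp add: J_0 one_mem)
  next
    case (Suc k)
    then show ?case using J_mult[OF assms Suc] by simp
  qed
  define S where "S k = (\<Sum>i<k. x ^ i)" for k
  have SD: "S k \<in> \<Delta>" for k unfolding S_def using xD power_mem by (intro sum_mem)
  obtain s where s: "s \<in> \<Delta>" "\<And>k. s - S k \<in> J k"
    using J_complete[of S] SD xk by (auto simp: S_def)
  have tele: "(1 - x) * S k = 1 - x ^ k" for k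
  proof (induction k)
    case (Suc k)
    have "(1 - x) * S (Suc k) = (1 - x) * S k + (1 - x) * x ^ k" by (simp add: S_def distrib_left)
    then show ?case unfolding Suc by (simp add: left_diff_distrib)
  qed (simp add: S_def)
  have "(1 - x) * s - 1 \<in> J k" for k
  proof -
    have "(1 - x) * s - 1 = (1 - x) * (s - S k) - x ^ k" using tele[of k] by (simp add: right_diff_distrib)
    moreover have "(1 - x) * (s - S k) \<in> J k" using s(2) xD one_mem diff_mem by (intro J_mult_left) auto
    ultimately show ?thesis using J_diff xk by metis
  qed
  then have "(1 - x) * s - 1 = 0" by (rule J_separated)
  then show ?thesis using s(1) by (intro bexI[of _ s]) auto
qed

text \<open>Some power of \<open>x\<close> is idempotent modulo \<open>J 1\<close>; it lifts to an idempotent of the division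
  algebra, which is 0 or 1.\<close>

lemma power_J_or_unit:
  assumes x: "x \<in> \<Delta>"
  shows "\<exists>n\<ge>1. x ^ n \<in> J 1 \<or> (x \<noteq> 0 \<and> inverse x \<in> \<Delta>)"
proof -
  obtain F where F: "finite F" "transversal \<Delta> (J 1) F" using J_transversal by blast
  have "\<exists>r. r \<in> F \<and> x ^ i - r \<in> J 1" for i using F(2) power_mem[OF x] unfolding transversal_def by blast
  then obtain r where r: "\<And>i. r i \<in> F \<and> x ^ i - r i \<in> J 1" by metis
  have "\<not> inj r" using F(1) r finite_subset[of "range r" F] range_inj_infinite by blast
  then obtain i j where ij: "r i = r j" "i < j" unfolding inj_def by (metis linorder_neqE_nat)
  have per: "x ^ (i + l) - x ^ (j + l) \<in> J 1" for l
  proof -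
    have "(x ^ i - r i) - (x ^ j - r j) \<in> J 1" using r J_diff by blast
    then have "(x ^ i - x ^ j) * x ^ l \<in> J 1" using ij(1) J_mult_right power_mem[OF x] by simp
    then show ?thesis by (simp add: left_diff_distrib power_add)
  qed
  define q where "q = j - i"
  have q: "q \<ge> 1" using ij by (simp add: q_def)
  have per': "x ^ m - x ^ (m + q * k) \<in> J 1" if "m \<ge> i" for m k
  proof (induction k)
    case (Suc k)
    have "j = i + q" using ij(2) by (simp add: q_def)
    then have "i + (m - i + q * k) = m + q * k" "j + (m - i + q * k) = m + q * Suc k" using that by simp_all
    then have "x ^ (m + q * k) - x ^ (m + q * Suc k) \<in> J 1" using per[of "m - i + q * k"] by simp
    then show ?case using J_add[OF Suc] by fastforce
  qed (simp add: J_zero)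
  \<comment> \<open>A multiple of the period \<open>q\<close> beyond the start \<open>i\<close> of
    the periodic range, so that \<open>x ^ n\<close> and its square agree modulo
    \<open>J 1\<close>.\<close>
  define n where "n = q * (i + 1)"
  have "n = q + q * i" by (simp add: n_def)
  moreover have "1 * i \<le> q * i" using q by (rule mult_le_mono1)
  ultimately have n: "n \<ge> 1" "n \<ge> i" using q by linarith+
  have "x ^ n - x ^ n * x ^ n \<in> J 1" using per'[OF n(2), of "i + 1"] by (simp add: n_def power_add)
  \<comment> \<open>This is \<open>3 e^2 - 2 e^3\<close>, the standard polynomial for lifting
    idempotents: it is divisible by \<open>e^2\<close> and its complement by
    \<open>(1 - e)^2\<close>, so the defect \<open>e^2 - e\<close> gets squared up to a
    factor.\<close>
  define \<phi> where "\<phi> e = e * e * (1 + (1 - e) + (1 - e))" for e :: 'd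
  define E where "E k = (\<phi> ^^ k) (x ^ n)" for k
  have E_Suc: "E (Suc k) = \<phi> (E k)" for k by (simp add: E_def)
  have ED: "E k \<in> \<Delta>" for k
    by (induction k) (auto simp: E_def \<phi>_def power_mem x diff_mem add_mem mult_mem one_mem)
  have idem: "E k * E k - E k \<in> J (Suc k)" for k
  proof (induction k)
    case 0
    show ?case using J_uminus[OF \<open>x ^ n - x ^ n * x ^ n \<in> J 1\<close>] by (simp add: E_def)
  next
    case (Suc k)
    define e where "e = E k"
    define a where "a = 1 - e"
    have ea: "e * a = - (e * e - e)" "a * e = e * a" by (simp_all add: a_def algebra_simps)
    define b where "b = 1 + e + e"
    define c where "c = 1 + a + a"
    have ca: "c * a = a * c" by (simp add: c_def algebra_simps)
    have "1 - \<phi> e = a * a * b" by (simp add: \<phi>_def a_def b_def algebra_simps mult_2_right mult_3_right)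
    then have "\<phi> e * (1 - \<phi> e) = e * e * c * (a * a * b)" by (simp add: \<phi>_def c_def a_def)
    also have "\<dots> = e * e * (c * a) * (a * b)" by (simp only: mult.assoc)
    also have "\<dots> = e * e * (a * c) * (a * b)" by (simp only: ca)
    also have "\<dots> = e * e * a * (c * a) * b" by (simp only: mult.assoc)
    also have "\<dots> = e * (e * a) * a * (c * b)" unfolding ca by (simp only: mult.assoc)
    also have "\<dots> = e * (a * e) * a * (c * b)" by (simp only: ea(2))
    also have "\<dots> = (e * a) * (e * a) * (c * b)" by (simp only: mult.assoc)
    finally have eq: "\<phi> e * \<phi> e - \<phi> e = - ((e * a) * (e * a) * (c * b))"
      by (metis minus_diff_eq mult.right_neutral right_diff_distrib)
    have "e * a \<in> J (Suc k)" unfolding ea(1) using Suc J_uminus unfolding e_def by blast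
    then have "(e * a) * (e * a) \<in> J (Suc (Suc k))"
      using J_mult[of "e * a" "Suc k" "e * a" "Suc k"] J_mono[of "Suc (Suc k)" "Suc k + Suc k"] by auto
    moreover have "c * b \<in> \<Delta>" unfolding c_def b_def a_def e_def
      using ED by (intro mult_mem add_mem diff_mem one_mem)
    ultimately show ?case unfolding E_Suc e_def[symmetric] eq by (rule J_uminus[OF J_mult_right])
  qed
  \<comment> \<open>An iterate changes by a multiple of its own defect, so the iterates
    converge.\<close>
  have step: "E (Suc k) - E k \<in> J (Suc k)" for k
  proof -
    define e where "e = E k"
    have "E (Suc k) - E k = (e * e - e) * (1 - e - e)"
      unfolding E_Suc e_def[symmetric] by (simp add: \<phi>_def algebra_simps mult_2_right mult_3_right)
    moreover have "1 - e - e \<in> \<Delta>" unfolding e_def using ED by (intro diff_mem one_mem)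
    ultimately show ?thesis using idem[of k] J_mult_right unfolding e_def by simp
  qed
  have "E (Suc k) - E k \<in> J k" for k using step[of k] J_mono[of k "Suc k"] by auto
  then obtain L where L: "L \<in> \<Delta>" "\<And>k. L - E k \<in> J k" using J_complete[of E] ED by blast
  have "L * L - L \<in> J k" for k
  proof -
    have "L * L - L = (L - E k) * L + E k * (L - E k) - (L - E k) + (E k * E k - E k)"
      by (simp add: algebra_simps)
    moreover have "(L - E k) * L \<in> J k" "E k * (L - E k) \<in> J k" "E k * E k - E k \<in> J k"
      using L ED J_mult_right J_mult_left idem[of k] J_mono[of k "Suc k"] by auto
    ultimately show ?thesis using L J_add J_diff by metis
  qed
  then have "L * L - L = 0" by (rule J_separated)
  then have "L * (L - 1) = 0" by (simp add: right_diff_distrib)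
  then have L01: "L = 0 \<or> L = 1" by simp
  have "(L - E 1) + (E 1 - E 0) \<in> J 1" using L(2)[of 1] step[of 0] by (intro J_add) simp_all
  then have Lx: "L - x ^ n \<in> J 1" by (simp add: E_def)
  show ?thesis
  proof (cases "L = 0")
    case True
    then have "x ^ n \<in> J 1" using J_uminus[OF Lx] by simp
    then show ?thesis using n by blast
  next
    case False
    then have "1 - x ^ n \<in> J 1" using Lx L01 by simp
    from one_minus_unit[OF this] obtain s where s: "s \<in> \<Delta>" "x ^ n * s = 1" by auto
    obtain m where m: "n = Suc m" using n by (cases n) auto
    have x1: "x * (x ^ m * s) = 1" using s m by (simp add: mult.assoc)
    then have "inverse x = x ^ m * s" by (rule inverse_unique)
    moreover have "x \<noteq> 0" using x1 by auto
    ultimately show ?thesis using s power_mem[OF x] mult_mem by (intro exI[of _ 1]) auto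
  qed
qed

end

section \<open>The non-units form a principal ideal\<close>

context maximal_order
begin

definition N :: "'d set" where "N = {x \<in> \<Delta>. x = 0 \<or> inverse x \<notin> \<Delta>}"

lemma unit_inverse: "x \<in> \<Delta> \<Longrightarrow> x \<notin> N \<Longrightarrow> x \<noteq> 0 \<and> inverse x \<in> \<Delta>"
  by (auto simp: N_def)

lemma N_subset: "x \<in> N \<Longrightarrow> x \<in> \<Delta>"
  by (auto simp: N_def)

lemma N_not_unit: "x \<in> N \<Longrightarrow> y \<in> \<Delta> \<Longrightarrow> x * y \<noteq> 1"
  unfolding N_def by (auto dest: inverse_unique)

lemma N_power: "x \<in> N \<Longrightarrow> \<exists>n\<ge>1. x ^ n \<in> J 1"
  using power_J_or_unit[of x] unfolding N_def by blast

lemma one_notin_J1: "1 \<notin> J 1"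
proof
  assume "1 \<in> J 1"
  then have "inverse varpi \<in> \<Delta>" by (simp add: J_iff)
  then have "1 \<in> J k" for k using power_mem by (simp add: J_iff)
  then show False using J_separated[of 1] by simp
qed

lemma J1_N: "x \<in> J 1 \<Longrightarrow> x \<in> N"
  using J_subset[of 1] J_mult_right[of x 1 "inverse x"] one_notin_J1 unfolding N_def by auto

lemma one_notin_N: "1 \<notin> N" by (simp add: N_def one_mem)

lemma zero_N: "0 \<in> N" by (simp add: N_def zero_mem)

lemma varpi_N: "varpi \<in> N" using varpi_power_J[of 1] J1_N by simp

lemma N_mult_right: assumes "x \<in> N" "y \<in> \<Delta>" shows "x * y \<in> N"
proof (rule ccontr)
  assume n: "x * y \<notin> N"
  have "x * y \<in> \<Delta>" using assms N_subset mult_mem by blast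
  then have i: "x * y \<noteq> 0" "inverse (x * y) \<in> \<Delta>" using unit_inverse[OF _ n] by auto
  have "x * (y * inverse (x * y)) = 1" using i(1) by (simp add: mult.assoc[symmetric])
  then show False using N_not_unit[OF assms(1)] mult_mem[OF assms(2) i(2)] by blast
qed

lemma N_mult_left: assumes "x \<in> N" "y \<in> \<Delta>" shows "y * x \<in> N"
proof (rule ccontr)
  assume n: "y * x \<notin> N"
  have "y * x \<in> \<Delta>" using assms N_subset mult_mem by blast
  then have i: "y * x \<noteq> 0" "inverse (y * x) \<in> \<Delta>" using unit_inverse[OF _ n] by auto
  have "(inverse (y * x) * y) * x = 1" using i(1) by (simp add: mult.assoc)
  moreover have "x \<noteq> 0" using i(1) by auto
  ultimately have "inverse x = inverse (y * x) * y"
    by (metis mult.assoc mult.right_neutral right_inverse mult.left_neutral)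
  then have "inverse x \<in> \<Delta>" using mult_mem[OF i(2) assms(2)] by simp
  then show False using assms(1) \<open>x \<noteq> 0\<close> unfolding N_def by simp
qed

text \<open>Some power \<open>x ^ n\<close> lies in \<open>J 1\<close>, so \<open>1 - x ^ n\<close>
  is invertible, and \<open>1 - x\<close> divides it.\<close>

lemma one_minus_N: assumes "x \<in> N" shows "1 - x \<notin> N"
proof
  assume m: "1 - x \<in> N"
  obtain n where n: "x ^ n \<in> J 1" using N_power[OF assms] by blast
  have xD: "x \<in> \<Delta>" using assms N_subset by blast
  have "(1 - x) * (\<Sum>i<n. x ^ i) = 1 - x ^ n"
  proof (induction n)
    case (Suc n)
    then show ?case by (simp add: distrib_left left_diff_distrib)
  qed simp
  moreover obtain s where "s \<in> \<Delta>" "(1 - x ^ n) * s = 1" using one_minus_unit[OF n] by blast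
  ultimately have "(1 - x) * ((\<Sum>i<n. x ^ i) * s) = 1" "(\<Sum>i<n. x ^ i) * s \<in> \<Delta>"
    using xD by (simp_all add: mult.assoc[symmetric] mult_mem sum_mem power_mem)
  then show False using N_not_unit[OF m] by blast
qed

text \<open>If \<open>u = x - y\<close> were a unit, then \<open>inverse u * - y\<close> would be a
  non-unit equal to \<open>1 - inverse u * x\<close>, against \<open>one_minus_N\<close>. So the
  ring is local.\<close>

lemma N_diff: assumes "x \<in> N" "y \<in> N" shows "x - y \<in> N"
proof (rule ccontr)
  assume n: "x - y \<notin> N"
  have "x - y \<in> \<Delta>" using assms N_subset diff_mem by blast
  then have u: "x - y \<noteq> 0" "inverse (x - y) \<in> \<Delta>" using unit_inverse[OF _ n] by auto
  have "inverse (x - y) * (x - y) = 1" using u(1) by simp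
  then have "inverse (x - y) * - y = 1 - inverse (x - y) * x"
    by (simp add: right_diff_distrib algebra_simps)
  moreover have "- y \<in> N" using N_mult_left[OF assms(2) uminus_mem[OF one_mem]] by simp
  then have "inverse (x - y) * - y \<in> N" using N_mult_left u by blast
  moreover have "inverse (x - y) * x \<in> N" using N_mult_left[OF assms(1) u(2)] .
  ultimately show False using one_minus_N by metis
qed

text \<open>A proper ideal contains no unit, so it lies in \<open>N\<close>, and \<open>N\<close> is
  itself a proper two-sided ideal.\<close>

lemma maximal_ideal_eq_N:
  assumes "maximal_two_sided_ideal \<Delta> I"
  shows "I = N"
proof -
  have I: "I \<subseteq> \<Delta>" "0 \<in> I" "\<And>x r. x \<in> I \<Longrightarrow> r \<in> \<Delta> \<Longrightarrow> x * r \<in> I" "I \<noteq> \<Delta>"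
    and max: "\<And>J'. two_sided_ideal \<Delta> J' \<Longrightarrow> I \<subseteq> J' \<Longrightarrow> J' = I \<or> J' = \<Delta>"
    using assms unfolding maximal_two_sided_ideal_def two_sided_ideal_def by auto
  have "I \<subseteq> N"
  proof
    fix x assume x: "x \<in> I"
    show "x \<in> N"
    proof (rule ccontr)
      assume "x \<notin> N"
      then have "x \<noteq> 0" "inverse x \<in> \<Delta>" using x I(1) unit_inverse by auto
      then have "1 \<in> I" using I(3)[OF x, of "inverse x"] by simp
      then have "\<Delta> \<subseteq> I" using I(3)[of 1] by auto
      then show False using I by blast
    qed
  qed
  moreover have "two_sided_ideal \<Delta> N"
    unfolding two_sided_ideal_def using N_subset zero_N N_diff N_mult_left N_mult_right by blast
  ultimately show ?thesis using max one_notin_N one_mem by blast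
qed

text \<open>Take \<open>y\<close> such that the right ideal generated by \<open>y\<close> modulo \<open>J 1\<close> is minimal. If \<open>y n\<close> were not
  in \<open>J 1\<close>, then \<open>y\<close> would be congruent to some \<open>y n w\<close>, but \<open>1 - n w\<close> is a unit.\<close>

lemma annihilator: "\<exists>y\<in>\<Delta>. y \<notin> J 1 \<and> (\<forall>n\<in>N. y * n \<in> J 1)"
proof -
  obtain F where F: "finite F" "transversal \<Delta> (J 1) F" using J_transversal by blast
  define S where "S y = {r \<in> F. \<exists>z\<in>\<Delta>. y * z - r \<in> J 1}" for y
  have finS: "finite (S y)" for y unfolding S_def using F(1) by simp
  have "\<exists>y. (y \<in> \<Delta> \<and> y \<notin> J 1) \<and> (\<forall>y'. (y' \<in> \<Delta> \<and> y' \<notin> J 1) \<longrightarrow> card (S y) \<le> card (S y'))"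
    using one_mem one_notin_J1 by (intro ex_has_least_nat[of _ 1]) blast
  then obtain y where y: "y \<in> \<Delta>" "y \<notin> J 1" "\<And>y'. y' \<in> \<Delta> \<Longrightarrow> y' \<notin> J 1 \<Longrightarrow> card (S y) \<le> card (S y')"
    by blast
  have "y * n \<in> J 1" if n: "n \<in> N" for n
  proof (rule ccontr)
    assume yn: "y * n \<notin> J 1"
    have nD: "n \<in> \<Delta>" using n N_subset by blast
    have "S (y * n) \<subseteq> S y"
    proof
      fix r assume "r \<in> S (y * n)"
      then obtain z where z: "r \<in> F" "z \<in> \<Delta>" "y * n * z - r \<in> J 1" unfolding S_def by blast
      then have "n * z \<in> \<Delta>" "y * (n * z) - r \<in> J 1" using nD mult_mem by (simp_all add: mult.assoc)
      then show "r \<in> S y" using z unfolding S_def by blast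
    qed
    then have eq: "S (y * n) = S y" using y(3)[OF mult_mem[OF y(1) nD] yn] finS card_seteq by metis
    obtain r where r: "r \<in> F" "y - r \<in> J 1" using F(2) y(1) unfolding transversal_def by blast
    then have "r \<in> S y" unfolding S_def using one_mem by force
    then obtain w where w: "w \<in> \<Delta>" "y * n * w - r \<in> J 1" using eq unfolding S_def by blast
    have "(y - r) - (y * n * w - r) \<in> J 1" using r w J_diff by blast
    then have yw: "y * (1 - n * w) \<in> J 1" by (simp add: algebra_simps)
    have "n * w \<in> N" using n w N_mult_right by blast
    then have u: "1 - n * w \<noteq> 0" "inverse (1 - n * w) \<in> \<Delta>"
      using one_minus_N unit_inverse[of "1 - n * w"] diff_mem[OF one_mem N_subset] by blast+
    have "y * (1 - n * w) * inverse (1 - n * w) \<in> J 1" using yw u J_mult_right by blast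
    then show False using y(2) u(1) by (simp add: mult.assoc)
  qed
  then show ?thesis using y by blast
qed

text \<open>Maximality speaks of orders, so \<open>M\<close> must be shown to be finitely generated.
  As \<open>M\<close> lies between \<open>\<Delta>\<close> and the inverse of \<open>varpi\<close>
  times \<open>\<Delta>\<close>, it suffices to add to \<open>B\<close> those among finitely many
  coset representatives that lie in \<open>M\<close>.\<close>

lemma overorder:
  assumes M: "\<Delta> \<subseteq> M" "\<And>x y. x \<in> M \<Longrightarrow> y \<in> M \<Longrightarrow> x - y \<in> M" "\<And>x y. x \<in> M \<Longrightarrow> y \<in> M \<Longrightarrow> x * y \<in> M"
    and bound: "\<And>x. x \<in> M \<Longrightarrow> varpi * x \<in> \<Delta>"
  shows "M = \<Delta>"
proof (rule maximal[OF _ M(1)])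
  obtain F where F: "finite F" "transversal \<Delta> (J 1) F" using J_transversal by blast
  define Gs where "Gs = {inverse varpi * r |r. r \<in> F} \<inter> M"
  have Mz: "0 \<in> M" using M zero_mem by blast
  have Madd: "x + y \<in> M" if "x \<in> M" "y \<in> M" for x y
    using M(2)[OF that(1) M(2)[OF Mz that(2)]] by simp
  have Msmul: "smul a x \<in> M" if "a \<in> val_ring v" "x \<in> M" for a x
    using M(3)[of "emb a" x] emb_mem[OF that(1)] M(1) that(2) smul_emb[of a x] by auto
  have Msum: "sum f A \<in> M" if "\<And>i. i \<in> A \<Longrightarrow> f i \<in> M" for f :: "'d \<Rightarrow> 'd" and A
    using that by (induction A rule: infinite_finite_induct) (auto simp: Mz Madd)
  have BM: "B \<subseteq> M"
  proof
    fix b assume b: "b \<in> B"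
    have "(\<Sum>c\<in>B. smul (if c = b then 1 else 0) c) \<in> \<Delta>" using R.one_mem R.zero_mem by (intro coords_mem) auto
    also have "(\<Sum>c\<in>B. smul (if c = b then 1 else 0) c) = (\<Sum>c\<in>B. if c = b then b else 0)"
      by (intro sum.cong) auto
    finally show "b \<in> M" using b B(1) M(1) by auto
  qed
  have finG: "finite Gs" unfolding Gs_def using F(1) by simp
  have "M = coeff_span smul (val_ring v) (B \<union> Gs)"
  proof (intro equalityI subsetI)
    fix x assume x: "x \<in> M"
    obtain r where r: "r \<in> F" "varpi * x - r \<in> J 1" using F(2) bound[OF x] unfolding transversal_def by blast
    define g where "g = inverse varpi * r"
    have "inverse varpi ^ 1 * (varpi * x - r) \<in> \<Delta>" using r(2) unfolding J_iff .
    then have xg: "x - g \<in> \<Delta>" using varpi_nonzero by (simp add: g_def right_diff_distrib mult.assoc[symmetric])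
    have "x - (x - g) \<in> M" using M x xg by blast
    then have gG: "g \<in> Gs" unfolding Gs_def g_def using r(1) by auto
    obtain c where c: "x - g = (\<Sum>b\<in>B. smul (c b) b)" "\<forall>b\<in>B. c b \<in> val_ring v" using coords[OF xg] by blast
    define e where "e b = (if b \<in> B then c b else 0) + (if b = g then 1 else 0)" for b
    have "(\<Sum>b\<in>B \<union> Gs. smul (e b) b) = (\<Sum>b\<in>B \<union> Gs. if b \<in> B then smul (c b) b else 0)
        + (\<Sum>b\<in>B \<union> Gs. if b = g then g else 0)"
      unfolding sum.distrib[symmetric] by (intro sum.cong) (auto simp: e_def scale_left_distrib)
    also have "(\<Sum>b\<in>B \<union> Gs. if b = g then g else 0) = g" using gG B(1) finG by simp
    also have "(\<Sum>b\<in>B \<union> Gs. if b \<in> B then smul (c b) b else 0) = (\<Sum>b\<in>B. smul (c b) b)"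
      using B(1) finG by (intro sum.mono_neutral_cong_right) auto
    finally have "x = (\<Sum>b\<in>B \<union> Gs. smul (e b) b)" using c(1) by (simp add: algebra_simps)
    then show "x \<in> coeff_span smul (val_ring v) (B \<union> Gs)"
      by (rule coeff_spanI) (use c(2) R.add_mem R.one_mem R.zero_mem in \<open>simp add: e_def\<close>)
  next
    fix x assume "x \<in> coeff_span smul (val_ring v) (B \<union> Gs)"
    then obtain c where c: "x = (\<Sum>b\<in>B \<union> Gs. smul (c b) b)" "\<forall>b\<in>B \<union> Gs. c b \<in> val_ring v"
      unfolding coeff_span_def by blast
    show "x \<in> M" unfolding c(1) using c(2) BM by (intro Msum Msmul) (auto simp: Gs_def)
  qed
  then have gen: "\<exists>B. finite B \<and> M = coeff_span smul (val_ring v) B"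
    using B(1) finG by (intro exI[of _ "B \<union> Gs"]) simp
  have "span M = UNIV" using span_mono[OF M(1)] span_order by auto
  moreover have "1 \<in> M" using M(1) one_mem by (rule subsetD)
  ultimately show "is_order (val_ring v) smul M"
    unfolding is_order_def using gen[unfolded coeff_span_def] M(2,3) by simp
qed

text \<open>For the comparison of left and right multiples of a uniformizer: if
  \<open>\<Delta>\<close> is contained in such a conjugate, maximality makes the two equal.\<close>

lemma conjugate_order:
  assumes p: "p \<noteq> 0"
  shows "is_order (val_ring v) smul ((\<lambda>x. p * x * inverse p) ` \<Delta>)"
proof -
  define c where "c x = p * x * inverse p" for x
  have c1: "c 1 = 1" and cd: "c x - c y = c (x - y)" and cm: "c x * c y = c (x * y)"
    and cs: "c (smul a x) = smul a (c x)" for x y a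
  proof -
    show "c 1 = 1" using p by (simp add: c_def)
    show "c x - c y = c (x - y)" by (simp add: c_def algebra_simps)
    have "c x * c y = p * x * (inverse p * p) * y * inverse p" by (simp add: c_def mult.assoc)
    then show "c x * c y = c (x * y)" using p by (simp add: c_def mult.assoc)
    show "c (smul a x) = smul a (c x)" by (simp add: c_def smul_mult_left smul_mult_right)
  qed
  have csum: "c (sum f A) = (\<Sum>i\<in>A. c (f i))" for f :: "'d \<Rightarrow> 'd" and A
    by (simp add: c_def sum_distrib_left sum_distrib_right)
  have inj: "inj c"
    using p by (auto intro!: injI simp: c_def)
  define B' where "B' = c ` B"
  have finB': "finite B'" unfolding B'_def using B(1) by simp
  have "c ` \<Delta> = coeff_span smul (val_ring v) B'"
  proof (intro equalityI subsetI)
    fix x assume "x \<in> c ` \<Delta>"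
    then obtain y where y: "x = c y" "y \<in> \<Delta>" by blast
    obtain e where e: "y = (\<Sum>b\<in>B. smul (e b) b)" "\<forall>b\<in>B. e b \<in> val_ring v" using coords[OF y(2)] by blast
    have "x = (\<Sum>b\<in>B'. smul (e (inv_into UNIV c b)) b)"
      unfolding y(1) e(1) csum B'_def sum.reindex[OF inj_on_subset[OF inj subset_UNIV]]
      by (simp add: cs inv_f_f[OF inj])
    then show "x \<in> coeff_span smul (val_ring v) B'"
      by (rule coeff_spanI) (use e(2) in \<open>auto simp: B'_def inv_f_f[OF inj]\<close>)
  next
    fix x assume "x \<in> coeff_span smul (val_ring v) B'"
    then obtain e where e: "x = (\<Sum>b\<in>B'. smul (e b) b)" "\<forall>b\<in>B'. e b \<in> val_ring v"
      unfolding coeff_span_def by blast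
    have "x = c (\<Sum>b\<in>B. smul (e (c b)) b)"
      unfolding e(1) csum B'_def sum.reindex[OF inj_on_subset[OF inj subset_UNIV]] by (simp add: cs)
    moreover have "(\<Sum>b\<in>B. smul (e (c b)) b) \<in> \<Delta>" using e(2) by (intro coords_mem) (auto simp: B'_def)
    ultimately show "x \<in> c ` \<Delta>" by blast
  qed
  then have gen: "\<exists>B. finite B \<and> c ` \<Delta> = coeff_span smul (val_ring v) B" using finB' by blast
  have "span (c ` \<Delta>) = UNIV"
  proof -
    have cspan: "c y \<in> span (c ` \<Delta>)" if "y \<in> span \<Delta>" for y
      using that
    proof (induction rule: span_induct_alt)
      case base
      have "c 0 = 0" by (simp add: c_def)
      then show ?case using span_zero by metis
    next
      case (step a x y)
      have "c (smul a x + y) = smul a (c x) + c y" unfolding cs[symmetric] by (simp add: c_def algebra_simps)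
      moreover have "c x \<in> span (c ` \<Delta>)" using step by (intro span_base) simp
      ultimately show ?case using step by (simp add: span_add span_scale)
    qed
    have "x \<in> span (c ` \<Delta>)" for x
    proof -
      have "x = c (inverse p * x * p)" using p
        by (simp add: c_def mult.assoc mult.assoc[symmetric, of p "inverse p"])
      then show ?thesis using cspan[of "inverse p * x * p"] span_order by simp
    qed
    then show ?thesis by blast
  qed
  moreover have "1 \<in> c ` \<Delta>" using c1 one_mem by (metis image_eqI)
  moreover have "\<forall>x\<in>c ` \<Delta>. \<forall>y\<in>c ` \<Delta>. x - y \<in> c ` \<Delta> \<and> x * y \<in> c ` \<Delta>"
    using cd cm diff_mem mult_mem by auto
  ultimately show ?thesis
    unfolding is_order_def c_def[symmetric, abs_def] using gen[unfolded coeff_span_def] by blast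
qed

text \<open>Some \<open>t'\<close> outside \<open>\<Delta>\<close> multiplies \<open>N\<close> into \<open>\<Delta>\<close>. Since the left order of \<open>N\<close> is \<open>\<Delta>\<close>, the right ideal
  \<open>t' N\<close> contains a unit, so that \<open>N\<close> is generated by the inverse of \<open>t'\<close>.\<close>

lemma N_principal: "\<exists>p. p \<in> N \<and> p \<noteq> 0 \<and> (\<forall>x\<in>N. inverse p * x \<in> \<Delta>)"
proof -
  obtain y where y: "y \<in> \<Delta>" "y \<notin> J 1" "\<And>n. n \<in> N \<Longrightarrow> y * n \<in> J 1" using annihilator by blast
  define s where "s = inverse varpi * y"
  have sN: "s * n \<in> \<Delta>" if "n \<in> N" for n
    using y(3)[OF that] by (simp add: J_iff s_def mult.assoc)
  have sD: "s \<notin> \<Delta>" using y(2) by (simp add: J_iff s_def)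
  define M where "M = {x. \<forall>n\<in>N. x * n \<in> N}"
  have "M = \<Delta>"
  proof (rule overorder)
    show "\<Delta> \<subseteq> M" unfolding M_def using N_mult_left by blast
    show "x - y \<in> M" if "x \<in> M" "y \<in> M" for x y
      using that N_diff unfolding M_def by (simp add: left_diff_distrib)
    show "x * y \<in> M" if "x \<in> M" "y \<in> M" for x y
      using that unfolding M_def by (simp add: mult.assoc)
    \<comment> \<open>\<open>varpi\<close> is central and lies in \<open>N\<close>, which bounds the
      left order of \<open>N\<close>.\<close>
    show "varpi * x \<in> \<Delta>" if "x \<in> M" for x
      using that varpi_N N_subset emb_comm unfolding M_def by auto
  qed
  then obtain n where n: "n \<in> N" "s * n \<notin> N" using sD unfolding M_def by blast
  define u where "u = s * n"
  have u: "u \<in> \<Delta>" "u \<noteq> 0" "inverse u \<in> \<Delta>" using unit_inverse[OF sN[OF n(1)] n(2)] sN[OF n(1)] unfolding u_def by auto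
  have s0: "s \<noteq> 0" using u(2) unfolding u_def by auto
  have "inverse s = n * inverse u"
    using s0 u(2) unfolding u_def by (intro inverse_unique) (simp add: mult.assoc[symmetric])
  then have "inverse s \<in> N" using N_mult_right n u by simp
  then show ?thesis using s0 sN by (intro exI[of _ "inverse s"]) auto
qed

text \<open>That \<open>N\<close> is a left ideal puts \<open>x p\<close> into
  \<open>p \<Delta>\<close>. Hence \<open>\<Delta>\<close> lies in its conjugate by
  \<open>p\<close>, and equality, by maximality, gives \<open>p_left\<close>. Separatedness and
  completeness come from the filtration \<open>J\<close>, because a power of \<open>p\<close> lies
  in \<open>J 1\<close> and \<open>varpi\<close> is a multiple of \<open>p\<close>.\<close>

lemma uniformizer: "\<exists>p. nc_dvr \<Delta> p \<and> (\<forall>x. x \<in> N \<longleftrightarrow> (\<exists>y\<in>\<Delta>. x = p * y))"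
proof -
  obtain p where p: "p \<in> N" "p \<noteq> 0" "\<And>x. x \<in> N \<Longrightarrow> inverse p * x \<in> \<Delta>" using N_principal by blast
  have pD: "p \<in> \<Delta>" using p N_subset by blast
  have N_iff: "x \<in> N \<longleftrightarrow> (\<exists>y\<in>\<Delta>. x = p * y)" for x
  proof
    assume "x \<in> N"
    moreover have "x = p * (inverse p * x)" using p by (simp add: mult.assoc[symmetric])
    ultimately show "\<exists>y\<in>\<Delta>. x = p * y" using p(3) by blast
  qed (use N_mult_right p in blast)
  have right: "\<exists>y\<in>\<Delta>. x * p = p * y" if "x \<in> \<Delta>" for x
    using N_iff[of "x * p"] N_mult_left[OF p(1) that] by blast
  have "\<Delta> \<subseteq> (\<lambda>x. p * x * inverse p) ` \<Delta>"
  proof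
    fix x assume "x \<in> \<Delta>"
    then obtain y where y: "y \<in> \<Delta>" "x * p = p * y" using right by blast
    have "p * y * inverse p = x" unfolding y(2)[symmetric] using p by (simp add: mult.assoc)
    then show "x \<in> (\<lambda>x. p * x * inverse p) ` \<Delta>" using y(1) by blast
  qed
  then have conj: "(\<lambda>x. p * x * inverse p) ` \<Delta> = \<Delta>" using maximal[OF conjugate_order[OF p(2)]] by blast
  have left: "\<exists>y\<in>\<Delta>. p * x = y * p" if "x \<in> \<Delta>" for x
  proof -
    have "p * x * inverse p \<in> \<Delta>" using conj that by blast
    moreover have "p * x = (p * x * inverse p) * p" using p by (simp add: mult.assoc)
    ultimately show ?thesis by blast
  qed
  have pow_comm: "\<exists>y\<in>\<Delta>. x * p ^ k = p ^ k * y" if "x \<in> \<Delta>" for x k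
    using that
  proof (induction k arbitrary: x)
    case (Suc k)
    obtain y where y: "y \<in> \<Delta>" "x * p = p * y" using right[OF Suc.prems] by blast
    obtain z where z: "z \<in> \<Delta>" "y * p ^ k = p ^ k * z" using Suc.IH[OF y(1)] by blast
    have "x * p ^ Suc k = p * (y * p ^ k)" using y by (simp add: mult.assoc[symmetric])
    also have "\<dots> = p ^ Suc k * z" unfolding z(2) by (simp add: mult.assoc)
    finally show ?case using z by blast
  qed auto
  obtain c where c: "c \<ge> 1" "p ^ c \<in> J 1" using N_power[OF p(1)] by blast
  have pcJ: "p ^ (c * k) * y \<in> J k" if "y \<in> \<Delta>" for k y
  proof -
    have "(p ^ c) ^ k \<in> J k"
    proof (induction k)
      case 0
      then show ?case by (simp add: J_0 one_mem)
    next
      case (Suc k)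
      then show ?case using J_mult[OF c(2) Suc] by simp
    qed
    then show ?thesis using J_mult_right that by (simp add: power_mult)
  qed
  obtain w where w: "w \<in> \<Delta>" "varpi = p * w" using N_iff varpi_N by blast
  have Jp: "\<exists>z\<in>\<Delta>. x = p ^ k * z" if "x \<in> J k" for x k
  proof -
    have "\<exists>z\<in>\<Delta>. varpi ^ k = p ^ k * z"
    proof (induction k)
      case 0
      then show ?case using one_mem by auto
    next
      case (Suc k)
      then obtain z where z: "z \<in> \<Delta>" "varpi ^ k = p ^ k * z" by blast
      obtain w' where w': "w' \<in> \<Delta>" "w * p ^ k = p ^ k * w'" using pow_comm[OF w(1)] by blast
      have "varpi ^ Suc k = p * (w * p ^ k) * z" using w(2) z(2) by (simp add: mult.assoc)
      also have "\<dots> = p ^ Suc k * (w' * z)" unfolding w'(2) by (simp add: mult.assoc)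
      finally show ?case using w' z mult_mem by blast
    qed
    then obtain z where z: "z \<in> \<Delta>" "varpi ^ k = p ^ k * z" by blast
    obtain y where y: "y \<in> \<Delta>" "x = smul (t ^ k) y" using \<open>x \<in> J k\<close> unfolding J_def by blast
    then have "x = p ^ k * (z * y)" using z by (simp add: smul_emb[of "t ^ k"] emb_power mult.assoc)
    then show ?thesis using z y mult_mem by blast
  qed
  have "nc_dvr \<Delta> p"
  proof
    show "inverse p \<notin> \<Delta>" using N_not_unit[OF p(1), of "inverse p"] p(2) by auto
    show "x \<noteq> 0 \<and> inverse x \<in> \<Delta> \<or> (\<exists>y\<in>\<Delta>. x = p * y)" if "x \<in> \<Delta>" for x
      using unit_inverse[OF that] N_iff by blast
    show "x = 0" if x: "\<And>k. \<exists>y\<in>\<Delta>. x = p ^ k * y" for x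
    proof (rule J_separated)
      fix k show "x \<in> J k" using x[of "c * k"] pcJ by blast
    qed
    show "\<exists>L\<in>\<Delta>. \<forall>k. \<exists>y\<in>\<Delta>. L - X k = p ^ k * y"
      if X: "\<And>k. X k \<in> \<Delta>" "\<And>k. \<exists>y\<in>\<Delta>. X (Suc k) - X k = p ^ k * y" for X
    proof -
      have st: "\<exists>y\<in>\<Delta>. X (k + m) - X k = p ^ k * y" for k m
      proof (induction m)
        case 0
        then show ?case using zero_mem by auto
      next
        case (Suc m)
        then obtain y where y: "y \<in> \<Delta>" "X (k + m) - X k = p ^ k * y" by blast
        obtain z where z: "z \<in> \<Delta>" "X (Suc (k + m)) - X (k + m) = p ^ (k + m) * z" using X(2) by blast
        have "X (k + Suc m) - X k = p ^ (k + m) * z + p ^ k * y" using y(2) z(2) by (simp add: algebra_simps)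
        also have "\<dots> = p ^ k * (p ^ m * z + y)" by (simp add: power_add distrib_left mult.assoc)
        finally show ?case using y z add_mem mult_mem power_mem[OF pD] by blast
      qed
      \<comment> \<open>The subsequence at the indices \<open>c * k\<close> converges fast enough
        for \<open>J_complete\<close>, because \<open>p ^ (c * k)\<close> lies in
        \<open>J k\<close>.\<close>
      have "X (c * Suc k) - X (c * k) \<in> J k" for k
        using st[of "c * k" c] pcJ by (auto simp: add.commute)
      then obtain L where L: "L \<in> \<Delta>" "\<And>k. L - X (c * k) \<in> J k"
        using J_complete[of "\<lambda>k. X (c * k)"] X(1) by blast
      have "\<exists>y\<in>\<Delta>. L - X k = p ^ k * y" for k
      proof -
        obtain y where y: "y \<in> \<Delta>" "L - X (c * k) = p ^ k * y" using Jp[OF L(2)] by blast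
        have "c * k = k + (c * k - k)" using c(1) by simp
        then obtain z where z: "z \<in> \<Delta>" "X (c * k) - X k = p ^ k * z" using st[of k "c * k - k"] by auto
        have "L - X k = p ^ k * (y + z)" using y(2) z(2) by (simp add: algebra_simps)
        then show ?thesis using y z add_mem by blast
      qed
      then show ?thesis using L by blast
    qed
  qed (use one_mem diff_mem mult_mem pD p left right in blast)+
  then show ?thesis using N_iff by blast
qed

end

section \<open>Cyclotomic polynomials and finite division rings\<close>

definition primitive_roots :: "nat \<Rightarrow> complex set" where
  "primitive_roots m = {z. z ^ m = 1 \<and> (\<forall>k. 0 < k \<longrightarrow> k < m \<longrightarrow> z ^ k \<noteq> 1)}"

definition cyclotomic :: "nat \<Rightarrow> complex poly" where
  "cyclotomic m = (\<Prod>z\<in>primitive_roots m. [:- z, 1:])"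

lemma roots_unity_finite: "m > 0 \<Longrightarrow> finite {z :: complex. z ^ m = 1}"
  using card_roots_unity_eq[of m] card.infinite by fastforce

lemma primitive_roots_finite: "m > 0 \<Longrightarrow> finite (primitive_roots m)"
  using roots_unity_finite[of m] by (rule finite_subset[rotated]) (auto simp: primitive_roots_def)

lemma roots_unity_eq_UN:
  assumes m: "m > 0"
  shows "{z :: complex. z ^ m = 1} = (\<Union>t\<in>{t. t dvd m}. primitive_roots t)"
proof (intro equalityI subsetI)
  fix z :: complex assume "z \<in> {z. z ^ m = 1}"
  then have z: "z ^ m = 1" by simp
  define t where "t = (LEAST t. 0 < t \<and> z ^ t = 1)"
  have t: "0 < t" "z ^ t = 1"
    using LeastI[of "\<lambda>t. 0 < t \<and> z ^ t = 1" m] m z unfolding t_def by auto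
  have min: "z ^ k \<noteq> 1" if "0 < k" "k < t" for k
    using not_less_Least[of k "\<lambda>t. 0 < t \<and> z ^ t = 1"] that unfolding t_def by auto
  have "z ^ m = z ^ (t * (m div t) + m mod t)" by simp
  also have "\<dots> = z ^ (m mod t)" unfolding power_add power_mult t(2) by simp
  finally have "m mod t = 0" using min[of "m mod t"] z t(1) by force
  then show "z \<in> (\<Union>t\<in>{t. t dvd m}. primitive_roots t)"
    using t min unfolding primitive_roots_def by auto
next
  fix z assume "z \<in> (\<Union>t\<in>{t. t dvd m}. primitive_roots t)"
  then obtain t where "t dvd m" "z ^ t = 1" unfolding primitive_roots_def by auto
  then show "z \<in> {z. z ^ m = 1}" by (auto elim!: dvdE simp: power_mult)
qed

text \<open>The roots on the right are simple, and on the left they are sorted by their exact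
  order.\<close>

lemma prod_cyclotomic:
  assumes m: "m > 0"
  shows "(\<Prod>t | t dvd m. cyclotomic t) = [:0, 1:] ^ m - 1"
proof -
  let ?p = "[:0, 1:] ^ m - 1 :: complex poly"
  have p: "?p = Polynomial.monom 1 m - 1" by (simp add: monom_altdef)
  have disj: "primitive_roots t \<inter> primitive_roots t' = {}"
    if "t \<in> {t. t dvd m}" "t' \<in> {t. t dvd m}" "t \<noteq> t'" for t t'
    using that m unfolding primitive_roots_def by (force dest: dvd_pos_nat elim: linorder_neqE_nat)
  have "(\<Prod>t | t dvd m. cyclotomic t) = (\<Prod>z\<in>(\<Union>t\<in>{t. t dvd m}. primitive_roots t). [:- z, 1:])"
    unfolding cyclotomic_def using m disj primitive_roots_finite
    by (intro prod.UNION_disjoint[symmetric]) (auto dest: dvd_pos_nat)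
  also have "\<dots> = (\<Prod>z | poly ?p z = 0. [:- z, 1:])"
    unfolding roots_unity_eq_UN[OF m, symmetric] by (simp add: poly_power)
  also have "\<dots> = Polynomial.smult (lead_coeff ?p) (\<Prod>z | poly ?p z = 0. [:- z, 1:])"
  proof -
    have "degree ?p = m"
      unfolding p using m by (intro antisym degree_le le_degree) (auto simp: coeff_eq_0)
    then have "lead_coeff ?p = 1" unfolding p using m by simp
    then show ?thesis by simp
  qed
  also have "\<dots> = ?p"
  proof (rule complex_poly_decompose_rsquarefree)
    show "rsquarefree ?p" unfolding rsquarefree_roots p
      using m by (auto simp: pderiv_diff pderiv_monom poly_monom power_0_left split: if_splits)
  qed
  finally show ?thesis .
qed

definition int_coeffs :: "complex poly \<Rightarrow> bool" where
  "int_coeffs p \<longleftrightarrow> (\<forall>i. poly.coeff p i \<in> \<int>)"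

lemma int_coeffs_mult: "int_coeffs p \<Longrightarrow> int_coeffs q \<Longrightarrow> int_coeffs (p * q)"
  unfolding int_coeffs_def coeff_mult by (intro allI Ints_sum Ints_mult) auto

lemma int_coeffs_prod: "(\<And>i. i \<in> I \<Longrightarrow> int_coeffs (p i)) \<Longrightarrow> int_coeffs (\<Prod>i\<in>I. p i)"
proof (induction I rule: infinite_finite_induct)
  case (insert x F)
  then show ?case by (simp add: int_coeffs_mult)
qed (simp_all add: int_coeffs_def coeff_1)

lemma int_coeffs_poly: "int_coeffs p \<Longrightarrow> x \<in> \<int> \<Longrightarrow> poly p x \<in> \<int>"
  unfolding poly_altdef int_coeffs_def by (intro Ints_sum Ints_mult Ints_power) auto

text \<open>The nonintegral coefficient of \<open>s\<close> of highest index \<open>i\<close> would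
  meet the leading 1 of \<open>p\<close> in the coefficient of index \<open>i + degree p\<close> of
  the product, where all other summands are integers.\<close>

lemma int_coeffs_monic_divide:
  assumes p: "lead_coeff p = 1" "int_coeffs p" and pq: "int_coeffs (p * s)"
  shows "int_coeffs s"
proof (rule ccontr)
  assume "\<not> int_coeffs s"
  define B where "B = {i. poly.coeff s i \<notin> \<int>}"
  have "B \<subseteq> {..degree s}"
  proof
    fix i assume "i \<in> B"
    then have "poly.coeff s i \<noteq> 0" unfolding B_def using Ints_0 by force
    then show "i \<in> {..degree s}" using le_degree by simp
  qed
  then have B: "finite B" by (rule finite_subset) simp
  have B0: "B \<noteq> {}" using \<open>\<not> int_coeffs s\<close> unfolding B_def int_coeffs_def by auto
  define i where "i = Max B"
  have iB: "i \<in> B" unfolding i_def using B B0 by (rule Max_in)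
  have above: "poly.coeff s j \<in> \<int>" if "j > i" for j
    using that Max_ge[OF B, of j] unfolding i_def B_def by fastforce
  let ?d = "degree p"
  have "poly.coeff (p * s) (i + ?d) = (\<Sum>j\<le>i + ?d. poly.coeff p j * poly.coeff s (i + ?d - j))"
    by (rule coeff_mult)
  also have "\<dots> = poly.coeff p ?d * poly.coeff s (i + ?d - ?d) +
      (\<Sum>j\<in>{..i + ?d} - {?d}. poly.coeff p j * poly.coeff s (i + ?d - j))"
    by (intro sum.remove) auto
  finally have "poly.coeff s i = poly.coeff (p * s) (i + ?d) -
      (\<Sum>j\<in>{..i + ?d} - {?d}. poly.coeff p j * poly.coeff s (i + ?d - j))"
    using p(1) by simp
  moreover have "poly.coeff p j * poly.coeff s (i + ?d - j) \<in> \<int>" if "j \<noteq> ?d" for j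
  proof (cases "j > ?d")
    case True
    then show ?thesis by (simp add: coeff_eq_0)
  next
    case False
    then show ?thesis using that p(2) above[of "i + ?d - j"] unfolding int_coeffs_def
      by (intro Ints_mult) auto
  qed
  ultimately have "poly.coeff s i \<in> \<int>"
    using pq unfolding int_coeffs_def by (metis (no_types, lifting) DiffD2 Ints_diff Ints_sum singletonI)
  then show False using iB unfolding B_def by simp
qed

lemma lead_coeff_cyclotomic: "lead_coeff (cyclotomic m) = 1"
  unfolding cyclotomic_def lead_coeff_prod by simp

text \<open>Induction along divisors: the product over the proper divisors of \<open>m\<close> is
  monic and integral, and so is its product with \<open>cyclotomic m\<close>.\<close>

lemma int_coeffs_cyclotomic: "m > 0 \<Longrightarrow> int_coeffs (cyclotomic m)"
proof (induction m rule: less_induct)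
  case (less m)
  define p where "p = (\<Prod>t\<in>{t. t dvd m} - {m}. cyclotomic t)"
  have fin: "finite {t. t dvd m}" using less.prems by simp
  have "int_coeffs (cyclotomic t)" if "t \<in> {t. t dvd m} - {m}" for t
    using that less.prems dvd_imp_le[of t m] by (intro less.IH) (auto dest: dvd_pos_nat)
  then have ip: "int_coeffs p" unfolding p_def by (rule int_coeffs_prod)
  have "p * cyclotomic m = [:0, 1:] ^ m - 1"
    unfolding p_def prod_cyclotomic[OF less.prems, symmetric]
    using prod.remove[OF fin, of m cyclotomic] by simp
  moreover have "int_coeffs ([:0, 1:] ^ m - 1 :: complex poly)"
    by (auto simp: int_coeffs_def monom_altdef[of 1 m, simplified, symmetric] coeff_1)
  ultimately have "int_coeffs (p * cyclotomic m)" by simp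
  moreover have "lead_coeff p = 1" unfolding p_def lead_coeff_prod lead_coeff_cyclotomic by simp
  ultimately show ?case using int_coeffs_monic_divide ip by blast
qed

text \<open>\<open>M\<close> is the absolute value of the \<open>m\<close>-th cyclotomic polynomial
  at \<open>Q\<close>. For a proper divisor \<open>t\<close> the cyclotomic factors of
  \<open>Q ^ t - 1\<close> are among the remaining factors of \<open>Q ^ m - 1\<close>, hence the
  divisibility by a product.\<close>

lemma cyclotomic_value:
  fixes Q :: int and m :: nat
  assumes Q: "Q \<ge> 2" and m: "m \<ge> 2"
  shows "\<exists>M. M > Q - 1 \<and> M dvd Q ^ m - 1 \<and> (\<forall>t. t dvd m \<longrightarrow> t < m \<longrightarrow> M * (Q ^ t - 1) dvd Q ^ m - 1)"
proof -
  have val: "(\<Prod>t | t dvd k. poly (cyclotomic t) (of_int Q)) = of_int (Q ^ k - 1)" if "k > 0" for k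
  proof -
    have "(\<Prod>t | t dvd k. poly (cyclotomic t) (of_int Q)) = poly (\<Prod>t | t dvd k. cyclotomic t) (of_int Q)"
      by (simp add: poly_prod)
    then show ?thesis unfolding prod_cyclotomic[OF that] by (simp add: poly_power)
  qed
  have ints: "poly (cyclotomic t) (of_int Q) \<in> \<int>" if "t > 0" for t
    using int_coeffs_poly[OF int_coeffs_cyclotomic[OF that]] by simp
  obtain M0 where M0: "poly (cyclotomic m) (of_int Q) = of_int M0"
    using ints[of m] m by (auto simp: Ints_def)
  have fin: "finite {t. t dvd k}" if "k > 0" for k :: nat using that by simp
  have split: "\<exists>r. of_int (Q ^ m - 1) = of_int M0 * (\<Prod>t\<in>A. poly (cyclotomic t) (of_int Q)) * (of_int r :: complex)"
    if A: "A \<subseteq> {t. t dvd m} - {m}" for A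
  proof -
    let ?f = "\<lambda>t. poly (cyclotomic t) (of_int Q)"
    have "(\<Prod>t\<in>{t. t dvd m} - {m} - A. ?f t) \<in> \<int>"
      using m by (intro Ints_prod ints) (auto dest: dvd_pos_nat)
    then obtain r where r: "(\<Prod>t\<in>{t. t dvd m} - {m} - A. ?f t) = of_int r" by (auto simp: Ints_def)
    have "of_int (Q ^ m - 1) = ?f m * (\<Prod>t\<in>{t. t dvd m} - {m}. ?f t)"
      unfolding val[of m, symmetric, OF order.strict_trans2[OF _ m, of 0, simplified]]
      using m by (intro prod.remove) auto
    also have "(\<Prod>t\<in>{t. t dvd m} - {m}. ?f t) = of_int r * (\<Prod>t\<in>A. ?f t)"
      using prod.subset_diff[OF A, of ?f] m r by simp
    finally show ?thesis using M0 by (intro exI[of _ r]) (simp add: mult_ac)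
  qed
  have dvd: "M0 * (Q ^ t - 1) dvd Q ^ m - 1" if "t dvd m" "t < m" for t
  proof -
    have t: "t > 0" using that m by (auto dest: dvd_pos_nat)
    have "{s. s dvd t} \<subseteq> {t. t dvd m} - {m}"
    proof
      fix s assume "s \<in> {s. s dvd t}"
      then have "s dvd m" "s \<le> t" using that t dvd_trans[of s t m] dvd_imp_le[of s t] by simp_all
      then show "s \<in> {t. t dvd m} - {m}" using that by simp
    qed
    then obtain r where "of_int (Q ^ m - 1) = of_int M0 * (of_int (Q ^ t - 1) :: complex) * of_int r"
      using split[of "{s. s dvd t}"] val[OF t] by auto
    then have "(of_int (Q ^ m - 1) :: complex) = of_int (M0 * (Q ^ t - 1) * r)" by simp
    then show ?thesis using of_int_eq_iff dvdI by metis
  qed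
  have dvd1: "M0 dvd Q ^ m - 1"
  proof -
    obtain r where "of_int (Q ^ m - 1) = of_int M0 * (of_int r :: complex)"
      using split[of "{}"] by auto
    then have "(of_int (Q ^ m - 1) :: complex) = of_int (M0 * r)" by simp
    then show ?thesis using of_int_eq_iff dvdI by metis
  qed
  have "norm (poly (cyclotomic m) (of_int Q)) > Q - 1"
  proof -
    have norm1: "norm z = 1" if "z \<in> primitive_roots m" for z
      using that m power_eq_1_iff[of z m] unfolding primitive_roots_def by auto
    have ge: "norm (of_int Q - z) \<ge> Q - 1" if "z \<in> primitive_roots m" for z
      using norm_triangle_ineq2[of "of_int Q" z] norm1[OF that] Q by simp
    \<comment> \<open>One factor suffices for strictness: a primitive root other than 1 has real
      part below 1, so its distance from \<open>Q\<close> exceeds \<open>Q - 1\<close>; the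
      remaining factors are at least 1.\<close>
    define z0 where "z0 = exp (2 * of_real pi * \<i> * of_nat 1 / of_nat m)"
    have zk: "z0 ^ k = exp (2 * of_real pi * \<i> * of_nat k / of_nat m)" for k
      unfolding z0_def by (simp add: exp_of_nat_mult[symmetric] field_simps)
    have z01: "z0 ^ k = 1 \<longleftrightarrow> m dvd k" for k
      unfolding zk using complex_root_unity_eq_1[of m k] m by simp
    have z0: "z0 \<in> primitive_roots m"
      using m by (auto simp: primitive_roots_def z01 dest: dvd_imp_le)
    have "Re z0 < 1"
    proof (rule ccontr)
      assume "\<not> Re z0 < 1"
      then have "Re z0 = 1" using complex_Re_le_cmod[of z0] norm1[OF z0] by simp
      then have "Im z0 = 0" using norm1[OF z0] cmod_power2[of z0] by simp
      then have "z0 ^ 1 = 1" using \<open>Re z0 = 1\<close> by (simp add: complex_eq_iff)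
      then have "m dvd 1" by (simp only: z01)
      then show False using m by simp
    qed
    then have gt: "norm (of_int Q - z0) > Q - 1"
      using complex_Re_le_cmod[of "of_int Q - z0"] by simp
    have "norm (poly (cyclotomic m) (of_int Q)) = (\<Prod>z\<in>primitive_roots m. norm (of_int Q - z))"
      unfolding cyclotomic_def by (simp add: poly_prod prod_norm)
    also have "\<dots> = norm (of_int Q - z0) * (\<Prod>z\<in>primitive_roots m - {z0}. norm (of_int Q - z))"
      using z0 primitive_roots_finite[of m] m by (intro prod.remove) auto
    also have "\<dots> \<ge> norm (of_int Q - z0) * 1"
      using ge Q by (intro mult_left_mono prod_ge_1) force+
    finally show ?thesis using gt by simp
  qed
  then have "\<bar>M0\<bar> > Q - 1" unfolding M0 by simp
  then show ?thesis using dvd dvd1 by (intro exI[of _ "\<bar>M0\<bar>"]) (auto simp: abs_if)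
qed

context ring
begin

text \<open>\<open>V\<close> is a maximal \<open>S\<close>-submodule of \<open>T\<close> whose cardinality is a power of that of \<open>S\<close>; if \<open>b\<close> lies
  in \<open>T\<close> but not in \<open>V\<close>, the sum of \<open>V\<close> and \<open>S b\<close> is direct, contradicting maximality.\<close>

lemma card_eq_power_card_division_subring:
  assumes fin: "finite (carrier R)"
    and S: "S \<subseteq> carrier R" "\<zero> \<in> S" "\<one> \<in> S" "\<And>x y. x \<in> S \<Longrightarrow> y \<in> S \<Longrightarrow> x \<ominus> y \<in> S"
      "\<And>x y. x \<in> S \<Longrightarrow> y \<in> S \<Longrightarrow> x \<otimes> y \<in> S"
      "\<And>x. x \<in> S \<Longrightarrow> x \<noteq> \<zero> \<Longrightarrow> \<exists>y\<in>S. y \<otimes> x = \<one>"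
    and T: "T \<subseteq> carrier R" "\<zero> \<in> T" "\<And>x y. x \<in> T \<Longrightarrow> y \<in> T \<Longrightarrow> x \<ominus> y \<in> T"
      "\<And>s x. s \<in> S \<Longrightarrow> x \<in> T \<Longrightarrow> s \<otimes> x \<in> T"
  shows "\<exists>r. card T = card S ^ r"
proof -
  define sub where "sub V \<longleftrightarrow> V \<subseteq> T \<and> \<zero> \<in> V \<and> (\<forall>x\<in>V. \<forall>y\<in>V. x \<ominus> y \<in> V) \<and>
      (\<forall>s\<in>S. \<forall>x\<in>V. s \<otimes> x \<in> V) \<and> (\<exists>r. card V = card S ^ r)" for V
  have finT: "finite T" using fin T(1) finite_subset by blast
  have "sub {\<zero>}"
    unfolding sub_def using T(2) S(1) by (auto simp: a_minus_def intro: exI[of _ 0])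
  moreover have "\<forall>V. sub V \<longrightarrow> card V < Suc (card T)"
    unfolding sub_def using card_mono[OF finT] by (simp add: less_Suc_eq_le)
  ultimately have "\<exists>V. sub V \<and> (\<forall>V'. sub V' \<longrightarrow> card V' \<le> card V)"
    by (rule Lattices_Big.ex_has_greatest_nat)
  then obtain V where V: "sub V" "\<And>V'. sub V' \<Longrightarrow> card V' \<le> card V" by metis
  have VT: "V \<subseteq> T" "\<zero> \<in> V" "\<And>x y. x \<in> V \<Longrightarrow> y \<in> V \<Longrightarrow> x \<ominus> y \<in> V"
     "\<And>s x. s \<in> S \<Longrightarrow> x \<in> V \<Longrightarrow> s \<otimes> x \<in> V" "\<exists>r. card V = card S ^ r"
    using V(1) unfolding sub_def by blast+
  have "V = T"
  proof (rule ccontr)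
    assume "V \<noteq> T"
    then obtain b where b: "b \<in> T" "b \<notin> V" using VT by blast
    have c: "b \<in> carrier R" "\<And>v. v \<in> V \<Longrightarrow> v \<in> carrier R" "\<And>s. s \<in> S \<Longrightarrow> s \<in> carrier R"
      using b VT T S by auto
    define V' where "V' = (\<lambda>(v, s). v \<oplus> s \<otimes> b) ` (V \<times> S)"
    have inj: "inj_on (\<lambda>(v, s). v \<oplus> s \<otimes> b) (V \<times> S)"
    proof (rule inj_onI, clarify)
      fix v s w t assume h: "v \<in> V" "s \<in> S" "w \<in> V" "t \<in> S" "v \<oplus> s \<otimes> b = w \<oplus> t \<otimes> b"
      have hc: "v \<in> carrier R" "s \<in> carrier R" "w \<in> carrier R" "t \<in> carrier R" using h c by auto
      have "(s \<ominus> t) \<otimes> b = (v \<oplus> s \<otimes> b) \<ominus> v \<ominus> t \<otimes> b" using hc c(1) by algebra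
      also have "\<dots> = w \<ominus> v" unfolding h(5) using hc c(1) by algebra
      finally have e: "(s \<ominus> t) \<otimes> b = w \<ominus> v" .
      have "s = t"
      proof (rule ccontr)
        assume "s \<noteq> t"
        then have "s \<ominus> t \<noteq> \<zero>" using hc by simp
        then obtain y where y: "y \<in> S" "y \<otimes> (s \<ominus> t) = \<one>" using S(4,6) h by blast
        have "b = (y \<otimes> (s \<ominus> t)) \<otimes> b" using y c by simp
        also have "\<dots> = y \<otimes> (w \<ominus> v)" unfolding e[symmetric] using y hc c by (intro m_assoc) simp_all
        also have "\<dots> \<in> V" using VT h y by blast
        finally show False using b by blast
      qed
      then have "v = w" using h(5) hc c(1) by simp
      then show "v = w \<and> s = t" using \<open>s = t\<close> by blast
    qed
    have "card V' = card V * card S" unfolding V'_def card_image[OF inj] by (rule card_cartesian_product)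
    moreover have "V' \<subseteq> T"
    proof
      fix x assume "x \<in> V'"
      then obtain v s where x: "v \<in> V" "s \<in> S" "x = v \<oplus> s \<otimes> b" unfolding V'_def by auto
      have "x = v \<ominus> (\<zero> \<ominus> s \<otimes> b)" unfolding x(3) using x c by algebra
      then show "x \<in> T" using T VT b x by (metis subsetD)
    qed
    moreover have "\<zero> \<in> V'" unfolding V'_def using VT S c by (intro image_eqI[of _ _ "(\<zero>, \<zero>)"]) auto
    moreover have "x \<ominus> y \<in> V'" if "x \<in> V'" "y \<in> V'" for x y
    proof -
      have "\<exists>v\<in>V. \<exists>s\<in>S. x = v \<oplus> s \<otimes> b" "\<exists>w\<in>V. \<exists>t\<in>S. y = w \<oplus> t \<otimes> b"
        using that unfolding V'_def by auto
      then obtain v s w t where xy: "v \<in> V" "s \<in> S" "x = v \<oplus> s \<otimes> b" "w \<in> V" "t \<in> S" "y = w \<oplus> t \<otimes> b"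
        by blast
      have "v \<in> carrier R" "s \<in> carrier R" "w \<in> carrier R" "t \<in> carrier R" using xy c by auto
      then have "x \<ominus> y = (v \<ominus> w) \<oplus> (s \<ominus> t) \<otimes> b" unfolding xy(3,6) using c(1) by algebra
      then show ?thesis unfolding V'_def using VT(3) S(4) xy by (intro image_eqI[of _ _ "(v \<ominus> w, s \<ominus> t)"]) auto
    qed
    moreover have "s \<otimes> x \<in> V'" if "s \<in> S" "x \<in> V'" for s x
    proof -
      have "\<exists>v\<in>V. \<exists>t\<in>S. x = v \<oplus> t \<otimes> b" using that unfolding V'_def by auto
      then obtain v t where x: "v \<in> V" "t \<in> S" "x = v \<oplus> t \<otimes> b" by blast
      have "s \<otimes> x = (s \<otimes> v) \<oplus> (s \<otimes> t) \<otimes> b" unfolding x(3) using x c that by (simp add: r_distr m_assoc)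
      then show ?thesis unfolding V'_def using VT(4) S(5) x that
        by (intro image_eqI[of _ _ "(s \<otimes> v, s \<otimes> t)"]) auto
    qed
    moreover have "\<exists>r. card V' = card S ^ r"
    proof -
      obtain r where "card V = card S ^ r" using VT by blast
      then have "card V' = card S ^ Suc r" using \<open>card V' = card V * card S\<close> by simp
      then show ?thesis by blast
    qed
    ultimately have "sub V'" unfolding sub_def by blast
    then have le: "card V * card S \<le> card V" using V(2) \<open>card V' = card V * card S\<close> by metis
    have "finite V" using finT VT(1) finite_subset by blast
    then have "card V > 0" using VT(2) card_gt_0_iff by blast
    have "\<one> \<noteq> \<zero>"
    proof
      assume "\<one> = \<zero>"
      then have "b = \<zero>" using c(1) l_one l_null by metis
      then show False using b VT by blast
    qed
    then have "card {\<zero>, \<one>} \<le> card S"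
      using S fin finite_subset by (intro card_mono) auto
    then have "card S \<ge> 2" using \<open>\<one> \<noteq> \<zero>\<close> by simp
    then show False using le \<open>card V > 0\<close> by simp
  qed
  then show ?thesis using VT by blast
qed

text \<open>Witt's argument: with \<open>Q\<close> the order of the centre, the cyclotomic value
  \<open>M\<close> divides \<open>Q ^ m - 1\<close> and the length of every noncentral conjugacy
  class. There are \<open>Q ^ m - Q\<close> noncentral elements, so \<open>M\<close> divides the
  difference \<open>Q - 1\<close>, which is too small.\<close>

theorem Wedderburn_little:
  assumes fin: "finite (carrier R)" and div: "Units R = carrier R - {\<zero>}"
    and xy: "x \<in> carrier R" "y \<in> carrier R"
  shows "x \<otimes> y = y \<otimes> x"
proof (rule ccontr)
  assume nc: "x \<otimes> y \<noteq> y \<otimes> x"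
  define C where "C a = {u \<in> carrier R. u \<otimes> a = a \<otimes> u}" for a
  define Z where "Z = {u \<in> carrier R. \<forall>a\<in>carrier R. u \<otimes> a = a \<otimes> u}"
  have ZC: "Z \<subseteq> C a" if "a \<in> carrier R" for a using that unfolding Z_def C_def by blast
  have ne: "\<one> \<noteq> \<zero>" using nc xy by (metis l_null l_one r_null)
  have inv_ex: "\<exists>v\<in>carrier R. v \<otimes> u = \<one> \<and> u \<otimes> v = \<one>" if "u \<in> carrier R" "u \<noteq> \<zero>" for u
    using that div unfolding Units_def by blast
  have comm_inv: "v \<otimes> a = a \<otimes> v"
    if "u \<in> carrier R" "v \<in> carrier R" "a \<in> carrier R" "u \<otimes> v = \<one>" "v \<otimes> u = \<one>" "u \<otimes> a = a \<otimes> u" for u v a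
  proof -
    have "v \<otimes> a = v \<otimes> (a \<otimes> u) \<otimes> v" using that by (simp add: m_assoc)
    also have "\<dots> = v \<otimes> (u \<otimes> a) \<otimes> v" using that by simp
    also have "\<dots> = (v \<otimes> u) \<otimes> a \<otimes> v" using that(1-3) by (simp add: m_assoc)
    finally show ?thesis using that by simp
  qed
  have m_comm: "(u \<otimes> w) \<otimes> a = a \<otimes> (u \<otimes> w)"
    if "u \<in> carrier R" "w \<in> carrier R" "a \<in> carrier R" "u \<otimes> a = a \<otimes> u" "w \<otimes> a = a \<otimes> w" for u w a
  proof -
    have "(u \<otimes> w) \<otimes> a = u \<otimes> (a \<otimes> w)" using that by (simp add: m_assoc)
    also have "\<dots> = (u \<otimes> a) \<otimes> w" using that(1-3) by (simp add: m_assoc)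
    finally show ?thesis using that by (simp add: m_assoc)
  qed
  have d_comm: "(u \<ominus> w) \<otimes> a = a \<otimes> (u \<ominus> w)"
    if "u \<in> carrier R" "w \<in> carrier R" "a \<in> carrier R" "u \<otimes> a = a \<otimes> u" "w \<otimes> a = a \<otimes> w" for u w a
    using that by (simp add: a_minus_def l_distr r_distr l_minus r_minus)
  have C_sub: "C a \<subseteq> carrier R" "\<zero> \<in> C a" "\<one> \<in> C a" "\<And>u w. u \<in> C a \<Longrightarrow> w \<in> C a \<Longrightarrow> u \<ominus> w \<in> C a"
      "\<And>u w. u \<in> C a \<Longrightarrow> w \<in> C a \<Longrightarrow> u \<otimes> w \<in> C a"
      "\<And>u. u \<in> C a \<Longrightarrow> u \<noteq> \<zero> \<Longrightarrow> \<exists>w\<in>C a. w \<otimes> u = \<one>" if a: "a \<in> carrier R" for a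
  proof -
    show "C a \<subseteq> carrier R" "\<zero> \<in> C a" "\<one> \<in> C a" using a by (auto simp: C_def)
    show "u \<ominus> w \<in> C a" "u \<otimes> w \<in> C a" if "u \<in> C a" "w \<in> C a" for u w
      using that a m_comm[of u w a] d_comm[of u w a] by (auto simp: C_def)
    show "\<exists>w\<in>C a. w \<otimes> u = \<one>" if "u \<in> C a" "u \<noteq> \<zero>" for u
      using that a inv_ex[of u] comm_inv[of u _ a] by (auto simp: C_def)
  qed
  have Z_sub: "Z \<subseteq> carrier R" "\<zero> \<in> Z" "\<one> \<in> Z" "\<And>u w. u \<in> Z \<Longrightarrow> w \<in> Z \<Longrightarrow> u \<ominus> w \<in> Z"
      "\<And>u w. u \<in> Z \<Longrightarrow> w \<in> Z \<Longrightarrow> u \<otimes> w \<in> Z"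
      "\<And>u. u \<in> Z \<Longrightarrow> u \<noteq> \<zero> \<Longrightarrow> \<exists>w\<in>Z. w \<otimes> u = \<one>"
  proof -
    show "Z \<subseteq> carrier R" "\<zero> \<in> Z" "\<one> \<in> Z" by (auto simp: Z_def)
    show "u \<ominus> w \<in> Z" "u \<otimes> w \<in> Z" if "u \<in> Z" "w \<in> Z" for u w
      using that m_comm[of u w] d_comm[of u w] unfolding Z_def mem_Collect_eq by (metis m_closed minus_closed)+
    show "\<exists>w\<in>Z. w \<otimes> u = \<one>" if uz: "u \<in> Z" "u \<noteq> \<zero>" for u
    proof -
      have u: "u \<in> carrier R" "\<And>a. a \<in> carrier R \<Longrightarrow> u \<otimes> a = a \<otimes> u" using uz by (simp_all add: Z_def)
      obtain v where v: "v \<in> carrier R" "v \<otimes> u = \<one>" "u \<otimes> v = \<one>" using inv_ex[OF u(1) uz(2)] by blast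
      have "v \<otimes> a = a \<otimes> v" if "a \<in> carrier R" for a using comm_inv[OF u(1) v(1) that v(3,2) u(2)[OF that]] .
      then show ?thesis using v unfolding Z_def by blast
    qed
  qed
  let ?Q = "card Z"
  have "card {\<zero>, \<one>} \<le> ?Q" using Z_sub fin finite_subset by (intro card_mono) auto
  then have Q2: "?Q \<ge> 2" using ne by simp
  obtain m where m: "card (carrier R) = ?Q ^ m"
    using card_eq_power_card_division_subring[OF fin Z_sub, of "carrier R"] Z_sub(1) by auto
  \<comment> \<open>The ring is a module over the centraliser, and both are modules over the centre,
    so all orders are powers and the exponent \<open>t\<close> divides \<open>m\<close>; it is
    smaller because \<open>a\<close> is not central.\<close>
  have centr: "\<exists>t. card (C a) = ?Q ^ t \<and> t dvd m \<and> 0 < t \<and> t < m" if a: "a \<in> carrier R" "a \<notin> Z" for a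
  proof -
    obtain t where t: "card (C a) = ?Q ^ t"
      using card_eq_power_card_division_subring[OF fin Z_sub C_sub(1,2,4)] ZC C_sub(5) a by blast
    obtain r where r: "card (carrier R) = card (C a) ^ r"
      using card_eq_power_card_division_subring[OF fin C_sub, of a "carrier R"] C_sub(1) a by auto
    have "?Q ^ m = ?Q ^ (t * r)" using m r t by (simp add: power_mult)
    then have mtr: "m = t * r" using Q2 by simp
    have "finite (C a)" using fin C_sub(1)[OF a(1)] finite_subset by blast
    have "C a \<noteq> carrier R"
    proof
      assume "C a = carrier R"
      then have "b \<otimes> a = a \<otimes> b" if "b \<in> carrier R" for b using that unfolding C_def by blast
      then have "a \<in> Z" unfolding Z_def using a by simp
      then show False using a by blast
    qed
    then have "C a \<subset> carrier R" using C_sub(1)[OF a(1)] by blast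
    then have "?Q ^ t < ?Q ^ m" using psubset_card_mono[OF fin] t m by metis
    then have "t < m" using Q2 by simp
    moreover have "?Q \<le> ?Q ^ t" using card_mono[OF \<open>finite (C a)\<close> ZC] a t by simp
    then have "t \<noteq> 0" using Q2 by (intro notI) simp
    ultimately show ?thesis using t mtr by auto
  qed
  have "x \<notin> Z" using nc xy by (auto simp: Z_def)
  then have m2: "m \<ge> 2" using centr[of x] xy by auto
  obtain M where M: "M > int ?Q - 1" "M dvd int ?Q ^ m - 1"
      "\<And>t. t dvd m \<Longrightarrow> t < m \<Longrightarrow> M * (int ?Q ^ t - 1) dvd int ?Q ^ m - 1"
    using cyclotomic_value[of "int ?Q" m] Q2 m2 by auto
  define cls where "cls a = (\<lambda>u. u \<otimes> a \<otimes> inv u) ` Units R" for a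
  have Uc: "u \<in> carrier R" "inv u \<in> carrier R" "u \<otimes> inv u = \<one>" "inv u \<otimes> u = \<one>" "inv u \<in> Units R"
    if "u \<in> Units R" for u using that by auto
  have finU: "finite (Units R)" using fin div by simp
  have cardU: "card (Units R) = ?Q ^ m - 1" unfolding div using m fin by simp
  have conj_eq: "u \<otimes> a \<otimes> inv u = w \<otimes> a \<otimes> inv w \<longleftrightarrow> inv w \<otimes> u \<in> C a"
    if "u \<in> Units R" "w \<in> Units R" "a \<in> carrier R" for u w a
  proof
    note c = Uc[OF that(1)] Uc[OF that(2)]
    assume e: "u \<otimes> a \<otimes> inv u = w \<otimes> a \<otimes> inv w"
    have "inv w \<otimes> u \<otimes> a = inv w \<otimes> (u \<otimes> a \<otimes> inv u) \<otimes> u" using c that by (simp add: m_assoc)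
    also have "\<dots> = (inv w \<otimes> w) \<otimes> a \<otimes> (inv w \<otimes> u)" unfolding e using c(1,2,6,7) that(3) by (simp add: m_assoc)
    finally show "inv w \<otimes> u \<in> C a" using c that by (simp add: C_def)
  next
    note c = Uc[OF that(1)] Uc[OF that(2)]
    assume "inv w \<otimes> u \<in> C a"
    then have e: "inv w \<otimes> u \<otimes> a = a \<otimes> (inv w \<otimes> u)" by (simp add: C_def)
    have "u \<otimes> a \<otimes> inv u = (w \<otimes> inv w) \<otimes> u \<otimes> a \<otimes> inv u" using c that by simp
    also have "\<dots> = w \<otimes> (inv w \<otimes> u \<otimes> a) \<otimes> inv u" using c(1,2,6,7) that(3) by (simp add: m_assoc)
    also have "\<dots> = w \<otimes> a \<otimes> inv w \<otimes> (u \<otimes> inv u)" unfolding e using c(1,2,6,7) that(3) by (simp add: m_assoc)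
    finally show "u \<otimes> a \<otimes> inv u = w \<otimes> a \<otimes> inv w" using c that by simp
  qed
  have M_dvd: "M dvd int (card (cls a))" if a: "a \<in> carrier R" "a \<notin> Z" for a
  proof -
    obtain t where t: "card (C a) = ?Q ^ t" "t dvd m" "0 < t" "t < m" using centr[OF a] by blast
    \<comment> \<open>The units that conjugate \<open>a\<close> to a given \<open>b\<close> form a
      coset of the nonzero part of the centraliser.\<close>
    have fib: "card {u \<in> Units R. u \<otimes> a \<otimes> inv u = b} = ?Q ^ t - 1" if "b \<in> cls a" for b
    proof -
      obtain w where w: "w \<in> Units R" "b = w \<otimes> a \<otimes> inv w" using \<open>b \<in> cls a\<close> unfolding cls_def by blast
      note wc = Uc[OF w(1)]
      have cl: "\<And>u v. u \<in> carrier R - {\<zero>} \<Longrightarrow> v \<in> carrier R - {\<zero>} \<Longrightarrow> u \<otimes> v \<in> carrier R - {\<zero>}"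
        unfolding div[symmetric] by (rule Units_m_closed)
      have "bij_betw (\<lambda>v. w \<otimes> v) (C a - {\<zero>}) {u \<in> Units R. u \<otimes> a \<otimes> inv u = b}"
      proof (rule bij_betw_byWitness[where f' = "\<lambda>u. inv w \<otimes> u"])
        show "\<forall>v\<in>C a - {\<zero>}. inv w \<otimes> (w \<otimes> v) = v"
          using C_sub(1)[OF a(1)] wc by (auto simp: m_assoc[symmetric])
        show "\<forall>u\<in>{u \<in> Units R. u \<otimes> a \<otimes> inv u = b}. w \<otimes> (inv w \<otimes> u) = u"
          using wc by (auto simp: m_assoc[symmetric])
        show "(\<otimes>) w ` (C a - {\<zero>}) \<subseteq> {u \<in> Units R. u \<otimes> a \<otimes> inv u = b}"
        proof clarify
          fix v assume v: "v \<in> C a" "v \<notin> {}" "v \<noteq> \<zero>"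
          have vc: "v \<in> carrier R" using v C_sub(1)[OF a(1)] by blast
          then have vU: "v \<in> Units R" using v div by blast
          have "inv w \<otimes> (w \<otimes> v) = v" using wc vc by (simp add: m_assoc[symmetric])
          then show "w \<otimes> v \<in> Units R \<and> w \<otimes> v \<otimes> a \<otimes> inv (w \<otimes> v) = b"
            using conj_eq[OF Units_m_closed[OF w(1) vU] w(1) a(1)] v w vU by simp
        qed
        show "(\<otimes>) (inv w) ` {u \<in> Units R. u \<otimes> a \<otimes> inv u = b} \<subseteq> C a - {\<zero>}"
          using conj_eq[OF _ w(1) a(1)] w(2) Units_m_closed[OF wc(5)] div by auto
      qed
      then have "card {u \<in> Units R. u \<otimes> a \<otimes> inv u = b} = card (C a - {\<zero>})"
        by (simp add: bij_betw_same_card)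
      also have "\<dots> = ?Q ^ t - 1" using C_sub(2)[OF a(1)] t by simp
      finally show ?thesis .
    qed
    have "card (Units R) = (\<Sum>b\<in>cls a. card {u \<in> Units R. u \<otimes> a \<otimes> inv u = b})"
      unfolding cls_def card_eq_sum by (rule sum.image_gen[OF finU])
    also have "\<dots> = card (cls a) * (?Q ^ t - 1)" using fib by simp
    finally have "card (cls a) * (?Q ^ t - 1) = ?Q ^ m - 1" using cardU by simp
    then have "int (card (cls a)) * (int ?Q ^ t - 1) = int ?Q ^ m - 1"
    proof -
      have "1 \<le> ?Q ^ k" for k using Q2 by simp
      then have "int (?Q ^ k - 1) = int ?Q ^ k - 1" for k by (simp add: of_nat_diff)
      then show ?thesis using \<open>card (cls a) * (?Q ^ t - 1) = ?Q ^ m - 1\<close> by (metis of_nat_mult)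
    qed
    then have "M * (int ?Q ^ t - 1) dvd int (card (cls a)) * (int ?Q ^ t - 1)" using M(3) t by simp
    moreover have "int ?Q ^ t - 1 \<noteq> 0"    proof -
      have "(1::int) < int ?Q ^ t" using Q2 t by (intro one_less_power) auto
      then show ?thesis by simp
    qed
    ultimately show ?thesis by simp
  qed
  have cls_self: "a \<in> cls a" if "a \<in> carrier R" for a
    unfolding cls_def using that by (intro image_eqI[of _ _ \<one>]) auto
  have cls_c: "cls a \<subseteq> carrier R" if "a \<in> carrier R" for a
    unfolding cls_def using that by auto
  have cls_trans: "b \<in> cls a \<Longrightarrow> cls b \<subseteq> cls a" if "a \<in> carrier R" for a b
  proof
    fix c assume "b \<in> cls a" "c \<in> cls b"
    then obtain u w where uw: "u \<in> Units R" "w \<in> Units R" "b = u \<otimes> a \<otimes> inv u" "c = w \<otimes> b \<otimes> inv w"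
      unfolding cls_def by blast
    have "(w \<otimes> u) \<otimes> (inv u \<otimes> inv w) = w \<otimes> (u \<otimes> inv u) \<otimes> inv w"
      "(inv u \<otimes> inv w) \<otimes> (w \<otimes> u) = inv u \<otimes> (inv w \<otimes> w) \<otimes> u"
      using Uc(1,2)[OF uw(1)] Uc(1,2)[OF uw(2)] by (simp_all only: m_assoc m_closed)
    then have "inv u \<otimes> inv w = inv (w \<otimes> u)"
      using Uc[OF uw(1)] Uc[OF uw(2)] by (intro inv_unique') simp_all
    moreover have "c = (w \<otimes> u) \<otimes> a \<otimes> (inv u \<otimes> inv w)"
      unfolding uw(3,4) using that Uc(1,2)[OF uw(1)] Uc(1,2)[OF uw(2)] by (simp add: m_assoc)
    ultimately have "c = (w \<otimes> u) \<otimes> a \<otimes> inv (w \<otimes> u)" by simp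
    then show "c \<in> cls a" unfolding cls_def using uw by blast
  qed
  have cls_sym: "a \<in> cls b" if a: "a \<in> carrier R" and ba: "b \<in> cls a" for a b
  proof -
    have "\<exists>u\<in>Units R. b = u \<otimes> a \<otimes> inv u" using ba unfolding cls_def by auto
    then obtain u where u: "u \<in> Units R" "b = u \<otimes> a \<otimes> inv u" by blast
    have "inv u \<otimes> b \<otimes> inv (inv u) = (inv u \<otimes> u) \<otimes> a \<otimes> (inv u \<otimes> u)"
      unfolding u(2) using Uc(1,2)[OF u(1)] a by (simp only: m_assoc m_closed Units_inv_inv[OF u(1)])
    then have "a = inv u \<otimes> b \<otimes> inv (inv u)" using Uc[OF u(1)] a by simp
    then show ?thesis unfolding cls_def using Uc(5)[OF u(1)] by (rule image_eqI)
  qed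
  have cls_Z: "b \<notin> Z" if a: "a \<in> carrier R" "a \<notin> Z" "b \<in> cls a" for a b
  proof
    assume bZ: "b \<in> Z"
    obtain u where u: "u \<in> Units R" "a = u \<otimes> b \<otimes> inv u" using cls_sym[OF a(1,3)] unfolding cls_def by blast
    have "a = b \<otimes> u \<otimes> inv u" using u bZ Uc by (simp add: Z_def)
    then have "a = b" using bZ Uc[OF u(1)] Z_sub(1) by (simp add: m_assoc subset_iff)
    then show False using a bZ by blast
  qed
  have UN: "carrier R - Z = \<Union> (cls ` (carrier R - Z))"
    using cls_self cls_c cls_Z by blast
  have "nat M dvd card (\<Union> (cls ` (carrier R - Z)))"
  proof (rule dvd_partition)
    show "finite (\<Union> (cls ` (carrier R - Z)))" using UN fin by (metis finite_Diff)
    show "\<forall>c\<in>cls ` (carrier R - Z). nat M dvd card c"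
      using M_dvd M(1) Q2 by (auto simp: nat_dvd_iff)
    show "\<forall>c1\<in>cls ` (carrier R - Z). \<forall>c2\<in>cls ` (carrier R - Z). c1 \<noteq> c2 \<longrightarrow> c1 \<inter> c2 = {}"
    proof (intro ballI impI)
      fix c1 c2 assume "c1 \<in> cls ` (carrier R - Z)" "c2 \<in> cls ` (carrier R - Z)" and ne: "c1 \<noteq> c2"
      then obtain a b where ab: "a \<in> carrier R" "c1 = cls a" "b \<in> carrier R" "c2 = cls b" by blast
      have eq: "cls d = cls e" if "e \<in> carrier R" "d \<in> cls e" for d e
        using cls_trans[OF that] cls_trans[OF _ cls_sym[OF that]] cls_c[OF that(1)] that(2) by blast
      show "c1 \<inter> c2 = {}"
      proof (rule ccontr)
        assume "c1 \<inter> c2 \<noteq> {}"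
        then obtain d where "d \<in> cls a" "d \<in> cls b" using ab by blast
        then show False using eq[OF ab(1)] eq[OF ab(3)] ab ne by metis
      qed
    qed
  qed
  moreover have "card (carrier R - Z) = ?Q ^ m - ?Q"
    using card_Diff_subset[OF finite_subset[OF Z_sub(1) fin] Z_sub(1)] m by simp
  ultimately have "nat M dvd ?Q ^ m - ?Q" using UN by metis
  then have "M dvd int (?Q ^ m - ?Q)" using M(1) Q2 by (simp add: nat_dvd_iff)
  moreover have "?Q \<le> ?Q ^ m" using self_le_power[of ?Q m] Q2 m2 by simp
  ultimately have "M dvd int ?Q ^ m - int ?Q" by (simp add: of_nat_diff)
  then have "M dvd (int ?Q ^ m - 1) - (int ?Q ^ m - int ?Q)" using M(2) by (rule dvd_diff[rotated])
  then have "M dvd int ?Q - 1" by simp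
  then have "M \<le> int ?Q - 1" using Q2 by (intro zdvd_imp_le) auto
  then show False using M(1) by simp
qed

end

section \<open>Linear algebra over division rings and the degree bound\<close>

lemma homogeneous_system:
  fixes C :: "'i \<Rightarrow> nat \<Rightarrow> 'd::division_ring"
  assumes "finite A" "r < card A"
  shows "\<exists>a. (\<exists>i\<in>A. a i \<noteq> 0) \<and> (\<forall>j<r. (\<Sum>i\<in>A. a i * C i j) = 0)"
  using assms
proof (induction r arbitrary: A C)
  case 0
  then obtain i where "i \<in> A" by fastforce
  then show ?case by (intro exI[of _ "\<lambda>_. 1"]) auto
next
  case (Suc r)
  show ?case
  proof (cases "\<forall>i\<in>A. C i r = 0")
    case True
    obtain a where a: "\<exists>i\<in>A. a i \<noteq> 0" "\<forall>j<r. (\<Sum>i\<in>A. a i * C i j) = 0"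
      using Suc.IH[of A C] Suc.prems by auto
    then have "\<forall>j<Suc r. (\<Sum>i\<in>A. a i * C i j) = 0" using True by (auto simp: less_Suc_eq)
    then show ?thesis using a by blast
  next
    case False
    then obtain k where k: "k \<in> A" "C k r \<noteq> 0" by blast
    \<comment> \<open>Gaussian elimination: equation \<open>r\<close> is solved for the unknown
      \<open>k\<close>, and the other unknowns face equations corrected by \<open>u\<close>.
      Unknowns stand to the left of the coefficients throughout.\<close>
    define u where "u i = C i r * inverse (C k r)" for i
    have "r < card (A - {k})" using Suc.prems k by simp
    then obtain a where a: "\<exists>i\<in>A - {k}. a i \<noteq> 0"
        "\<forall>j<r. (\<Sum>i\<in>A - {k}. a i * (C i j - u i * C k j)) = 0"
      using Suc.IH[of "A - {k}" "\<lambda>i j. C i j - u i * C k j"] Suc.prems by auto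
    define b where "b i = (if i = k then - (\<Sum>i\<in>A - {k}. a i * u i) else a i)" for i
    have val: "(\<Sum>i\<in>A. b i * C i j) = (\<Sum>i\<in>A - {k}. a i * (C i j - u i * C k j))" for j
    proof -
      have "(\<Sum>i\<in>A. b i * C i j) = b k * C k j + (\<Sum>i\<in>A - {k}. b i * C i j)"
        using Suc.prems(1) k(1) by (rule sum.remove)
      also have "(\<Sum>i\<in>A - {k}. b i * C i j) = (\<Sum>i\<in>A - {k}. a i * C i j)"
        by (intro sum.cong) (auto simp: b_def)
      finally show ?thesis
        by (simp add: b_def right_diff_distrib sum_subtractf sum_distrib_right mult.assoc)
    qed
    have "(\<Sum>i\<in>A. b i * C i j) = 0" if "j < Suc r" for j
    proof (cases "j = r")
      case True
      then show ?thesis unfolding val using k(2) by (simp add: u_def mult.assoc)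
    next
      case False
      then show ?thesis unfolding val using a(2) that by simp
    qed
    moreover have "\<exists>i\<in>A. b i \<noteq> 0" using a(1) by (auto simp: b_def)
    ultimately show ?thesis by blast
  qed
qed

context central_division_algebra
begin

text \<open>A relation of minimal length, normalised to have a coefficient 1, has central coefficients:
  its commutator with \<open>y\<close> is a shorter relation.\<close>

lemma two_sided_independent:
  fixes k :: "'i \<Rightarrow> 'd"
  assumes I: "finite I" and indep: "\<And>c. (\<Sum>i\<in>I. smul (c i) (k i)) = 0 \<Longrightarrow> \<forall>i\<in>I. c i = 0"
    and rel: "\<And>x. (\<Sum>i\<in>I. a i * x * k i) = 0"
  shows "\<forall>i\<in>I. a i = 0"
proof (rule ccontr)
  assume nontriv: "\<not> ?thesis"
  define good where "good a \<longleftrightarrow> (\<forall>x. (\<Sum>i\<in>I. a i * x * k i) = 0) \<and> (\<exists>i\<in>I. a i \<noteq> 0)" for a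
  define supp where "supp a = {i \<in> I. a i \<noteq> 0}" for a :: "'i \<Rightarrow> 'd"
  have "good a" using nontriv rel unfolding good_def by blast
  then have "\<exists>a. good a \<and> (\<forall>b. good b \<longrightarrow> card (supp a) \<le> card (supp b))"
    by (rule ex_has_least_nat[of good a "\<lambda>a. card (supp a)"])
  then obtain a where a: "good a" "\<And>b. good b \<Longrightarrow> card (supp a) \<le> card (supp b)" by blast
  obtain j where j: "j \<in> I" "a j \<noteq> 0" using a(1) unfolding good_def by blast
  define a' where "a' i = inverse (a j) * a i" for i
  have rel': "(\<Sum>i\<in>I. a' i * x * k i) = 0" for x
  proof -
    have "(\<Sum>i\<in>I. a' i * x * k i) = inverse (a j) * (\<Sum>i\<in>I. a i * x * k i)"
      by (simp add: a'_def sum_distrib_left mult.assoc)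
    then show ?thesis using a(1) unfolding good_def by simp
  qed
  have comm: "a' i * y = y * a' i" if i: "i \<in> I" for i y
  proof (rule ccontr)
    assume ne: "a' i * y \<noteq> y * a' i"
    define b where "b i = a' i * y - y * a' i" for i
    have "(\<Sum>i\<in>I. b i * x * k i) = 0" for x
    proof -
      have "(\<Sum>i\<in>I. b i * x * k i) = (\<Sum>i\<in>I. a' i * (y * x) * k i) - y * (\<Sum>i\<in>I. a' i * x * k i)"
        by (simp add: b_def left_diff_distrib sum_subtractf sum_distrib_left mult.assoc)
      then show ?thesis by (simp add: rel')
    qed
    then have "good b" using ne i unfolding good_def b_def by auto
    then have "card (supp a) \<le> card (supp b)" by (rule a(2))
    moreover have "supp b \<subseteq> supp a - {j}"
      using j by (auto simp: supp_def b_def a'_def)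
    then have "card (supp b) < card (supp a)"
      using j I by (intro psubset_card_mono) (auto simp: supp_def)
    ultimately show False by simp
  qed
  have "a' i \<in> range (\<lambda>c. smul c 1)" if "i \<in> I" for i
    unfolding central[symmetric] using comm[OF that] by simp
  then have "\<exists>c. a' i = smul c 1" if "i \<in> I" for i using that by blast
  then obtain c where c: "\<And>i. i \<in> I \<Longrightarrow> a' i = smul (c i) 1" by metis
  have "(\<Sum>i\<in>I. smul (c i) (k i)) = (\<Sum>i\<in>I. a' i * 1 * k i)"
    by (intro sum.cong) (simp_all add: c smul_mult_left)
  then have "\<forall>i\<in>I. c i = 0" using rel'[of 1] by (intro indep) simp
  then have "a' j = 0" using c j by simp
  then show False using j by (simp add: a'_def)
qed

lemma independent_family_card:
  fixes k :: "'i \<Rightarrow> 'd"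
  assumes I: "finite I" and indep: "\<And>c. (\<Sum>i\<in>I. smul (c i) (k i)) = 0 \<Longrightarrow> \<forall>i\<in>I. c i = 0"
  shows "card I \<le> d ^ 2"
proof -
  obtain S where S: "independent S" "span S = UNIV" "card S = d ^ 2"
    using basis_exists[of UNIV] dim_eq by (metis span_UNIV span_mono subset_antisym top_greatest span_span)
  have "card S > 0" using S(3) index_pos by simp
  then have finS: "finite S" using card_gt_0_iff by blast
  have inj: "inj_on k I"
  proof (rule inj_onI, rule ccontr)
    fix i j assume ij: "i \<in> I" "j \<in> I" "k i = k j" "i \<noteq> j"
    \<comment> \<open>A repeated member of the family gives a relation with the two coefficients 1
      and -1.\<close>
    define c where "c l = (if l = i then 1 else 0) - (if l = j then 1 else 0 :: 'f)" for l
    have "smul (c l) (k l) = (if l = i then k i else 0) - (if l = j then k j else 0)" for l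
      by (simp add: c_def scale_left_diff_distrib)
    then have "(\<Sum>l\<in>I. smul (c l) (k l)) = 0" using ij I by (simp add: sum_subtractf)
    then show False using indep ij by (force simp: c_def)
  qed
  have "independent (k ` I)"
    unfolding dependent_finite[OF finite_imageI[OF I]]
  proof clarify
    fix u i assume "i \<in> I" "u (k i) \<noteq> 0" "(\<Sum>x\<in>k ` I. smul (u x) x) = 0"
    moreover have "(\<Sum>x\<in>k ` I. smul (u x) x) = (\<Sum>i\<in>I. smul (u (k i)) (k i))"
      using inj by (simp add: sum.reindex)
    ultimately show False using indep[of "\<lambda>i. u (k i)"] by auto
  qed
  then have "card (k ` I) \<le> card S" using independent_span_bound[OF finS] S(2) by blast
  then show ?thesis using S(3) by (simp add: card_image[OF inj])
qed

text \<open>With \<open>M\<close> maximal, the powers of \<open>\<alpha>\<close> span a commutative subfield \<open>F\<close> of degree \<open>M\<close>. The algebra is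
  a right vector space over \<open>F\<close> of some dimension \<open>r\<close> with \<open>r M \<le> d\<^sup>2\<close>. If \<open>M > d\<close>, then
  \<open>r < M\<close>, and the \<open>r\<close> equations \<open>\<Sum>\<^sub>i a\<^sub>i b\<^sub>j \<alpha>\<^sup>i = 0\<close> have a nontrivial solution.\<close>

theorem power_independent_le_index:
  assumes m: "\<And>c. (\<Sum>i<m. smul (c i) (\<alpha> ^ i)) = 0 \<Longrightarrow> \<forall>i<m. c i = 0"
  shows "m \<le> d"
proof -
  define ind where "ind m \<longleftrightarrow> (\<forall>c. (\<Sum>i<m. smul (c i) (\<alpha> ^ i)) = 0 \<longrightarrow> (\<forall>i<m. c i = 0))" for m
  have ind_le: "m \<le> d ^ 2" if "ind m" for m
    using independent_family_card[of "{..<m}" "\<lambda>i. \<alpha> ^ i"] that unfolding ind_def by auto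
  have "ind m" using m unfolding ind_def by blast
  then have "\<exists>M. ind M \<and> (\<forall>l. ind l \<longrightarrow> l \<le> M)" using ind_le by (intro Nat.ex_has_greatest_nat) auto
  then obtain M where M: "ind M" "\<And>l. ind l \<Longrightarrow> l \<le> M" by blast
  have "m \<le> M" using M(2) \<open>ind m\<close> by blast
  have indM: "\<forall>i<M. c i = 0" if "(\<Sum>i<M. smul (c i) (\<alpha> ^ i)) = 0" for c
    using M(1) that unfolding ind_def by blast
  define F where "F = {\<Sum>i<M. smul (c i) (\<alpha> ^ i) |c. True}"
  have FI: "(\<Sum>i<M. smul (c i) (\<alpha> ^ i)) \<in> F" for c unfolding F_def by blast
  have F_add: "x + y \<in> F" if xy: "x \<in> F" "y \<in> F" for x y
  proof -
    obtain c e where ce: "x = (\<Sum>i<M. smul (c i) (\<alpha> ^ i))" "y = (\<Sum>i<M. smul (e i) (\<alpha> ^ i))"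
      using xy unfolding F_def by blast
    then have "x + y = (\<Sum>i<M. smul (c i + e i) (\<alpha> ^ i))" by (simp add: scale_left_distrib sum.distrib)
    then show ?thesis using FI by simp
  qed
  have F_smul: "smul a x \<in> F" if x: "x \<in> F" for a x
  proof -
    obtain c where c: "x = (\<Sum>i<M. smul (c i) (\<alpha> ^ i))" using x unfolding F_def by blast
    then have "smul a x = (\<Sum>i<M. smul (a * c i) (\<alpha> ^ i))" by (simp add: scale_sum_right)
    then show ?thesis using FI by simp
  qed
  have F_zero: "0 \<in> F" using FI[of "\<lambda>_. 0"] by simp
  have F_sum: "sum g A \<in> F" if "\<And>i. i \<in> A \<Longrightarrow> g i \<in> F" for g :: "nat \<Rightarrow> 'd" and A
    using that by (induction A rule: infinite_finite_induct) (auto simp: F_zero F_add)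
  have F_pow: "\<alpha> ^ i \<in> F" if "i \<le> M" for i
  proof (cases "i < M")
    case True
    have "(\<Sum>l<M. smul (if l = i then 1 else 0) (\<alpha> ^ l)) = (\<Sum>l<M. if l = i then \<alpha> ^ i else 0)"
      by (intro sum.cong) auto
    then have "(\<Sum>l<M. smul (if l = i then 1 else 0) (\<alpha> ^ l)) = \<alpha> ^ i" using True by simp
    then show ?thesis using FI by metis
  next
    case False
    then have i: "i = M" using that by simp
    have "\<not> ind (Suc M)" using M(2)[of "Suc M"] by auto
    then obtain c where c: "(\<Sum>i<Suc M. smul (c i) (\<alpha> ^ i)) = 0" "\<exists>i<Suc M. c i \<noteq> 0" unfolding ind_def by blast
    have s: "(\<Sum>i<M. smul (c i) (\<alpha> ^ i)) + smul (c M) (\<alpha> ^ M) = 0" using c(1) by simp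
    have "c M \<noteq> 0"
    proof
      assume "c M = 0"
      then have "\<forall>i<M. c i = 0" using s by (intro indM) simp
      then show False using c(2) \<open>c M = 0\<close> by (auto simp: less_Suc_eq)
    qed
    have "smul (c M) (\<alpha> ^ M) = - (\<Sum>i<M. smul (c i) (\<alpha> ^ i))" using s by (simp add: eq_neg_iff_add_eq_0 add.commute)
    also have "\<dots> = smul (- 1) (\<Sum>i<M. smul (c i) (\<alpha> ^ i))" by simp
    finally have "smul (inverse (c M)) (smul (c M) (\<alpha> ^ M)) \<in> F" using F_smul FI by metis
    then show ?thesis using \<open>c M \<noteq> 0\<close> i by simp
  qed
  have F_mult_\<alpha>: "x * \<alpha> \<in> F" if x: "x \<in> F" for x
  proof -
    obtain c where c: "x = (\<Sum>i<M. smul (c i) (\<alpha> ^ i))" using x unfolding F_def by blast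
    have "x * \<alpha> = (\<Sum>i<M. smul (c i) (\<alpha> ^ Suc i))"
      unfolding c sum_distrib_right by (simp add: smul_mult_left power_commutes)
    then show ?thesis using F_sum F_smul F_pow by (metis (no_types, lifting) Suc_leI lessThan_iff)
  qed
  have F_mult_pow: "x * \<alpha> ^ i \<in> F" if "x \<in> F" for x i
  proof (induction i)
    case (Suc i)
    then have "x * \<alpha> ^ i * \<alpha> \<in> F" by (rule F_mult_\<alpha>)
    then show ?case by (simp add: mult.assoc power_commutes)
  qed (simp add: that)
  have F_mult: "x * y \<in> F" if "x \<in> F" and y: "y \<in> F" for x y
  proof -
    obtain c where c: "y = (\<Sum>i<M. smul (c i) (\<alpha> ^ i))" using y unfolding F_def by blast
    have "x * y = (\<Sum>i<M. smul (c i) (x * \<alpha> ^ i))" unfolding c sum_distrib_left by (simp add: smul_mult_right)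
    show ?thesis unfolding \<open>x * y = _\<close> by (intro F_sum F_smul F_mult_pow that)
  qed
  have F_comm: "x * \<alpha> ^ i = \<alpha> ^ i * x" if x: "x \<in> F" for x i
  proof -
    obtain c where c: "x = (\<Sum>i<M. smul (c i) (\<alpha> ^ i))" using x unfolding F_def by blast
    show ?thesis unfolding c sum_distrib_left sum_distrib_right
      by (simp add: smul_mult_left smul_mult_right power_add[symmetric] add.commute)
  qed
  have "ind 1" unfolding ind_def by simp
  then have M1: "M \<ge> 1" using M(2) by blast
  have F_one: "1 \<in> F" using F_pow[of 0] by simp
  \<comment> \<open>\<open>F\<close> has dimension \<open>M\<close>, so \<open>M + 1\<close> powers
    of \<open>x\<close> are dependent. Splitting off the lowest nonzero term and cancelling
    \<open>x ^ j\<close> leaves \<open>c j + x y = 0\<close>, which is solved for the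
    inverse.\<close>
  have F_inverse: "inverse x \<in> F" if x: "x \<in> F" "x \<noteq> 0" for x
  proof -
    have xp: "x ^ j \<in> F" for j by (induction j) (auto simp: F_one F_mult x)
    have "\<exists>c. (\<Sum>j<Suc M. smul (c j) (x ^ j)) = 0 \<and> (\<exists>j<Suc M. c j \<noteq> 0)"
    proof -
      have "\<exists>e. x ^ j = (\<Sum>i<M. smul (e i) (\<alpha> ^ i))" for j using xp unfolding F_def by blast
      then obtain e where e: "\<And>j. x ^ j = (\<Sum>i<M. smul (e j i) (\<alpha> ^ i))" by metis
      obtain c where c: "\<exists>j\<in>{..<Suc M}. c j \<noteq> 0" "\<forall>i<M. (\<Sum>j<Suc M. c j * e j i) = 0"
        using homogeneous_system[of "{..<Suc M}" M e] by auto
      have "(\<Sum>j<Suc M. smul (c j) (x ^ j)) = (\<Sum>j<Suc M. \<Sum>i<M. smul (c j * e j i) (\<alpha> ^ i))"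
        unfolding e scale_sum_right by (simp only: scale_scale)
      also have "\<dots> = (\<Sum>i<M. \<Sum>j<Suc M. smul (c j * e j i) (\<alpha> ^ i))" by (rule sum.swap)
      also have "\<dots> = (\<Sum>i<M. smul (\<Sum>j<Suc M. c j * e j i) (\<alpha> ^ i))" by (simp only: scale_sum_left)
      also have "\<dots> = 0" using c(2) by simp
      finally show ?thesis using c(1) by blast
    qed
    then obtain c where c: "(\<Sum>j<Suc M. smul (c j) (x ^ j)) = 0" "\<exists>j<Suc M. c j \<noteq> 0" by blast
    define j where "j = (LEAST j. c j \<noteq> 0)"
    have cj: "c j \<noteq> 0" unfolding j_def using c(2) by (metis (mono_tags) LeastI)
    have "j < Suc M" unfolding j_def using c(2) by (metis (mono_tags) Least_le le_less_trans)
    have low: "c l = 0" if "l < j" for l using that not_less_Least unfolding j_def by blast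
    define y where "y = (\<Sum>l\<in>{Suc j..<Suc M}. smul (c l) (x ^ (l - Suc j)))"
    have yF: "y \<in> F" unfolding y_def by (intro F_sum F_smul xp)
    have "(\<Sum>l<Suc M. smul (c l) (x ^ l)) = (\<Sum>l\<in>{j..<Suc M}. smul (c l) (x ^ l))"
      using low by (intro sum.mono_neutral_right) auto
    also have "\<dots> = smul (c j) (x ^ j) + (\<Sum>l\<in>{Suc j..<Suc M}. smul (c l) (x ^ l))"
      using \<open>j < Suc M\<close> by (rule sum.atLeast_Suc_lessThan)
    also have "(\<Sum>l\<in>{Suc j..<Suc M}. smul (c l) (x ^ l)) = x ^ j * (x * y)"
      unfolding y_def sum_distrib_left
    proof (intro sum.cong refl)
      fix l assume "l \<in> {Suc j..<Suc M}"
      then have "l = j + (1 + (l - Suc j))" by simp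
      then have "x ^ l = x ^ j * (x * x ^ (l - Suc j))" by (metis power_add power_one_right)
      then show "smul (c l) (x ^ l) = x ^ j * (x * smul (c l) (x ^ (l - Suc j)))"
        by (simp add: smul_mult_right)
    qed
    also have "smul (c j) (x ^ j) = x ^ j * smul (c j) 1" by (simp add: smul_mult_right)
    finally have "x ^ j * (smul (c j) 1 + x * y) = 0" using c(1) by (simp add: distrib_left)
    then have xy: "x * y = - smul (c j) 1" using x(2) by (simp add: eq_neg_iff_add_eq_0 add.commute)
    have "x * smul (- inverse (c j)) y = smul (- inverse (c j)) (x * y)" by (rule smul_mult_right)
    also have "\<dots> = 1" unfolding xy using cj by simp
    finally have "inverse x = smul (- inverse (c j)) y" by (rule inverse_unique)
    then show ?thesis using F_smul[OF yF] by metis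
  qed
  \<comment> \<open>Independence of the \<open>b j\<close> over \<open>F\<close> acting from the
    right, written out over the base field so that \<open>independent_family_card\<close> bounds
    \<open>r * M\<close>.\<close>
  define fam where "fam r b \<longleftrightarrow> (\<forall>c. (\<Sum>(j, i)\<in>{..<r} \<times> {..<M}. smul (c (j, i)) (b j * \<alpha> ^ i)) = 0 \<longrightarrow>
      (\<forall>j<r. \<forall>i<M. c (j, i) = 0))" for r :: nat and b :: "nat \<Rightarrow> 'd"
  have fam_sum: "(\<Sum>(j, i)\<in>{..<r} \<times> {..<M}. smul (c (j, i)) (b j * \<alpha> ^ i))
      = (\<Sum>j<r. b j * (\<Sum>i<M. smul (c (j, i)) (\<alpha> ^ i)))" for r b c
    unfolding sum.cartesian_product[symmetric] sum_distrib_left by (simp add: smul_mult_right)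
  have fam_le: "r * M \<le> d ^ 2" if f: "fam r b" for r b
  proof -
    have "card ({..<r} \<times> {..<M}) \<le> d ^ 2"
    proof (rule independent_family_card[of _ "\<lambda>(j, i). b j * \<alpha> ^ i"])
      fix c :: "nat \<times> nat \<Rightarrow> 'f"
      assume s: "(\<Sum>i\<in>{..<r} \<times> {..<M}. smul (c i) (case i of (j, i) \<Rightarrow> b j * \<alpha> ^ i)) = 0"
      have "(\<Sum>(j, i)\<in>{..<r} \<times> {..<M}. smul (c (j, i)) (b j * \<alpha> ^ i)) = 0"
        using s by (simp add: case_prod_unfold)
      then show "\<forall>i\<in>{..<r} \<times> {..<M}. c i = 0" using f unfolding fam_def by auto
    qed simp
    then show ?thesis by (simp add: card_cartesian_product)
  qed
  have "\<exists>b. fam 0 b" unfolding fam_def by simp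
  moreover have "\<forall>r. (\<exists>b. fam r b) \<longrightarrow> r \<le> d ^ 2"
  proof clarify
    fix r b assume "fam r b"
    then have "r * M \<le> d ^ 2" by (rule fam_le)
    moreover have "r * 1 \<le> r * M" using M1 by (intro mult_le_mono2)
    ultimately show "r \<le> d ^ 2" by linarith
  qed
  ultimately have "\<exists>r. (\<exists>b. fam r b) \<and> (\<forall>l. (\<exists>b. fam l b) \<longrightarrow> l \<le> r)"
    by (rule Nat.ex_has_greatest_nat)
  then obtain r b where r: "fam r b" "\<And>l b. fam l b \<Longrightarrow> l \<le> r" by blast
  \<comment> \<open>Adding \<open>x\<close> to a maximal family produces a relation; the coefficient
    of \<open>x\<close> in it is nonzero, hence invertible in \<open>F\<close>.\<close>
  have span: "\<exists>k. (\<forall>j<r. k j \<in> F) \<and> x = (\<Sum>j<r. b j * k j)" for x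
  proof -
    define b' where "b' = b(r := x)"
    have "\<not> fam (Suc r) b'" using r(2)[of "Suc r" b'] by auto
    then obtain c where c: "(\<Sum>(j, i)\<in>{..<Suc r} \<times> {..<M}. smul (c (j, i)) (b' j * \<alpha> ^ i)) = 0"
      "\<exists>j<Suc r. \<exists>i<M. c (j, i) \<noteq> 0" unfolding fam_def by blast
    define k where "k j = (\<Sum>i<M. smul (c (j, i)) (\<alpha> ^ i))" for j
    have kF: "k j \<in> F" for j unfolding k_def by (rule FI)
    have s: "(\<Sum>j<r. b j * k j) + x * k r = 0"
      using c(1) unfolding fam_sum k_def[symmetric] by (simp add: b'_def)
    have kr: "k r \<noteq> 0"
    proof
      assume z: "k r = 0"
      then have cr: "\<forall>i<M. c (r, i) = 0" unfolding k_def by (rule indM)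
      have "(\<Sum>j<r. b j * k j) = 0" using s z by simp
      then have "\<forall>j<r. \<forall>i<M. c (j, i) = 0" using r(1) unfolding fam_def fam_sum k_def by blast
      then show False using c(2) cr by (auto simp: less_Suc_eq)
    qed
    have "x * k r = - (\<Sum>j<r. b j * k j)" using s by (simp add: eq_neg_iff_add_eq_0 add.commute)
    then have "x * k r * inverse (k r) = - (\<Sum>j<r. b j * k j) * inverse (k r)" by simp
    then have "x = (\<Sum>j<r. b j * - (k j * inverse (k r)))"
      using kr by (simp add: mult.assoc sum_distrib_right sum_negf)
    moreover have "- (k j * inverse (k r)) \<in> F" for j
      using F_smul[OF F_mult[OF kF F_inverse[OF kF kr]], of "- 1"] by simp
    ultimately show ?thesis by (intro exI[of _ "\<lambda>j. - (k j * inverse (k r))"]) simp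
  qed
  have "M \<le> d"
  proof (rule ccontr)
    assume "\<not> M \<le> d"
    then have "d * d < M * M" by (intro mult_strict_mono) auto
    then have "r * M < M * M" using fam_le[OF r(1)] unfolding power2_eq_square by linarith
    then have "r < M" by simp
    then obtain a where a: "\<exists>i\<in>{..<M}. a i \<noteq> 0" "\<forall>j<r. (\<Sum>i<M. a i * (b j * \<alpha> ^ i)) = 0"
      using homogeneous_system[of "{..<M}" r "\<lambda>i j. b j * \<alpha> ^ i"] by auto
    have "(\<Sum>i<M. a i * x * \<alpha> ^ i) = 0" for x
    proof -
      obtain k where k: "\<forall>j<r. k j \<in> F" "x = (\<Sum>j<r. b j * k j)" using span by blast
      have "(\<Sum>i<M. a i * x * \<alpha> ^ i) = (\<Sum>i<M. \<Sum>j<r. a i * (b j * (k j * \<alpha> ^ i)))"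
        unfolding k(2) by (simp add: sum_distrib_left sum_distrib_right mult.assoc)
      also have "\<dots> = (\<Sum>j<r. \<Sum>i<M. a i * (b j * (k j * \<alpha> ^ i)))" by (rule sum.swap)
      also have "\<dots> = (\<Sum>j<r. (\<Sum>i<M. a i * (b j * \<alpha> ^ i)) * k j)"
        using F_comm k(1) by (intro sum.cong refl) (simp add: sum_distrib_right mult.assoc)
      also have "\<dots> = 0" using a(2) by simp
      finally show ?thesis .
    qed
    then have "\<forall>i\<in>{..<M}. a i = 0"
      using indM by (intro two_sided_independent[of "{..<M}" "\<lambda>i. \<alpha> ^ i" a]) auto
    then show False using a(1) by blast
  qed
  then show ?thesis using \<open>m \<le> M\<close> by simp
qed

end

section \<open>Residue degree and ramification index\<close>

lemma transversal_ex: "transversal S I T \<Longrightarrow> x \<in> S \<Longrightarrow> \<exists>r. r \<in> T \<and> x - r \<in> I"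
  unfolding transversal_def by (elim conjE) (drule (1) bspec, rule ex1_implies_ex)

lemma transversal_mem: "transversal S I T \<Longrightarrow> r \<in> T \<Longrightarrow> r \<in> S"
  unfolding transversal_def by (elim conjE) (rule subsetD)

lemma transversal_unique:
  assumes "transversal S I T" "x \<in> S" "r \<in> T" "r' \<in> T" "x - r \<in> I" "x - r' \<in> I"
  shows "r = r'"
proof -
  have "\<exists>!r. r \<in> T \<and> x - r \<in> I" using assms(1,2) unfolding transversal_def by (elim conjE) (rule bspec)
  then show ?thesis using assms(3-6) by (elim ex1E) metis
qed

context nc_dvr
begin

text \<open>By \<open>unit_iff\<close> the residue ring is a finite division ring, thus a field, and
  its multiplicative group is cyclic. A lift of a generator presents all nonzero residues as powers
  of one element, which is the form that the degree bound can use.\<close>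

lemma residue_generator:
  assumes F: "finite F" "transversal \<Delta> (I 1) F"
  shows "\<exists>\<alpha>\<in>\<Delta>. \<forall>x\<in>\<Delta>. x \<notin> I 1 \<longrightarrow> (\<exists>i. x - \<alpha> ^ i \<in> I 1)"
proof -
  define Rg where "Rg = \<lparr>carrier = \<Delta>, monoid.mult = (*), one = 1 :: 'd, zero = 0 :: 'd, add = (+)\<rparr>"
  have Rg: "carrier Rg = \<Delta>" "x \<otimes>\<^bsub>Rg\<^esub> y = x * y" "\<one>\<^bsub>Rg\<^esub> = 1" "\<zero>\<^bsub>Rg\<^esub> = 0" "x \<oplus>\<^bsub>Rg\<^esub> y = x + y" for x y
    by (simp_all add: Rg_def)
  have ag: "abelian_group Rg"
  proof (rule abelian_groupI)
    fix x assume "x \<in> carrier Rg"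
    then show "\<exists>y\<in>carrier Rg. y \<oplus>\<^bsub>Rg\<^esub> x = \<zero>\<^bsub>Rg\<^esub>"
      using uminus_mem[of x] unfolding Rg by (intro bexI[of _ "- x"]) auto
  qed (simp_all add: Rg add_mem zero_mem algebra_simps)
  have ringR: "ring Rg"
  proof (rule ringI)
    show "abelian_group Rg" by (rule ag)
    show "monoid Rg" by (rule monoidI) (simp_all add: Rg mult_mem one_mem mult.assoc)
  qed (simp_all add: Rg distrib_left distrib_right)
  interpret Rg: ring Rg by (rule ringR)
  have a_inv: "\<ominus>\<^bsub>Rg\<^esub> x = - x" if "x \<in> \<Delta>" for x
    using that uminus_mem by (intro Rg.minus_equality) (simp_all add: Rg)
  have minus: "x \<ominus>\<^bsub>Rg\<^esub> y = x - y" if "y \<in> \<Delta>" for x y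
    using that by (simp add: a_minus_def a_inv Rg)
  have idl: "ideal (I 1) Rg"
  proof (rule idealI)
    show "subgroup (I 1) (add_monoid Rg)"
    proof (rule subgroup.intro)
      show "I 1 \<subseteq> carrier (add_monoid Rg)" using I_subset Rg by simp
      show "x \<otimes>\<^bsub>add_monoid Rg\<^esub> y \<in> I 1" if "x \<in> I 1" "y \<in> I 1" for x y
        using that I_add Rg by simp
      show "\<one>\<^bsub>add_monoid Rg\<^esub> \<in> I 1" using I_zero Rg by simp
      show "inv\<^bsub>add_monoid Rg\<^esub> x \<in> I 1" if "x \<in> I 1" for x
      proof -
        have "x \<in> \<Delta>" using that I_subset by blast
        from a_inv[OF this] have "inv\<^bsub>add_monoid Rg\<^esub> x = - x" unfolding a_inv_def .
        then show ?thesis using that I_uminus by simp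
      qed
    qed
  qed (simp_all add: Rg ringR I_mult_left I_mult_right)
  interpret Id: ideal "I 1" Rg by (rule idl)
  define Q where "Q = Rg Quot (I 1)"
  define \<pi> where "\<pi> x = I 1 +>\<^bsub>Rg\<^esub> x" for x
  interpret Q: ring Q unfolding Q_def by (rule Id.quotient_is_ring)
  have car: "carrier Q = \<pi> ` \<Delta>"
    unfolding Q_def FactRing_def \<pi>_def by (auto simp: A_RCOSETS_def' Rg)
  have mult: "\<pi> x \<otimes>\<^bsub>Q\<^esub> \<pi> y = \<pi> (x * y)" if "x \<in> \<Delta>" "y \<in> \<Delta>" for x y
    using Id.rcoset_mult_add[of x y] that unfolding Q_def \<pi>_def by (simp add: FactRing_def Rg)
  have one: "\<one>\<^bsub>Q\<^esub> = \<pi> 1" unfolding Q_def \<pi>_def by (simp add: FactRing_def Rg)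
  have eq_iff: "\<pi> x = \<pi> y \<longleftrightarrow> x - y \<in> I 1" if "x \<in> \<Delta>" "y \<in> \<Delta>" for x y
    using Rg.quotient_eq_iff_same_a_r_cos[OF idl, of x y] that minus unfolding \<pi>_def by (simp add: Rg)
  have zero: "\<zero>\<^bsub>Q\<^esub> = \<pi> 0"
  proof -
    have "\<zero>\<^bsub>Q\<^esub> = I 1" unfolding Q_def by (simp add: FactRing_def)
    also have "\<dots> = \<pi> 0" unfolding \<pi>_def a_r_coset_def' by (simp add: Rg)
    finally show ?thesis .
  qed
  have fin: "finite (carrier Q)"
  proof -
    have "\<pi> ` \<Delta> \<subseteq> \<pi> ` F"
    proof
      fix X assume "X \<in> \<pi> ` \<Delta>"
      then obtain x where x: "x \<in> \<Delta>" "X = \<pi> x" by blast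
      then obtain r where "r \<in> F" "x - r \<in> I 1" using transversal_ex[OF F(2)] by metis
      moreover have "r \<in> \<Delta>" using F(2) \<open>r \<in> F\<close> by (rule transversal_mem)
      ultimately show "X \<in> \<pi> ` F" using eq_iff x by blast
    qed
    then show ?thesis unfolding car using F(1) finite_surj by metis
  qed
  have ne: "\<one>\<^bsub>Q\<^esub> \<noteq> \<zero>\<^bsub>Q\<^esub>" unfolding one zero using eq_iff[OF one_mem zero_mem] one_notin_I[of 0] by simp
  have units: "Units Q = carrier Q - {\<zero>\<^bsub>Q\<^esub>}"
  proof (intro equalityI subsetI)
    fix X assume X: "X \<in> Units Q"
    have "X \<noteq> \<zero>\<^bsub>Q\<^esub>"
    proof
      assume "X = \<zero>\<^bsub>Q\<^esub>"
      then show False using X ne Q.Units_l_inv Q.Units_inv_closed Q.r_null by metis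
    qed
    then show "X \<in> carrier Q - {\<zero>\<^bsub>Q\<^esub>}" using X by blast
  next
    fix X assume X: "X \<in> carrier Q - {\<zero>\<^bsub>Q\<^esub>}"
    then obtain x where x: "x \<in> \<Delta>" "X = \<pi> x" unfolding car by blast
    then have "x \<notin> I 1" using X eq_iff[OF x(1) zero_mem] zero by auto
    then have i: "inverse x \<in> \<Delta>" "x \<noteq> 0" using unit_iff[OF x(1)] by auto
    have "X \<otimes>\<^bsub>Q\<^esub> \<pi> (inverse x) = \<one>\<^bsub>Q\<^esub>" "\<pi> (inverse x) \<otimes>\<^bsub>Q\<^esub> X = \<one>\<^bsub>Q\<^esub>"
      unfolding x(2) one using mult x i by simp_all
    moreover have "\<pi> (inverse x) \<in> carrier Q" unfolding car using i by blast
    ultimately show "X \<in> Units Q" using X unfolding Units_def by blast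
  qed
  have "comm_monoid Q"
    using Q.Wedderburn_little[OF fin units] by (intro Q.monoid_comm_monoidI)
  then have "cring Q" using Q.ring_axioms by (simp add: cring_def)
  then interpret Qf: field Q using units by (rule cring.cring_fieldI)
  obtain X where X: "X \<in> carrier (mult_of Q)" "carrier (mult_of Q) = {X [^]\<^bsub>Q\<^esub> i |i::nat. i \<in> UNIV}"
    using Qf.finite_field_mult_group_has_gen[OF fin] by blast
  then obtain \<alpha> where \<alpha>: "\<alpha> \<in> \<Delta>" "X = \<pi> \<alpha>" using car by auto
  have pow: "X [^]\<^bsub>Q\<^esub> i = \<pi> (\<alpha> ^ i)" for i :: nat
  proof (induction i)
    case 0
    then show ?case by (simp add: one)
  next
    case (Suc i)
    then show ?case using mult[OF power_mem[OF \<alpha>(1), of i] \<alpha>(1)] \<alpha>(2) by (simp add: power_commutes)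
  qed
  have "\<exists>i. x - \<alpha> ^ i \<in> I 1" if x: "x \<in> \<Delta>" "x \<notin> I 1" for x
  proof -
    have "\<pi> x \<noteq> \<zero>\<^bsub>Q\<^esub>" using eq_iff[OF x(1) zero_mem] x(2) zero by auto
    then have "\<pi> x \<in> carrier (mult_of Q)" using x(1) car by simp
    then obtain i :: nat where "\<pi> x = X [^]\<^bsub>Q\<^esub> i" unfolding X(2) by (elim CollectE exE conjE)
    then have "\<pi> x = \<pi> (\<alpha> ^ i)" by (simp only: pow)
    then show ?thesis using eq_iff x(1) power_mem[OF \<alpha>(1)] by blast
  qed
  then show ?thesis using \<alpha>(1) by blast
qed

end

context maximal_order
begin

lemma N_sum: "(\<And>i. i \<in> A \<Longrightarrow> g i \<in> N) \<Longrightarrow> sum g A \<in> N" for g :: "nat \<Rightarrow> 'd"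
proof (induction A rule: infinite_finite_induct)
  case (insert x A)
  have "g x - (0 - sum g A) \<in> N"
    by (rule N_diff[OF _ N_diff[OF zero_N]]) (use insert in auto)
  then show ?case using insert(1,2) by simp
qed (simp_all add: zero_N)

lemma smul_N: "x \<in> N \<Longrightarrow> a \<in> val_ring v \<Longrightarrow> smul a x \<in> N"
  unfolding smul_emb[of a x] by (rule N_mult_left[OF _ emb_mem])

lemma smul_I_N: "a \<in> R.I 1 \<Longrightarrow> x \<in> \<Delta> \<Longrightarrow> smul a x \<in> N"
proof -
  assume a: "a \<in> R.I 1" and x: "x \<in> \<Delta>"
  obtain b where b: "a = t ^ 1 * b" "b \<in> val_ring v" using a unfolding R.I_def by blast
  have "smul a x = smul t (smul b x)" unfolding b(1) by simp
  also have "\<dots> = emb t * smul b x" by (rule smul_emb)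
  finally show ?thesis using N_mult_right[OF varpi_N smul_mem[OF b(2) x]] by (simp only:)
qed

lemma N_add: "x \<in> N \<Longrightarrow> y \<in> N \<Longrightarrow> x + y \<in> N"
  using N_diff[OF _ N_diff[OF zero_N], of x y] by simp

lemma K_ring: "a \<in> K \<Longrightarrow> a \<in> val_ring v"
  using K(1) by (rule transversal_mem)

lemma K_card: "card K \<ge> 2"
proof -
  obtain a where a: "a \<in> K" "0 - a \<in> R.I 1" using transversal_ex[OF K(1) R.zero_mem] by (elim exE conjE)
  obtain b where b: "b \<in> K" "1 - b \<in> R.I 1" using transversal_ex[OF K(1) R.one_mem] by (elim exE conjE)
  have "a \<noteq> b"
  proof
    assume "a = b"
    have "(1 - b) - (0 - a) \<in> R.I 1" by (rule R.I_diff[OF b(2) a(2)])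
    then show False using \<open>a = b\<close> R.one_notin_I[of 0] by simp
  qed
  then have "card {a, b} = 2" by simp
  then show ?thesis using card_mono[OF K(2), of "{a, b}"] a(1) b(1) by simp
qed

text \<open>\<open>N\<close> is coarser than \<open>J 1\<close>, for which a finite system exists;
  within that system one element is selected for each class modulo \<open>N\<close>, by a choice
  that depends on the class only.\<close>

lemma transversal_N: "\<exists>F. finite F \<and> transversal \<Delta> N F"
proof -
  obtain G where G: "finite G" "transversal \<Delta> (J 1) G" using J_transversal by blast
  define h where "h x = (SOME s. s \<in> G \<and> x - s \<in> N)" for x
  have h: "h x \<in> G \<and> x - h x \<in> N" if x: "x \<in> \<Delta>" for x
  proof -
    obtain s where "s \<in> G" "x - s \<in> J 1" using transversal_ex[OF G(2) x] by (elim exE conjE)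
    then have "\<exists>s. s \<in> G \<and> x - s \<in> N" using J1_N by (intro exI[of _ s] conjI)
    then show ?thesis unfolding h_def by (rule someI_ex)
  qed
  have hcong: "h x = h y" if "x - y \<in> N" for x y
  proof -
    have "x - s \<in> N \<longleftrightarrow> y - s \<in> N" for s
    proof
      assume "x - s \<in> N"
      from N_diff[OF this that] show "y - s \<in> N" by simp
    next
      assume "y - s \<in> N"
      from N_diff[OF this N_diff[OF zero_N that]] show "x - s \<in> N" by simp
    qed
    then show ?thesis unfolding h_def by (simp only:)
  qed
  have GD: "s \<in> \<Delta>" if "s \<in> G" for s using G(2) that by (rule transversal_mem)
  have "transversal \<Delta> N (h ` \<Delta>)"
    unfolding transversal_def
  proof (intro conjI ballI)
    show "h ` \<Delta> \<subseteq> \<Delta>" by (rule image_subsetI, rule GD, rule conjunct1[OF h])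
    fix x assume x: "x \<in> \<Delta>"
    show "\<exists>!r. r \<in> h ` \<Delta> \<and> x - r \<in> N"
    proof (rule ex1I[of _ "h x"])
      show "h x \<in> h ` \<Delta> \<and> x - h x \<in> N" using conjunct2[OF h[OF x]] x by (intro conjI imageI)
      fix r assume r: "r \<in> h ` \<Delta> \<and> x - r \<in> N"
      then obtain y where y: "y \<in> \<Delta>" "r = h y" by (elim conjE imageE)
      have "(x - r) - (y - h y) \<in> N" by (rule N_diff) (use r h[OF y(1)] in auto)
      then have "x - y \<in> N" unfolding y(2) by simp
      from hcong[OF this] show "r = h x" using y(2) by simp
    qed
  qed
  moreover have "finite (h ` \<Delta>)" by (rule finite_subset[OF _ G(1)]) (intro image_subsetI conjunct1[OF h])
  ultimately show ?thesis by (intro exI[of _ "h ` \<Delta>"] conjI)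
qed

text \<open>\<open>f\<close> is the degree of the residue of \<open>\<alpha>\<close> over the
  residue field of the centre. The first \<open>f\<close> powers form a basis there, which counts
  \<open>F\<close>. They are also independent over the field itself, since a relation scaled by
  \<open>scale_to_unit\<close> would reduce to a nontrivial one; hence the bound.\<close>

lemma residue_degree:
  assumes F: "finite F" "transversal \<Delta> N F"
    and \<alpha>: "\<alpha> \<in> \<Delta>" "\<And>x. x \<in> \<Delta> \<Longrightarrow> x \<notin> N \<Longrightarrow> \<exists>i. x - \<alpha> ^ i \<in> N"
  shows "\<exists>f\<le>d. card F = card K ^ f"
proof -
  have \<alpha>p: "\<alpha> ^ i \<in> \<Delta>" for i using \<alpha>(1) by (rule power_mem)
  define rel where "rel f \<longleftrightarrow> (\<exists>c. (\<forall>i<f. c i \<in> val_ring v) \<and> \<alpha> ^ f - (\<Sum>i<f. smul (c i) (\<alpha> ^ i)) \<in> N)" for f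
  have delta: "(\<Sum>i<n. smul (if i = l then 1 else 0) (\<alpha> ^ i)) = \<alpha> ^ l" if "l < n" for l n :: nat
  proof -
    have "(\<Sum>i<n. smul (if i = l then 1 else 0) (\<alpha> ^ i)) = (\<Sum>i<n. if i = l then \<alpha> ^ l else 0)"
      by (intro sum.cong) auto
    then show ?thesis using that by simp
  qed
  have "\<exists>f. rel f"
  proof -
    define r where "r i = (SOME r. r \<in> F \<and> \<alpha> ^ i - r \<in> N)" for i
    have r: "r i \<in> F \<and> \<alpha> ^ i - r i \<in> N" for i
      unfolding r_def by (rule someI_ex[OF transversal_ex[OF F(2) \<alpha>p]])
    have "finite (range r)" by (rule finite_subset[OF image_subsetI F(1)]) (rule conjunct1[OF r])
    then have "\<not> inj r" using range_inj_infinite by (rule contrapos_pn)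
    then obtain i j where ij: "r i = r j" "i < j" unfolding inj_def by (metis linorder_neqE_nat)
    have "(\<alpha> ^ j - r j) - (\<alpha> ^ i - r i) \<in> N" by (rule N_diff[OF conjunct2[OF r] conjunct2[OF r]])
    then have "\<alpha> ^ j - (\<Sum>l<j. smul (if l = i then 1 else 0) (\<alpha> ^ l)) \<in> N" using ij by (simp add: delta)
    then have "rel j" unfolding rel_def using R.one_mem R.zero_mem
      by (intro exI[of _ "\<lambda>l. if l = i then 1 else 0"]) auto
    then show ?thesis by blast
  qed
  define f where "f = (LEAST f. rel f)"
  have "rel f" unfolding f_def using \<open>\<exists>f. rel f\<close> by (rule LeastI_ex)
  have least: "\<not> rel i" if "i < f" for i using that unfolding f_def by (rule not_less_Least)
  obtain e where e: "\<forall>i<f. e i \<in> val_ring v" "\<alpha> ^ f - (\<Sum>i<f. smul (e i) (\<alpha> ^ i)) \<in> N"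
    using \<open>rel f\<close> unfolding rel_def by blast
  have "f \<noteq> 0" using e(2) one_notin_N by (intro notI) simp
  then obtain g where g: "f = Suc g" by (cases f) auto
  define S where "S = {x. \<exists>c. (\<forall>i<f. c i \<in> val_ring v) \<and> x - (\<Sum>i<f. smul (c i) (\<alpha> ^ i)) \<in> N}"
  have S_pow: "\<alpha> ^ j \<in> S" for j
  proof (induction j)
    case 0
    have "\<alpha> ^ 0 - (\<Sum>i<f. smul (if i = 0 then 1 else 0) (\<alpha> ^ i)) \<in> N"
      using delta[of 0 f] g zero_N by simp
    then show ?case unfolding S_def using R.one_mem R.zero_mem
      by (intro CollectI exI[of _ "\<lambda>i. if i = 0 then 1 else 0"]) auto
  next
    case (Suc j)
    then obtain c where c: "\<forall>i<f. c i \<in> val_ring v" "\<alpha> ^ j - (\<Sum>i<f. smul (c i) (\<alpha> ^ i)) \<in> N"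
      unfolding S_def by blast
    \<comment> \<open>Multiplication by \<open>\<alpha>\<close> shifts the coefficients, and the new
      top power \<open>\<alpha> ^ f\<close> is replaced by means of \<open>e\<close>.\<close>
    define b where "b i = (case i of 0 \<Rightarrow> 0 | Suc l \<Rightarrow> c l) + c g * e i" for i
    have "(\<Sum>i<f. smul (b i) (\<alpha> ^ i)) = (\<Sum>i<f. smul (case i of 0 \<Rightarrow> 0 | Suc l \<Rightarrow> c l) (\<alpha> ^ i))
        + smul (c g) (\<Sum>i<f. smul (e i) (\<alpha> ^ i))"
      by (simp add: b_def scale_left_distrib sum.distrib scale_sum_right)
    also have "(\<Sum>i<f. smul (case i of 0 \<Rightarrow> 0 | Suc l \<Rightarrow> c l) (\<alpha> ^ i)) = (\<Sum>i<g. smul (c i) (\<alpha> ^ Suc i))"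
      unfolding g sum.lessThan_Suc_shift by simp
    finally have b_sum: "(\<Sum>i<f. smul (b i) (\<alpha> ^ i)) = (\<Sum>i<g. smul (c i) (\<alpha> ^ Suc i))
        + smul (c g) (\<Sum>i<f. smul (e i) (\<alpha> ^ i))" .
    have "(\<alpha> ^ j - (\<Sum>i<f. smul (c i) (\<alpha> ^ i))) * \<alpha> = \<alpha> ^ Suc j - (\<Sum>i<f. smul (c i) (\<alpha> ^ Suc i))"
      unfolding left_diff_distrib sum_distrib_right by (simp add: smul_mult_left power_commutes)
    also have "(\<Sum>i<f. smul (c i) (\<alpha> ^ Suc i)) = (\<Sum>i<g. smul (c i) (\<alpha> ^ Suc i)) + smul (c g) (\<alpha> ^ f)"
      unfolding g by simp
    finally have "\<alpha> ^ Suc j - ((\<Sum>i<g. smul (c i) (\<alpha> ^ Suc i)) + smul (c g) (\<alpha> ^ f)) \<in> N"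
      using N_mult_right[OF c(2) \<alpha>(1)] by simp
    moreover have "smul (c g) (\<alpha> ^ f - (\<Sum>i<f. smul (e i) (\<alpha> ^ i))) \<in> N"
      using c(1) g by (intro smul_N e(2)) simp
    ultimately have "(\<alpha> ^ Suc j - ((\<Sum>i<g. smul (c i) (\<alpha> ^ Suc i)) + smul (c g) (\<alpha> ^ f)))
        - (0 - smul (c g) (\<alpha> ^ f - (\<Sum>i<f. smul (e i) (\<alpha> ^ i)))) \<in> N"
      by (rule N_diff[OF _ N_diff[OF zero_N]])
    then have "\<alpha> ^ Suc j - (\<Sum>i<f. smul (b i) (\<alpha> ^ i)) \<in> N"
      unfolding b_sum by (simp add: scale_right_diff_distrib algebra_simps)
    moreover have "\<forall>i<f. b i \<in> val_ring v"
      unfolding b_def using c(1) e(1) g R.zero_mem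
      by (auto intro!: R.add_mem R.mult_mem split: nat.splits)
    ultimately show ?case unfolding S_def by blast
  qed
  have S_all: "x \<in> S" if x: "x \<in> \<Delta>" for x
  proof (cases "x \<in> N")
    case True
    then show ?thesis unfolding S_def using R.zero_mem by (intro CollectI exI[of _ "\<lambda>_. 0"]) simp
  next
    case False
    then obtain i where i: "x - \<alpha> ^ i \<in> N" using \<alpha>(2)[OF x] by metis
    obtain c where c: "\<forall>i<f. c i \<in> val_ring v" "\<alpha> ^ i - (\<Sum>i<f. smul (c i) (\<alpha> ^ i)) \<in> N"
      using S_pow[of i] unfolding S_def by blast
    have "(x - \<alpha> ^ i) + (\<alpha> ^ i - (\<Sum>i<f. smul (c i) (\<alpha> ^ i))) \<in> N"
      using i c(2) by (rule N_add)
    then show ?thesis unfolding S_def using c(1) by (intro CollectI exI[of _ c]) simp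
  qed
  have indep: "c i \<in> R.I 1"
    if c: "\<forall>i<f. c i \<in> val_ring v" "(\<Sum>i<f. smul (c i) (\<alpha> ^ i)) \<in> N" and i: "i < f" for c i
  proof (rule ccontr)
    assume "c i \<notin> R.I 1"
    \<comment> \<open>Dividing by the highest coefficient that is a unit would yield a relation
      \<open>rel l\<close> below the least degree \<open>f\<close>.\<close>
    define A where "A = {i. i < f \<and> c i \<notin> R.I 1}"
    have A: "finite A" "A \<noteq> {}" using \<open>c i \<notin> R.I 1\<close> i unfolding A_def by auto
    define l where "l = Max A"
    have l: "l < f" "c l \<notin> R.I 1" using Max_in[OF A] unfolding l_def A_def by auto
    have above: "c j \<in> R.I 1" if "l < j" "j < f" for j
    proof (rule ccontr)
      assume "c j \<notin> R.I 1"
      then have "j \<in> A" using that by (simp add: A_def)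
      then have "j \<le> l" using Max_ge[OF A(1)] by (simp add: l_def)
      then show False using that by simp
    qed
    have cl: "c l \<noteq> 0" "inverse (c l) \<in> val_ring v" using R.unit_iff[of "c l"] c(1) l by auto
    have split: "{..<f} = {..l} \<union> {Suc l..<f}" using l by auto
    have "(\<Sum>i<f. smul (c i) (\<alpha> ^ i)) = (\<Sum>i\<le>l. smul (c i) (\<alpha> ^ i)) + (\<Sum>i\<in>{Suc l..<f}. smul (c i) (\<alpha> ^ i))"
      unfolding split by (rule sum.union_disjoint) auto
    moreover have "(\<Sum>i\<in>{Suc l..<f}. smul (c i) (\<alpha> ^ i)) \<in> N"
      using above \<alpha>p by (intro N_sum smul_I_N) auto
    ultimately have "(\<Sum>i\<le>l. smul (c i) (\<alpha> ^ i)) \<in> N" using N_diff[OF c(2)] by (metis add_diff_cancel_right')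
    then have "smul (inverse (c l)) (\<Sum>i\<le>l. smul (c i) (\<alpha> ^ i)) \<in> N" using cl(2) by (rule smul_N)
    also have "smul (inverse (c l)) (\<Sum>i\<le>l. smul (c i) (\<alpha> ^ i))
        = \<alpha> ^ l - (\<Sum>i<l. smul (- (inverse (c l) * c i)) (\<alpha> ^ i))"
      using cl(1) by (simp add: lessThan_Suc_atMost[symmetric] scale_right_distrib scale_sum_right sum_negf)
    finally have "rel l" unfolding rel_def using c(1) cl(2) l(1)
      by (intro exI[of _ "\<lambda>i. - (inverse (c l) * c i)"]) (auto intro!: R.uminus_mem R.mult_mem)
    then show False using least l(1) by blast
  qed
  have diff: "(\<Sum>i<f. smul (c i) (\<alpha> ^ i)) - (\<Sum>i<f. smul (b i) (\<alpha> ^ i)) = (\<Sum>i<f. smul (c i - b i) (\<alpha> ^ i))" for c b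
    by (simp add: scale_left_diff_distrib sum_subtractf)
  define T where "T = (\<lambda>h. \<Sum>i<f. smul (h i) (\<alpha> ^ i)) ` ({..<f} \<rightarrow>\<^sub>E K)"
  have KI: "a = a'" if "a \<in> K" "a' \<in> K" "a - a' \<in> R.I 1" for a a'
    using transversal_unique[OF K(1) K_ring[OF that(1)] that(1,2) _ that(3)] R.I_zero[of 1] by simp
  have uniq: "h = h'" if hh: "h \<in> {..<f} \<rightarrow>\<^sub>E K" "h' \<in> {..<f} \<rightarrow>\<^sub>E K"
      "(\<Sum>i<f. smul (h i) (\<alpha> ^ i)) - (\<Sum>i<f. smul (h' i) (\<alpha> ^ i)) \<in> N" for h h'
  proof (rule PiE_ext[OF hh(1,2)])
    fix i assume i: "i \<in> {..<f}"
    have hK: "h j \<in> K" "h' j \<in> K" if "j < f" for j using hh that by auto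
    have "h i - h' i \<in> R.I 1"
      using hh(3) i hK K_ring unfolding diff by (intro indep[of "\<lambda>i. h i - h' i"]) (auto intro!: R.diff_mem)
    then show "h i = h' i" using KI hK i by simp
  qed
  have "inj_on (\<lambda>h. \<Sum>i<f. smul (h i) (\<alpha> ^ i)) ({..<f} \<rightarrow>\<^sub>E K)"
    by (rule inj_onI, rule uniq) (auto simp: zero_N)
  then have "card T = card K ^ f" unfolding T_def by (simp add: card_image card_PiE)
  moreover have "transversal \<Delta> N T"
    unfolding transversal_def
  proof (intro conjI ballI)
    have "(\<Sum>i<f. smul (h i) (\<alpha> ^ i)) \<in> \<Delta>" if "h \<in> {..<f} \<rightarrow>\<^sub>E K" for h
      using that K_ring \<alpha>p by (intro sum_mem smul_mem) auto
    then show "T \<subseteq> \<Delta>" unfolding T_def by blast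
    fix x assume "x \<in> \<Delta>"
    then obtain c where c: "\<forall>i<f. c i \<in> val_ring v" "x - (\<Sum>i<f. smul (c i) (\<alpha> ^ i)) \<in> N"
      using S_all unfolding S_def by blast
    define h0 where "h0 i = (SOME a. a \<in> K \<and> c i - a \<in> R.I 1)" for i
    have h0: "h0 i \<in> K \<and> c i - h0 i \<in> R.I 1" if "i < f" for i
      unfolding h0_def by (rule someI_ex[OF transversal_ex[OF K(1)]]) (use c(1) that in simp)
    define h where "h = restrict h0 {..<f}"
    have h: "h \<in> {..<f} \<rightarrow>\<^sub>E K" "\<And>i. i < f \<Longrightarrow> c i - h i \<in> R.I 1" using h0 by (auto simp: h_def)
    have "(\<Sum>i<f. smul (c i) (\<alpha> ^ i)) - (\<Sum>i<f. smul (h i) (\<alpha> ^ i)) \<in> N"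
      unfolding diff using h(2) \<alpha>p by (intro N_sum smul_I_N) auto
    then have "(x - (\<Sum>i<f. smul (c i) (\<alpha> ^ i))) + ((\<Sum>i<f. smul (c i) (\<alpha> ^ i)) - (\<Sum>i<f. smul (h i) (\<alpha> ^ i))) \<in> N"
      by (rule N_add[OF c(2)])
    then have xh: "x - (\<Sum>i<f. smul (h i) (\<alpha> ^ i)) \<in> N" by simp
    show "\<exists>!r. r \<in> T \<and> x - r \<in> N"
    proof (rule ex1I[of _ "\<Sum>i<f. smul (h i) (\<alpha> ^ i)"])
      show "(\<Sum>i<f. smul (h i) (\<alpha> ^ i)) \<in> T \<and> x - (\<Sum>i<f. smul (h i) (\<alpha> ^ i)) \<in> N"
        unfolding T_def using h(1) xh by blast
      fix r assume r: "r \<in> T \<and> x - r \<in> N"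
      then obtain h' where h': "h' \<in> {..<f} \<rightarrow>\<^sub>E K" "r = (\<Sum>i<f. smul (h' i) (\<alpha> ^ i))" unfolding T_def by blast
      have "(x - (\<Sum>i<f. smul (h i) (\<alpha> ^ i))) - (x - r) \<in> N" using xh conjunct2[OF r] by (rule N_diff)
      then have "r - (\<Sum>i<f. smul (h i) (\<alpha> ^ i)) \<in> N" by simp
      then show "r = (\<Sum>i<f. smul (h i) (\<alpha> ^ i))" using uniq[OF h'(1) h(1)] unfolding h'(2) by simp
    qed
  qed
  ultimately have "card F = card K ^ f" using transversal_card[OF F(2) _ zero_N N_diff] by metis
  moreover have "f \<le> d"
  proof (rule power_independent_le_index)
    fix c assume c: "(\<Sum>i<f. smul (c i) (\<alpha> ^ i)) = 0"
    show "\<forall>i<f. c i = 0"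
    proof (rule ccontr)
      assume "\<not> ?thesis"
      then obtain i where "i \<in> {..<f}" "c i \<noteq> 0" by blast
      then obtain a j where a: "j \<in> {..<f}" "a * c j = 1" "\<forall>i\<in>{..<f}. a * c i \<in> val_ring v"
        using scale_to_unit[of "{..<f}" i c] by blast
      have "smul a (\<Sum>i<f. smul (c i) (\<alpha> ^ i)) = (\<Sum>i<f. smul (a * c i) (\<alpha> ^ i))"
        by (simp add: scale_sum_right)
      then have "(\<Sum>i<f. smul (a * c i) (\<alpha> ^ i)) \<in> N" using c zero_N by simp
      then have "a * c j \<in> R.I 1" using a by (intro indep[of "\<lambda>i. a * c i"]) auto
      then show False using a(2) R.one_notin_I[of 0] by simp
    qed
  qed
  ultimately show ?thesis by blast
qed

text \<open>The powers of \<open>p\<close> below \<open>e\<close> have valuations that are distinct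
  modulo \<open>e\<close>. In a scaled relation let \<open>l\<close> be the first index whose
  coefficient is a unit: the terms before it lie in \<open>J 1\<close>, those after it in the ideal
  of exponent \<open>Suc l\<close>, but the term at \<open>l\<close> does not lie there.\<close>

lemma ramification_index_le:
  assumes p: "nc_dvr \<Delta> p" and J: "J 1 = nc_dvr.I \<Delta> p e"
  shows "e \<le> d"
proof (rule power_independent_le_index)
  interpret D: nc_dvr \<Delta> p by (rule p)
  fix c assume c: "(\<Sum>i<e. smul (c i) (p ^ i)) = 0"
  show "\<forall>i<e. c i = 0"
  proof (rule ccontr)
    assume "\<not> ?thesis"
    then obtain i where "i \<in> {..<e}" "c i \<noteq> 0" by blast
    then obtain a j where a: "j \<in> {..<e}" "a * c j = 1" "\<forall>i\<in>{..<e}. a * c i \<in> val_ring v"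
      using scale_to_unit[of "{..<e}" i c] by blast
    define b where "b i = a * c i" for i
    have b: "b i \<in> val_ring v" if "i < e" for i using a that by (simp add: b_def)
    have "smul a (\<Sum>i<e. smul (c i) (p ^ i)) = (\<Sum>i<e. smul (b i) (p ^ i))"
      by (simp add: scale_sum_right b_def)
    then have s: "(\<Sum>i<e. smul (b i) (p ^ i)) = 0" using c by simp
    define l where "l = (LEAST i. b i \<notin> R.I 1)"
    have bj: "b j \<notin> R.I 1" using a R.one_notin_I[of 0] by (simp add: b_def)
    have l: "b l \<notin> R.I 1" unfolding l_def using bj by (rule LeastI)
    have "l \<le> j" unfolding l_def using bj by (rule Least_le)
    then have le: "l < e" using a(1) by simp
    have low: "b i \<in> R.I 1" if "i < l" for i using not_less_Least[OF that[unfolded l_def]] by simp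
    have bl: "b l \<noteq> 0" "inverse (b l) \<in> val_ring v" using R.unit_iff[of "b l"] b le l by auto
    have "smul (b i) (p ^ i) \<in> D.I (Suc l)" if "i \<in> {..<e} - {l}" for i
    proof (cases "i < l")
      case True
      obtain b' where b': "b i = t ^ 1 * b'" "b' \<in> val_ring v" using low[OF True] unfolding R.I_def by blast
      have "smul (b i) (p ^ i) = smul (t ^ 1) (smul b' (p ^ i))" unfolding b'(1) by simp
      also have "\<dots> = emb (t ^ 1) * smul b' (p ^ i)" by (rule smul_emb)
      also have "\<dots> = varpi ^ 1 * smul b' (p ^ i)" by simp
      finally have "smul (b i) (p ^ i) \<in> J 1"
        using J_mult_right[OF varpi_power_J smul_mem[OF b'(2) D.power_mem[OF D.p_mem]]] by (simp only:)
      then show ?thesis using D.I_mono[of "Suc l" e] le unfolding J by auto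
    next
      case False
      then have "p ^ i \<in> D.I (Suc l)" using that D.p_pow_I[of i] D.I_mono[of "Suc l" i] by auto
      then show ?thesis unfolding smul_emb[of "b i" "p ^ i"] using that by (intro D.I_mult_left emb_mem b) auto
    qed
    then have rest: "(\<Sum>i\<in>{..<e} - {l}. smul (b i) (p ^ i)) \<in> D.I (Suc l)" by (rule D.I_sum)
    have "smul (b l) (p ^ l) + (\<Sum>i\<in>{..<e} - {l}. smul (b i) (p ^ i)) = 0"
      using s sum.remove[of "{..<e}" l "\<lambda>i. smul (b i) (p ^ i)"] le by simp
    then have "smul (b l) (p ^ l) \<in> D.I (Suc l)" using D.I_uminus[OF rest] by (metis eq_neg_iff_add_eq_0)
    then have "emb (inverse (b l)) * smul (b l) (p ^ l) \<in> D.I (Suc l)"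
      using bl(2) emb_mem by (intro D.I_mult_left)
    then have "smul (inverse (b l)) (smul (b l) (p ^ l)) \<in> D.I (Suc l)"
      by (simp only: smul_emb[of "inverse (b l)" "smul (b l) (p ^ l)"])
    then have "p ^ l * 1 \<in> D.I (l + 1)" using bl(1) by simp
    then have "1 \<in> D.I 1" by (simp only: D.p_pow_mult_I)
    then show False using D.one_notin_I[of 0] by simp
  qed
qed

theorem maximal_order_structure:
  "\<exists>p e F. nc_dvr \<Delta> p \<and> N = nc_dvr.I \<Delta> p 1 \<and> e \<ge> 1 \<and> (\<forall>k. J k = nc_dvr.I \<Delta> p (e * k)) \<and>
     finite F \<and> transversal \<Delta> (nc_dvr.I \<Delta> p 1) F \<and> card F = card K ^ d"
proof -
  obtain p where p: "nc_dvr \<Delta> p" "\<And>x. x \<in> N \<longleftrightarrow> (\<exists>y\<in>\<Delta>. x = p * y)" using uniformizer by blast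
  interpret D: nc_dvr \<Delta> p by (rule p)
  have NI: "N = D.I 1" unfolding D.I_def using p(2) by auto
  have vD: "varpi \<in> \<Delta>" using varpi_N N_subset by blast
  \<comment> \<open>The ramification index arises as the exponent of \<open>p\<close> in
    \<open>varpi\<close>.\<close>
  obtain e u where u: "varpi = p ^ e * u" "u \<in> \<Delta>" "inverse u \<in> \<Delta>" "u \<noteq> 0"
    using D.unit_factor[OF vD varpi_nonzero] by blast
  have e: "e \<ge> 1"
  proof (rule ccontr)
    assume "\<not> e \<ge> 1"
    then have "e = 0" by simp
    then have "varpi * inverse u = 1" using u(1,4) by simp
    then show False using N_not_unit[OF varpi_N u(3)] by blast
  qed
  have Jk: "J k = D.I (e * k)" for k
  proof
    have vI: "varpi ^ k \<in> D.I (e * k)"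
    proof (induction k)
      case 0
      then show ?case using D.I_0 one_mem by simp
    next
      case (Suc k)
      have "varpi \<in> D.I e" unfolding u(1) using D.p_pow_I u(2) by (rule D.I_mult_right)
      then show ?case using D.I_mult[OF _ Suc] by simp
    qed
    show "J k \<subseteq> D.I (e * k)"
    proof
      fix x assume "x \<in> J k"
      then obtain y where y: "x = smul (t ^ k) y" "y \<in> \<Delta>" unfolding J_def by blast
      have "x = varpi ^ k * y" unfolding y(1) smul_emb[of "t ^ k" y] emb_power by (rule refl)
      then show "x \<in> D.I (e * k)" using D.I_mult_right[OF vI y(2)] by simp
    qed
    have pJ: "p ^ (e * k) \<in> J k"
    proof -
      have "p ^ e = varpi ^ 1 * inverse u" using u by (simp add: mult.assoc)
      then have pe: "p ^ e \<in> J 1" using J_mult_right[OF varpi_power_J[of 1] u(3)] by simp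
      have "(p ^ e) ^ k \<in> J k"
      proof (induction k)
        case 0
        then show ?case by (simp add: J_0 one_mem)
      next
        case (Suc k)
        then show ?case using J_mult[OF pe Suc] by simp
      qed
      then show ?thesis by (simp add: power_mult)
    qed
    show "D.I (e * k) \<subseteq> J k"
      unfolding D.I_def using J_mult_right[OF pJ] by blast
  qed
  obtain F where F: "finite F" "transversal \<Delta> N F" using transversal_N by blast
  obtain \<alpha> where \<alpha>0: "\<alpha> \<in> \<Delta>" "\<forall>x\<in>\<Delta>. x \<notin> D.I 1 \<longrightarrow> (\<exists>i. x - \<alpha> ^ i \<in> D.I 1)"
    using D.residue_generator[OF F(1) F(2)[unfolded NI]] by (elim bexE)
  have \<alpha>: "\<exists>i. x - \<alpha> ^ i \<in> N" if "x \<in> \<Delta>" "x \<notin> N" for x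
    using \<alpha>0(2)[rule_format, OF that(1)] that(2) unfolding NI by (elim meta_mp)
  obtain f where f: "f \<le> d" "card F = card K ^ f" using residue_degree[of F \<alpha>] F \<alpha>0(1) \<alpha> by metis
  have J1: "J 1 = D.I e" using Jk[of 1] by simp
  then have ed: "e \<le> d" using ramification_index_le[OF p(1)] by blast
  obtain T where T: "transversal \<Delta> (D.I e) T" "card T = card F ^ e"
    using D.transversal_I[OF F(2)[unfolded NI], of e] F(1) by metis
  obtain G where G: "transversal \<Delta> (J 1) G" "card G = card K ^ (d ^ 2)" using J_transversal by (elim exE conjE)
  \<comment> \<open>Two counts of \<open>\<Delta>\<close> modulo \<open>J 1\<close>, one by digits
    in \<open>p\<close> and one by coordinates in the basis, determine \<open>f * e\<close>.\<close>
  have "card T = card G" using transversal_card[OF T(1) G(1)[unfolded J1] D.I_zero D.I_diff] .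
  then have "card K ^ (f * e) = card K ^ (d ^ 2)" using T(2) G(2) f(2) by (simp add: power_mult)
  then have fe: "f * e = d * d" using K_card by (simp add: power2_eq_square)
  have "f = d"
  proof (rule ccontr)
    assume "f \<noteq> d"
    then have "f < d" using f by simp
    then have "f * e < d * d" using ed e by (intro mult_less_le_imp_less) auto
    then show False using fe by simp
  qed
  show ?thesis
  proof (intro exI conjI allI)
    show "nc_dvr \<Delta> p" by (rule p(1))
    show "N = D.I 1" by (rule NI)
    show "e \<ge> 1" by (rule e)
    show "J k = D.I (e * k)" for k by (rule Jk)
    show "finite F" by (rule F(1))
    show "transversal \<Delta> (D.I 1) F" using F(2) unfolding NI .
    show "card F = card K ^ d" using f(2) \<open>f = d\<close> by simp
  qed
qed

end

no_notation fps_nth (infixl "$" 75)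

section \<open>Vectors and matrices modulo powers of the maximal ideal\<close>

context nc_dvr
begin

definition U :: "'d set" where "U = {u \<in> \<Delta>. u \<notin> I 1}"

definition V :: "nat \<Rightarrow> ('d ^ 'n) set" where "V k = {x. \<forall>i. x $ i \<in> I k}"

definition M :: "nat \<Rightarrow> ('d ^ 'n ^ 'n) set" where "M k = {A. \<forall>i j. A $ i $ j \<in> I k}"

text \<open>For primitive vectors this is equality of projective points modulo
  \<open>I k\<close>.\<close>

definition rel :: "nat \<Rightarrow> 'd ^ 'n \<Rightarrow> 'd ^ 'n \<Rightarrow> bool" where
  "rel k y y' \<longleftrightarrow> (\<exists>u\<in>U. y - u *s y' \<in> V k)"

lemma U_D: "u \<in> U \<Longrightarrow> u \<in> \<Delta>" "u \<in> U \<Longrightarrow> u \<noteq> 0" "u \<in> U \<Longrightarrow> inverse u \<in> \<Delta>"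
  using unit_iff[of u] by (auto simp: U_def)

lemma U_I: "u \<in> \<Delta> \<Longrightarrow> u \<noteq> 0 \<Longrightarrow> inverse u \<in> \<Delta> \<Longrightarrow> u \<in> U"
  using unit_iff[of u] by (auto simp: U_def)

lemma U_one: "1 \<in> U" by (rule U_I) (simp_all add: one_mem)

lemma U_inverse: "u \<in> U \<Longrightarrow> inverse u \<in> U"
  by (rule U_I) (simp_all add: U_D)

lemma U_mult: "u \<in> U \<Longrightarrow> w \<in> U \<Longrightarrow> u * w \<in> U"
  by (rule U_I) (simp_all add: U_D mult_mem nonzero_inverse_mult_distrib)

lemma U_cong: assumes "u \<in> U" "a - u \<in> I 1" shows "a \<in> U"
proof -
  have "a = u + (a - u)" by simp
  then have "a \<in> \<Delta>" using add_mem[OF U_D(1)[OF assms(1)]] assms(2) I_subset by (metis subsetD)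
  moreover have "a \<notin> I 1"
  proof
    assume "a \<in> I 1"
    from I_diff[OF this assms(2)] show False using assms(1) by (simp add: U_def)
  qed
  ultimately show ?thesis by (simp add: U_def)
qed

lemma order_units_eq: "order_units \<Delta> = U"
proof (intro equalityI subsetI)
  fix z assume "z \<in> order_units \<Delta>"
  then obtain w where w: "z \<in> \<Delta>" "w \<in> \<Delta>" "z * w = 1" unfolding order_units_def by auto
  then have "z \<noteq> 0" "inverse z = w" by (auto intro: inverse_unique)
  then show "z \<in> U" using w by (intro U_I) auto
next
  fix z assume "z \<in> U"
  then show "z \<in> order_units \<Delta>"
    unfolding order_units_def by (intro CollectI conjI bexI[of _ "inverse z"]) (simp_all add: U_D)
qed

lemma V_0: "y \<in> V 0 \<longleftrightarrow> (\<forall>i. y $ i \<in> \<Delta>)" by (simp add: V_def I_0)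

lemma M_0: "A \<in> M 0 \<longleftrightarrow> (\<forall>i j. A $ i $ j \<in> \<Delta>)" by (simp add: M_def I_0)

lemma V_mono: "y \<in> V l \<Longrightarrow> k \<le> l \<Longrightarrow> y \<in> V k" unfolding V_def using I_mono by blast

lemma M_mono: "A \<in> M l \<Longrightarrow> k \<le> l \<Longrightarrow> A \<in> M k" unfolding M_def using I_mono by blast

lemma V_diff: "y \<in> V k \<Longrightarrow> z \<in> V k \<Longrightarrow> y - z \<in> V k" by (simp add: V_def I_diff)

lemma V_add: "y \<in> V k \<Longrightarrow> z \<in> V k \<Longrightarrow> y + z \<in> V k" by (simp add: V_def I_add)

lemma V_zero: "0 \<in> V k" by (simp add: V_def I_zero)

lemma V_smult: "y \<in> V k \<Longrightarrow> u \<in> \<Delta> \<Longrightarrow> u *s y \<in> V k" by (simp add: V_def I_mult_left)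

lemma M_diff: "A \<in> M k \<Longrightarrow> B \<in> M k \<Longrightarrow> A - B \<in> M k" by (simp add: M_def I_diff)

lemma M_add: "A \<in> M k \<Longrightarrow> B \<in> M k \<Longrightarrow> A + B \<in> M k" by (simp add: M_def I_add)

lemma axis_V: "axis i 1 \<in> V 0" by (simp add: V_0 axis_def one_mem zero_mem)

lemma mat_1_M: "mat 1 \<in> M 0" by (simp add: M_0 mat_def one_mem zero_mem)

lemma vm_nth: "(y v* A) $ j = (\<Sum>i\<in>UNIV. y $ i * A $ i $ j)" for A :: "'d ^ 'n ^ 'n"
  by (simp add: vector_matrix_mult_def)

lemma mm_nth: "(A ** B) $ i = A $ i v* B" for A B :: "'d ^ 'n ^ 'n"
  by (simp add: vec_eq_iff vm_nth matrix_matrix_mult_def)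

lemma vm_diff: "(y - z) v* A = y v* A - z v* A" for A :: "'d ^ 'n ^ 'n"
  by (simp add: vec_eq_iff vm_nth left_diff_distrib sum_subtractf)

lemma vm_diff_right: "y v* (A - B) = y v* A - y v* B" for A B :: "'d ^ 'n ^ 'n"
  by (simp add: vec_eq_iff vm_nth right_diff_distrib sum_subtractf)

lemma vm_smult: "(u *s y) v* A = u *s (y v* A)" for A :: "'d ^ 'n ^ 'n"
  by (simp add: vec_eq_iff vm_nth sum_distrib_left mult.assoc)

lemma mm_diff_left: "(A - B) ** C = A ** C - B ** C" for A B C :: "'d ^ 'n ^ 'n"
  by (simp add: vec_eq_iff matrix_matrix_mult_def left_diff_distrib sum_subtractf)

lemma mm_diff_right: "C ** (A - B) = C ** A - C ** B" for A B C :: "'d ^ 'n ^ 'n"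
  by (simp add: vec_eq_iff matrix_matrix_mult_def right_diff_distrib sum_subtractf)

lemma vm_one: "y v* mat 1 = y" for y :: "'d ^ 'n"
  by (simp add: vec_eq_iff vm_nth mat_def if_distrib[of "\<lambda>a. _ * a"] cong: if_cong)

lemma axis_vm: "axis i 1 v* A = A $ i" for A :: "'d ^ 'n ^ 'n"
  by (simp add: vec_eq_iff vm_nth axis_def if_distrib[of "\<lambda>a. a * _"] cong: if_cong)

lemma vm_V: "y \<in> V k \<Longrightarrow> A \<in> M 0 \<Longrightarrow> y v* A \<in> V k"
  unfolding V_def M_def by (auto simp: vm_nth I_0 intro!: I_sum I_mult_right)

lemma vm_M: "y \<in> V 0 \<Longrightarrow> A \<in> M k \<Longrightarrow> y v* A \<in> V k"
  unfolding V_def M_def by (auto simp: vm_nth I_0 intro!: I_sum I_mult_left)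

lemma M_row: "A \<in> M k \<longleftrightarrow> (\<forall>i. A $ i \<in> V k)" by (simp add: M_def V_def)

lemma mm_left: "A \<in> M k \<Longrightarrow> B \<in> M 0 \<Longrightarrow> A ** B \<in> M k"
  unfolding M_row[of "A ** B"] M_row[of A k] mm_nth by (intro allI vm_V) (rule spec)

lemma mm_right: "A \<in> M 0 \<Longrightarrow> B \<in> M k \<Longrightarrow> A ** B \<in> M k"
  unfolding M_row[of "A ** B"] M_row[of A 0] mm_nth by (intro allI vm_M) (rule spec)

lemma M_separated: assumes "\<And>k. A - B \<in> M k" shows "A = B"
proof -
  have "A $ i $ j - B $ i $ j = 0" for i j
    by (rule I_separated) (use assms in \<open>simp add: M_def\<close>)
  then show ?thesis by (simp add: vec_eq_iff)
qed

lemma M_complete: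
  assumes A: "\<And>k. A k \<in> M 0" "\<And>k. A (Suc k) - A k \<in> M k"
  shows "\<exists>L\<in>M 0. \<forall>k. L - A k \<in> M k"
proof -
  define l where "l i j = (SOME l. l \<in> \<Delta> \<and> (\<forall>k. l - A k $ i $ j \<in> I k))" for i j
  have l: "l i j \<in> \<Delta> \<and> (\<forall>k. l i j - A k $ i $ j \<in> I k)" for i j
  proof -
    have "\<exists>L\<in>\<Delta>. \<forall>k. L - A k $ i $ j \<in> I k"
      by (rule I_complete) (use A in \<open>simp_all add: M_def I_0\<close>)
    then have "\<exists>l. l \<in> \<Delta> \<and> (\<forall>k. l - A k $ i $ j \<in> I k)" by (elim bexE) (rule exI, rule conjI)
    then show ?thesis unfolding l_def by (rule someI_ex)
  qed
  then show ?thesis by (intro bexI[of _ "\<chi> i j. l i j"]) (simp_all add: M_def I_0)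
qed

lemma rel_refl: "rel k y y"
  unfolding rel_def by (rule bexI[OF _ U_one]) (simp add: V_zero)

lemma rel_sym: assumes "rel k y z" shows "rel k z y"
proof -
  obtain u where u: "u \<in> U" "y - u *s z \<in> V k" using assms unfolding rel_def by (elim bexE)
  have "0 - inverse u *s (y - u *s z) \<in> V k" by (intro V_diff V_zero V_smult u U_D)
  also have "0 - inverse u *s (y - u *s z) = z - inverse u *s y"
    using U_D(2)[OF u(1)] by (simp add: vec_eq_iff right_diff_distrib mult.assoc[symmetric])
  finally show ?thesis unfolding rel_def using U_inverse[OF u(1)] by (intro bexI)
qed

lemma rel_trans: assumes "rel k y z" "rel k z w" shows "rel k y w"
proof -
  obtain u where u: "u \<in> U" "y - u *s z \<in> V k" using assms(1) unfolding rel_def by (elim bexE)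
  obtain a where a: "a \<in> U" "z - a *s w \<in> V k" using assms(2) unfolding rel_def by (elim bexE)
  have "(y - u *s z) + u *s (z - a *s w) \<in> V k" by (intro V_add V_smult u a U_D)
  also have "(y - u *s z) + u *s (z - a *s w) = y - (u * a) *s w"
    by (simp add: vec_eq_iff right_diff_distrib mult.assoc)
  finally show ?thesis unfolding rel_def using U_mult[OF u(1) a(1)] by (intro bexI)
qed

lemma rel_vm: assumes "rel k y z" "A \<in> M 0" shows "rel k (y v* A) (z v* A)"
proof -
  obtain u where u: "u \<in> U" "y - u *s z \<in> V k" using assms(1) unfolding rel_def by (elim bexE)
  have "(y - u *s z) v* A \<in> V k" using u(2) assms(2) by (rule vm_V)
  then show ?thesis unfolding rel_def vm_diff vm_smult using u(1) by (intro bexI)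
qed

lemma rel_smult: "u \<in> U \<Longrightarrow> rel k (u *s y) y"
  unfolding rel_def by (rule bexI) (simp_all add: V_zero)

lemma GL_iff: "A \<in> carrier (GL \<Delta>) \<longleftrightarrow> A \<in> M 0 \<and> (\<exists>B\<in>M 0. B ** A = mat 1 \<and> A ** B = mat 1)"
  unfolding GL_def units_of_carrier Units_def mat_monoid_def by (auto simp: Bex_def M_0)

lemma GL_mult: "A \<otimes>\<^bsub>GL \<Delta>\<^esub> B = A ** B" by (simp add: GL_def units_of_def mat_monoid_def)

lemma GL_one: "\<one>\<^bsub>GL \<Delta>\<^esub> = mat 1" by (simp add: GL_def units_of_def mat_monoid_def)

lemma GL_group: "group (GL \<Delta> :: ('d ^ 'n ^ 'n) monoid)"
proof -
  have "monoid (mat_monoid \<Delta> :: ('d ^ 'n ^ 'n) monoid)"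
  proof (rule monoidI)
    fix A B :: "'d ^ 'n ^ 'n"
    assume "A \<in> carrier (mat_monoid \<Delta>)" "B \<in> carrier (mat_monoid \<Delta>)"
    then show "A \<otimes>\<^bsub>mat_monoid \<Delta>\<^esub> B \<in> carrier (mat_monoid \<Delta>)"
      using mm_left[of A 0 B] by (simp add: mat_monoid_def M_0)
  qed (simp_all add: mat_monoid_def mat_1_M[unfolded M_0] matrix_mul_assoc)
  then show ?thesis unfolding GL_def by (rule monoid.units_group)
qed

end

section \<open>Congruence subgroups and the stabiliser of a point\<close>

locale primitive_vector = nc_dvr \<Delta> p for \<Delta> :: "'d::division_ring set" and p +
  fixes F :: "'d set" and x :: "'d ^ 'n"
  assumes F: "finite F" "transversal \<Delta> (I 1) F" "card F \<ge> 2"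
    and x: "x \<in> V 0" "x \<notin> V 1"
    and dim_ge_2: "CARD('n) \<ge> 2"
begin

sublocale GL: group "GL \<Delta> :: ('d ^ 'n ^ 'n) monoid" by (rule GL_group)

abbreviation Gc :: "('d ^ 'n ^ 'n) set" where "Gc \<equiv> carrier (GL \<Delta>)"

abbreviation minv :: "'d ^ 'n ^ 'n \<Rightarrow> 'd ^ 'n ^ 'n" where "minv A \<equiv> inv\<^bsub>GL \<Delta>\<^esub> A"

lemma Gc_M: "A \<in> Gc \<Longrightarrow> A \<in> M 0" by (simp add: GL_iff)

lemma Gc_I: "A \<in> M 0 \<Longrightarrow> B \<in> M 0 \<Longrightarrow> A ** B = mat 1 \<Longrightarrow> B ** A = mat 1 \<Longrightarrow> A \<in> Gc"
  unfolding GL_iff by (intro conjI bexI)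

lemma Gc_mult: "A \<in> Gc \<Longrightarrow> B \<in> Gc \<Longrightarrow> A ** B \<in> Gc" using GL.m_closed by (simp only: GL_mult)

lemma Gc_one: "mat 1 \<in> Gc" using GL.one_closed by (simp only: GL_one)

lemma minv_Gc: "A \<in> Gc \<Longrightarrow> minv A \<in> Gc" by (rule GL.inv_closed)

lemma minv_l: "A \<in> Gc \<Longrightarrow> minv A ** A = mat 1" using GL.l_inv by (simp only: GL_mult GL_one)

lemma minv_r: "A \<in> Gc \<Longrightarrow> A ** minv A = mat 1" using GL.r_inv by (simp only: GL_mult GL_one)

lemma vm_minv: "A \<in> Gc \<Longrightarrow> y v* A v* minv A = y" "A \<in> Gc \<Longrightarrow> y v* minv A v* A = y"
  by (simp_all add: vector_matrix_mul_assoc minv_l minv_r vm_one)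

lemma minv_cancel: "A \<in> Gc \<Longrightarrow> A ** (minv A ** B) = B" "A \<in> Gc \<Longrightarrow> minv A ** (A ** B) = B"
  by (simp_all add: matrix_mul_assoc minv_l minv_r)

lemma minv_cancel_right: "A \<in> Gc \<Longrightarrow> B ** A ** minv A = B" "A \<in> Gc \<Longrightarrow> B ** minv A ** A = B"
  by (simp_all add: matrix_mul_assoc[symmetric] minv_l minv_r)

lemma vm_not_V: "A \<in> Gc \<Longrightarrow> y v* A \<in> V k \<Longrightarrow> y \<in> V k"
  using vm_V[of "y v* A" k "minv A"] by (simp add: vm_minv Gc_M minv_Gc)

definition N :: "nat \<Rightarrow> ('d ^ 'n ^ 'n) set" where "N k = {A \<in> Gc. A - mat 1 \<in> M k}"

lemma N_subgroup: "subgroup (N k) (GL \<Delta>)"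
proof (rule GL.subgroupI)
  show "N k \<subseteq> Gc" by (auto simp: N_def)
  show "N k \<noteq> {}" using Gc_one by (auto simp: N_def M_def I_zero)
  fix A assume A: "A \<in> N k"
  then have A': "A \<in> Gc" "A - mat 1 \<in> M k" by (auto simp: N_def)
  have "0 - (A - mat 1) \<in> M k" by (rule M_diff[OF _ A'(2)]) (simp add: M_def I_zero)
  then have "mat 1 - A \<in> M k" by simp
  then have "minv A ** (mat 1 - A) \<in> M k" by (rule mm_right[OF Gc_M[OF minv_Gc[OF A'(1)]]])
  then show "minv A \<in> N k" using A' by (simp add: N_def mm_diff_right minv_l minv_Gc)
  fix B assume B: "B \<in> N k"
  then have B': "B \<in> Gc" "B - mat 1 \<in> M k" by (auto simp: N_def)
  have "A ** (B - mat 1) + (A - mat 1) \<in> M k" using A' B' Gc_M by (intro M_add mm_right) auto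
  then show "A \<otimes>\<^bsub>GL \<Delta>\<^esub> B \<in> N k" using A' B' by (simp add: GL_mult N_def mm_diff_right Gc_mult)
qed

lemma N_normal: "N k \<lhd> GL \<Delta>"
proof (rule GL.normal_invI[OF N_subgroup])
  fix A B assume A: "A \<in> Gc" and "B \<in> N k"
  then have B: "B \<in> Gc" "B - mat 1 \<in> M k" by (auto simp: N_def)
  have "A ** (B - mat 1) ** minv A \<in> M k" by (intro mm_left mm_right B Gc_M minv_Gc A)
  then show "A \<otimes>\<^bsub>GL \<Delta>\<^esub> B \<otimes>\<^bsub>GL \<Delta>\<^esub> minv A \<in> N k"
    using A B by (simp add: GL_mult N_def mm_diff_right mm_diff_left minv_r Gc_mult minv_Gc)
qed

lemma N_0: "N 0 = Gc"
proof -
  have "A - mat 1 \<in> M 0" if "A \<in> Gc" for A using M_diff[OF Gc_M[OF that] mat_1_M] .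
  then show ?thesis by (auto simp: N_def)
qed

text \<open>Multiplying by the inverse of \<open>A\<close>, which is integral, turns an additive
  neighbourhood of \<open>A\<close> into a coset of \<open>N k\<close>.\<close>

lemma N_cong:
  assumes A: "A \<in> Gc" and B: "B \<in> Gc"
  shows "B - A \<in> M k \<longleftrightarrow> (\<exists>n\<in>N k. B = A ** n)"
proof
  assume "B - A \<in> M k"
  then have "minv A ** (B - A) \<in> M k" by (intro mm_right Gc_M minv_Gc A)
  then have "minv A ** B \<in> N k" using A B by (simp add: N_def mm_diff_right minv_l Gc_mult minv_Gc)
  then show "\<exists>n\<in>N k. B = A ** n" by (rule bexI[rotated]) (simp add: minv_cancel A)
next
  assume "\<exists>n\<in>N k. B = A ** n"
  then obtain n where n: "n \<in> N k" "B = A ** n" by (elim bexE)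
  then have "A ** (n - mat 1) \<in> M k" by (intro mm_right Gc_M A) (simp add: N_def)
  then show "B - A \<in> M k" by (simp add: n mm_diff_right)
qed

definition P :: "('d ^ 'n ^ 'n) set" where "P = {A \<in> Gc. \<exists>u\<in>U. x v* A = u *s x}"

lemma stabiliser_eq_P: "proj_stabiliser \<Delta> (proj_point \<Delta> x) = P"
proof -
  have pt: "proj_point \<Delta> x = {z *s x | z. z \<in> U}"
    unfolding proj_point_def order_units_eq vector_scalar_mult_def ..
  define S where "S = {z *s x | z. z \<in> U}"
  have SI: "z *s x \<in> S" if "z \<in> U" for z unfolding S_def using that by (intro CollectI exI[of _ z] conjI) (rule refl)
  have SE: "\<exists>z. y = z *s x \<and> z \<in> U" if "y \<in> S" for y using that unfolding S_def by (rule CollectD)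
  have "(\<lambda>y. y v* A) ` S = S \<longleftrightarrow> (\<exists>u\<in>U. x v* A = u *s x)" for A
  proof
    assume eq: "(\<lambda>y. y v* A) ` S = S"
    have "x \<in> S" using SI[OF U_one] by simp
    then have "x v* A \<in> (\<lambda>y. y v* A) ` S" by (rule imageI)
    then have "x v* A \<in> S" by (simp only: eq)
    from SE[OF this] show "\<exists>u\<in>U. x v* A = u *s x" by (elim exE conjE) (rule bexI)
  next
    assume "\<exists>u\<in>U. x v* A = u *s x"
    then obtain u where u: "u \<in> U" "x v* A = u *s x" by (elim bexE)
    have zA: "(z *s x) v* A = (z * u) *s x" for z unfolding vm_smult u(2) by simp
    show "(\<lambda>y. y v* A) ` S = S"
    proof (intro equalityI subsetI)
      fix y assume "y \<in> (\<lambda>y. y v* A) ` S"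
      then obtain w where w: "y = w v* A" "w \<in> S" by (elim imageE)
      obtain z where z: "w = z *s x" "z \<in> U" using SE[OF w(2)] by (elim exE conjE)
      show "y \<in> S" unfolding w(1) z(1) zA by (intro SI U_mult z(2) u(1))
    next
      fix y assume "y \<in> S"
      obtain z where z: "y = z *s x" "z \<in> U" using SE[OF \<open>y \<in> S\<close>] by (elim exE conjE)
      have "y = ((z * inverse u) *s x) v* A" unfolding zA z(1) using U_D(2)[OF u(1)] by (simp add: mult.assoc)
      then show "y \<in> (\<lambda>y. y v* A) ` S" by (rule image_eqI) (intro SI U_mult z(2) U_inverse u(1))
    qed
  qed
  then show ?thesis unfolding proj_stabiliser_def pt P_def S_def[symmetric] by simp
qed

lemma P_subgroup: "subgroup P (GL \<Delta>)"
proof (rule GL.subgroupI)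
  show "P \<subseteq> Gc" by (auto simp: P_def)
  have "mat 1 \<in> P" unfolding P_def using Gc_one U_one by (intro CollectI conjI bexI[of _ 1]) (simp_all add: vm_one)
  then show "P \<noteq> {}" by blast
  fix A assume "A \<in> P"
  then obtain u where A: "A \<in> Gc" "u \<in> U" "x v* A = u *s x" unfolding P_def by blast
  have "u *s (x v* minv A) = x" using vm_minv(1)[OF A(1), of x] unfolding A(3) vm_smult .
  then have "x v* minv A = inverse u *s x"
    using U_D(2)[OF A(2)] by (metis left_inverse vector_smult_assoc vector_smult_lid)
  then show "minv A \<in> P" unfolding P_def using minv_Gc[OF A(1)] U_inverse[OF A(2)] by (intro CollectI conjI bexI)
  fix B assume "B \<in> P"
  then obtain w where B: "B \<in> Gc" "w \<in> U" "x v* B = w *s x" unfolding P_def by blast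
  have "x v* (A ** B) = (u * w) *s x" by (simp add: vector_matrix_mul_assoc[symmetric] A(3) B(3) vm_smult)
  then show "A \<otimes>\<^bsub>GL \<Delta>\<^esub> B \<in> P"
    unfolding P_def GL_mult using Gc_mult[OF A(1) B(1)] U_mult[OF A(2) B(2)] by (intro CollectI conjI bexI)
qed

text \<open>Acting from the right, this moves the \<open>i\<close>-th unit vector to
  \<open>z\<close> and fixes the other unit vectors. An inverse has the same shape, which makes
  invertibility explicit.\<close>

definition rowmat :: "'n \<Rightarrow> 'd ^ 'n \<Rightarrow> 'd ^ 'n ^ 'n" where
  "rowmat i z = (\<chi> a. if a = i then z else axis a 1)"

lemma rowmat_nth: "rowmat i z $ a = (if a = i then z else axis a 1)" by (simp add: rowmat_def)

lemma vm_rowmat: "(y v* rowmat i z) $ b = y $ i * z $ b + (if b = i then 0 else y $ b)"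
proof -
  have "(y v* rowmat i z) $ b = y $ i * z $ b + (\<Sum>a\<in>UNIV - {i}. y $ a * rowmat i z $ a $ b)"
    unfolding vm_nth by (subst sum.remove[of UNIV i]) (simp_all add: rowmat_nth)
  also have "(\<Sum>a\<in>UNIV - {i}. y $ a * rowmat i z $ a $ b) = (\<Sum>a\<in>UNIV - {i}. if a = b then y $ b else 0)"
    by (rule sum.cong) (auto simp: rowmat_nth axis_def)
  also have "\<dots> = (if b = i then 0 else y $ b)" by simp
  finally show ?thesis .
qed

lemma rowmat_M: "z \<in> V 0 \<Longrightarrow> rowmat i z \<in> M 0"
  unfolding M_row rowmat_nth by (simp add: axis_V)

lemma rowmat_mult:
  assumes "z v* rowmat i w = axis i 1"
  shows "rowmat i z ** rowmat i w = mat 1"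
proof -
  have "(rowmat i z ** rowmat i w) $ a = axis a 1" for a
    unfolding mm_nth rowmat_nth[of i z] using assms by (simp add: axis_vm rowmat_nth)
  then show ?thesis by (simp add: vec_eq_iff mat_def axis_def)
qed

lemma rowmat_Gc:
  assumes z: "z \<in> V 0" "z $ i \<in> U"
  shows "rowmat i z \<in> Gc"
proof -
  define w where "w = (\<chi> b. if b = i then inverse (z $ i) else - (inverse (z $ i) * z $ b))"
  have "w \<in> V 0" using z U_D(3)[OF z(2)] by (simp add: V_0 w_def uminus_mem mult_mem)
  moreover have "z v* rowmat i w = axis i 1" "w v* rowmat i z = axis i 1"
    using U_D(2)[OF z(2)] by (simp_all add: vec_eq_iff vm_rowmat w_def axis_def mult.assoc[symmetric])
  ultimately show ?thesis using rowmat_M z by (intro Gc_I[of _ "rowmat i w"] rowmat_mult) auto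
qed

text \<open>\<open>y\<close> may have no unit at place \<open>j\<close>, so the \<open>j\<close>-th
  unit vector is first moved to the \<open>i\<close>-th. That the remaining unit vectors stay fixed
  matters later, when \<open>B\<close> has to fix the pivot.\<close>

lemma reach:
  assumes y: "y \<in> V 0" "y $ i \<in> U"
  shows "\<exists>B\<in>Gc. axis j 1 v* B = y \<and> (\<forall>k. k \<noteq> i \<longrightarrow> k \<noteq> j \<longrightarrow> axis k 1 v* B = axis k 1)"
proof (cases "i = j")
  case True
  then show ?thesis using rowmat_Gc[OF y] by (intro bexI[of _ "rowmat i y"]) (simp_all add: axis_vm rowmat_nth)
next
  case False
  \<comment> \<open>\<open>B1\<close> sends the \<open>j\<close>-th unit vector to the sum of the
    two, and \<open>B2\<close> takes this sum to the \<open>i\<close>-th one.\<close>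
  define B1 where "B1 = rowmat j (axis i 1 + axis j 1)"
  define B2 where "B2 = rowmat i (axis i 1 - axis j 1)"
  have B: "B1 \<in> Gc" "B2 \<in> Gc" unfolding B1_def B2_def
    using False axis_V by (auto intro!: rowmat_Gc V_add V_diff simp: axis_def U_one)
  have "axis j 1 v* B1 v* B2 = axis i 1"
    using False by (simp add: B1_def axis_vm rowmat_nth) (simp add: vec_eq_iff vm_rowmat B2_def axis_def)
  then show ?thesis
    using rowmat_Gc[OF y] B
    by (intro bexI[of _ "B1 ** B2 ** rowmat i y"] Gc_mult conjI allI impI)
      (simp_all add: vector_matrix_mul_assoc[symmetric] axis_vm rowmat_nth B1_def B2_def)
qed

end

lemma finite_vectors: "finite S \<Longrightarrow> finite {y :: 'a ^ 'n. \<forall>i. y $ i \<in> S}"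
  and card_vectors: "card {y :: 'a ^ 'n. \<forall>i. y $ i \<in> S} = card S ^ CARD('n)"
proof -
  have eq: "{y :: 'a ^ 'n. \<forall>i. y $ i \<in> S} = vec_lambda ` (UNIV \<rightarrow>\<^sub>E S)"
  proof (intro equalityI subsetI)
    fix y :: "'a ^ 'n" assume "y \<in> {y. \<forall>i. y $ i \<in> S}"
    then have "vec_nth y \<in> UNIV \<rightarrow>\<^sub>E S" by auto
    then have "vec_lambda (vec_nth y) \<in> vec_lambda ` (UNIV \<rightarrow>\<^sub>E S)" by (rule imageI)
    then show "y \<in> vec_lambda ` (UNIV \<rightarrow>\<^sub>E S)" by simp
  qed auto
  have inj: "inj_on (vec_lambda :: ('n \<Rightarrow> 'a) \<Rightarrow> _) (UNIV \<rightarrow>\<^sub>E S)"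
    by (rule inj_onI) (simp add: vec_lambda_inject)
  show "finite S \<Longrightarrow> finite {y :: 'a ^ 'n. \<forall>i. y $ i \<in> S}"
    unfolding eq by (intro finite_imageI finite_PiE) auto
  show "card {y :: 'a ^ 'n. \<forall>i. y $ i \<in> S} = card S ^ CARD('n)"
    unfolding eq card_image[OF inj] by (simp add: card_PiE)
qed

section \<open>Shells are single double cosets\<close>

context primitive_vector
begin

definition piv :: 'n where "piv = (SOME i. x $ i \<notin> I 1)"

lemma x_piv: "x $ piv \<in> U"
proof -
  have "\<exists>i. x $ i \<notin> I 1" using x(2) by (simp add: V_def)
  then have "x $ piv \<notin> I 1" unfolding piv_def by (rule someI_ex)
  then show ?thesis using x(1) by (simp add: U_def V_0)
qed

definition g :: "'d ^ 'n ^ 'n" where "g = (SOME g. g \<in> Gc \<and> axis piv 1 v* g = x)"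

lemma g: "g \<in> Gc" "axis piv 1 v* g = x"
proof -
  have "\<exists>g. g \<in> Gc \<and> axis piv 1 v* g = x" using reach[OF x(1) x_piv, of piv] by (elim bexE conjE) (rule exI, rule conjI)
  then have "g \<in> Gc \<and> axis piv 1 v* g = x" unfolding g_def by (rule someI_ex)
  then show "g \<in> Gc" "axis piv 1 v* g = x" by simp_all
qed

lemma x_minv_g: "x v* minv g = axis piv 1"
  using vm_minv(1)[OF g(1), of "axis piv 1"] by (simp add: g(2))

text \<open>This is the vector \<open>x A\<close> in coordinates where \<open>x\<close> is the unit
  vector at \<open>piv\<close>; a general point is thereby reduced to a standard one.\<close>

definition zz :: "'d ^ 'n ^ 'n \<Rightarrow> 'd ^ 'n" where "zz A = x v* A v* minv g"

lemma zz_V: "A \<in> Gc \<Longrightarrow> zz A \<in> V 0" "A \<in> Gc \<Longrightarrow> zz A \<notin> V 1"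
proof -
  assume A: "A \<in> Gc"
  show "zz A \<in> V 0" unfolding zz_def by (intro vm_V x Gc_M A minv_Gc g)
  show "zz A \<notin> V 1"
  proof
    assume "zz A \<in> V 1"
    then have "x \<in> V 1" unfolding zz_def by (rule vm_not_V[OF A vm_not_V[OF minv_Gc[OF g(1)]]])
    then show False using x(2) by blast
  qed
qed

lemma zz_surj:
  assumes "\<theta> \<in> V 0" "\<theta> \<notin> V 1"
  shows "\<exists>A\<in>Gc. zz A = \<theta>"
proof -
  obtain i where "\<theta> $ i \<notin> I 1" using assms(2) by (auto simp: V_def)
  then have "\<theta> $ i \<in> U" using assms(1) by (simp add: U_def V_0)
  obtain B where B: "B \<in> Gc" "axis piv 1 v* B = \<theta>"
    using reach[OF assms(1) \<open>\<theta> $ i \<in> U\<close>, of piv] by (elim bexE conjE)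
  have "zz (minv g ** B ** g) = \<theta>"
    by (simp add: zz_def vector_matrix_mul_assoc[symmetric] x_minv_g B(2) vm_minv g(1))
  then show ?thesis by (intro bexI[of _ "minv g ** B ** g"] Gc_mult minv_Gc g B)
qed

lemma rel_zz:
  "rel k (x v* A) (x v* B) \<longleftrightarrow> rel k (zz A) (zz B)"
proof
  assume "rel k (x v* A) (x v* B)"
  then show "rel k (zz A) (zz B)" unfolding zz_def by (rule rel_vm) (intro Gc_M minv_Gc g)
next
  assume "rel k (zz A) (zz B)"
  then have "rel k (zz A v* g) (zz B v* g)" by (rule rel_vm) (intro Gc_M g)
  then show "rel k (x v* A) (x v* B)" by (simp add: zz_def vm_minv g)
qed

definition zok :: "nat \<Rightarrow> 'd ^ 'n \<Rightarrow> bool" where "zok k z \<longleftrightarrow> k = 0 \<or> rel k z (axis piv 1)"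

text \<open>A matrix that fixes the point of \<open>x\<close> modulo \<open>I k\<close> can be
  corrected within \<open>N k\<close>: \<open>u *s zz A\<close> is congruent to the unit vector at
  \<open>piv\<close>, so putting it into the identity matrix as a row gives an element of
  \<open>N k\<close>, and the conjugate \<open>n\<close> of this element maps \<open>x\<close> to a
  unit multiple of \<open>x A\<close>.\<close>

lemma L_iff: "A \<in> P <#>\<^bsub>GL \<Delta>\<^esub> N k \<longleftrightarrow> A \<in> Gc \<and> zok k (zz A)"
proof
  assume "A \<in> P <#>\<^bsub>GL \<Delta>\<^esub> N k"
  then obtain B n where B: "B \<in> P" "n \<in> N k" "A = B ** n" unfolding set_mult_def GL_mult by blast
  then obtain u where u: "B \<in> Gc" "u \<in> U" "x v* B = u *s x" unfolding P_def by blast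
  have n: "n \<in> Gc" "n - mat 1 \<in> M k" using B(2) by (auto simp: N_def)
  have "x v* (n - mat 1) \<in> V k" using x(1) n(2) by (rule vm_M)
  then have "x v* n - 1 *s x \<in> V k" by (simp add: vm_diff_right vm_one)
  then have "rel k (x v* n) x" unfolding rel_def using U_one by (intro bexI)
  then have "rel k (x v* A) (x v* mat 1)"
    using rel_trans[OF rel_smult[OF u(2)]] by (simp add: B(3) vector_matrix_mul_assoc[symmetric] u(3) vm_smult vm_one)
  then show "A \<in> Gc \<and> zok k (zz A)"
    using Gc_mult[OF u(1) n(1)] unfolding rel_zz by (simp add: zok_def B(3) zz_def[of "mat 1"] vm_one x_minv_g)
next
  assume A: "A \<in> Gc \<and> zok k (zz A)"
  show "A \<in> P <#>\<^bsub>GL \<Delta>\<^esub> N k"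
  proof (cases "k = 0")
    case True
    have "mat 1 \<in> P" using subgroup.one_closed[OF P_subgroup] by (simp only: GL_one)
    moreover have "A \<in> N k" using A True by (simp add: N_0)
    ultimately have "mat 1 ** A \<in> P <#>\<^bsub>GL \<Delta>\<^esub> N k" unfolding set_mult_def GL_mult by blast
    then show ?thesis by simp
  next
    case False
    then have "rel k (zz A) (axis piv 1)" using A by (simp add: zok_def)
    then have "rel k (axis piv 1) (zz A)" by (rule rel_sym)
    then obtain u where u: "u \<in> U" "axis piv 1 - u *s zz A \<in> V k" unfolding rel_def by (elim bexE)
    define z where "z = u *s zz A"
    have zV: "z \<in> V 0" unfolding z_def using A by (intro V_smult zz_V U_D u) auto
    have zk: "z - axis piv 1 \<in> V k" using V_diff[OF V_zero u(2)] by (simp add: z_def)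
    then have "z - axis piv 1 \<in> V 1" using V_mono[of _ k 1] False by simp
    then have "z $ piv - 1 \<in> I 1" unfolding V_def by (auto simp: axis_def dest!: spec[of _ piv])
    then have zo: "z $ piv \<in> U" by (rule U_cong[OF U_one])
    define r where "r = rowmat piv z"
    have r: "r \<in> Gc" unfolding r_def using zV zo by (rule rowmat_Gc)
    have "(r - mat 1) $ a \<in> V k" for a
    proof (cases "a = piv")
      case True
      have "mat 1 $ a = (axis a 1 :: 'd ^ 'n)" by (simp add: vec_eq_iff mat_def axis_def)
      then show ?thesis using zk True by (simp add: r_def rowmat_nth)
    next
      case False
      have "mat 1 $ a = (axis a 1 :: 'd ^ 'n)" by (simp add: vec_eq_iff mat_def axis_def)
      then show ?thesis using False by (simp add: r_def rowmat_nth V_zero)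
    qed
    then have "r \<in> N k" using r by (simp add: N_def M_row)
    then have "minv g \<otimes>\<^bsub>GL \<Delta>\<^esub> r \<otimes>\<^bsub>GL \<Delta>\<^esub> minv (minv g) \<in> N k"
      using normal.inv_op_closed2[OF N_normal minv_Gc[OF g(1)]] by blast
    then have n: "minv g ** r ** g \<in> N k" using g(1) by (simp add: GL_mult)
    define n where "n = minv g ** r ** g"
    have nG: "n \<in> Gc" unfolding n_def by (intro Gc_mult minv_Gc g r)
    have xn: "x v* n = u *s (x v* A)"
    proof -
      have "x v* n = z v* g" by (simp add: n_def vector_matrix_mul_assoc[symmetric] x_minv_g axis_vm r_def rowmat_nth)
      also have "\<dots> = u *s (x v* A)" by (simp add: z_def zz_def vm_smult vm_minv g(1))
      finally show ?thesis .
    qed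
    have "x v* A = inverse u *s (x v* n)" unfolding xn using U_D(2)[OF u(1)] by simp
    then have "x v* (A ** minv n) = inverse u *s x"
      by (simp add: vector_matrix_mul_assoc[symmetric] vm_smult vm_minv nG)
    then have "A ** minv n \<in> P"
      unfolding P_def using A nG U_inverse[OF u(1)] by (intro CollectI conjI bexI Gc_mult minv_Gc) auto
    then have "A ** minv n ** n \<in> P <#>\<^bsub>GL \<Delta>\<^esub> N k" unfolding set_mult_def GL_mult using n[folded n_def] by blast
    then show ?thesis by (simp add: minv_cancel_right nG)
  qed
qed

text \<open>Applying \<open>B\<close> turns the condition that \<open>A ** minv B\<close> fixes the
  point into a congruence of the points \<open>x A\<close> and \<open>x B\<close>. Transversals of
  cosets can therefore be found among projective points.\<close>

lemma quotient_L: "A \<in> Gc \<Longrightarrow> B \<in> Gc \<Longrightarrow> zok k (zz (A ** minv B)) \<longleftrightarrow> k = 0 \<or> rel k (zz A) (zz B)"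
proof -
  assume A: "A \<in> Gc" and B: "B \<in> Gc"
  have "rel k (zz (A ** minv B)) (zz (mat 1)) \<longleftrightarrow> rel k (x v* (A ** minv B)) (x v* mat 1)"
    by (simp only: rel_zz)
  also have "\<dots> \<longleftrightarrow> rel k (x v* A) (x v* B)"
  proof
    assume "rel k (x v* (A ** minv B)) (x v* mat 1)"
    from rel_vm[OF this Gc_M[OF B]] show "rel k (x v* A) (x v* B)"
      by (simp add: vector_matrix_mul_assoc[symmetric] vm_minv B vm_one)
  next
    assume "rel k (x v* A) (x v* B)"
    from rel_vm[OF this Gc_M[OF minv_Gc[OF B]]] show "rel k (x v* (A ** minv B)) (x v* mat 1)"
      by (simp add: vector_matrix_mul_assoc[symmetric] vm_minv B vm_one)
  qed
  finally show ?thesis by (simp add: zok_def rel_zz zz_def[of "mat 1"] vm_one x_minv_g)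
qed

lemma other_index: "\<exists>i. i \<noteq> piv"
proof (rule ccontr)
  assume "\<not> ?thesis"
  then have "(UNIV :: 'n set) = {piv}" by auto
  then have "CARD('n) = card {piv}" by simp
  then show False using dim_ge_2 by simp
qed

text \<open>This is transitivity of the stabiliser on a shell, with a standard vector as base point.
  At level 0 the point differs from the pivot modulo \<open>I 1\<close>, so another coordinate is a
  unit. At later levels \<open>z\<close> is a unit multiple of the pivot vector plus
  \<open>p ^ k *s w\<close>, where \<open>w\<close> vanishes at \<open>piv\<close> and has a unit
  elsewhere. \<open>reach\<close> moves the \<open>j\<close>-th unit vector to \<open>z\<close> or
  to \<open>w\<close> and fixes the pivot vector.\<close>

lemma normal_form:
  assumes j: "j \<noteq> piv" and z: "z \<in> V 0" "z \<notin> V 1" "zok k z" "\<not> zok (Suc k) z"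
  shows "\<exists>C\<in>Gc. \<exists>c\<in>U. axis piv 1 v* C = axis piv 1 \<and>
    (if k = 0 then axis j 1 else axis piv 1 + p ^ k *s axis j 1) v* C = c *s z"
proof (cases "k = 0")
  case True
  have "\<exists>i. i \<noteq> piv \<and> z $ i \<notin> I 1"
  proof (rule ccontr)
    assume n: "\<not> ?thesis"
    have zo: "z $ piv \<notin> I 1"
    proof
      assume "z $ piv \<in> I 1"
      then have "z $ i \<in> I 1" for i using n by (cases "i = piv") auto
      then show False using z(2) by (simp add: V_def)
    qed
    then have "z $ piv \<in> U" using z(1) by (simp add: U_def V_0)
    moreover have "z - z $ piv *s axis piv 1 \<in> V 1" using n by (auto simp: V_def axis_def I_zero)
    ultimately have "rel 1 z (axis piv 1)" unfolding rel_def by (intro bexI)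
    then show False using z(4) True by (simp add: zok_def)
  qed
  then obtain i where i: "i \<noteq> piv" "z $ i \<notin> I 1" by blast
  then have "z $ i \<in> U" using z(1) by (simp add: U_def V_0)
  obtain C where C: "C \<in> Gc" "axis j 1 v* C = z" "\<forall>k. k \<noteq> i \<longrightarrow> k \<noteq> j \<longrightarrow> axis k 1 v* C = axis k 1"
    using reach[OF z(1) \<open>z $ i \<in> U\<close>, of j] by (elim bexE conjE)
  have "axis piv 1 v* C = axis piv 1" using C(3) i j by metis
  then show ?thesis using C(1,2) True U_one by (intro bexI[of _ C] bexI[of _ 1]) auto
next
  case False
  then have "rel k z (axis piv 1)" using z(3) by (simp add: zok_def)
  then obtain u where u: "u \<in> U" "z - u *s axis piv 1 \<in> V k" unfolding rel_def by (elim bexE)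
  have zi: "z $ i - u * axis piv 1 $ i \<in> I k" for i using u(2) by (simp add: V_def)
  have "z $ piv - u \<in> I 1" using zi[of piv] I_mono[of 1 k] False by (auto simp: axis_def)
  then have zo: "z $ piv \<in> U" by (rule U_cong[OF u(1)])
  note zo' = U_D[OF zo]
  have zk: "z $ i \<in> I k" if "i \<noteq> piv" for i using zi[of i] that by (simp add: axis_def)
  \<comment> \<open>The solution of \<open>z = z $ piv *s (axis piv 1 + p ^ k *s w)\<close>.\<close>
  define w where "w = (\<chi> i. if i = piv then 0 else inverse (p ^ k) * (inverse (z $ piv) * z $ i))"
  have wz: "z $ i = z $ piv * (p ^ k * w $ i)" if "i \<noteq> piv" for i
    using that zo'(2) p_nonzero by (simp add: w_def mult.assoc[symmetric] del: power_inverse)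
  have wV: "w \<in> V 0"
    using zk I_mult_left zo'(3) I_iff by (auto simp: V_0 w_def zero_mem)
  have "\<exists>i. w $ i \<notin> I 1"
  proof (rule ccontr)
    assume "\<not> ?thesis"
    then have w1: "w $ i \<in> I 1" for i by blast
    have "z - z $ piv *s axis piv 1 \<in> V (Suc k)"
    proof -
      have "(z - z $ piv *s axis piv 1) $ i \<in> I (Suc k)" for i
      proof (cases "i = piv")
        case False
        have "p ^ k * w $ i \<in> I (k + 1)" using w1 by (simp only: p_pow_mult_I)
        then have "z $ piv * (p ^ k * w $ i) \<in> I (k + 1)" using zo'(1) by (rule I_mult_left)
        then show ?thesis using wz[OF False] False by (simp add: axis_def)
      qed (simp add: axis_def I_zero)
      then show ?thesis unfolding V_def by blast
    qed
    then have "rel (Suc k) z (axis piv 1)" unfolding rel_def using zo by (intro bexI)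
    then show False using z(4) by (simp add: zok_def)
  qed
  then obtain i where i: "w $ i \<notin> I 1" by blast
  have io: "i \<noteq> piv" using i by (auto simp: w_def I_zero)
  have "w $ i \<in> U" using i wV by (simp add: U_def V_0)
  obtain C where C: "C \<in> Gc" "axis j 1 v* C = w" "\<forall>k. k \<noteq> i \<longrightarrow> k \<noteq> j \<longrightarrow> axis k 1 v* C = axis k 1"
    using reach[OF wV \<open>w $ i \<in> U\<close>, of j] by (elim bexE conjE)
  have Co: "axis piv 1 v* C = axis piv 1" using C(3) io j by metis
  have eq: "axis piv 1 + p ^ k *s axis j 1 = axis piv 1 - (- (p ^ k)) *s axis j 1"
    by (simp add: vec_eq_iff)
  have "(axis piv 1 + p ^ k *s axis j 1) v* C = axis piv 1 v* C - (- (p ^ k)) *s (axis j 1 v* C)"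
    unfolding eq vm_diff vm_smult by (rule refl)
  also have "\<dots> = axis piv 1 + p ^ k *s w" unfolding Co C(2) by (simp add: vec_eq_iff)
  also have "\<dots> = inverse (z $ piv) *s z"
  proof -
    have "axis piv 1 $ i + p ^ k * w $ i = inverse (z $ piv) * z $ i" for i
    proof (cases "i = piv")
      case True
      then show ?thesis using zo'(2) by (simp add: w_def axis_def)
    next
      case False
      have "inverse (z $ piv) * z $ i = inverse (z $ piv) * (z $ piv * (p ^ k * w $ i))" using wz[OF False] by simp
      also have "\<dots> = p ^ k * w $ i" using zo'(2) by (simp add: mult.assoc[symmetric])
      finally show ?thesis using False by (simp add: axis_def)
    qed
    then show ?thesis by (simp add: vec_eq_iff)
  qed
  finally show ?thesis using C(1) Co U_inverse[OF zo] False by (intro bexI[of _ C] bexI[of _ "inverse (z $ piv)"]) auto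
qed

text \<open>Both points come from the same standard vector by elements that fix the pivot vector.
  Composing these gives \<open>D\<close> in \<open>P\<close>, which takes the point of
  \<open>x A\<close> to that of \<open>x B\<close>; so \<open>B\<close> differs from
  \<open>A ** D\<close> by a left factor in \<open>P\<close>.\<close>

lemma double_coset_P:
  assumes A: "A \<in> P <#>\<^bsub>GL \<Delta>\<^esub> N k" "A \<notin> P <#>\<^bsub>GL \<Delta>\<^esub> N (Suc k)"
    and B: "B \<in> P <#>\<^bsub>GL \<Delta>\<^esub> N k" "B \<notin> P <#>\<^bsub>GL \<Delta>\<^esub> N (Suc k)"
  shows "\<exists>a\<in>P. \<exists>b\<in>P. B = a \<otimes>\<^bsub>GL \<Delta>\<^esub> A \<otimes>\<^bsub>GL \<Delta>\<^esub> b"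
proof -
  obtain j where j: "j \<noteq> piv" using other_index by blast
  define r where "r = (if k = 0 then axis j 1 else axis piv 1 + p ^ k *s axis j 1)"
  have AB: "A \<in> Gc" "B \<in> Gc" using A(1) B(1) unfolding L_iff by simp_all
  have "zok k (zz A)" "\<not> zok (Suc k) (zz A)" "zok k (zz B)" "\<not> zok (Suc k) (zz B)"
    using A B AB unfolding L_iff by simp_all
  then obtain C c C' c' where C: "C \<in> Gc" "c \<in> U" "axis piv 1 v* C = axis piv 1" "r v* C = c *s zz A"
    and C': "C' \<in> Gc" "c' \<in> U" "axis piv 1 v* C' = axis piv 1" "r v* C' = c' *s zz B"
    using normal_form[OF j zz_V[OF AB(1)]] normal_form[OF j zz_V[OF AB(2)]] unfolding r_def by metis
  define D where "D = minv g ** (minv C ** C') ** g"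
  have DG: "D \<in> Gc" unfolding D_def by (intro Gc_mult minv_Gc C C' g)
  have "axis piv 1 v* minv C = axis piv 1" using vm_minv(1)[OF C(1), of "axis piv 1"] by (simp add: C(3))
  then have "x v* D = 1 *s x"
    by (simp add: D_def vector_matrix_mul_assoc[symmetric] x_minv_g C'(3) g(2))
  then have DP: "D \<in> P" unfolding P_def using DG U_one by (intro CollectI conjI bexI)
  have zA: "zz A v* minv C = inverse c *s r"
  proof -
    have "c *s (zz A v* minv C) = r" unfolding vm_smult[symmetric] C(4)[symmetric] by (rule vm_minv(1)[OF C(1)])
    then show ?thesis using U_D(2)[OF C(2)] by (metis left_inverse vector_smult_assoc vector_smult_lid)
  qed
  define e where "e = inverse c * c'"
  have e: "e \<in> U" unfolding e_def by (intro U_mult U_inverse C C')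
  have "x v* (A ** D) = zz A v* minv C v* C' v* g"
    by (simp add: D_def zz_def vector_matrix_mul_assoc matrix_mul_assoc)
  also have "\<dots> = e *s (x v* B)"
    unfolding zA by (simp add: vm_smult C'(4) zz_def vm_minv g(1) e_def)
  finally have AD: "x v* (A ** D) = e *s (x v* B)" .
  have ADG: "A ** D \<in> Gc" using AB(1) DG by (rule Gc_mult)
  have "x v* B = inverse e *s (x v* (A ** D))" unfolding AD using U_D(2)[OF e] by simp
  then have "x v* (B ** minv (A ** D)) = inverse e *s x"
    by (simp add: vector_matrix_mul_assoc[symmetric, of _ B] vm_smult vm_minv ADG)
  then have "B ** minv (A ** D) \<in> P"
    unfolding P_def using U_inverse[OF e]
    by (intro CollectI conjI bexI[of _ "inverse e"] Gc_mult[OF AB(2) minv_Gc[OF ADG]])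
  moreover have "B = B ** minv (A ** D) ** A ** D"
    using minv_cancel_right(2)[OF ADG, of B] by (simp add: matrix_mul_assoc)
  ultimately show ?thesis unfolding GL_mult using DP by blast
qed

end

section \<open>Transversals, finite index, completeness and the tower\<close>

context primitive_vector
begin

lemma F_mem: "f \<in> F \<Longrightarrow> f \<in> \<Delta>" using F(2) by (rule transversal_mem)

lemma F_unique: "f \<in> F \<Longrightarrow> f' \<in> F \<Longrightarrow> f - f' \<in> I 1 \<Longrightarrow> f = f'"
  using transversal_unique[OF F(2) F_mem, of f f f'] by (simp add: I_zero)

text \<open>Every primitive vector is \<open>zz A\<close> for some \<open>A\<close>, so a system of
  points modulo \<open>I (Suc k)\<close> among those of level \<open>k\<close> lifts to matrices,
  and \<open>quotient_L\<close> identifies the cosets.\<close>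

lemma transversal_from_vectors:
  assumes \<Theta>: "\<And>\<theta>. \<theta> \<in> \<Theta> \<Longrightarrow> \<theta> \<in> V 0" "\<And>\<theta>. \<theta> \<in> \<Theta> \<Longrightarrow> \<theta> \<notin> V 1" "\<And>\<theta>. \<theta> \<in> \<Theta> \<Longrightarrow> zok k \<theta>"
    and ex: "\<And>z. z \<in> V 0 \<Longrightarrow> z \<notin> V 1 \<Longrightarrow> zok k z \<Longrightarrow> \<exists>\<theta>. \<theta> \<in> \<Theta> \<and> rel (Suc k) z \<theta>"
    and un: "\<And>\<theta> \<theta>'. \<theta> \<in> \<Theta> \<Longrightarrow> \<theta>' \<in> \<Theta> \<Longrightarrow> rel (Suc k) \<theta> \<theta>' \<Longrightarrow> \<theta> = \<theta>'"
  shows "\<exists>T. T \<subseteq> P <#>\<^bsub>GL \<Delta>\<^esub> N k \<and> card T = card \<Theta> \<and>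
    (\<forall>A\<in>P <#>\<^bsub>GL \<Delta>\<^esub> N k. \<exists>!t. t \<in> T \<and> A \<otimes>\<^bsub>GL \<Delta>\<^esub> inv\<^bsub>GL \<Delta>\<^esub> t \<in> P <#>\<^bsub>GL \<Delta>\<^esub> N (Suc k))"
proof -
  define t where "t \<theta> = (SOME A. A \<in> Gc \<and> zz A = \<theta>)" for \<theta>
  have t: "t \<theta> \<in> Gc \<and> zz (t \<theta>) = \<theta>" if "\<theta> \<in> \<Theta>" for \<theta>
  proof -
    have "\<exists>A. A \<in> Gc \<and> zz A = \<theta>" using zz_surj[OF \<Theta>(1,2)[OF that]] by (elim bexE) (rule exI, rule conjI)
    then show ?thesis unfolding t_def by (rule someI_ex)
  qed
  have q: "A \<otimes>\<^bsub>GL \<Delta>\<^esub> inv\<^bsub>GL \<Delta>\<^esub> (t \<theta>) \<in> P <#>\<^bsub>GL \<Delta>\<^esub> N (Suc k) \<longleftrightarrow> rel (Suc k) (zz A) \<theta>"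
    if "A \<in> Gc" "\<theta> \<in> \<Theta>" for A \<theta>
    using quotient_L[OF that(1), of "t \<theta>" "Suc k"] t[OF that(2)] that(1)
    by (simp add: L_iff GL_mult Gc_mult minv_Gc)
  have "inj_on t \<Theta>" by (rule inj_onI) (metis t)
  moreover have "t ` \<Theta> \<subseteq> P <#>\<^bsub>GL \<Delta>\<^esub> N k"
    by (rule image_subsetI) (simp add: L_iff t \<Theta>(3))
  moreover have "\<exists>!s. s \<in> t ` \<Theta> \<and> A \<otimes>\<^bsub>GL \<Delta>\<^esub> inv\<^bsub>GL \<Delta>\<^esub> s \<in> P <#>\<^bsub>GL \<Delta>\<^esub> N (Suc k)"
    if "A \<in> P <#>\<^bsub>GL \<Delta>\<^esub> N k" for A
  proof -
    have A: "A \<in> Gc" "zok k (zz A)" using that by (simp_all add: L_iff)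
    obtain \<theta> where \<theta>: "\<theta> \<in> \<Theta>" "rel (Suc k) (zz A) \<theta>" using ex[OF zz_V[OF A(1)] A(2)] by (elim exE conjE)
    show ?thesis
    proof (rule ex1I[of _ "t \<theta>"])
      show "t \<theta> \<in> t ` \<Theta> \<and> A \<otimes>\<^bsub>GL \<Delta>\<^esub> inv\<^bsub>GL \<Delta>\<^esub> (t \<theta>) \<in> P <#>\<^bsub>GL \<Delta>\<^esub> N (Suc k)"
        using \<theta> q[OF A(1)] by simp
      fix s assume "s \<in> t ` \<Theta> \<and> A \<otimes>\<^bsub>GL \<Delta>\<^esub> inv\<^bsub>GL \<Delta>\<^esub> s \<in> P <#>\<^bsub>GL \<Delta>\<^esub> N (Suc k)"
      then obtain \<theta>' where s: "s = t \<theta>'" "\<theta>' \<in> \<Theta>" "A \<otimes>\<^bsub>GL \<Delta>\<^esub> inv\<^bsub>GL \<Delta>\<^esub> (t \<theta>') \<in> P <#>\<^bsub>GL \<Delta>\<^esub> N (Suc k)"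
        by auto
      then have "rel (Suc k) (zz A) \<theta>'" using q[OF A(1) s(2)] by simp
      then have "rel (Suc k) \<theta>' \<theta>" using rel_trans[OF rel_sym \<theta>(2)] by simp
      then show "s = t \<theta>" using un[OF s(2) \<theta>(1)] s(1) by simp
    qed
  qed
  ultimately show ?thesis by (intro exI[of _ "t ` \<Theta>"]) (simp add: card_image)
qed

text \<open>Normalised to have 1 at the pivot, the points of level \<open>k\<close> are, modulo
  \<open>I (Suc k)\<close>, the pivot vector plus \<open>p ^ k\<close> times digits from
  \<open>F\<close> at the other \<open>CARD('n) - 1\<close> places.\<close>

lemma transversal_Suc:
  assumes k: "k \<noteq> 0"
  shows "\<exists>T. T \<subseteq> P <#>\<^bsub>GL \<Delta>\<^esub> N k \<and> card T = card F ^ (CARD('n) - 1) \<and>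
    (\<forall>A\<in>P <#>\<^bsub>GL \<Delta>\<^esub> N k. \<exists>!t. t \<in> T \<and> A \<otimes>\<^bsub>GL \<Delta>\<^esub> inv\<^bsub>GL \<Delta>\<^esub> t \<in> P <#>\<^bsub>GL \<Delta>\<^esub> N (Suc k))"
proof -
  define H where "H = (UNIV - {piv}) \<rightarrow>\<^sub>E F"
  define v :: "('n \<Rightarrow> 'd) \<Rightarrow> 'd ^ 'n" where "v h = (\<chi> i. if i = piv then 1 else p ^ k * h i)" for h
  have H: "h i \<in> F" if "h \<in> H" "i \<noteq> piv" for h i using that unfolding H_def by auto
  have vV: "v h \<in> V 0" if "h \<in> H" for h
    using H[OF that] F_mem by (auto simp: V_0 v_def one_mem intro!: mult_mem power_mem p_mem)
  have v1: "v h \<notin> V 1" for h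
    using one_notin_I[of 0] by (auto simp: V_def v_def intro!: exI[of _ piv])
  have vok: "zok k (v h)" if "h \<in> H" for h
  proof -
    have "(v h - 1 *s axis piv 1) $ i \<in> I k" for i
      using H[OF that, of i] F_mem by (auto simp: v_def axis_def I_zero intro!: I_mult_right[OF p_pow_I])
    then have "v h - 1 *s axis piv 1 \<in> V k" unfolding V_def by blast
    then show ?thesis unfolding zok_def rel_def using U_one by (intro disjI2 bexI)
  qed
  have un: "h = h'" if h: "h \<in> H" "h' \<in> H" and r: "rel (Suc k) (v h) (v h')" for h h'
  proof -
    obtain u where u: "u \<in> U" "v h - u *s v h' \<in> V (Suc k)" using r unfolding rel_def by (elim bexE)
    have ui: "v h $ i - u * v h' $ i \<in> I (Suc k)" for i using u(2) by (simp add: V_def)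
    \<comment> \<open>Both pivot entries are 1, which forces the scalar to be 1 modulo
      \<open>I (Suc k)\<close>; the other entries may then be compared directly.\<close>
    have u1: "1 - u \<in> I (Suc k)" using ui[of piv] by (simp add: v_def)
    have "h i = h' i" if i: "i \<in> UNIV - {piv}" for i
    proof -
      have hF: "h i \<in> F" "h' i \<in> F" using H h i by auto
      have "(1 - u) * v h' $ i \<in> I (Suc k)" using u1 vV[OF h(2)] by (intro I_mult_right) (simp_all add: V_0)
      from I_diff[OF ui[of i] this] have "p ^ k * (h i - h' i) \<in> I (k + 1)"
        using i by (simp add: v_def algebra_simps)
      then have "h i - h' i \<in> I 1" by (simp only: p_pow_mult_I)
      then show ?thesis by (rule F_unique[OF hF])
    qed
    then show ?thesis using h unfolding H_def by (intro PiE_ext)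
  qed
  have "inj_on v H" by (rule inj_onI, rule un) (simp_all add: rel_refl)
  then have card: "card (v ` H) = card F ^ (CARD('n) - 1)"
    by (simp add: card_image H_def card_PiE card_Diff_singleton)
  show ?thesis
    unfolding card[symmetric]
  proof (rule transversal_from_vectors)
    fix \<theta> assume "\<theta> \<in> v ` H"
    then obtain h where h: "h \<in> H" "\<theta> = v h" by (elim imageE)
    show "\<theta> \<in> V 0" "\<theta> \<notin> V 1" "zok k \<theta>" unfolding h(2) using vV vok v1 h(1) by simp_all
    fix \<theta>' assume "\<theta>' \<in> v ` H" and r: "rel (Suc k) \<theta> \<theta>'"
    then obtain h' where h': "h' \<in> H" "\<theta>' = v h'" by (elim imageE)
    show "\<theta> = \<theta>'" using un[OF h(1) h'(1)] r unfolding h h' by simp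
  next
    fix z assume z: "z \<in> V 0" "z \<notin> V 1" "zok k z"
    then have "rel k z (axis piv 1)" using k by (simp add: zok_def)
    then obtain u where u: "u \<in> U" "z - u *s axis piv 1 \<in> V k" unfolding rel_def by (elim bexE)
    have zi: "z $ i - u * axis piv 1 $ i \<in> I k" for i using u(2) by (simp add: V_def)
    have "z $ piv - u \<in> I k" using zi[of piv] by (simp add: axis_def)
    then have "z $ piv - u \<in> I 1" using I_mono[of 1 k] k by auto
    then have zo: "z $ piv \<in> U" by (rule U_cong[OF u(1)])
    have "\<exists>f. f \<in> F \<and> z $ i - z $ piv * (p ^ k * f) \<in> I (Suc k)" if i: "i \<noteq> piv" for i
    proof -
      have "z $ i \<in> I k" using zi[of i] i by (simp add: axis_def)
      then have "inverse (z $ piv) * z $ i \<in> I k" using U_D(3)[OF zo] by (rule I_mult_left)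
      then obtain w where w: "inverse (z $ piv) * z $ i = p ^ k * w" "w \<in> \<Delta>" unfolding I_def by blast
      obtain f where f: "f \<in> F" "w - f \<in> I 1" using transversal_ex[OF F(2) w(2)] by (elim exE conjE)
      have "z $ i = z $ piv * (inverse (z $ piv) * z $ i)" using U_D(2)[OF zo] by (simp add: mult.assoc[symmetric])
      then have zw: "z $ i = z $ piv * (p ^ k * w)" unfolding w(1) .
      have "p ^ k * (w - f) \<in> I (k + 1)" using f(2) by (simp only: p_pow_mult_I)
      then have "z $ piv * (p ^ k * (w - f)) \<in> I (k + 1)" using U_D(1)[OF zo] by (rule I_mult_left)
      then have "z $ i - z $ piv * (p ^ k * f) \<in> I (Suc k)" unfolding zw by (simp add: right_diff_distrib)
      then show ?thesis using f(1) by (intro exI conjI)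
    qed
    then obtain h0 where h0: "\<And>i. i \<noteq> piv \<Longrightarrow> h0 i \<in> F \<and> z $ i - z $ piv * (p ^ k * h0 i) \<in> I (Suc k)" by metis
    define h where "h = restrict h0 (UNIV - {piv})"
    have hH: "h \<in> H" using h0 by (auto simp: h_def H_def)
    have "(z - z $ piv *s v h) $ i \<in> I (Suc k)" for i
      using h0[of i] by (cases "i = piv") (simp_all add: v_def h_def I_zero)
    then have "z - z $ piv *s v h \<in> V (Suc k)" unfolding V_def by blast
    then have "rel (Suc k) z (v h)" unfolding rel_def using zo by (intro bexI)
    then show "\<exists>\<theta>. \<theta> \<in> v ` H \<and> rel (Suc k) z \<theta>" using hH by (intro exI[of _ "v h"] conjI imageI)
  qed
qed

definition red :: "'d \<Rightarrow> 'd" where "red a = (SOME f. f \<in> F \<and> a - f \<in> I 1)"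

definition rv :: "'d ^ 'n \<Rightarrow> 'd ^ 'n" where "rv y = (\<chi> i. red (y $ i))"

text \<open>Representatives of the nonzero vectors over the residue ring.\<close>

definition Y :: "('d ^ 'n) set" where "Y = {y. (\<forall>i. y $ i \<in> F) \<and> y \<notin> V 1}"

lemma red: "a \<in> \<Delta> \<Longrightarrow> red a \<in> F" "a \<in> \<Delta> \<Longrightarrow> a - red a \<in> I 1"
proof -
  assume "a \<in> \<Delta>"
  then have "red a \<in> F \<and> a - red a \<in> I 1" unfolding red_def by (rule someI_ex[OF transversal_ex[OF F(2)]])
  then show "red a \<in> F" "a - red a \<in> I 1" by simp_all
qed

lemma rv_cong: "y \<in> V 0 \<Longrightarrow> y - rv y \<in> V 1"
  unfolding V_0 by (simp add: V_def rv_def red del: One_nat_def)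

lemma rv_Y: assumes "y \<in> V 0" "y \<notin> V 1" shows "rv y \<in> Y"
proof -
  have "rv y \<notin> V 1"
  proof
    assume "rv y \<in> V 1"
    from V_add[OF rv_cong[OF assms(1)] this] show False using assms(2) by simp
  qed
  then show ?thesis using assms(1) by (simp add: Y_def rv_def red V_0)
qed

lemma Y_V: "y \<in> Y \<Longrightarrow> y \<in> V 0" "y \<in> Y \<Longrightarrow> y \<notin> V 1"
  by (simp_all add: Y_def V_0 F_mem)

lemma Y_unique: assumes "y \<in> Y" "y' \<in> Y" "y - y' \<in> V 1" shows "y = y'"
proof -
  have "y $ i = y' $ i" for i using assms by (intro F_unique) (simp_all add: Y_def V_def)
  then show ?thesis by (simp add: vec_eq_iff)
qed

text \<open>\<open>F\<close> may fail to contain 0, so the class of 0 is represented by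
  \<open>red 0\<close>.\<close>

lemma F_I: "{f \<in> F. f \<in> I 1} = {red 0}"
proof -
  have r: "red 0 \<in> F" "0 - red 0 \<in> I 1" using red[OF zero_mem] by simp_all
  have r1: "red 0 \<in> I 1" using I_uminus[OF r(2)] by simp
  have u: "f = red 0" if "f \<in> F" "f \<in> I 1" for f using F_unique[OF that(1) r(1) I_diff[OF that(2) r1]] .
  show ?thesis
  proof (intro equalityI subsetI)
    fix f assume "f \<in> {f \<in> F. f \<in> I 1}"
    then show "f \<in> {red 0}" using u[of f] by simp
  next
    fix f assume "f \<in> {red 0}"
    then have "f = red 0" by (rule singletonD)
    then show "f \<in> {f \<in> F. f \<in> I 1}" using r(1) r1 by (simp only: mem_Collect_eq simp_thms)
  qed
qed

lemma card_F_units: "card {f \<in> F. f \<notin> I 1} = card F - 1"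
proof -
  have "{f \<in> F. f \<notin> I 1} = F - {f \<in> F. f \<in> I 1}" by auto
  also have "\<dots> = F - {red 0}" unfolding F_I ..
  finally show ?thesis using red(1)[OF zero_mem] F(1) by (simp add: card_Diff_singleton)
qed

lemma card_Y: "card Y = card F ^ CARD('n) - 1"
proof -
  have f0: "red 0 \<in> F" by (rule red(1)[OF zero_mem])
  have iff: "f \<in> F \<and> f \<in> I 1 \<longleftrightarrow> f = red 0" for f using arg_cong[OF F_I, of "\<lambda>S. f \<in> S"] by simp
  have "Y = {y. \<forall>i. y $ i \<in> F} - {\<chi> i. red 0}"
  proof (intro equalityI subsetI)
    fix y assume y: "y \<in> Y"
    have "y \<noteq> (\<chi> i. red 0)" using Y_V(2)[OF y] iff[of "red 0"] by (auto simp: V_def)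
    then show "y \<in> {y. \<forall>i. y $ i \<in> F} - {\<chi> i. red 0}" using y by (simp add: Y_def)
  next
    fix y :: "'d ^ 'n" assume y: "y \<in> {y. \<forall>i. y $ i \<in> F} - {\<chi> i. red 0}"
    have "y \<notin> V 1"
    proof
      assume "y \<in> V 1"
      then have "y $ i = red 0" for i using y iff[of "y $ i"] by (simp add: V_def)
      then show False using y by (simp add: vec_eq_iff)
    qed
    then show "y \<in> Y" using y by (simp add: Y_def)
  qed
  moreover have "(\<chi> i. red 0) \<in> {y :: 'd ^ 'n. \<forall>i. y $ i \<in> F}" using f0 by simp
  ultimately show ?thesis using finite_vectors[OF F(1)] by (simp add: card_Diff_singleton card_vectors)
qed

text \<open>The points modulo \<open>I 1\<close> are the lines over the residue ring: each nonzero
  vector is a unique nonzero residue times the representative of its line. The count is left as a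
  product, which avoids division of natural numbers.\<close>

lemma transversal_0:
  "\<exists>T. T \<subseteq> P <#>\<^bsub>GL \<Delta>\<^esub> N 0 \<and> card T * (card F - 1) = card F ^ CARD('n) - 1 \<and>
    (\<forall>A\<in>P <#>\<^bsub>GL \<Delta>\<^esub> N 0. \<exists>!t. t \<in> T \<and> A \<otimes>\<^bsub>GL \<Delta>\<^esub> inv\<^bsub>GL \<Delta>\<^esub> t \<in> P <#>\<^bsub>GL \<Delta>\<^esub> N (Suc 0))"
proof -
  \<comment> \<open>One representative per line: the choice depends only on the class of
    \<open>y\<close> under \<open>rel 1\<close>.\<close>
  define c where "c y = (SOME h. h \<in> Y \<and> rel 1 y h)" for y
  have c: "c y \<in> Y \<and> rel 1 y (c y)" if "y \<in> V 0" "y \<notin> V 1" for y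
  proof -
    have "rel 1 y (rv y)" unfolding rel_def using rv_cong[OF that(1)] by (intro bexI[OF _ U_one]) simp
    then have "\<exists>h. h \<in> Y \<and> rel 1 y h" using rv_Y[OF that] by (intro exI conjI)
    then show ?thesis unfolding c_def by (rule someI_ex)
  qed
  have c_cong: "c y = c y'" if "rel 1 y y'" for y y'
  proof -
    have "rel 1 y h \<longleftrightarrow> rel 1 y' h" for h
      by (rule iffI, erule rel_trans[OF rel_sym[OF that]], erule rel_trans[OF that])
    then show ?thesis unfolding c_def by (simp only:)
  qed
  define \<Theta> where "\<Theta> = c ` Y"
  have \<Theta>: "\<theta> \<in> Y \<and> c \<theta> = \<theta>" if "\<theta> \<in> \<Theta>" for \<theta>
  proof -
    obtain y where y: "\<theta> = c y" "y \<in> Y" using \<open>\<theta> \<in> \<Theta>\<close> unfolding \<Theta>_def by (elim imageE)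
    have cy: "c y \<in> Y \<and> rel 1 y (c y)" using Y_V[OF y(2)] by (rule c)
    show ?thesis unfolding y(1) using conjunct1[OF cy] c_cong[OF conjunct2[OF cy], symmetric] by (rule conjI)
  qed
  have un: "\<theta> = \<theta>'" if "\<theta> \<in> \<Theta>" "\<theta>' \<in> \<Theta>" "rel 1 \<theta> \<theta>'" for \<theta> \<theta>'
    using c_cong[OF that(3)] \<Theta>[OF that(1)] \<Theta>[OF that(2)] by simp
  have c\<Theta>: "c z \<in> \<Theta> \<and> rel 1 z (c z)" if "z \<in> V 0" "z \<notin> V 1" for z
  proof -
    have cz: "c z \<in> Y" "rel 1 z (c z)" using conjunct1[OF c[OF that]] conjunct2[OF c[OF that]] .
    have "c (c z) \<in> \<Theta>" unfolding \<Theta>_def by (rule imageI[OF cz(1)])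
    then have "c z \<in> \<Theta>" by (simp only: c_cong[OF cz(2), symmetric])
    then show ?thesis using cz(2) by (rule conjI)
  qed
  define \<phi> :: "('d ^ 'n) \<times> 'd \<Rightarrow> 'd ^ 'n" where "\<phi> = (\<lambda>(\<theta>, f). rv (f *s \<theta>))"
  define Fu where "Fu = {f \<in> F. f \<notin> I 1}"
  have Fu: "f \<in> U" "f \<in> F" if "f \<in> Fu" for f using that F_mem by (simp_all add: Fu_def U_def)
  have s0: "f *s \<theta> \<in> V 0" and s1: "f *s \<theta> \<notin> V 1" if "\<theta> \<in> \<Theta>" "f \<in> Fu" for \<theta> f
  proof -
    have Y: "\<theta> \<in> V 0" "\<theta> \<notin> V 1" using Y_V \<Theta>[OF that(1)] by simp_all
    show "f *s \<theta> \<in> V 0" by (intro V_smult Y U_D Fu that)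
    show "f *s \<theta> \<notin> V 1"
    proof
      assume "f *s \<theta> \<in> V 1"
      then have "inverse f *s (f *s \<theta>) \<in> V 1" using U_D(3)[OF Fu(1)[OF that(2)]] by (rule V_smult)
      then show False using Y(2) U_D(2)[OF Fu(1)[OF that(2)]] by simp
    qed
  qed
  have "bij_betw \<phi> (\<Theta> \<times> Fu) Y"
    unfolding bij_betw_def
  proof (intro conjI inj_onI equalityI subsetI)
    fix a b assume a: "a \<in> \<Theta> \<times> Fu" and b: "b \<in> \<Theta> \<times> Fu" and eq: "\<phi> a = \<phi> b"
    obtain \<theta> f \<theta>' f' where ab: "a = (\<theta>, f)" "b = (\<theta>', f')" by (cases a, cases b) simp
    have m: "\<theta> \<in> \<Theta>" "f \<in> Fu" "\<theta>' \<in> \<Theta>" "f' \<in> Fu" using a b unfolding ab by simp_all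
    have "(f *s \<theta> - rv (f *s \<theta>)) - (f' *s \<theta>' - rv (f' *s \<theta>')) \<in> V 1"
      by (intro V_diff rv_cong s0 m)
    then have d: "f *s \<theta> - f' *s \<theta>' \<in> V 1" using eq by (simp add: \<phi>_def ab)
    then have "rel 1 (f *s \<theta>) \<theta>'" unfolding rel_def by (rule bexI) (rule Fu(1)[OF m(4)])
    then have "rel 1 \<theta> \<theta>'" by (rule rel_trans[OF rel_sym[OF rel_smult[OF Fu(1)[OF m(2)]]]])
    then have \<theta>: "\<theta> = \<theta>'" by (rule un[OF m(1,3)])
    have "\<theta>' \<in> Y" using \<Theta>[OF m(3)] by simp
    \<comment> \<open>The representative has a unit coordinate, from which the scalar can be
      recovered modulo \<open>I 1\<close>.\<close>
    then obtain i where i: "\<theta>' $ i \<notin> I 1" "\<theta>' $ i \<in> \<Delta>" using Y_V[of \<theta>'] unfolding V_0 by (auto simp: V_def)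
    have "(f - f') * \<theta>' $ i \<in> I 1" using d unfolding \<theta> by (simp add: V_def left_diff_distrib)
    then have "f - f' \<in> I 1" using I_1_prime[OF diff_mem[OF F_mem F_mem] i(2)] Fu(2) m i(1) by metis
    then have "f = f'" by (rule F_unique[OF Fu(2)[OF m(2)] Fu(2)[OF m(4)]])
    then show "a = b" using \<theta> ab by simp
  next
    fix y assume "y \<in> \<phi> ` (\<Theta> \<times> Fu)"
    then obtain \<theta> f where m: "y = rv (f *s \<theta>)" "\<theta> \<in> \<Theta>" "f \<in> Fu" unfolding \<phi>_def by auto
    show "y \<in> Y" unfolding m(1) by (intro rv_Y s0 s1 m)
  next
    fix h assume h: "h \<in> Y"
    have ch: "c h \<in> \<Theta>" "rel 1 h (c h)" using c\<Theta>[OF Y_V[OF h]] by simp_all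
    obtain u where u: "u \<in> U" "h - u *s c h \<in> V 1" using ch(2) unfolding rel_def by (elim bexE)
    \<comment> \<open>Only the residue of the scalar matters modulo \<open>I 1\<close>, so it may be
      taken from \<open>F\<close>.\<close>
    have f: "red u \<in> F" "u - red u \<in> I 1" using red[OF U_D(1)[OF u(1)]] by simp_all
    have "red u \<notin> I 1"
    proof
      assume "red u \<in> I 1"
      from I_add[OF f(2) this] show False using u(1) by (simp add: U_def)
    qed
    then have fu: "red u \<in> Fu" using f(1) by (simp add: Fu_def)
    have ch\<Delta>: "c h $ i \<in> \<Delta>" for i using \<Theta>[OF ch(1)] Y_V(1)[of "c h"] by (simp add: V_0)
    have "(u - red u) *s c h \<in> V 1"
      unfolding V_def mem_Collect_eq vector_smult_component by (rule allI, rule I_mult_right[OF f(2) ch\<Delta>])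
    have "h - rv (red u *s c h) \<in> V 1"
    proof -
      have "h - u *s c h + (u - red u) *s c h + (red u *s c h - rv (red u *s c h)) = h - rv (red u *s c h)"
        by (simp add: vec_eq_iff left_diff_distrib)
      then show ?thesis using V_add[OF V_add[OF u(2) \<open>(u - red u) *s c h \<in> V 1\<close>] rv_cong[OF s0[OF ch(1) fu]]] by (simp only:)
    qed
    then have "h = rv (red u *s c h)"
      by (rule Y_unique[OF h rv_Y[OF s0[OF ch(1) fu] s1[OF ch(1) fu]]])
    then have "h = \<phi> (c h, red u)" by (simp add: \<phi>_def)
    then show "h \<in> \<phi> ` (\<Theta> \<times> Fu)" using ch(1) fu by (intro image_eqI[of _ _ "(c h, red u)"]) simp_all
  qed
  then have "card (\<Theta> \<times> Fu) = card Y" by (rule bij_betw_same_card)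
  then have card: "card \<Theta> * (card F - 1) = card F ^ CARD('n) - 1"
    unfolding card_cartesian_product card_Y Fu_def card_F_units .
  have "\<exists>T. T \<subseteq> P <#>\<^bsub>GL \<Delta>\<^esub> N 0 \<and> card T = card \<Theta> \<and>
    (\<forall>A\<in>P <#>\<^bsub>GL \<Delta>\<^esub> N 0. \<exists>!t. t \<in> T \<and> A \<otimes>\<^bsub>GL \<Delta>\<^esub> inv\<^bsub>GL \<Delta>\<^esub> t \<in> P <#>\<^bsub>GL \<Delta>\<^esub> N (Suc 0))"
  proof (rule transversal_from_vectors)
    fix \<theta> assume \<theta>: "\<theta> \<in> \<Theta>"
    show "\<theta> \<in> V 0" "\<theta> \<notin> V 1" using Y_V \<Theta>[OF \<theta>] by simp_all
    show "zok 0 \<theta>" by (simp add: zok_def)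
    fix \<theta>' assume "\<theta>' \<in> \<Theta>" "rel (Suc 0) \<theta> \<theta>'"
    then show "\<theta> = \<theta>'" using un[OF \<theta>] by simp
  next
    fix z :: "'d ^ 'n" assume "z \<in> V 0" "z \<notin> V 1"
    then have "c z \<in> \<Theta> \<and> rel 1 z (c z)" by (rule c\<Theta>)
    then show "\<exists>\<theta>. \<theta> \<in> \<Theta> \<and> rel (Suc 0) z \<theta>" unfolding One_nat_def by (rule exI)
  qed
  then show ?thesis using card by (elim exE conjE) (intro exI conjI, simp_all)
qed

text \<open>Reducing all entries modulo \<open>I k\<close> leaves finitely many matrices. A reduced
  matrix may fail to be invertible, so a group element with the same reduction is chosen
  instead.\<close>

lemma N_finite_index:
  "\<exists>S. finite S \<and> S \<subseteq> Gc \<and> (\<forall>A\<in>Gc. \<exists>f\<in>S. \<exists>n\<in>N k. A = f \<otimes>\<^bsub>GL \<Delta>\<^esub> n)"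
proof -
  obtain K where K: "finite K" "transversal \<Delta> (I k) K" using transversal_I[OF F(2), of k] F(1) by metis
  define r where "r a = (SOME f. f \<in> K \<and> a - f \<in> I k)" for a
  have r: "r a \<in> K \<and> a - r a \<in> I k" if "a \<in> \<Delta>" for a
    unfolding r_def by (rule someI_ex[OF transversal_ex[OF K(2) that]])
  define R where "R A = (\<chi> i j. r (A $ i $ j))" for A :: "'d ^ 'n ^ 'n"
  have RA: "A - R A \<in> M k" if "A \<in> Gc" for A
    using r Gc_M[OF that] by (simp add: M_def R_def I_0)
  have "R ` Gc \<subseteq> {B. \<forall>i. B $ i \<in> {y. \<forall>j. y $ j \<in> K}}"
    using r Gc_M by (auto simp: R_def M_0)
  then have fin: "finite (R ` Gc)" by (rule finite_subset) (intro finite_vectors K(1))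
  define s where "s B = (SOME A. A \<in> Gc \<and> R A = B)" for B
  have s: "s (R A) \<in> Gc \<and> R (s (R A)) = R A" if "A \<in> Gc" for A
    unfolding s_def by (rule someI[of "\<lambda>A'. A' \<in> Gc \<and> R A' = R A" A]) (simp add: that)
  show ?thesis
  proof (intro exI[of _ "s ` R ` Gc"] conjI ballI)
    show "finite (s ` R ` Gc)" using fin by (rule finite_imageI)
    show "s ` R ` Gc \<subseteq> Gc" using s by auto
    fix A assume A: "A \<in> Gc"
    have "(A - R A) - (s (R A) - R (s (R A))) \<in> M k" using s[OF A] by (intro M_diff RA A) simp
    then have "A - s (R A) \<in> M k" using s[OF A] by simp
    then have "\<exists>n\<in>N k. A = s (R A) ** n" using N_cong[of "s (R A)" A] s[OF A] A by simp
    then show "\<exists>f\<in>s ` R ` Gc. \<exists>n\<in>N k. A = f \<otimes>\<^bsub>GL \<Delta>\<^esub> n"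
      unfolding GL_mult by (rule bexI) (intro imageI A)
  qed
qed

text \<open>The inverses converge as well, and their limit inverts the limit of the sequence; this
  keeps the limit in the group.\<close>

lemma N_complete:
  assumes A: "\<forall>k. A k \<in> Gc \<and> (\<exists>n\<in>N k. A (Suc k) = A k \<otimes>\<^bsub>GL \<Delta>\<^esub> n)"
  shows "\<exists>a\<in>Gc. \<forall>k. \<exists>n\<in>N k. a = A k \<otimes>\<^bsub>GL \<Delta>\<^esub> n"
proof -
  have G: "A k \<in> Gc" for k using A by simp
  have d: "A (Suc k) - A k \<in> M k" for k using N_cong[OF G G, of "Suc k" k k] A unfolding GL_mult by simp
  have di: "minv (A (Suc k)) - minv (A k) \<in> M k" for k
  proof -
    have "minv (A (Suc k)) ** (A (Suc k) - A k) ** minv (A k) \<in> M k"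
      by (rule mm_left[OF mm_right[OF Gc_M[OF minv_Gc[OF G]] d] Gc_M[OF minv_Gc[OF G]]])
    then have "minv (A k) - minv (A (Suc k)) \<in> M k"
      by (simp add: mm_diff_left mm_diff_right minv_l minv_r G minv_cancel_right)
    from M_diff[OF _ this, of 0] show ?thesis by (simp add: M_def I_zero)
  qed
  obtain a where a: "a \<in> M 0" "\<forall>k. a - A k \<in> M k" using M_complete[of A, OF Gc_M[OF G] d] by (elim bexE)
  obtain b where b: "b \<in> M 0" "\<forall>k. b - minv (A k) \<in> M k"
    using M_complete[of "\<lambda>k. minv (A k)", OF Gc_M[OF minv_Gc[OF G]] di] by (elim bexE)
  have "a ** b = mat 1"
  proof (rule M_separated)
    fix k
    have "a ** (b - minv (A k)) + (a - A k) ** minv (A k) \<in> M k"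
      by (rule M_add[OF mm_right[OF a(1) spec[OF b(2)]] mm_left[OF spec[OF a(2)] Gc_M[OF minv_Gc[OF G]]]])
    then show "a ** b - mat 1 \<in> M k" by (simp add: mm_diff_left mm_diff_right minv_r G)
  qed
  moreover have "b ** a = mat 1"
  proof (rule M_separated)
    fix k
    have "b ** (a - A k) + (b - minv (A k)) ** A k \<in> M k"
      by (rule M_add[OF mm_right[OF b(1) spec[OF a(2)]] mm_left[OF spec[OF b(2)] Gc_M[OF G]]])
    then show "b ** a - mat 1 \<in> M k" by (simp add: mm_diff_left mm_diff_right minv_l G)
  qed
  ultimately have aG: "a \<in> Gc" using a(1) b(1) by (intro Gc_I)
  have n: "\<exists>n\<in>N k. a = A k ** n" for k using N_cong[OF G aG, of k k] a(2) by simp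
  show ?thesis unfolding GL_mult by (rule bexI[OF _ aG], rule allI, rule n)
qed

text \<open>The assumption describes the topology through the exponents \<open>e * k\<close>, as the
  central filtration does. With \<open>e\<close> at least 1 these are cofinal among all exponents,
  so the finer chain \<open>N k\<close> defines the same topology.\<close>

theorem tower_exists:
  assumes Top: "\<And>W. openin Top W \<longleftrightarrow> W \<subseteq> Gc \<and> (\<forall>A\<in>W. \<exists>k. \<forall>B\<in>Gc. B - A \<in> M (e * k) \<longrightarrow> B \<in> W)"
    and e: "e \<ge> 1"
  shows "\<exists>T. tower (GL \<Delta>) Top P N T \<and> card (T 0) * (card F - 1) = card F ^ CARD('n) - 1 \<and>
    (\<forall>k. k \<ge> 1 \<longrightarrow> card (T k) = card F ^ (CARD('n) - 1))"
proof -
  obtain T0 where T0: "T0 \<subseteq> P <#>\<^bsub>GL \<Delta>\<^esub> N 0" "card T0 * (card F - 1) = card F ^ CARD('n) - 1"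
    "\<forall>A\<in>P <#>\<^bsub>GL \<Delta>\<^esub> N 0. \<exists>!t. t \<in> T0 \<and> A \<otimes>\<^bsub>GL \<Delta>\<^esub> inv\<^bsub>GL \<Delta>\<^esub> t \<in> P <#>\<^bsub>GL \<Delta>\<^esub> N (Suc 0)"
    using transversal_0 by (elim exE conjE)
  define Q where "Q k S \<longleftrightarrow> S \<subseteq> P <#>\<^bsub>GL \<Delta>\<^esub> N k \<and> card S = card F ^ (CARD('n) - 1) \<and>
    (\<forall>A\<in>P <#>\<^bsub>GL \<Delta>\<^esub> N k. \<exists>!t. t \<in> S \<and> A \<otimes>\<^bsub>GL \<Delta>\<^esub> inv\<^bsub>GL \<Delta>\<^esub> t \<in> P <#>\<^bsub>GL \<Delta>\<^esub> N (Suc k))" for k S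
  define T where "T k = (if k = 0 then T0 else SOME S. Q k S)" for k
  have QT: "Q k (T k)" if "k \<noteq> 0" for k
    using someI_ex[of "Q k"] transversal_Suc[OF that] that unfolding T_def Q_def by simp
  have T00: "T 0 = T0" by (simp add: T_def)
  have sub: "T k \<subseteq> P <#>\<^bsub>GL \<Delta>\<^esub> N k" for k
    using T0(1) QT[of k] by (cases "k = 0") (simp_all add: T00 Q_def)
  have tr: "\<exists>!t. t \<in> T k \<and> A \<otimes>\<^bsub>GL \<Delta>\<^esub> inv\<^bsub>GL \<Delta>\<^esub> t \<in> P <#>\<^bsub>GL \<Delta>\<^esub> N (Suc k)"
    if "A \<in> P <#>\<^bsub>GL \<Delta>\<^esub> N k" for A k
    using T0(3) QT[of k] that by (cases "k = 0") (simp_all add: T00 Q_def)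
  have cardk: "card (T k) = card F ^ (CARD('n) - 1)" if "k \<noteq> 0" for k using QT[OF that] by (simp add: Q_def)
  \<comment> \<open>\<open>card F ^ 2 - 1\<close> is \<open>card F - 1\<close> times
    \<open>card F + 1\<close>, and \<open>card F + 1\<close> is at least 3.\<close>
  have card0: "card (T 0) \<ge> 3"
  proof (rule ccontr)
    assume n3: "\<not> card (T 0) \<ge> 3"
    obtain a where a: "card F = Suc (Suc a)" using F(3) by (metis add_2_eq_Suc le_Suc_ex)
    have "card F ^ 2 \<le> card F ^ CARD('n)" using dim_ge_2 F(3) by (intro power_increasing) auto
    then have "card F ^ 2 - 1 \<le> card T0 * (card F - 1)" unfolding T0(2) by simp
    also have "\<dots> \<le> 2 * (card F - 1)" using n3 by (intro mult_right_mono) (simp_all add: T00)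
    finally show False by (simp add: a power2_eq_square)
  qed
  have cardge: "card (T k) \<ge> 2" for k
  proof (cases "k = 0")
    case False
    have "card F ^ 1 \<le> card F ^ (CARD('n) - 1)" using dim_ge_2 F(3) by (intro power_increasing) auto
    then show ?thesis using cardk[OF False] F(3) by simp
  qed (use card0 in simp)
  have op: "openin Top W \<longleftrightarrow> W \<subseteq> Gc \<and> (\<forall>A\<in>W. \<exists>k. \<forall>n\<in>N k. A \<otimes>\<^bsub>GL \<Delta>\<^esub> n \<in> W)" for W
  proof -
    have "(\<exists>k. \<forall>B\<in>Gc. B - A \<in> M (e * k) \<longrightarrow> B \<in> W) \<longleftrightarrow> (\<exists>k. \<forall>n\<in>N k. A ** n \<in> W)"
      if W: "W \<subseteq> Gc" and "A \<in> W" for A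
    proof
      have A: "A \<in> Gc" using that by blast
      show "\<exists>k. \<forall>n\<in>N k. A ** n \<in> W" if ex: "\<exists>k. \<forall>B\<in>Gc. B - A \<in> M (e * k) \<longrightarrow> B \<in> W"
      proof -
        obtain k where k: "\<forall>B\<in>Gc. B - A \<in> M (e * k) \<longrightarrow> B \<in> W" using ex by (elim exE)
        have "A ** n \<in> W" if n: "n \<in> N (e * k)" for n
        proof -
          have nG: "A ** n \<in> Gc" using n A by (intro Gc_mult) (simp_all add: N_def)
          have "A ** n - A \<in> M (e * k)" unfolding N_cong[OF A nG] by (rule bexI[OF refl n])
          then show ?thesis using k nG by simp
        qed
        then show ?thesis by (intro exI[of _ "e * k"] ballI)
      qed
      show "\<exists>k. \<forall>B\<in>Gc. B - A \<in> M (e * k) \<longrightarrow> B \<in> W" if ex: "\<exists>k. \<forall>n\<in>N k. A ** n \<in> W"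
      proof -
        obtain k where k: "\<forall>n\<in>N k. A ** n \<in> W" using ex by (elim exE)
        have "B \<in> W" if B: "B \<in> Gc" "B - A \<in> M (e * k)" for B
        proof -
          have "B - A \<in> M k" using M_mono[OF B(2), of k] e by simp
          then obtain n where "n \<in> N k" "B = A ** n" unfolding N_cong[OF A B(1)] by (elim bexE)
          then show ?thesis using k by simp
        qed
        then show ?thesis by (intro exI[of _ k] ballI impI)
      qed
    qed
    then show ?thesis unfolding Top GL_mult by (intro conj_cong refl ball_cong) auto
  qed
  have "tower (GL \<Delta>) Top P N T"
  proof (intro tower.intro tower_axioms.intro)
    show "group (GL \<Delta> :: ('d ^ 'n ^ 'n) monoid)" by (rule GL_group)
    show "N (Suc k) \<subseteq> N k" for k using M_mono[of _ "Suc k" k] by (auto simp: N_def)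
  qed (fact P_subgroup N_normal N_0 N_finite_index N_complete op sub tr card0 cardge double_coset_P)+
  then show ?thesis using cardk T0(2) T00 by (intro exI[of _ T] conjI allI impI) simp_all
qed

end

section \<open>Assembly for the given maximal order and projective point\<close>

theorem proposition6p5:
  fixes v :: "'f::field \<Rightarrow> int"
    and smul :: "'f \<Rightarrow> 'd::division_ring \<Rightarrow> 'd"
    and \<Delta> \<PP> :: "'d set"
    and q d n :: nat
  assumes "discrete_valuation v" and "val_complete v"
    and "finite (residue_field v)" and "card (residue_field v) = q"
    and "central_division_algebra smul d"
    and "is_maximal_order (val_ring v) smul \<Delta>"
    and "maximal_two_sided_ideal \<Delta> \<PP>"
    and "n \<ge> 1" and "CARD('n::finite) = n + 1"
  shows "\<forall>\<xi> \<in> (proj_space \<Delta> \<PP> :: ('d ^ 'n) set set).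
    let G = (GL \<Delta> :: ('d ^ 'n ^ 'n) monoid);
        T = GL_topology v smul \<Delta>;
        P = proj_stabiliser \<Delta> \<xi>;
        \<rho> = Ind G T P
    in gelfand_pair G T P \<and>
       smooth_rep G T \<rho> \<and> finitely_many_constituents G T \<rho> \<and>
       (\<forall>s::complex. Re s > 0 \<longrightarrow>
          zeta_term G \<rho> s summable_on smooth_irr_classes G T \<and>
          rep_zeta G T \<rho> s =
            1 + ((of_nat q ^ (d * n) - 1) / (of_nat q ^ d - 1)) powr (- s) *
                (of_nat q powr (- (of_nat d * s)) +
                 (of_nat q ^ (d * (n + 1)) - 1) powr (- s) /
                   (1 - of_nat q powr (- (of_nat d * of_nat n * s)))))"
proof (rule ballI)
  fix \<xi> assume \<xi>: "\<xi> \<in> (proj_space \<Delta> \<PP> :: ('d ^ 'n) set set)"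
  obtain t where t: "t \<noteq> 0" "v t = 1" using valuation_surj[OF assms(1), of 1] by (elim exE conjE)
  have dvf: "complete_dvf v t" by (rule complete_dvf.intro) (fact assms(1) assms(2) t)+
  obtain K where res: "transversal (val_ring v) (nc_dvr.I (val_ring v) t 1) K" "card K = card (residue_field v)" "finite K"
    using complete_dvf.residue_transversal[OF dvf] assms(3) by metis
  interpret maximal_order smul d v t \<Delta> K
    by (rule maximal_order.intro[OF assms(5) dvf maximal_order_axioms.intro]) (fact assms(6) res)+
  obtain p e F where D: "nc_dvr \<Delta> p" and NI: "N = nc_dvr.I \<Delta> p 1" and e: "e \<ge> 1"
    and Jk: "\<forall>k. J k = nc_dvr.I \<Delta> p (e * k)" and finF: "finite F"
    and trF: "transversal \<Delta> (nc_dvr.I \<Delta> p 1) F" and cardF: "card F = card K ^ d"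
    using maximal_order_structure by (elim exE conjE)
  have q: "card K = q" "q \<ge> 2" using res(2) assms(4) K_card by simp_all
  have F: "card F = q ^ d" using cardF q(1) by simp
  have "q ^ 1 \<le> q ^ d" using q(2) index_pos by (intro power_increasing) auto
  then have F2: "card F \<ge> 2" using F q(2) by simp
  \<comment> \<open>The given maximal ideal is the set of non-units, so the primitive vectors of the
    statement are those of \<open>V 0\<close> outside \<open>V 1\<close>.\<close>
  have PP: "\<PP> = nc_dvr.I \<Delta> p 1" using maximal_ideal_eq_N[OF assms(7)] NI by simp
  obtain x where x: "x \<in> primitive_vectors \<Delta> \<PP>" "\<xi> = proj_point \<Delta> x"
    using \<xi> unfolding proj_space_def by (elim imageE)
  interpret D: primitive_vector \<Delta> p F x
  proof (intro primitive_vector.intro primitive_vector_axioms.intro)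
    show "x \<in> nc_dvr.V \<Delta> p 0" "x \<notin> nc_dvr.V \<Delta> p 1"
      using x(1) unfolding PP primitive_vectors_def nc_dvr.V_def[OF D] nc_dvr.I_0[OF D] by auto
    show "CARD('n) \<ge> 2" using assms(8,9) by simp
  qed (fact D finF trF F2)+
  \<comment> \<open>\<open>cong_ideal\<close> is the filtration \<open>J\<close>, whose member
    \<open>J k\<close> is the power \<open>e * k\<close> of the maximal ideal; this is the shape
    that \<open>tower_exists\<close> expects.\<close>
  have Top: "openin (GL_topology v smul \<Delta>) W \<longleftrightarrow> W \<subseteq> carrier (GL \<Delta>) \<and>
      (\<forall>A\<in>W. \<exists>k. \<forall>B\<in>carrier (GL \<Delta>). B - A \<in> D.M (e * k) \<longrightarrow> B \<in> W)" for W :: "('d ^ 'n ^ 'n) set"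
    unfolding openin_GL_topology cong_ideal_eq by (simp add: D.M_def Jk)
  obtain T where T: "tower (GL \<Delta>) (GL_topology v smul \<Delta>) D.P D.N T"
    "card (T 0) * (card F - 1) = card F ^ CARD('n) - 1"
    "\<forall>k. k \<ge> 1 \<longrightarrow> card (T k) = card F ^ (CARD('n) - 1)"
    using D.tower_exists[OF Top e] by (elim exE conjE)
  interpret Tw: tower "GL \<Delta>" "GL_topology v smul \<Delta>" D.P D.N T by (rule T(1))
  have P: "proj_stabiliser \<Delta> \<xi> = D.P" unfolding x(2) by (rule D.stabiliser_eq_P)
  have sum: "(zeta_term (GL \<Delta>) (Ind (GL \<Delta>) (GL_topology v smul \<Delta>) D.P) s has_sum
      (1 + ((of_nat q ^ (d * n) - 1) / (of_nat q ^ d - 1)) powr (- s) *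
                (of_nat q powr (- (of_nat d * s)) +
                 (of_nat q ^ (d * (n + 1)) - 1) powr (- s) /
                   (1 - of_nat q powr (- (of_nat d * of_nat n * s))))))
      (smooth_irr_classes (GL \<Delta>) (GL_topology v smul \<Delta>))" if s: "Re s > 0" for s
  proof (rule Tw.has_sum_zeta_term, rule has_sum_zeta[where T = "\<lambda>k. card (T k)"])
    show "(q ^ d - 1) * card (T 0) = q ^ (d * (n + 1)) - 1"
      using T(2) unfolding F assms(9) power_mult by (simp add: mult.commute)
    show "card (T k) = q ^ (d * n)" if "k \<ge> 1" for k
      using T(3) that unfolding F assms(9) power_mult by simp
    show "cfun.dim (Tw.U 0) = 1" by (rule Tw.dim_U_0)
    show "cfun.dim (Tw.U (Suc k)) = (card (T k) - 1) * (\<Prod>i<k. card (T i))" for k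
      unfolding Tw.dim_U_Suc Tw.card_reps ..
  qed (fact q(2) index_pos assms(8) s)+
  show "let G = (GL \<Delta> :: ('d ^ 'n ^ 'n) monoid);
        T = GL_topology v smul \<Delta>;
        P = proj_stabiliser \<Delta> \<xi>;
        \<rho> = Ind G T P
    in gelfand_pair G T P \<and>
       smooth_rep G T \<rho> \<and> finitely_many_constituents G T \<rho> \<and>
       (\<forall>s::complex. Re s > 0 \<longrightarrow>
          zeta_term G \<rho> s summable_on smooth_irr_classes G T \<and>
          rep_zeta G T \<rho> s =
            1 + ((of_nat q ^ (d * n) - 1) / (of_nat q ^ d - 1)) powr (- s) *
                (of_nat q powr (- (of_nat d * s)) +
                 (of_nat q ^ (d * (n + 1)) - 1) powr (- s) /
                   (1 - of_nat q powr (- (of_nat d * of_nat n * s)))))"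
    unfolding Let_def P rep_zeta_def
  proof (intro conjI allI impI)
    show "gelfand_pair (GL \<Delta>) (GL_topology v smul \<Delta>) D.P" by (rule Tw.gelfand_pair)
    show "smooth_rep (GL \<Delta>) (GL_topology v smul \<Delta>) (Ind (GL \<Delta>) (GL_topology v smul \<Delta>) D.P)"
      by (rule Tw.smooth_rep_Ind)
    show "finitely_many_constituents (GL \<Delta>) (GL_topology v smul \<Delta>) (Ind (GL \<Delta>) (GL_topology v smul \<Delta>) D.P)"
      by (rule Tw.finitely_many_constituents_Ind)
  qed (use has_sum_imp_summable[OF sum] infsumI[OF sum] in blast)+
qed

end
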